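(* Let $H\in W^{1,\infty}(\mathbb R)$ and let $u_0$ be a Radon measure on $\mathbb R$ with $u_{0s}=\sum_{j=1}^pc_j\delta_{x_j}$, $x_1<\dots<x_p$, $c_j\in\mathbb R\setminus\{0\}$; let $\mathcal J=\{x_1,\dots,x_p\}$. Let $u\in C([0,\infty);\mathcal M(\mathbb R))$ be the unique global entropy solution of the Cauchy problem $u_t+[H(u)]_x=0$ in $\mathbb R\times\mathbb R^+$, $u=u_0$ in $\mathbb R\times\{0\}$, which satisfies the compatibility condition at all $x_j\in\mathcal J$. Let $t_j:=\sup\{t>0: u_s(\cdot,t)(\{x_j\})\ne0\}$ be the waiting time at $x_j$, and let $(H^* )_\pm:=\limsup_{\xi\to\pm\infty}H(\xi)$, $(H_* )_\pm:=\liminf_{\xi\to\pm\infty}H(\xi)$. Then $$t_j\le\begin{cases}\dfrac{c_j}{(H^* )_+-(H_* )_+}&\text{if }c_j>0\text{ and }(H^* )_+>(H_* )_+,\\[2ex]\dfrac{|c_j|}{(H^* )_--(H_* )_-}&\text{if }c_j<0\text{ and }(H^* )_->(H_* )_-.\end{cases}$$ In addition, if there are $\bar A,\bar B>0$ such that $$\left|\int_0^xu_{0r}(s)\,ds\right|\le\bar A+\bar B|x|\quad\text{for }x\in\mathbb R,$$ then the waiting time $t_j$ is finite if either (i) $c_j>0$, the limit $\lim_{\xi\to\infty}H(\xi)$ exists, and there is no $c>0$ such that $H$ is constant in $(c,\infty)$; or (ii) $c_j<0$, the limit $\lim_{\xi\to-\infty}H(\xi)$ exists, and there is no $d<0$ such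 that $H$ is constant in $(-\infty,d)$.
   Context: **Measures.** $\mathcal M^+(\mathbb R)$: nonnegative Radon measures on $\mathbb R$; $\mathcal M(\mathbb R)$: signed Radon measures, i.e. $\mu$ for which there are $\nu\in\mathcal M^+(\mathbb R)$ and a locally $\nu$-summable $f$ with $\mu(K)=\int_Kf\,d\nu$ for all compact $K$. $\langle\cdot,\cdot\rangle$ is the duality with $C_c(\mathbb R)$. $\mu=\mu_{ac}+\mu_s$ is the Lebesgue decomposition, $\mu_r\in L^1_{\rm loc}(\mathbb R)$ the density of $\mu_{ac}$. Let $Q=\mathbb R\times(0,T)$. $L^\infty_{w*}(0,T;\mathcal M^+(\mathbb R))$ is the set of nonnegative Radon measures $u$ on $Q$ such that for a.e. $t\in(0,T)$ there is $u(\cdot,t)\in\mathcal M^+(\mathbb R)$ with: for $\zeta\in C([0,T];C_c(\mathbb R))$ the map $t\mapsto\langle u(\cdot,t),\zeta(\cdot,t)\rangle$ is in $L^1(0,T)$ and $\langle u,\zeta\rangle=\int_0^T\langle u(\cdot,t),\zeta(\cdot,t)\rangle dt$; and $t\mapsto\|u(\cdot,t)\|_{\mathcal M(K)}$ is in $L^\infty(0,T)$ for each compact $K$. A signed Radon measure $u$ on $Q$ is in $L^\infty_{w*}(0,T;\mathcal M(\mathbb R))$ if $u^+,u^-$ both are in $L^\infty_{w*}(0,T;\mathcal M^+(\mathbb R))$; $u(\cdot,t):=u^+(\cdot,t)-u^-(\cdot,t)$. For a.e. $t$, $u_s(\cdot,t)=[u(\cdot,t)]_s$ and $u_r(\cdot,t)=[u(\cdot,t)]_r$.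 $C([0,\infty);\mathcal M(\mathbb R))$: maps with $\|u(\cdot,t)-u(\cdot,t_0)\|_{\mathcal M(K)}\to0$ as $t\to t_0$ for each $t_0\ge0$ and compact $K$. **Signs.** ${\rm sgn}_+=\chi_{(0,\infty)}$, ${\rm sgn}_-=-\chi_{(-\infty,0)}$, ${\rm sgn}={\rm sgn}_++{\rm sgn}_-$. **Entropy solutions.** $u\in L^\infty_{w*}(0,T;\mathcal M(\mathbb R))$ is an entropy solution of the Cauchy problem in $Q$ if for all $\zeta\in C^1([0,T];C^1_c(\mathbb R))$ with $\zeta(\cdot,T)=0$ $$\iint_Q[u_r\zeta_t+H(u_r)\zeta_x]dxdt+\int_0^T\langle u_s(\cdot,t),\zeta_t(\cdot,t)\rangle dt=-\langle u_0,\zeta(\cdot,0)\rangle,$$ and for all $k\in\mathbb R$ and all such $\zeta\ge0$ $$\iint_Q\{|u_r-k|\zeta_t+{\rm sgn}(u_r-k)[H(u_r)-H(k)]\zeta_x\}dxdt+\int_0^T\langle|u_s(\cdot,t)|,\zeta_t(\cdot,t)\rangle dt\ge-\int_{\mathbb R}|u_{0r}-k|\zeta(x,0)dx-\langle|u_{0s}|,\zeta(\cdot,0)\rangle.$$ It is global if this holds for every $T>0$. **Compatibility condition** at $x_j$: for all $k\in\mathbb R$, $0\le\beta\in C_c^1(0,t_j)$, with $\sigma=-$ if $c_j>0$ and $\sigma=+$ if $c_j<0$, ${\rm ess}\lim_{x\to x_j^+}\int_0^{t_j}{\rm sgn}_\sigma(u_r(x,t)-k)[H(u_r(x,t))-H(k)]\beta(t)dt\le0$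 and ${\rm ess}\lim_{x\to x_j^-}$ of the same integral is $\ge0$. (It is known that a unique global entropy solution satisfying the compatibility condition at all $x_j\in\mathcal J$ exists, that it belongs to $C([0,\infty);\mathcal M(\mathbb R))$, and that $t_j>0$.) *)

theory Defs
  imports "HOL-Analysis.Analysis"
begin

section \<open>Radon measures\<close>

text \<open>On an open subset \<open>S\<close> of a Euclidean space, a Borel measure that is finite on compact
  sets is automatically regular.\<close>

definition radon_on :: "'a::euclidean_space set \<Rightarrow> 'a measure \<Rightarrow> bool" where
  "radon_on S M \<longleftrightarrow> sets M = sets (restrict_space borel S) \<and>
     (\<forall>K. compact K \<and> K \<subseteq> S \<longrightarrow> emeasure M K < \<infinity>)"

text \<open>A signed Radon measure need not be a signed measure on all Borel sets (both its positive and
  its negative part may be infinite), so it is represented by its values on compact sets; its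
  values on other sets are meaningless, and two such set functions denote the same measure iff they
  agree on all compact subsets of \<open>S\<close>.\<close>

definition signed_radon_on :: "'a::euclidean_space set \<Rightarrow> ('a set \<Rightarrow> real) \<Rightarrow> bool" where
  "signed_radon_on S \<mu> \<longleftrightarrow> (\<exists>\<nu> f. radon_on S \<nu> \<and> f \<in> borel_measurable \<nu> \<and>
     (\<forall>K. compact K \<and> K \<subseteq> S \<longrightarrow> set_integrable \<nu> K f \<and> \<mu> K = (LINT x:K|\<nu>. f x)))"

definition jordan_decomp_on ::
    "'a::euclidean_space set \<Rightarrow> ('a set \<Rightarrow> real) \<Rightarrow> 'a measure \<Rightarrow> 'a measure \<Rightarrow> bool" where
  "jordan_decomp_on S \<mu> P N \<longleftrightarrow> radon_on S P \<and> radon_on S N \<and>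
     (\<exists>A\<in>sets P. emeasure P A = 0 \<and> emeasure N (S - A) = 0) \<and>
     (\<forall>K. compact K \<and> K \<subseteq> S \<longrightarrow> \<mu> K = measure P K - measure N K)"

definition pos_part_on :: "'a::euclidean_space set \<Rightarrow> ('a set \<Rightarrow> real) \<Rightarrow> 'a measure" where
  "pos_part_on S \<mu> = (THE P. \<exists>N. jordan_decomp_on S \<mu> P N)"

definition neg_part_on :: "'a::euclidean_space set \<Rightarrow> ('a set \<Rightarrow> real) \<Rightarrow> 'a measure" where
  "neg_part_on S \<mu> = (THE N. \<exists>P. jordan_decomp_on S \<mu> P N)"

text \<open>On the real line: \<open>pairing \<mu> \<phi>\<close> is the duality pairing of \<open>\<mu>\<close> with \<open>\<phi>\<close>,
  \<open>abs_pairing \<mu> \<phi>\<close> that of \<open>\<bar>\<mu>\<bar>\<close> with \<open>\<phi>\<close>, and \<open>var_norm K \<mu>\<close> is \<open>\<bar>\<mu>\<bar>(K)\<close>, where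
  \<open>\<bar>\<mu>\<bar>\<close> is the sum of the positive and the negative part.\<close>

abbreviation signed_radon :: "(real set \<Rightarrow> real) \<Rightarrow> bool" where
  "signed_radon \<equiv> signed_radon_on UNIV"

definition pairing :: "(real set \<Rightarrow> real) \<Rightarrow> (real \<Rightarrow> real) \<Rightarrow> real" where
  "pairing \<mu> \<phi> = (LINT x|pos_part_on UNIV \<mu>. \<phi> x) - (LINT x|neg_part_on UNIV \<mu>. \<phi> x)"

definition abs_pairing :: "(real set \<Rightarrow> real) \<Rightarrow> (real \<Rightarrow> real) \<Rightarrow> real" where
  "abs_pairing \<mu> \<phi> = (LINT x|pos_part_on UNIV \<mu>. \<phi> x) + (LINT x|neg_part_on UNIV \<mu>. \<phi> x)"

definition var_norm :: "real set \<Rightarrow> (real set \<Rightarrow> real) \<Rightarrow> real" where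
  "var_norm K \<mu> = measure (pos_part_on UNIV \<mu>) K + measure (neg_part_on UNIV \<mu>) K"


section \<open>Lebesgue decomposition\<close>

definition lebesgue_singular :: "(real set \<Rightarrow> real) \<Rightarrow> bool" where
  "lebesgue_singular \<mu> \<longleftrightarrow> (\<exists>N\<in>null_sets lborel.
     emeasure (pos_part_on UNIV \<mu>) (- N) = 0 \<and> emeasure (neg_part_on UNIV \<mu>) (- N) = 0)"

text \<open>The density of the absolutely continuous part, determined up to Lebesgue null sets.\<close>

definition regular_part :: "(real set \<Rightarrow> real) \<Rightarrow> real \<Rightarrow> real" where
  "regular_part \<mu> = (SOME f. f \<in> borel_measurable borel \<and>
     (\<forall>K. compact K \<longrightarrow> set_integrable lborel K f) \<and>
     lebesgue_singular (\<lambda>K. \<mu> K - (LINT x:K|lborel. f x)))"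

definition singular_part :: "(real set \<Rightarrow> real) \<Rightarrow> real set \<Rightarrow> real" where
  "singular_part \<mu> K = \<mu> K - (LINT x:K|lborel. regular_part \<mu> x)"


section \<open>Measure-valued functions of time\<close>

definition strip :: "real \<Rightarrow> (real \<times> real) set" where
  "strip T = UNIV \<times> {0<..<T}"

text \<open>\<open>C([0,T]; C_c(\<real>))\<close>: by compactness of \<open>[0,T]\<close>, the supports of the functions
  \<open>\<zeta>(\<cdot>,t)\<close> lie in a common compact set.\<close>

definition cont_test :: "real \<Rightarrow> (real \<times> real \<Rightarrow> real) \<Rightarrow> bool" where
  "cont_test T \<zeta> \<longleftrightarrow> continuous_on (UNIV \<times> {0..T}) \<zeta> \<and>
     (\<exists>K. compact K \<and> (\<forall>x t. t \<in> {0..T} \<and> x \<notin> K \<longrightarrow> \<zeta> (x, t) = 0))"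

text \<open>\<open>U\<close> belongs to the space of nonnegative measures on the strip that are essentially bounded
  in time, and \<open>v t\<close> is its slice at time \<open>t\<close>. The integral against \<open>\<zeta>\<close> is required to
  converge, since \<open>\<zeta>\<close> need not have compact support in the open strip.\<close>

definition Linf_wstar_pos ::
    "real \<Rightarrow> (real \<times> real) measure \<Rightarrow> (real \<Rightarrow> real measure) \<Rightarrow> bool" where
  "Linf_wstar_pos T U v \<longleftrightarrow> radon_on (strip T) U \<and>
     (AE t in lebesgue_on {0<..<T}. radon_on UNIV (v t)) \<and>
     (\<forall>\<zeta>. cont_test T \<zeta> \<longrightarrow>
        integrable (lebesgue_on {0<..<T}) (\<lambda>t. LINT x|v t. \<zeta> (x, t)) \<and>
        integrable U \<zeta> \<and>
        (LINT z|U. \<zeta> z) = (LINT t|lebesgue_on {0<..<T}. (LINT x|v t. \<zeta> (x, t)))) \<and>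
     (\<forall>K. compact K \<longrightarrow>
        (\<lambda>t. measure (v t) K) \<in> borel_measurable (lebesgue_on {0<..<T}) \<and>
        (\<exists>C. AE t in lebesgue_on {0<..<T}. measure (v t) K \<le> C))"

text \<open>A measure on the strip is identified with the family \<open>u t\<close> of its time slices.\<close>

definition Linf_wstar :: "real \<Rightarrow> (real \<Rightarrow> real set \<Rightarrow> real) \<Rightarrow> bool" where
  "Linf_wstar T u \<longleftrightarrow> (\<exists>U vp vn. signed_radon_on (strip T) U \<and>
     Linf_wstar_pos T (pos_part_on (strip T) U) vp \<and>
     Linf_wstar_pos T (neg_part_on (strip T) U) vn \<and>
     (AE t in lebesgue_on {0<..<T}. \<forall>K. compact K \<longrightarrow>
        u t K = measure (vp t) K - measure (vn t) K))"

text \<open>\<open>C([0,\<infinity>); M(\<real>))\<close>\<close>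

definition cont_signed_radon :: "(real \<Rightarrow> real set \<Rightarrow> real) \<Rightarrow> bool" where
  "cont_signed_radon u \<longleftrightarrow> (\<forall>t\<ge>0. signed_radon (u t)) \<and>
     (\<forall>t0\<ge>0. \<forall>K. compact K \<longrightarrow>
        ((\<lambda>t. var_norm K (\<lambda>E. u t E - u t0 E)) \<longlongrightarrow> 0) (at t0 within {0..}))"

text \<open>\<open>ur\<close> is a jointly measurable representative of \<open>(x,t) \<mapsto> u_r(x,t)\<close>. By Fubini it is
  determined up to a null set of the half plane.\<close>

definition is_regular_part :: "(real \<Rightarrow> real set \<Rightarrow> real) \<Rightarrow> (real \<times> real \<Rightarrow> real) \<Rightarrow> bool" where
  "is_regular_part u ur \<longleftrightarrow> ur \<in> borel_measurable borel \<and>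
     (AE t in lebesgue_on {0<..}. AE x in lborel. ur (x, t) = regular_part (u t) x)"


section \<open>Test functions and flux\<close>

text \<open>\<open>\<zeta>\<close> lies in \<open>C\<^sup>1([0,T]; C\<^sup>1_c(\<real>))\<close> with partial derivatives \<open>\<zeta>x\<close>, \<open>\<zeta>t\<close>. Since both
  \<open>\<zeta>(\<cdot>,t)\<close> and \<open>\<zeta>t(\<cdot>,t)\<close> must depend continuously on \<open>t\<close> in the \<open>C\<^sup>1\<close> norm, the mixed
  derivative \<open>\<zeta>tx\<close> exists and is continuous as well.\<close>

definition C1_test ::
    "real \<Rightarrow> (real \<times> real \<Rightarrow> real) \<Rightarrow> (real \<times> real \<Rightarrow> real) \<Rightarrow> (real \<times> real \<Rightarrow> real) \<Rightarrow> bool" where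
  "C1_test T \<zeta> \<zeta>x \<zeta>t \<longleftrightarrow> cont_test T \<zeta> \<and>
     continuous_on (UNIV \<times> {0..T}) \<zeta>x \<and> continuous_on (UNIV \<times> {0..T}) \<zeta>t \<and>
     (\<exists>\<zeta>tx. continuous_on (UNIV \<times> {0..T}) \<zeta>tx \<and>
        (\<forall>x. \<forall>t\<in>{0..T}.
           ((\<lambda>y. \<zeta> (y, t)) has_real_derivative \<zeta>x (x, t)) (at x) \<and>
           ((\<lambda>s. \<zeta> (x, s)) has_real_derivative \<zeta>t (x, t)) (at t within {0..T}) \<and>
           ((\<lambda>y. \<zeta>t (y, t)) has_real_derivative \<zeta>tx (x, t)) (at x)))"

text \<open>\<open>C\<^sup>1_c(S)\<close> for an open set \<open>S\<close> of reals, functions being extended by zero.\<close>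

definition C1c :: "real set \<Rightarrow> (real \<Rightarrow> real) set" where
  "C1c S = {\<phi>. \<phi> C1_differentiable_on UNIV \<and>
     (\<exists>K. compact K \<and> K \<subseteq> S \<and> (\<forall>x. x \<notin> K \<longrightarrow> \<phi> x = 0))}"

text \<open>\<open>W\<^sup>1\<^sup>,\<^sup>\<infinity>(\<real>)\<close>, elements being given by their continuous representative; \<open>g\<close> is the
  weak derivative.\<close>

definition W1_inf :: "(real \<Rightarrow> real) \<Rightarrow> bool" where
  "W1_inf H \<longleftrightarrow> continuous_on UNIV H \<and> bounded (range H) \<and>
     (\<exists>g \<in> borel_measurable borel. (\<exists>C. AE x in lborel. \<bar>g x\<bar> \<le> C) \<and>
        (\<forall>\<phi>\<in>C1c UNIV. (LINT x|lborel. H x * deriv \<phi> x) = - (LINT x|lborel. g x * \<phi> x)))"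


section \<open>Entropy solutions and the compatibility condition\<close>

definition entropy_solution ::
    "(real \<Rightarrow> real) \<Rightarrow> (real set \<Rightarrow> real) \<Rightarrow> real \<Rightarrow> (real \<Rightarrow> real set \<Rightarrow> real) \<Rightarrow>
     (real \<times> real \<Rightarrow> real) \<Rightarrow> bool" where
  "entropy_solution H u0 T u ur \<longleftrightarrow> Linf_wstar T u \<and>
     (\<forall>\<zeta> \<zeta>x \<zeta>t. C1_test T \<zeta> \<zeta>x \<zeta>t \<and> (\<forall>x. \<zeta> (x, T) = 0) \<longrightarrow>
        (LINT z:strip T|lborel. ur z * \<zeta>t z + H (ur z) * \<zeta>x z)
          + (LINT t|lebesgue_on {0<..<T}. pairing (singular_part (u t)) (\<lambda>x. \<zeta>t (x, t)))
        = - pairing u0 (\<lambda>x. \<zeta> (x, 0))) \<and>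
     (\<forall>k \<zeta> \<zeta>x \<zeta>t. C1_test T \<zeta> \<zeta>x \<zeta>t \<and> (\<forall>x. \<zeta> (x, T) = 0) \<and>
          (\<forall>x. \<forall>t\<in>{0..T}. 0 \<le> \<zeta> (x, t)) \<longrightarrow>
        (LINT z:strip T|lborel.
            \<bar>ur z - k\<bar> * \<zeta>t z + sgn (ur z - k) * (H (ur z) - H k) * \<zeta>x z)
          + (LINT t|lebesgue_on {0<..<T}. abs_pairing (singular_part (u t)) (\<lambda>x. \<zeta>t (x, t)))
        \<ge> - (LINT x|lborel. \<bar>regular_part u0 x - k\<bar> * \<zeta> (x, 0))
          - abs_pairing (singular_part u0) (\<lambda>x. \<zeta> (x, 0)))"

definition global_entropy_solution ::
    "(real \<Rightarrow> real) \<Rightarrow> (real set \<Rightarrow> real) \<Rightarrow> (real \<Rightarrow> real set \<Rightarrow> real) \<Rightarrow>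
     (real \<times> real \<Rightarrow> real) \<Rightarrow> bool" where
  "global_entropy_solution H u0 u ur \<longleftrightarrow> (\<forall>T>0. entropy_solution H u0 T u ur)"

definition waiting_time :: "(real \<Rightarrow> real set \<Rightarrow> real) \<Rightarrow> real \<Rightarrow> ereal" where
  "waiting_time u x = Sup {ereal t | t. t > 0 \<and> singular_part (u t) {x} \<noteq> 0}"

definition sgn_plus :: "real \<Rightarrow> real" where
  "sgn_plus = indicator {0<..}"

definition sgn_minus :: "real \<Rightarrow> real" where
  "sgn_minus r = - indicator {..<0} r"

text \<open>\<open>L\<close> is the essential limit of \<open>f\<close> at \<open>a\<close> along \<open>S\<close>.\<close>

definition has_ess_lim :: "(real \<Rightarrow> real) \<Rightarrow> real \<Rightarrow> real \<Rightarrow> real set \<Rightarrow> bool" where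
  "has_ess_lim f L a S \<longleftrightarrow>
     (\<forall>e>0. \<exists>d>0. AE x in lborel. x \<in> S \<and> dist x a < d \<longrightarrow> dist (f x) L < e)"

text \<open>The compatibility condition at \<open>xj\<close>, where \<open>cj\<close> is the initial mass there.\<close>

definition compatible_at ::
    "(real \<Rightarrow> real) \<Rightarrow> (real \<Rightarrow> real set \<Rightarrow> real) \<Rightarrow> (real \<times> real \<Rightarrow> real) \<Rightarrow> real \<Rightarrow> real \<Rightarrow> bool" where
  "compatible_at H u ur xj cj \<longleftrightarrow>
     (let I = {t. 0 < t \<and> ereal t < waiting_time u xj};
          sg = (if cj > 0 then sgn_minus else sgn_plus) in
      \<forall>k. \<forall>\<beta>\<in>C1c I. (\<forall>t. 0 \<le> \<beta> t) \<longrightarrow>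
        (let F = (\<lambda>x. LINT t:I|lborel. sg (ur (x, t) - k) * (H (ur (x, t)) - H k) * \<beta> t) in
          (\<exists>L. has_ess_lim F L xj {xj<..} \<and> L \<le> 0) \<and>
          (\<exists>L. has_ess_lim F L xj {..<xj} \<and> L \<ge> 0)))"

end

theory Submission
  imports Defs
begin

text \<open>Let \<open>U\<close> be a potential of the solution, \<open>U\<^sub>x = u\<close> and \<open>U\<^sub>t = - H(u\<^sub>r)\<close>. The mass of a singular point \<open>a\<close> is
 the jump of \<open>U\<close> at \<open>a\<close>, so a waiting time is bounded by bounding how long the jump can survive.
 The key estimate (\<open>jump_decay\<close>) says that a positive jump shrinks at least at the rate \<open>H k - H k'\<close>, up to an
 error \<open>2 A\<close>, whenever \<open>U\<close> initially lies below \<open>U(a+) + A + k (x - a)\<close> on the right of \<open>a\<close> and above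
 \<open>U(a-) - A - k' (a - x)\<close> on the left, with enough room at some distance from \<open>a\<close>.

 Each side is a comparison (\<open>comparison\<close>) of \<open>U\<close> with an affine solution of \<open>U\<^sub>t + H(U\<^sub>x) = 0\<close> of slope \<open>k\<close>. Let \<open>W\<close>
 be the difference, so that \<open>W\<^sub>x = v - k\<close> and \<open>W\<^sub>t = - f\<close> with \<open>v = u\<^sub>r\<close> and \<open>f = H v - H k\<close>. The entropy pair with the constant \<open>k\<close>
 is \<open>\<bar>v - k\<bar>\<close> with the flux \<open>q = sgn (v - k) f\<close>, and \<open>\<bar>v - k\<bar> W\<^sub>t + q W\<^sub>x = 0\<close>. Hence the entropy inequality
 for the test function \<open>th(W) eta(x) psi(t)\<close> contains no derivative of \<open>th\<close> (\<open>entropy_along_potential\<close>; \<open>W\<close> is first replaced by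
 averages over small squares). Letting \<open>eta\<close> approach an indicator function leaves fluxes through thin layers at
 the singular points. There the compatibility condition replaces \<open>q\<close> by \<open>f\<close> or \<open>- f\<close>, and \<open>f th(W)\<close> is
 a time derivative, so that only the traces of \<open>W\<close> matter (\<open>entropy_flux_trace\<close>). The jumps of \<open>W\<close> have the right
 signs, and \<open>W\<close> cannot become positive. Reflecting space gives the comparison on the left, and changing the sign
 of \<open>u\<close> exchanges positive and negative masses.

 For the explicit bound (\<open>waiting_rate\<close>), every \<open>A > 0\<close> is admissible near \<open>a\<close> if the slopes are
 large, so \<open>H k\<close> and \<open>H k'\<close> can be taken close to the upper and lower limits of \<open>H\<close>; the jump stays nonnegative until
 the waiting time. If the potential grows at most linearly and the mass at \<open>a\<close> never disappears (\<open>immortal_flux_constant\<close>), the comparison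
 starts after all finite waiting times, on a large interval, with any slopes \<open>k\<close>, \<open>k'\<close> above the growth rate;
 then \<open>H k <= H k'\<close> for all of them, and \<open>H\<close> is constant near infinity.

 It remains to find \<open>U\<close>. The entropy inequalities with constants tending to plus and minus infinity show that the
 positive and negative singular parts stay where they were initially (\<open>entropy_concentration\<close>), hence the singular part
 of every slice consists of point masses with the initial signs. The weak equation
 gives a balance law for each time (\<open>weak_balance\<close>), from which \<open>U\<close> is constructed and shown to be Lipschitz in time
 (\<open>time_limit\<close>, \<open>pot_lip\<close>, \<open>pot_time_derivative\<close>). Pairings and variations of signed
 measures are computed from densities with respect to a common dominating Radon measure (\<open>pairing_dens\<close>, \<open>var_norm_bounds\<close>).\<close>

abbreviation "BM \<equiv> borel_measurable borel"
abbreviation "LM \<equiv> borel_measurable lborel"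
abbreviation "integ \<equiv> integrable lborel"
abbreviation "cont \<equiv> continuous_on UNIV"
abbreviation lim_seq (infix "--->" 60) where "f ---> l \<equiv> filterlim f (nhds l) sequentially"
lemmas LINT_cong = Bochner_Integration.integral_cong

section \<open>Averages over small squares\<close>

lemma lborel_translate:
 fixes f :: "'a::euclidean_space => real"
 assumes "f \<in> BM"
 shows "integ (%z. f (z + h)) \<longleftrightarrow> integ f"
  and "(LINT z|lborel. f (z + h)) = (LINT z|lborel. f z)"
proof -
 have d: "lborel = distr lborel lborel (%z. z + h)"
  using lborel_distr_plus[of h] by (simp add: add.commute cong: distr_cong)
 have "integrable (distr lborel lborel (%z. z + h)) f \<longleftrightarrow> integ (%z. f (z + h))"
  using assms by (intro integrable_distr_eq) auto
 then show "integ (%z. f (z + h)) \<longleftrightarrow> integ f"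
  using d by simp
 have "integral\<^sup>L (distr lborel lborel (%z. z + h)) f = (LINT z|lborel. f (z + h))"
  using assms by (intro integral_distr) auto
 then show "(LINT z|lborel. f (z + h)) = (LINT z|lborel. f z)" using d by simp
qed

text \<open>For an open set the excess \<open>1\<^sub>U(z) - 1\<^sub>U(z + h)\<close> has a positive part that tends to zero
 pointwise, and its integral vanishes by translation invariance; hence its negative part has the
 same integral as the positive one.\<close>

lemma translation_L1_open:
 fixes U :: "'a::euclidean_space set"
 assumes U: "open U" "emeasure lborel U < \<infinity>" and h: "h ---> 0"
 shows "(%n. LINT z|lborel. \<bar>indicator U (z + h n) - indicator U z :: real\<bar>) ---> 0"
proof -
 define p where "p = (%n z. max 0 (indicator U z - indicator U (z + h n) :: real))"
 have iU: "integ (indicator U :: 'a => real)"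
  using U by (simp add: integrable_indicator_iff)
 then have iUh: "integ (%z. indicator U (z + c) :: real)" for c
  using lborel_translate(1)[of "indicator U"] U by (simp add: borel_open)
 have [measurable]: "(indicator U :: 'a => real) \<in> BM" using U by simp
 have ip: "integ (p n)" for n
  unfolding p_def using iU iUh by (intro integrable_max) auto
 have "(%n. integral\<^sup>L lborel (p n)) ---> integral\<^sup>L lborel (%z::'a. 0::real)"
 proof (rule integral_dominated_convergence[where w="indicator U"])
  show "p n \<in> LM" for n using ip by auto
  show "AE z in lborel. norm (p n z) <= indicator U z" for n
   by (auto simp: p_def indicator_def)
  show "AE z in lborel. (%n. p n z) ---> 0"
  proof (rule AE_I2, rule tendsto_eventually)
   fix z
   show "eventually (%n. p n z = 0) sequentially"
   proof (cases "z \<in> U")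
    case True
    have "(%n. z + h n) ---> z + 0" by (intro tendsto_intros h)
    then have "eventually (%n. z + h n \<in> U) sequentially"
     using True U by (intro topological_tendstoD) auto
    then show ?thesis by eventually_elim (auto simp: p_def)
   qed (auto simp: p_def)
  qed
 qed (use iU in auto)
 then have "(%n. 2 * integral\<^sup>L lborel (p n)) ---> 2 * 0" by (intro tendsto_intros) simp
 moreover have "(LINT z|lborel. \<bar>indicator U (z + h n) - indicator U z :: real\<bar>) = 2 * integral\<^sup>L lborel (p n)" for n
 proof -
  have "(LINT z|lborel. \<bar>indicator U (z + h n) - indicator U z :: real\<bar>)
    = (LINT z|lborel. 2 * p n z + (indicator U (z + h n) - indicator U z))"
   by (rule LINT_cong) (auto simp: p_def indicator_def)
  also have "\<dots> = 2 * integral\<^sup>L lborel (p n) + ((LINT z|lborel. indicator U (z + h n)) - (LINT z|lborel. indicator U z))"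
   using ip iU iUh by simp
  finally show ?thesis using lborel_translate(2)[of "indicator U" "h n"] by simp
 qed
 ultimately show ?thesis by simp
qed

lemma translation_L1:
 fixes g :: "'a::euclidean_space => real"
 assumes "integ g" "h ---> 0"
 shows "(%n. LINT z|lborel. \<bar>g (z + h n) - g z\<bar>) ---> 0"
 using assms(1)
proof (induction rule: integrable_induct)
 case (base A c)
 have A[measurable]: "A \<in> sets borel" using base by simp
 have iA: "integ (indicator A :: 'a => real)"
  using base by (simp add: integrable_indicator_iff)
 have iAh: "integ (%z. indicator A (z + k) :: real)" for k
  using iA lborel_translate(1)[of "indicator A"] by simp
 have "(%n. LINT z|lborel. \<bar>indicator A (z + h n) - indicator A z :: real\<bar>) ---> 0"
 proof (rule tendstoI)
  fix e :: real assume e: "e > 0"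
  obtain U where U: "open U" "A \<subseteq> U" "emeasure lborel (U - A) < e / 3"
   using outer_regular_lborel[of A "e/3"] e by auto
  have "emeasure lborel U = emeasure lborel A + emeasure lborel (U - A)"
   using U by (subst plus_emeasure) (auto simp: Un_absorb1)
  moreover have "emeasure lborel (U - A) < \<infinity>" using less_trans[OF U(3) ennreal_less_top] by simp
  ultimately have Uf: "emeasure lborel U < \<infinity>" using base by (simp add: ennreal_add_less_top)
  have [measurable]: "U \<in> sets borel" using U by simp
  have iU: "integ (indicator U :: 'a => real)"
   using Uf by (simp add: integrable_indicator_iff)
  have iUh: "integ (%z. indicator U (z + k) :: real)" for k
   using iU lborel_translate(1)[of "indicator U"] by simp
  have iD: "integ (indicator (U - A) :: 'a => real)"
   using \<open>emeasure lborel (U - A) < \<infinity>\<close> by (simp add: integrable_indicator_iff)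
  have iDh: "integ (%z. indicator (U - A) (z + k) :: real)" for k
   using iD lborel_translate(1)[of "indicator (U - A)"] by simp
  have mD: "(LINT z|lborel. indicator (U - A) z :: real) < e / 3"
  proof -
   have "ennreal (measure lborel (U - A)) < ennreal (e/3)"
    using U(3) \<open>emeasure lborel (U - A) < \<infinity>\<close> by (simp add: emeasure_eq_ennreal_measure)
   then show ?thesis using e by (simp add: ennreal_less_iff)
  qed
  have "eventually (%n. (LINT z|lborel. \<bar>indicator U (z + h n) - indicator U z :: real\<bar>) < e/3) sequentially"
   using translation_L1_open[OF U(1) Uf assms(2)] e by (intro order_tendstoD) auto
  then show "eventually (%n. dist (LINT z|lborel. \<bar>indicator A (z + h n) - indicator A z :: real\<bar>) 0 < e) sequentially"
  proof eventually_elim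
   case (elim n)
   have "(LINT z|lborel. \<bar>indicator A (z + h n) - indicator A z :: real\<bar>)
    <= (LINT z|lborel. \<bar>indicator U (z + h n) - indicator U z\<bar> + (indicator (U - A) (z + h n) + indicator (U - A) z))"
    by (intro integral_mono Bochner_Integration.integrable_add integrable_abs Bochner_Integration.integrable_diff iA iAh iU iUh iD iDh)
      (use U(2) in \<open>auto simp: indicator_def split: if_splits\<close>)
   also have "\<dots> = (LINT z|lborel. \<bar>indicator U (z + h n) - indicator U z\<bar>) + 2 * (LINT z|lborel. indicator (U - A) z)"
    using iU iUh iD iDh lborel_translate(2)[of "indicator (U - A)" "h n"] by (subst Bochner_Integration.integral_add; auto)+
   also have "\<dots> < e" using elim mD by simp
   finally show ?case by (simp add: integral_nonneg_AE)
  qed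
 qed
 then have "(%n. \<bar>c\<bar> * (LINT z|lborel. \<bar>indicator A (z + h n) - indicator A z :: real\<bar>)) ---> \<bar>c\<bar> * 0"
  by (intro tendsto_intros)
 moreover have "\<bar>c\<bar> * (LINT z|lborel. \<bar>indicator A (z + h n) - indicator A z :: real\<bar>) = (LINT z|lborel. \<bar>indicator A (z + h n) *\<^sub>R c - indicator A z *\<^sub>R c\<bar>)" for n
  by (subst integral_mult_right_zero[symmetric], rule LINT_cong)
    (auto simp: indicator_def)
 ultimately show ?case by simp
next
 case (add f g)
 have m[measurable]: "f \<in> BM" "g \<in> BM" using add.hyps by auto
 have i: "integ (%z. f (z + k))" "integ (%z. g (z + k))" for k
  using add.hyps lborel_translate(1)[OF m(1)] lborel_translate(1)[OF m(2)] by auto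
 have "(%n. (LINT z|lborel. \<bar>f (z + h n) - f z\<bar>) + (LINT z|lborel. \<bar>g (z + h n) - g z\<bar>)) ---> 0"
  using tendsto_add[OF add.IH] by simp
 then show ?case
 proof (rule tendsto_sandwich[where f="%_. 0", rotated -1])
  show "eventually (%n. (LINT z|lborel. \<bar>f (z + h n) + g (z + h n) - (f z + g z)\<bar>)
    <= (LINT z|lborel. \<bar>f (z + h n) - f z\<bar>) + (LINT z|lborel. \<bar>g (z + h n) - g z\<bar>)) sequentially"
  proof (rule always_eventually, rule allI)
   fix n
   have "(LINT z|lborel. \<bar>f (z + h n) + g (z + h n) - (f z + g z)\<bar>)
     <= (LINT z|lborel. \<bar>f (z + h n) - f z\<bar> + \<bar>g (z + h n) - g z\<bar>)"
    using add.hyps i by (intro integral_mono) auto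
   also have "\<dots> = (LINT z|lborel. \<bar>f (z + h n) - f z\<bar>) + (LINT z|lborel. \<bar>g (z + h n) - g z\<bar>)"
    using add.hyps i by (intro Bochner_Integration.integral_add) auto
   finally show "(LINT z|lborel. \<bar>f (z + h n) + g (z + h n) - (f z + g z)\<bar>) <= \<dots>" .
  qed
 qed (auto intro!: always_eventually integral_nonneg_AE)
next
 case (lim f s)
 have m[measurable]: "f \<in> BM" "!!i. s i \<in> BM" using lim.hyps by auto
 have i: "integ (%z. f (z + k))" "integ (%z. s i (z + k))" for k i
  using lim.hyps lborel_translate(1) m by blast+
 have L: "(%i. LINT z|lborel. \<bar>s i z - f z\<bar>) ---> integral\<^sup>L lborel (%z::'a. 0::real)"
 proof (rule integral_dominated_convergence[where w="%z. 3 * \<bar>f z\<bar>"])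
  show "AE z in lborel. (%i. \<bar>s i z - f z\<bar>) ---> 0"
  proof (rule AE_I2)
   fix z
   have "(%i. \<bar>s i z - f z\<bar>) ---> \<bar>f z - f z\<bar>"
    by (intro tendsto_intros) (use lim.hyps in simp)
   then show "(%i. \<bar>s i z - f z\<bar>) ---> 0" by simp
  qed
  show "AE z in lborel. norm \<bar>s i z - f z\<bar> <= 3 * \<bar>f z\<bar>" for i
  proof (rule AE_I2)
   fix z show "norm \<bar>s i z - f z\<bar> <= 3 * \<bar>f z\<bar>" using lim.hyps(3)[of z i] by simp
  qed
 qed (use lim.hyps in auto)
 show ?case
 proof (rule tendstoI)
  fix e :: real assume e: "e > 0"
  then have "eventually (%i. (LINT z|lborel. \<bar>s i z - f z\<bar>) < e/3) sequentially"
   using L by (intro order_tendstoD(2)[OF L]) auto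
  then obtain i0 where i0: "(LINT z|lborel. \<bar>s i0 z - f z\<bar>) < e/3"
   by (auto simp: eventually_sequentially)
  have "eventually (%n. (LINT z|lborel. \<bar>s i0 (z + h n) - s i0 z\<bar>) < e/3) sequentially"
   using lim.IH e by (intro order_tendstoD(2)) auto
  then show "eventually (%n. dist (LINT z|lborel. \<bar>f (z + h n) - f z\<bar>) 0 < e) sequentially"
  proof eventually_elim
   case (elim n)
   have tr: "(LINT z|lborel. \<bar>s i0 (z + h n) - f (z + h n)\<bar>) = (LINT z|lborel. \<bar>s i0 z - f z\<bar>)"
    using lborel_translate(2)[of "%z. \<bar>s i0 z - f z\<bar>" "h n"] by simp
   have "(LINT z|lborel. \<bar>f (z + h n) - f z\<bar>)
    <= (LINT z|lborel. \<bar>s i0 (z + h n) - f (z + h n)\<bar> + (\<bar>s i0 (z + h n) - s i0 z\<bar> + \<bar>s i0 z - f z\<bar>))"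
    using lim.hyps i by (intro integral_mono) auto
   also have "\<dots> = (LINT z|lborel. \<bar>s i0 (z + h n) - f (z + h n)\<bar>) + ((LINT z|lborel. \<bar>s i0 (z + h n) - s i0 z\<bar>) + (LINT z|lborel. \<bar>s i0 z - f z\<bar>))"
    using lim.hyps i by (subst Bochner_Integration.integral_add; auto)+
   also have "\<dots> < e" using elim i0 tr by simp
   finally show ?case by (simp add: integral_nonneg_AE)
  qed
 qed
qed

definition box_avg :: "real => (real \<times> real => real) => real \<times> real => real" where
 "box_avg e g z = (LINT h:{0..e} \<times> {0..e}|lborel. g (z + h)) / e\<^sup>2"

lemma box_measure:
 assumes "e \<ge> 0"
 shows "measure lborel ({0..e} \<times> {0..e::real}) = e\<^sup>2"
  "emeasure lborel ({0..e} \<times> {0..e::real}) = ennreal (e\<^sup>2)"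
proof -
 show "emeasure lborel ({0..e} \<times> {0..e::real}) = ennreal (e\<^sup>2)"
  unfolding lborel_prod[symmetric] using assms
  by (subst lborel.emeasure_pair_measure_Times) (auto simp: ennreal_mult power2_eq_square)
 then show "measure lborel ({0..e} \<times> {0..e::real}) = e\<^sup>2"
  by (simp add: measure_def)
qed

lemma box_integrable: "e \<ge> 0 ==> set_integrable lborel ({0..e} \<times> {0..e::real}) (%_. c::real)"
 unfolding set_integrable_def using box_measure(2)[of e] borel_closed[OF closed_Times[of "{0..e}" "{0..e}"]] by (auto simp: integrable_indicator_iff)

lemma box_avg_abs_le:
 assumes "e > 0" "integ g"
 shows "(LINT z|lborel. \<bar>box_avg e g z - g z\<bar>)
   <= (LINT h:{0..e} \<times> {0..e}|lborel. (LINT z|lborel. \<bar>g (z + h) - g z\<bar>)) / e\<^sup>2"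
  and "integ (box_avg e g)"
proof -
 let ?B = "{0..e} \<times> {0..e}"
 have [measurable]: "g \<in> BM" using assms by auto
 have [measurable]: "?B \<in> sets borel" by (intro borel_closed closed_Times) auto
 have ig: "integ (%z. g (z + h))" for h using assms lborel_translate(1)[of g] by auto
 define G where "G = (%(h, z). indicator ?B h * \<bar>g (z + h) - g z\<bar>)"
 have Gm: "G \<in> borel_measurable (lborel \<Otimes>\<^sub>M lborel)" unfolding G_def by measurable
 have Gi: "integrable (lborel \<Otimes>\<^sub>M lborel) G"
 proof (rule lborel_pair.Fubini_integrable[OF Gm])
  have bd: "(LINT z|lborel. norm (G (h, z))) = indicator ?B h * (LINT z|lborel. \<bar>g (z + h) - g z\<bar>)" for h
   unfolding G_def by (auto simp: abs_mult)
  have b1: "(LINT z|lborel. \<bar>g (z + h) - g z\<bar>) <= (LINT z|lborel. \<bar>g (z + h)\<bar> + \<bar>g z\<bar>)" for h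
   using ig assms by (intro integral_mono) auto
  have b2: "(LINT z|lborel. \<bar>g (z + h) - g z\<bar>) <= 2 * (LINT z|lborel. \<bar>g z\<bar>)" for h
   using b1[of h] ig assms lborel_translate(2)[of "%z. \<bar>g z\<bar>" h] by simp
  show "integ (%h. LINT z|lborel. norm (G (h, z)))"
  proof (rule Bochner_Integration.integrable_bound)
   show "integ (%h. indicator ?B h * (2 * (LINT z|lborel. \<bar>g z\<bar>)))"
    using box_integrable[of e "2 * (LINT z|lborel. \<bar>g z\<bar>)"] assms unfolding set_integrable_def by simp
   show "(%h. LINT z|lborel. norm (G (h, z))) \<in> LM"
    using Gm by measurable
   show "AE h in lborel. norm (LINT z|lborel. norm (G (h, z))) <= norm (indicator ?B h * (2 * (LINT z|lborel. \<bar>g z\<bar>)))"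
    unfolding bd using b2 by (auto simp: indicator_def integral_nonneg_AE)
  qed
  show "AE h in lborel. integ (%z. G (h, z))"
   unfolding G_def using ig assms by auto
 qed
 define G' where "G' = (%(h, z). indicator ?B h * g (z + h))"
 have G'm: "G' \<in> borel_measurable (lborel \<Otimes>\<^sub>M lborel)" unfolding G'_def by measurable
 have G'i: "integrable (lborel \<Otimes>\<^sub>M lborel) G'"
 proof (rule lborel_pair.Fubini_integrable[OF G'm])
  have "(LINT z|lborel. norm (G' (h, z))) = indicator ?B h * (LINT z|lborel. \<bar>g z\<bar>)" for h
   unfolding G'_def using lborel_translate(2)[of "%z. \<bar>g z\<bar>" h] by (auto simp: abs_mult)
  then show "integ (%h. LINT z|lborel. norm (G' (h, z)))"
   using box_integrable[of e "(LINT z|lborel. \<bar>g z\<bar>)"] assms unfolding set_integrable_def by simp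
  show "AE h in lborel. integ (%z. G' (h, z))"
   unfolding G'_def using ig assms by auto
 qed
 have "integ (%z. LINT h|lborel. case_prod (%h z. G' (h, z)) (h, z))"
  by (rule lborel_pair.integrable_snd) (use G'i in simp)
 then have "integ (%z. (LINT h|lborel. G' (h, z)) / e\<^sup>2)"
  by simp
 also have "(%z. (LINT h|lborel. G' (h, z)) / e\<^sup>2) = box_avg e g"
  unfolding box_avg_def G'_def set_lebesgue_integral_def by (auto simp: fun_eq_iff)
 finally show I: "integ (box_avg e g)" .
 have AEi: "AE z in lborel. integ (%h. G (h, z))"
  using lborel_pair.AE_integrable_snd[of "%h z. G (h, z)"] Gi by simp
 have AEi': "AE z in lborel. integ (%h. G' (h, z))"
  using lborel_pair.AE_integrable_snd[of "%h z. G' (h, z)"] G'i by simp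
 have "(LINT z|lborel. \<bar>box_avg e g z - g z\<bar>) <= (LINT z|lborel. (LINT h|lborel. G (h, z)) / e\<^sup>2)"
 proof (rule integral_mono_AE)
  show "integ (%z. \<bar>box_avg e g z - g z\<bar>)" using I assms by auto
  show "integ (%z. (LINT h|lborel. G (h, z)) / e\<^sup>2)"
   using lborel_pair.integrable_snd[of "%h z. G (h, z)"] Gi by simp
  show "AE z in lborel. \<bar>box_avg e g z - g z\<bar> <= (LINT h|lborel. G (h, z)) / e\<^sup>2"
   using AEi AEi'
  proof eventually_elim
   case (elim z)
   have cB: "integ (%h. indicator ?B h * g z)"
    using box_integrable[of e "g z"] assms unfolding set_integrable_def by simp
   have "g z = (LINT h|lborel. indicator ?B h * g z) / e\<^sup>2"
    using assms box_measure[of e] by simp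
   moreover have "box_avg e g z = (LINT h|lborel. G' (h, z)) / e\<^sup>2"
    unfolding box_avg_def G'_def set_lebesgue_integral_def by simp
   ultimately have "\<bar>box_avg e g z - g z\<bar> = \<bar>((LINT h|lborel. G' (h, z)) - (LINT h|lborel. indicator ?B h * g z)) / e\<^sup>2\<bar>"
    unfolding diff_divide_distrib by metis
   also have "\<dots> = \<bar>(LINT h|lborel. G' (h, z) - indicator ?B h * g z)\<bar> / e\<^sup>2"
    using elim cB assms by (simp add: abs_divide)
   also have "\<dots> <= (LINT h|lborel. \<bar>G' (h, z) - indicator ?B h * g z\<bar>) / e\<^sup>2"
    by (intro divide_right_mono integral_abs_bound) auto
   also have "(LINT h|lborel. \<bar>G' (h, z) - indicator ?B h * g z\<bar>) = (LINT h|lborel. G (h, z))"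
    by (rule LINT_cong) (auto simp: G_def G'_def indicator_def)
   finally show ?case .
  qed
 qed
 also have "\<dots> = (LINT z|lborel. (LINT h|lborel. G (h, z))) / e\<^sup>2" by simp
 also have "(LINT z|lborel. (LINT h|lborel. G (h, z))) = (LINT h|lborel. (LINT z|lborel. G (h, z)))"
  using lborel_pair.Fubini_integral[of "%h z. G (h, z)"] Gi by simp
 also have "\<dots> = (LINT h:?B|lborel. (LINT z|lborel. \<bar>g (z + h) - g z\<bar>))"
  unfolding G_def set_lebesgue_integral_def by simp
 finally show "(LINT z|lborel. \<bar>box_avg e g z - g z\<bar>)
   <= (LINT h:?B|lborel. (LINT z|lborel. \<bar>g (z + h) - g z\<bar>)) / e\<^sup>2" .
qed

text \<open>Averages over shrinking boxes converge in mean, because they are averages of translates.\<close>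

lemma box_avg_L1:
 assumes g: "integ g" and e: "!!n. e n > 0" "e ---> 0"
 shows "(%n. LINT z|lborel. \<bar>box_avg (e n) g z - g z\<bar>) ---> 0"
proof (rule tendstoI)
 fix d :: real assume d: "d > 0"
 define ph where "ph = (%h. LINT z|lborel. \<bar>g (z + h) - g z\<bar>)"
 have "(ph \<longlongrightarrow> 0) (at 0)"
  unfolding tendsto_at_iff_sequentially comp_def ph_def using translation_L1[OF g] by auto
 moreover have "ph 0 = 0" by (simp add: ph_def)
 ultimately obtain r where r: "r > 0" "!!h. dist h 0 < r ==> \<bar>ph h\<bar> < d / 2"
 proof -
  have "eventually (%h. \<bar>ph h\<bar> < d / 2) (at 0)"
   using tendstoD[OF \<open>(ph \<longlongrightarrow> 0) (at 0)\<close>, of "d/2"] d by simp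
  then obtain r where "r > 0" "!!h. h \<noteq> 0 ==> dist h 0 < r ==> \<bar>ph h\<bar> < d / 2"
   by (auto simp: eventually_at)
  moreover have "\<bar>ph 0\<bar> < d / 2" using \<open>ph 0 = 0\<close> d by simp
  ultimately show ?thesis using that by metis
 qed
 have "eventually (%n. e n < r / 2) sequentially"
  using e r by (intro order_tendstoD(2)[OF e(2)]) auto
 then show "eventually (%n. dist (LINT z|lborel. \<bar>box_avg (e n) g z - g z\<bar>) 0 < d) sequentially"
 proof eventually_elim
  case (elim n)
  let ?B = "{0..e n} \<times> {0..e n}"
  have [measurable]: "?B \<in> sets borel" by (intro borel_closed closed_Times) auto
  have small: "ph h <= d / 2" if "h \<in> ?B" for h
  proof -
   have "dist h 0 <= \<bar>fst h\<bar> + \<bar>snd h\<bar>" by (simp add: norm_Pair sqrt_sum_squares_le_sum_abs norm_prod_def)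
   then show ?thesis using that elim r(2)[of h] by auto
  qed
  have nn: "0 <= ph h" for h unfolding ph_def by (simp add: integral_nonneg_AE)
  have ib: "integ (%h. indicator ?B h * (d / 2))"
   using box_integrable[of "e n" "d/2"] e(1)[of n] unfolding set_integrable_def by simp
  have "(LINT h:?B|lborel. ph h) <= (LINT h:?B|lborel. d / 2)"
   unfolding set_lebesgue_integral_def
   using small nn ib d by (intro integral_mono') (auto simp: indicator_def)
  also have "\<dots> = e n ^ 2 * (d / 2)"
   unfolding set_lebesgue_integral_def using box_measure[of "e n"] e(1)[of n] by simp
  finally have "(LINT h:?B|lborel. ph h) / e n ^ 2 <= d / 2"
   using e(1)[of n] by (simp add: field_simps)
  moreover have "(LINT z|lborel. \<bar>box_avg (e n) g z - g z\<bar>) <= (LINT h:?B|lborel. ph h) / e n ^ 2"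
   unfolding ph_def by (rule box_avg_abs_le(1)[OF e(1) g])
  moreover have "0 <= (LINT z|lborel. \<bar>box_avg (e n) g z - g z\<bar>)"
   by (simp add: integral_nonneg_AE)
  ultimately show ?case using d unfolding dist_real_def by linarith
 qed
qed

section \<open>A continuously differentiable step\<close>

lemma pos_power_deriv:
 "((%t. (max 0 t) ^ Suc (Suc n)) has_real_derivative real (Suc (Suc n)) * (max 0 t) ^ Suc n) (at t)"
proof (cases "t = 0")
 case True
 have "((%h::real. max 0 h ^ Suc (Suc n) / h) \<longlongrightarrow> 0) (at 0)"
 proof (rule Lim_null_comparison)
  have "norm (max 0 h ^ Suc (Suc n) / h) <= \<bar>h\<bar> ^ Suc n" for h :: real

  proof -
   have "max 0 h ^ Suc n <= \<bar>h\<bar> ^ Suc n" by (intro power_mono) auto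
   then have "\<bar>max 0 h / h\<bar> * max 0 h ^ Suc n <= 1 * \<bar>h\<bar> ^ Suc n"
    by (intro mult_mono) (auto simp: max_def)
   then show ?thesis by (simp add: abs_mult mult_ac)
  qed
  then show "eventually (%h::real. norm (max 0 h ^ Suc (Suc n) / h) <= \<bar>h\<bar> ^ Suc n) (at 0)" by simp
  have "((%h::real. \<bar>h\<bar> ^ Suc n) \<longlongrightarrow> \<bar>0\<bar> ^ Suc n) (at 0)" by (intro tendsto_intros)
  then show "((%h::real. \<bar>h\<bar> ^ Suc n) \<longlongrightarrow> 0) (at 0)" by simp
 qed
 then show ?thesis using True by (simp add: DERIV_def)
next
 case False
 then consider "t > 0" | "t < 0" by linarith
 then show ?thesis
 proof cases
  case 1
  have "((%t. t ^ Suc (Suc n)) has_real_derivative real (Suc (Suc n)) * t ^ Suc n) (at t)"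
   using DERIV_pow[of "Suc (Suc n)" t UNIV] by simp
  then have "((%t. (max 0 t) ^ Suc (Suc n)) has_real_derivative real (Suc (Suc n)) * t ^ Suc n) (at t)"
   by (rule has_field_derivative_transform_within_open[where S="{0<..}"]) (use 1 in auto)
  then show ?thesis using 1 by simp
 next
  case 2
  have "((%t::real. 0::real) has_real_derivative 0) (at t)" by simp
  then have "((%t. (max 0 t) ^ Suc (Suc n)) has_real_derivative 0) (at t)"
   by (rule has_field_derivative_transform_within_open[where S="{..<0}"]) (use 2 in auto)
  then show ?thesis using 2 by simp
 qed
qed

text \<open>A continuously differentiable step from \<open>0\<close> to \<open>1\<close> on the unit interval: a quadratic spline
 whose derivative is a hat function.\<close>

definition step :: "real => real" where
 "step x = 2 * (max 0 x)\<^sup>2 - 4 * (max 0 (x - 1/2))\<^sup>2 + 2 * (max 0 (x - 1))\<^sup>2"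

definition step' :: "real => real" where
 "step' x = 4 * max 0 x - 8 * max 0 (x - 1/2) + 4 * max 0 (x - 1)"

lemma step_deriv: "(step has_real_derivative step' x) (at x)"
proof -
 have sq: "((%t. (max 0 t)\<^sup>2) has_real_derivative 2 * max 0 t) (at t)" for t :: real
  using pos_power_deriv[of 0 t] by (simp add: power2_eq_square)
 have "((%x. 2 * (max 0 x)\<^sup>2 - 4 * (max 0 (x - 1/2))\<^sup>2 + 2 * (max 0 (x - 1))\<^sup>2) has_real_derivative
   2 * (2 * max 0 x) - 4 * ((2 * max 0 (x - 1/2)) * 1) + 2 * ((2 * max 0 (x - 1)) * 1)) (at x)"
  by (intro DERIV_add DERIV_diff DERIV_cmult sq DERIV_chain2[OF sq])
    (auto intro!: derivative_eq_intros)
 then show ?thesis by (simp add: step_def[abs_def] step'_def)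
qed

lemma step_deriv_chain [derivative_intros]:
 "(g has_real_derivative g') (at x within S) ==>
  ((%x. step (g x)) has_real_derivative step' (g x) * g') (at x within S)"
 using DERIV_chain2[OF step_deriv] by blast

lemma step'_cont: "continuous_on S step'"
 unfolding step'_def[abs_def] by (intro continuous_intros)

lemma step'_cont_comp [continuous_intros]: "continuous_on S g ==> continuous_on S (%x. step' (g x))"
 using continuous_on_compose2[OF step'_cont[of UNIV]] by blast

lemma step_cont: "continuous_on S step"
 unfolding step_def[abs_def] by (intro continuous_intros)

lemma step_cont_comp [continuous_intros]: "continuous_on S g ==> continuous_on S (%x. step (g x))"
 using continuous_on_compose2[OF step_cont[of UNIV]] by blast

lemma step_eq_0: "x <= 0 ==> step x = 0" by (simp add: step_def)

lemma step_eq_1: "x \<ge> 1 ==> step x = 1"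
 by (simp add: step_def max_def power2_eq_square algebra_simps)

lemma step'_eq_0: "x <= 0 \<or> x \<ge> 1 ==> step' x = 0"
 by (auto simp: step'_def max_def)

lemma step'_bounds: "0 <= step' x" "step' x <= 2"
 by (auto simp: step'_def max_def)

lemma step_mono: "x <= y ==> step x <= step y"
 by (rule DERIV_nonneg_imp_nondecreasing) (use step_deriv step'_bounds in blast)+

lemma step_bounds: "0 <= step x" "step x <= 1"
 using step_mono[of "min x 0" x] step_eq_0[of "min x 0"] step_mono[of x "max x 1"] step_eq_1[of "max x 1"]
 by auto

lemma step_measurable [measurable]: "step \<in> BM" "step' \<in> BM"
 using step_cont step'_cont by (auto intro!: borel_measurable_continuous_onI)

lemma step_kernel_mass:
 assumes "h > 0" "\<bar>sig\<bar> = (1::real)"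
 shows "integ (%x. step' (sig * (x - y) / h - 1) / h)"
  and "(LINT x|lborel. step' (sig * (x - y) / h - 1) / h) = 1"
proof -
 have 1: "has_bochner_integral lborel (%x. step' x * indicator {0..1} x) (step 1 - step 0)"
 proof (rule has_bochner_integral_FTC_Icc_real)
  show "isCont step' x" for x using step'_cont[of UNIV] by (simp add: continuous_on_eq_continuous_at)
 qed (use step_deriv in \<open>auto\<close>)
 moreover have "step' x * indicator {0..1} x = step' x" for x
  using step'_eq_0[of x] by (cases "x \<in> {0..1}") auto
 ultimately have i: "integ step'" "(LINT x|lborel. step' x) = 1"
  using step_eq_0[of 0] step_eq_1[of 1] by (auto simp: has_bochner_integral_iff)
 have nz: "sig / h \<noteq> 0" using assms by auto
 have eq: "sig * (x - y) / h - 1 = (- 1 - sig * y / h) + sig / h * x" for x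
  by (simp add: right_diff_distrib diff_divide_distrib)
 have "integ (%x. step' (sig * (x - y) / h - 1))"
  unfolding eq using i nz by (intro lborel_integrable_real_affine)
 then show "integ (%x. step' (sig * (x - y) / h - 1) / h)" by simp
 have "1 = \<bar>sig / h\<bar> * (LINT x|lborel. step' (sig * (x - y) / h - 1))"
  unfolding eq using lborel_integral_real_affine[OF nz, of step' "- 1 - sig * y / h"] i(2) by (simp only: real_scaleR_def)
 then show "(LINT x|lborel. step' (sig * (x - y) / h - 1) / h) = 1"
 proof -
  have "\<bar>sig / h\<bar> = 1 / h" using assms(1) by (simp add: abs_divide assms(2))
  then show ?thesis using \<open>1 = _\<close> by simp
 qed
qed

section \<open>Test functions on the plane\<close>

text \<open>The test functions of \<open>C1_test\<close>, on the whole plane instead of a strip.\<close>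

definition C1_plane :: "(real \<times> real => real) => (real \<times> real => real) => (real \<times> real => real) => bool" where
 "C1_plane ze zex zet \<longleftrightarrow> cont ze \<and> cont zex \<and> cont zet \<and>
   (\<exists>zetx. cont zetx \<and> (\<forall>x t.
    ((%y. ze (y, t)) has_real_derivative zex (x, t)) (at x) \<and>
    ((%s. ze (x, s)) has_real_derivative zet (x, t)) (at t) \<and>
    ((%y. zet (y, t)) has_real_derivative zetx (x, t)) (at x)))"

lemma continuous_on_comp_UNIV:
 "cont W ==> continuous_on S f ==> continuous_on S (%x. W (f x))"
 by (rule continuous_on_compose2[of UNIV W]) auto

text \<open>The mixed derivative of the product contains the second derivative of the outer function; this is why the
 truncations used below are twice differentiable.\<close>

lemma C1_plane_mult_compose:
 assumes W: "C1_plane w wx wt"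
  and th: "!!x. (th has_real_derivative th' x) (at x)" "!!x. (th' has_real_derivative th'' x) (at x)"
   "cont th''"
  and eta: "!!x. (eta has_real_derivative eta' x) (at x)" "cont eta'"
  and psi: "!!x. (psi has_real_derivative psi' x) (at x)" "cont psi'"
 shows "C1_plane (%z. th (w z) * eta (fst z) * psi (snd z))
   (%z. th' (w z) * wx z * eta (fst z) * psi (snd z) + th (w z) * eta' (fst z) * psi (snd z))
   (%z. th' (w z) * wt z * eta (fst z) * psi (snd z) + th (w z) * eta (fst z) * psi' (snd z))"
proof -
 obtain wtx where w: "cont w" "cont wx" "cont wt"
  "cont wtx"
  and dx: "!!x t. ((%y. w (y, t)) has_real_derivative wx (x, t)) (at x)"
  and dt: "!!x t. ((%s. w (x, s)) has_real_derivative wt (x, t)) (at t)"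
  and dtx: "!!x t. ((%y. wt (y, t)) has_real_derivative wtx (x, t)) (at x)"
  using W unfolding C1_plane_def by blast
 have c: "cont th" "cont th'" "cont eta" "cont psi"
  using th eta psi by (meson DERIV_continuous_on has_field_derivative_at_within)+
 have cc: "cont (%z. th (w z))" "cont (%z. th' (w z))" "cont (%z. th'' (w z))"
  "cont (%z::real\<times>real. eta (fst z))" "cont (%z::real\<times>real. eta' (fst z))"
  "cont (%z::real\<times>real. psi (snd z))" "cont (%z::real\<times>real. psi' (snd z))"
  by (intro continuous_on_comp_UNIV[OF c(1)] continuous_on_comp_UNIV[OF c(2)] continuous_on_comp_UNIV[OF th(3)]
   continuous_on_comp_UNIV[OF c(3)] continuous_on_comp_UNIV[OF c(4)] continuous_on_comp_UNIV[OF eta(2)]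
   continuous_on_comp_UNIV[OF psi(2)] w continuous_on_fst continuous_on_snd continuous_on_id)+
 show ?thesis
  unfolding C1_plane_def
 proof (intro conjI exI[of _ "%z. th'' (w z) * wx z * wt z * eta (fst z) * psi (snd z) + th' (w z) * wtx z * eta (fst z) * psi (snd z)
   + th' (w z) * wt z * eta' (fst z) * psi (snd z) + th' (w z) * wx z * eta (fst z) * psi' (snd z) + th (w z) * eta' (fst z) * psi' (snd z)"] allI)
  fix x t
  show "((%y. th (w (y, t)) * eta (fst (y, t)) * psi (snd (y, t))) has_real_derivative
    th' (w (x, t)) * wx (x, t) * eta (fst (x, t)) * psi (snd (x, t)) + th (w (x, t)) * eta' (fst (x, t)) * psi (snd (x, t))) (at x)"
   unfolding fst_conv snd_conv
   by (rule DERIV_cong[OF DERIV_cmult_right[OF DERIV_mult[OF DERIV_chain2[OF th(1) dx] eta(1)]]]) (simp add: algebra_simps)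
  show "((%s. th (w (x, s)) * eta (fst (x, s)) * psi (snd (x, s))) has_real_derivative
    th' (w (x, t)) * wt (x, t) * eta (fst (x, t)) * psi (snd (x, t)) + th (w (x, t)) * eta (fst (x, t)) * psi' (snd (x, t))) (at t)"
   unfolding fst_conv snd_conv
   by (rule DERIV_cong[OF DERIV_mult[OF DERIV_cmult_right[OF DERIV_chain2[OF th(1) dt]] psi(1)]]) (simp add: algebra_simps)
  show "((%y. th' (w (y, t)) * wt (y, t) * eta (fst (y, t)) * psi (snd (y, t)) + th (w (y, t)) * eta (fst (y, t)) * psi' (snd (y, t)))
   has_real_derivative th'' (w (x, t)) * wx (x, t) * wt (x, t) * eta (fst (x, t)) * psi (snd (x, t)) + th' (w (x, t)) * wtx (x, t) * eta (fst (x, t)) * psi (snd (x, t))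
   + th' (w (x, t)) * wt (x, t) * eta' (fst (x, t)) * psi (snd (x, t)) + th' (w (x, t)) * wx (x, t) * eta (fst (x, t)) * psi' (snd (x, t)) + th (w (x, t)) * eta' (fst (x, t)) * psi' (snd (x, t))) (at x)"
   unfolding fst_conv snd_conv
   by (rule DERIV_cong[OF DERIV_add[OF
      DERIV_cmult_right[OF DERIV_mult[OF DERIV_mult[OF DERIV_chain2[OF th(2) dx] dtx] eta(1)]]
      DERIV_cmult_right[OF DERIV_mult[OF DERIV_chain2[OF th(1) dx] eta(1)]]]]) (simp add: algebra_simps)
 qed (intro continuous_intros cc w)+
qed

section \<open>Box averages of continuous functions\<close>

lemma sliding_integral_deriv:
 fixes G :: "real => real"
 assumes "cont G" "e \<ge> 0"
 shows "((%x. integral {0..e} (%xi. G (x + xi))) has_real_derivative G (x + e) - G x) (at x)"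
proof -
 have c: "continuous_on S G" for S using assms continuous_on_subset by blast
 define F where "F = (%u. integral {x - 1..u} G)"
 have dF: "(F has_real_derivative G u) (at u)" if "x - 1 < u" for u
 proof -
  have "((%u. integral {x - 1..u} G) has_real_derivative G u) (at u within {x - 1..u + 1})"
   using that by (intro integral_has_real_derivative c) auto
  then show ?thesis unfolding F_def
   using that by (simp add: at_within_Icc_at)
 qed
 have "((%u. F (u + e) - F u) has_real_derivative G (x + e) * 1 - G x) (at x)"
  by (intro DERIV_diff DERIV_chain2[OF dF] dF) (use assms in \<open>auto intro!: derivative_eq_intros\<close>)
 then have "((%u. integral {0..e} (%xi. G (u + xi))) has_real_derivative G (x + e) * 1 - G x) (at x)"
 proof (rule has_field_derivative_transform_within_open[where S="{x - 1<..}"])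
  fix u assume u: "u \<in> {x - 1<..}"
  have "F (u + e) - F u = integral {u..u + e} G"
   using Henstock_Kurzweil_Integration.integral_combine[where a="x - 1" and c=u and b="u + e" and f=G] u assms c
   by (auto simp: F_def integrable_continuous_interval)
  also have "\<dots> = integral {0..e} (%xi. G (u + xi))"
   using integral_shift_Icc_real[of 0 e G u] by (simp add: add.commute o_def)
  finally show "F (u + e) - F u = integral {0..e} (%xi. G (u + xi))" .
 qed auto
 then show ?thesis by simp
qed

lemma box_avg_iterated:
 assumes W: "cont W" and e: "e > 0"
 shows "box_avg e W (x, t) = integral {0..e} (%xi. integral {0..e} (%tau. W (x + xi, t + tau))) / e\<^sup>2"
  and "box_avg e W (x, t) = integral {0..e} (%tau. integral {0..e} (%xi. W (x + xi, t + tau))) / e\<^sup>2"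
proof -
 have c: "continuous_on S (%h. W ((x, t) + h))" for S
  by (rule continuous_on_compose2[OF W]) (auto intro!: continuous_intros)
 have cb: "{0..e} \<times> {0..e} = cbox (0::real, 0::real) (e, e)"
  by (auto simp: cbox_Pair_eq cbox_interval)
 have si: "set_integrable lborel ({0..e} \<times> {0..e}) (%h. W ((x, t) + h))"
  unfolding set_integrable_def cb by (intro borel_integrable_compact compact_cbox c)
 have "(LINT h:{0..e} \<times> {0..e}|lborel. W ((x, t) + h)) = integral (cbox (0, 0) (e, e)) (%h. W ((x, t) + h))"
  using set_borel_integral_eq_integral(2)[OF si] cb by simp
 also have "\<dots> = integral (cbox 0 e) (%xi. integral (cbox 0 e) (%tau. W ((x, t) + (xi, tau))))"
  using integral_prod_continuous[of 0 0 e e "%h. W ((x, t) + h)"] c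
  by (simp add: case_prod_unfold)
 also have "\<dots> = integral {0..e} (%xi. integral {0..e} (%tau. W (x + xi, t + tau)))"
  by (simp add: cbox_interval)
 finally show 1: "box_avg e W (x, t) = integral {0..e} (%xi. integral {0..e} (%tau. W (x + xi, t + tau))) / e\<^sup>2"
  by (simp add: box_avg_def)
 have "continuous_on (cbox (0, 0) (e, e)) (%(xi, tau). W (x + xi, t + tau))"
  using c by (simp add: case_prod_unfold plus_prod_def)
 from integral_swap_continuous[OF this] 1
 show "box_avg e W (x, t) = integral {0..e} (%tau. integral {0..e} (%xi. W (x + xi, t + tau))) / e\<^sup>2"
  by (simp add: cbox_interval)
qed

lemma slice_integral_cont:
 fixes W :: "real \<times> real => real"
 assumes W: "cont W"
 shows "cont (%z. integral {0..e} (%tau. W (fst z + a, snd z + tau)))"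
  and "cont (%z. integral {0..e} (%xi. W (fst z + xi, snd z + a)))"
proof -
 have "continuous_on (UNIV \<times> cbox 0 e) (%(z, tau). W (fst z + a, snd z + tau))"
  unfolding case_prod_unfold by (rule continuous_on_compose2[OF W]) (auto intro!: continuous_intros)
 from integral_continuous_on_param[OF this]
 show "cont (%z. integral {0..e} (%tau. W (fst z + a, snd z + tau)))"
  by (simp add: cbox_interval)
 have "continuous_on (UNIV \<times> cbox 0 e) (%(z, xi). W (fst z + xi, snd z + a))"
  unfolding case_prod_unfold by (rule continuous_on_compose2[OF W]) (auto intro!: continuous_intros)
 from integral_continuous_on_param[OF this]
 show "cont (%z. integral {0..e} (%xi. W (fst z + xi, snd z + a)))"
  by (simp add: cbox_interval)
qed

definition box_avg_x :: "real => (real \<times> real => real) => real \<times> real => real" where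
 "box_avg_x e W z = (integral {0..e} (%tau. W (fst z + e, snd z + tau)) - integral {0..e} (%tau. W (fst z, snd z + tau))) / e\<^sup>2"

definition box_avg_t :: "real => (real \<times> real => real) => real \<times> real => real" where
 "box_avg_t e W z = (integral {0..e} (%xi. W (fst z + xi, snd z + e)) - integral {0..e} (%xi. W (fst z + xi, snd z))) / e\<^sup>2"

text \<open>Averaging over a square makes a continuous function continuously differentiable, and its mixed derivative
 is a second difference.\<close>

lemma box_avg_C1:
 assumes W: "cont W" and e: "e > 0"
 shows "C1_plane (box_avg e W) (box_avg_x e W) (box_avg_t e W)"
proof -
 have cx: "continuous_on S (%z. integral {0..e} (%tau. W (fst z + a, snd z + tau)))"
  and ct: "continuous_on S (%z. integral {0..e} (%xi. W (fst z + xi, snd z + a)))" for S a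
  using slice_integral_cont[OF W] continuous_on_subset by blast+
 have cX: "cont (%x. integral {0..e} (%tau. W (x, t + tau)))" for t
  using continuous_on_comp_UNIV[OF cx[of UNIV 0], OF continuous_on_Pair[OF continuous_on_id continuous_on_const], of UNIV t] by simp
 have cT: "cont (%t. integral {0..e} (%xi. W (x + xi, t)))" for x
  using continuous_on_comp_UNIV[OF ct[of UNIV 0], OF continuous_on_Pair[OF continuous_on_const continuous_on_id], of UNIV x] by simp
 have cW: "cont (%y. W (y, t))" for t
  by (rule continuous_on_compose2[OF W]) (auto intro!: continuous_intros)
 have dx: "((%y. box_avg e W (y, t)) has_real_derivative box_avg_x e W (x, t)) (at x)" for x t
  unfolding box_avg_iterated(1)[OF W e] box_avg_x_def fst_conv snd_conv
  by (intro DERIV_cdivide sliding_integral_deriv cX) (use e in simp)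
 have dt: "((%s. box_avg e W (x, s)) has_real_derivative box_avg_t e W (x, t)) (at t)" for x t
  unfolding box_avg_iterated(2)[OF W e] box_avg_t_def fst_conv snd_conv
  by (intro DERIV_cdivide sliding_integral_deriv cT) (use e in simp)
 have dtx: "((%y. box_avg_t e W (y, t)) has_real_derivative
   ((W (x + e, t + e) - W (x, t + e)) - (W (x + e, t) - W (x, t))) / e\<^sup>2) (at x)" for x t
  unfolding box_avg_t_def fst_conv snd_conv
  by (intro DERIV_cdivide DERIV_diff sliding_integral_deriv cW) (use e in simp_all)
 have c1: "cont (box_avg_x e W)" "cont (box_avg_t e W)"
  unfolding box_avg_x_def[abs_def] box_avg_t_def[abs_def] using cx[of UNIV 0] ct[of UNIV 0] e
  by (auto intro!: continuous_intros cx ct)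
 have c0: "cont (box_avg e W)"
 proof -
  have "cont (%p. integral {0..e} (%tau. W (fst p, snd p + tau)))" using cx[of UNIV 0] by simp
  from slice_integral_cont(2)[OF this, of e 0]
  have "cont (%z. integral {0..e} (%xi. integral {0..e} (%tau. W (fst z + xi, snd z + tau))) / e\<^sup>2)"
   using e by (auto intro!: continuous_intros)
  moreover have "box_avg e W = (%z. integral {0..e} (%xi. integral {0..e} (%tau. W (fst z + xi, snd z + tau))) / e\<^sup>2)"
   using box_avg_iterated(1)[OF W e] by (auto simp: fun_eq_iff)
  ultimately show ?thesis by simp
 qed
 have "cont (%z. ((W (fst z + e, snd z + e) - W (fst z, snd z + e)) - (W (fst z + e, snd z) - W z)) / e\<^sup>2)"
  using e by (auto intro!: continuous_intros continuous_on_compose2[OF W])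
 then show ?thesis unfolding C1_plane_def
  using c0 c1 dx dt dtx
  by (intro conjI exI[of _ "%z. ((W (fst z + e, snd z + e) - W (fst z, snd z + e)) - (W (fst z + e, snd z) - W z)) / e\<^sup>2"]) auto
qed

lemma box_avg_abs_bound:
 assumes "e > 0" "!!z. \<bar>g z\<bar> <= B" "g \<in> BM"
 shows "\<bar>box_avg e g z\<bar> <= B"
proof -
 let ?B = "{0..e} \<times> {0..e}"
 have [measurable]: "?B \<in> sets borel" by (intro borel_closed closed_Times) auto
 have [measurable]: "g \<in> BM" by fact
 have ib: "set_integrable lborel ?B (%_. B)" using assms by (intro box_integrable) simp
 have "\<bar>LINT h:?B|lborel. g (z + h)\<bar> <= (LINT h:?B|lborel. B)"
  unfolding set_lebesgue_integral_def
 proof (rule order_trans[OF integral_abs_bound], rule integral_mono')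
  show "integ (%x. indicator ?B x *\<^sub>R B)" using ib by (simp add: set_integrable_def)
 qed (use assms in \<open>auto simp: indicator_def abs_mult intro: order_trans[OF abs_ge_zero]\<close>)
 also have "\<dots> = B * e\<^sup>2" using box_measure[of e] assms by (simp add: set_lebesgue_integral_def)
 finally show ?thesis using assms by (simp add: box_avg_def abs_divide field_simps)
qed

lemma box_avg_pointwise:
 assumes W: "cont W" and e: "!!n. e n > 0" "e ---> 0"
 shows "(%n. box_avg (e n) W z) ---> W z"
proof (rule tendstoI)
 fix d :: real assume d: "d > 0"
 have "isCont W z" using W continuous_on_eq_continuous_at[OF open_UNIV, of W] by blast
 then obtain r where r: "r > 0" "!!z'. dist z' z < r ==> dist (W z') (W z) < d / 2"
  using d unfolding continuous_at_eps_delta by (metis half_gt_zero)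
 have "eventually (%n. e n < r / 2) sequentially"
  using e r by (intro order_tendstoD(2)[OF e(2)]) auto
 then show "eventually (%n. dist (box_avg (e n) W z) (W z) < d) sequentially"
 proof eventually_elim
  case (elim n)
  let ?B = "{0..e n} \<times> {0..e n}"
  have [measurable]: "?B \<in> sets borel" by (intro borel_closed closed_Times) auto
  have small: "\<bar>W (z + h) - W z\<bar> <= d / 2" if "h \<in> ?B" for h
  proof -
   have "dist (z + h) z <= \<bar>fst h\<bar> + \<bar>snd h\<bar>" by (simp add: dist_norm sqrt_sum_squares_le_sum_abs norm_prod_def)
   then show ?thesis using that elim r(2)[of "z + h"] by (auto simp: dist_real_def)
  qed
  have c: "continuous_on S (%h. W (z + h))" for S
   by (rule continuous_on_compose2[OF W]) (auto intro!: continuous_intros)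
  have si: "set_integrable lborel ?B (%h. W (z + h))"
   unfolding set_integrable_def by (intro borel_integrable_compact compact_Times compact_Icc c)
  have sc: "set_integrable lborel ?B (%h. c)" for c :: real using box_integrable[OF less_imp_le[OF e(1)[of n]]] .
  have v: "(LINT h:?B|lborel. c) = c * e n ^ 2" for c :: real
   using box_measure[of "e n"] e(1)[of n] by (simp add: set_lebesgue_integral_def)
  have up: "W (z + h) <= W z + d / 2" "W z - d / 2 <= W (z + h)" if "h \<in> ?B" for h
   using small[OF that] by linarith+
  have "(LINT h:?B|lborel. W (z + h)) <= (LINT h:?B|lborel. W z + d / 2)"
   by (intro set_integral_mono si sc up)
  moreover have "(LINT h:?B|lborel. W z - d / 2) <= (LINT h:?B|lborel. W (z + h))"
   by (intro set_integral_mono si sc up)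
  ultimately have "box_avg (e n) W z <= W z + d / 2" "W z - d / 2 <= box_avg (e n) W z"
   unfolding box_avg_def v using e(1)[of n] by (auto simp: field_simps)
  then show ?case using d by (auto simp: dist_real_def abs_if)
 qed
qed

lemma box_avg_rectangle:
 assumes "e > 0"
 shows "box_avg e g (x, t) = (LINT z:{x..x + e} \<times> {t..t + e}|lborel. g z) / e\<^sup>2"
proof (cases "(%z. indicator ({x..x + e} \<times> {t..t + e}) z *\<^sub>R g z) \<in> BM")
 case True
 have "(LINT z|lborel. indicator ({x..x + e} \<times> {t..t + e}) (z + (x, t)) *\<^sub>R g (z + (x, t)))
   = (LINT z|lborel. indicator ({x..x + e} \<times> {t..t + e}) z *\<^sub>R g z)"
  using lborel_translate(2)[OF True, of "(x, t)"] by simp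
 moreover have "indicator ({x..x + e} \<times> {t..t + e}) (z + (x, t)) = (indicator ({0..e} \<times> {0..e}) z :: real)" for z
  by (cases z) (auto simp: indicator_def)
 ultimately show ?thesis by (simp add: box_avg_def set_lebesgue_integral_def add.commute)
next
 case False
 let ?F = "%z. indicator ({x..x + e} \<times> {t..t + e}) z *\<^sub>R g z"
 let ?G = "%h. indicator ({0..e} \<times> {0..e}) h *\<^sub>R g ((x, t) + h)"
 have eq: "?F z = ?G (z - (x, t))" for z by (cases z) (auto simp: indicator_def)
 have "?G \<notin> BM"
 proof
  assume [measurable]: "?G \<in> BM"
  have "(%z. ?G (z - (x, t))) \<in> BM" by measurable
  with False show False unfolding eq[symmetric] by simp
 qed
 then have "\<not> integ ?F" "\<not> integ ?G"
  using False borel_measurable_integrable by auto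
 then show ?thesis by (simp add: box_avg_def set_lebesgue_integral_def not_integrable_integral_eq)
qed

section \<open>Entropy flows\<close>

text \<open>\<open>sig\<close> is the side on which \<open>y\<close> is approached. The factor
 \<open>sig\<close> in front of the integral turns the two opposite inequalities of the compatibility condition
 into one.\<close>

definition trace_nonpos :: "real => real => real => real => (real \<times> real => real) => bool" where
 "trace_nonpos s T y sig g \<longleftrightarrow> (\<forall>bta K e. cont bta \<and> (\<forall>t. 0 <= bta t) \<and> compact K \<and> K \<subseteq> {s<..<T} \<and>
   (\<forall>t. t \<notin> K --> bta t = 0) \<and> 0 < e -->
   (\<exists>d>0. AE x in lborel. 0 < sig * (x - y) \<and> sig * (x - y) < d --> sig * (LINT t|lborel. g (x, t) * bta t) <= e))"

text \<open>The limit is uniform in time: this is what lets the value of the potential at a moving point of a thin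
 layer be replaced by its trace.\<close>

definition trace_lim :: "real => real => real => real => (real \<times> real => real) => (real => real) => bool" where
 "trace_lim s T y sig U L \<longleftrightarrow> (\<forall>e>0. \<exists>d>0. \<forall>x t. 0 < sig * (x - y) --> sig * (x - y) < d --> t \<in> {s..T} -->
   \<bar>U (x, t) - L t\<bar> < e)"

text \<open>The solution \<open>v\<close> and its potential \<open>U\<close> in a space-time window. During the whole
 window the potential jumps upwards at the points of \<open>Xp\<close> and downwards at those of \<open>Xn\<close>,
 and it is continuous elsewhere; singular points whose mass has already disappeared are regular points of the window.
 The derivatives of \<open>U\<close> are stated through integrals over rectangles, because \<open>v\<close> is only
 integrable.\<close>

locale entropy_flow =
 fixes H :: "real => real" and v U :: "real \<times> real => real" and s T l r C :: real
  and Xp Xn :: "real set" and Ur Ul :: "real => real => real"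
 assumes H_cont: "cont H" and H_bound: "!!xi. \<bar>H xi\<bar> <= C"
  and sT: "s < T"
  and X_fin: "finite Xp" "finite Xn"
  and X_disj: "Xp \<inter> Xn = {}" and X_in: "Xp \<subseteq> {l<..<r}" "Xn \<subseteq> {l<..<r}"
  and v_meas [measurable]: "v \<in> BM"
  and v_int: "set_integrable lborel ({l..r} \<times> {s..T}) v"
  and entropy: "!!k K ze zex zet. compact K ==> K \<subseteq> ({l<..<r} - (Xp \<union> Xn)) \<times> {s<..<T} ==>
    C1_plane ze zex zet ==> (!!z. 0 <= ze z) ==> (!!z. z \<notin> K ==> ze z = 0 \<and> zex z = 0 \<and> zet z = 0) ==>
    0 <= (LINT z|lborel. \<bar>v z - k\<bar> * zet z + sgn (v z - k) * (H (v z) - H k) * zex z)"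
  and U_cont: "continuous_on (({l<..<r} - (Xp \<union> Xn)) \<times> {s..T}) U"
  and U_lip: "!!x t t'. x \<in> {l<..<r} - (Xp \<union> Xn) ==> t \<in> {s..T} ==> t' \<in> {s..T} ==>
    \<bar>U (x, t) - U (x, t')\<bar> <= C * \<bar>t - t'\<bar>"
  and U_x: "!!x y t t'. x <= y ==> t <= t' ==> {x..y} \<subseteq> {l<..<r} - (Xp \<union> Xn) ==> {t..t'} \<subseteq> {s<..<T} ==>
    integral {t..t'} (%tau. U (y, tau) - U (x, tau)) = (LINT z:{x..y} \<times> {t..t'}|lborel. v z)"
  and U_t: "!!x y t t'. x <= y ==> t <= t' ==> {x..y} \<subseteq> {l<..<r} - (Xp \<union> Xn) ==> {t..t'} \<subseteq> {s<..<T} ==>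
    integral {x..y} (%xi. U (xi, t') - U (xi, t)) = - (LINT z:{x..y} \<times> {t..t'}|lborel. H (v z))"
  and lim_right: "!!y. y \<in> Xp \<union> Xn ==> trace_lim s T y 1 U (Ur y)"
  and lim_left: "!!y. y \<in> Xp \<union> Xn ==> trace_lim s T y (- 1) U (Ul y)"
  and jump_p: "!!y t. y \<in> Xp ==> t \<in> {s..T} ==> Ul y t <= Ur y t"
  and jump_n: "!!y t. y \<in> Xn ==> t \<in> {s..T} ==> Ur y t <= Ul y t"
  and compat_p: "!!y k sig. y \<in> Xp ==> \<bar>sig\<bar> = 1 ==>
    trace_nonpos s T y sig (%z. sgn_minus (v z - k) * (H (v z) - H k))"
  and compat_n: "!!y k sig. y \<in> Xn ==> \<bar>sig\<bar> = 1 ==>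
    trace_nonpos s T y sig (%z. sgn_plus (v z - k) * (H (v z) - H k))"
begin

abbreviation "X \<equiv> Xp \<union> Xn"
abbreviation "R \<equiv> {l<..<r} - X"

lemma H_meas [measurable]: "H \<in> BM"
 using H_cont by (intro borel_measurable_continuous_onI)

text \<open>The difference of the potential and an affine solution of slope \<open>k\<close>.\<close>

definition W :: "real => real => real \<times> real => real" where
 "W k c z = U z - (k * fst z - H k * snd z + c)"

definition f :: "real => real \<times> real => real" where "f k z = H (v z) - H k"
definition q :: "real => real \<times> real => real" where "q k z = sgn (v z - k) * f k z"

lemma fq_meas [measurable]: "f k \<in> BM" "q k \<in> BM"
 unfolding f_def[abs_def] q_def[abs_def] by measurable

lemma C_nonneg: "0 <= C" using H_bound[of 0] by linarith

lemma f_bound: "\<bar>f k z\<bar> <= 2 * C"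
 using H_bound[of "v z"] H_bound[of k] unfolding f_def by linarith

lemma q_bound: "\<bar>q k z\<bar> <= 2 * C"
 using f_bound[of k z] C_nonneg by (auto simp: q_def sgn_real_def)

lemma W_cont: "continuous_on (R \<times> {s..T}) (W k c)"
 unfolding W_def by (intro continuous_intros U_cont)

lemma open_R: "open R"
 using X_fin by (intro open_Diff) (auto intro: finite_imp_closed)

text \<open>Near a compact set of regular points, \<open>W\<close> is approximated by smooth functions whose
 derivatives are the averages of \<open>v - k\<close> and \<open>- f\<close>.\<close>

lemma approximants:
 assumes Kx: "compact Kx" "Kx \<subseteq> R" and t12: "s < t1" "t2 < T"
 obtains wn wx wt :: "nat => real \<times> real => real" and B :: real where
  "!!n. C1_plane (wn n) (wx n) (wt n)"
  "!!z. z \<in> Kx \<times> {t1..t2} ==> (%n. wn n z) ---> W k c z"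
  "!!n z. \<bar>wn n z\<bar> <= B"
  "!!n z. z \<in> Kx \<times> {t1..t2} ==> \<bar>wt n z\<bar> <= 2 * C"
  "AE z in lborel. z \<in> Kx \<times> {t1..t2} --> (%n. wt n z) ---> - f k z"
  "!!n. set_integrable lborel (Kx \<times> {t1..t2}) (%z. \<bar>wx n z - (v z - k)\<bar>)"
  "(%n. LINT z:Kx \<times> {t1..t2}|lborel. \<bar>wx n z - (v z - k)\<bar>) ---> 0"
proof -
 obtain d where d: "d > 0" "!!x. infdist x Kx <= d ==> Kx \<noteq> {} ==> x \<in> R" "t2 + d < T"
 proof -
  obtain d0 where d0: "d0 > 0" "Kx \<noteq> {} ==> {x. infdist x Kx <= d0} \<subseteq> R"
  proof (cases "Kx = {}")
   case False
   obtain e where e: "e > 0" "(\<Union>x\<in>Kx. cball x e) \<subseteq> R"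
    using compact_subset_open_imp_cball_epsilon_subset[OF Kx(1) open_R Kx(2)] by auto
   have "{x. infdist x Kx <= e} \<subseteq> (\<Union>x\<in>Kx. cball x e)"
   proof
    fix x assume "x \<in> {x. infdist x Kx <= e}"
    moreover obtain y where "y \<in> Kx" "infdist x Kx = dist x y"
     using infdist_attains_inf[OF compact_imp_closed[OF Kx(1)] False] by blast
    ultimately show "x \<in> (\<Union>x\<in>Kx. cball x e)" by (auto simp: dist_commute)
   qed
   then have "{x. infdist x Kx <= e} \<subseteq> R" using e(2) by (rule subset_trans)
   with e(1) show ?thesis by (rule that)
  qed (use that[of 1] in auto)
  show ?thesis
  proof (rule that[of "min d0 ((T - t2) / 2)"])
   show "0 < min d0 ((T - t2) / 2)" using d0 t12 by simp
   have "min d0 ((T - t2) / 2) <= (T - t2) / 2" by (rule min.cobounded2)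
   then have "t2 + min d0 ((T - t2) / 2) <= t2 + (T - t2) / 2" by simp
   also have "\<dots> < T" using t12(2) by (simp add: field_simps)
   finally show "t2 + min d0 ((T - t2) / 2) < T" .
   show "x \<in> R" if "infdist x Kx <= min d0 ((T - t2) / 2)" "Kx \<noteq> {}" for x
    using d0(2)[OF that(2)] that(1) by auto
  qed
 qed
 define K' where "K' = {x + xi | x xi. x \<in> Kx \<and> xi \<in> {0..d}}"
 have K'c: "compact K'"
  unfolding K'_def using compact_sums[OF Kx(1) compact_Icc] by simp
 have K'R: "K' \<subseteq> R"
 proof
  fix z assume "z \<in> K'"
  then obtain x xi where z: "z = x + xi" "x \<in> Kx" "xi \<in> {0..d}" by (auto simp: K'_def)
  have "infdist z Kx <= dist z x" using z by (intro infdist_le)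
  moreover have "dist z x <= d" using z by (simp add: dist_real_def)
  ultimately show "z \<in> R" using z(2) by (intro d(2)) auto
 qed
 let ?K' = "K' \<times> {t1..t2 + d}"
 have cW: "continuous_on ?K' (W k c)"
  by (rule continuous_on_subset[OF W_cont]) (use K'R d t12 in auto)
 have compK': "compact ?K'" using K'c by (intro compact_Times) auto
 obtain B where B: "B \<ge> 0" "!!z. z \<in> ?K' ==> \<bar>W k c z\<bar> <= B"
 proof -
  obtain b where "\<forall>y\<in>W k c ` ?K'. norm y <= b"
   using compact_imp_bounded[OF compact_continuous_image[OF cW compK']] unfolding bounded_iff by blast
  then show ?thesis by (intro that[of "max 0 b"]) (auto simp: le_max_iff_disj)
 qed
 obtain w where w: "cont w" "!!z. z \<in> ?K' ==> w z = W k c z" "!!z. \<bar>w z\<bar> <= B"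
  using Tietze[OF cW, of UNIV B] compK' B by (auto simp: compact_imp_closed)
 have wm: "w \<in> BM" using w(1) by (intro borel_measurable_continuous_onI)
 let ?K = "Kx \<times> {t1..t2}"
 have Kc: "compact ?K" using Kx by (intro compact_Times) auto
 have KK': "?K \<subseteq> ?K'"
 proof -
  have "x \<in> K'" if "x \<in> Kx" for x unfolding K'_def using that d(1) by force
  then show ?thesis using d(1) by auto
 qed
 define Q where "Q = {l..r} \<times> {s..T}"
 have Qm [measurable]: "Q \<in> sets borel" unfolding Q_def by (intro borel_closed closed_Times) auto
 have Qc: "compact Q" unfolding Q_def by (intro compact_Times) auto
 have Qi: "integ (%z. indicator Q z * a)" for a :: real
  using borel_integrable_compact[OF Qc, of "%_. a"] by (simp)
 define g where "g z = indicator Q z * (v z - k)" for z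
 define h where "h z = indicator Q z * f k z" for z
 have gi: "integ g"
 proof -
  have "integ (%z. indicator Q z * v z - indicator Q z * k)"
   using v_int Qi[of k] unfolding set_integrable_def Q_def by (intro Bochner_Integration.integrable_diff) simp_all
  then show ?thesis unfolding g_def by (simp add: right_diff_distrib)
 qed
 have hi: "integ h"
  by (rule Bochner_Integration.integrable_bound[OF Qi[of "2 * C"]])
    (use f_bound C_nonneg in \<open>auto simp: h_def[abs_def] abs_mult indicator_def\<close>)
 have K'Q: "?K' \<subseteq> Q" using K'R d t12 by (auto simp: Q_def)
 have rect: "{x..x + e} \<times> {t..t + e} \<subseteq> ?K'" "{x..x + e} \<subseteq> K'" "{t..t+e} \<subseteq> {t1..t2 + d}"
  if "(x, t) \<in> ?K" "0 < e" "e <= d" for x t e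
 proof -
  show "{x..x + e} \<subseteq> K'"
  proof
   fix y assume "y \<in> {x..x + e}"
   then have "y = x + (y - x) \<and> x \<in> Kx \<and> y - x \<in> {0..d}" using that by auto
   then show "y \<in> K'" unfolding K'_def by blast
  qed
  moreover show "{t..t+e} \<subseteq> {t1..t2 + d}" using that by auto
  ultimately show "{x..x + e} \<times> {t..t + e} \<subseteq> ?K'" by auto
 qed
 have bx: "box_avg_x e w (x, t) = box_avg e g (x, t)" if xt: "(x, t) \<in> ?K" and e: "0 < e" "e <= d" for x t e
 proof -
  note rc = rect[OF xt e]
  have wW: "w (y, tau) = W k c (y, tau)" if "y \<in> {x..x+e}" "tau \<in> {t..t+e}" for y tau
   using subsetD[OF rc(1), of "(y, tau)"] that by (intro w(2)) simp
  have sub: "{x..x + e} \<subseteq> R" "{t..t + e} \<subseteq> {s<..<T}" using rc K'R t12 d by auto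
  have cU: "continuous_on {t..t+e} (%tau. U (y, tau))" if "y \<in> {x..x+e}" for y
  proof (rule continuous_on_compose2[OF U_cont])
   show "(%tau. (y, tau)) ` {t..t+e} \<subseteq> R \<times> {s..T}" using that sub less_imp_le by fastforce
  qed (intro continuous_intros)
  have cw: "continuous_on {t..t+e} (%tau. w (y, tau))" for y
   by (rule continuous_on_comp_UNIV[OF w(1)]) (intro continuous_intros)
  have sh: "integral {0..e} (%tau. w (y, t + tau)) = integral {t..t+e} (%tau. w (y, tau))" for y
   using integral_shift_Icc_real[of 0 e "%tau. w (y, tau)" t] by (simp add: o_def add.commute)
  have "box_avg_x e w (x, t) * e\<^sup>2 = integral {t..t+e} (%tau. w (x + e, tau)) - integral {t..t+e} (%tau. w (x, tau))"
   unfolding box_avg_x_def fst_conv snd_conv sh using e by simp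
  also have "\<dots> = integral {t..t+e} (%tau. w (x + e, tau) - w (x, tau))"
   by (intro Henstock_Kurzweil_Integration.integral_diff[symmetric] integrable_continuous_interval cw)
  also have "\<dots> = integral {t..t+e} (%tau. U (x + e, tau) - U (x, tau) - k * e)"
  proof (rule Henstock_Kurzweil_Integration.integral_cong)
   show "w (x + e, tau) - w (x, tau) = U (x + e, tau) - U (x, tau) - k * e" if "tau \<in> {t..t+e}" for tau
    using wW[of "x + e" tau] wW[of x tau] that e by (simp add: W_def algebra_simps)
  qed
  also have "\<dots> = integral {t..t+e} (%tau. U (x + e, tau) - U (x, tau)) - integral {t..t+e} (%tau. k * e)"
   using e by (intro Henstock_Kurzweil_Integration.integral_diff integrable_continuous_interval continuous_intros cU) auto
  also have "\<dots> = (LINT z:{x..x+e} \<times> {t..t+e}|lborel. v z) - k * e\<^sup>2"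
   using U_x[of x "x + e" t "t + e"] sub e by (simp add: power2_eq_square)
  also have "(LINT z:{x..x+e} \<times> {t..t+e}|lborel. v z) - k * e\<^sup>2 = (LINT z:{x..x+e} \<times> {t..t+e}|lborel. g z)"
  proof -
   let ?r = "{x..x+e} \<times> {t..t+e}"
   have rm: "?r \<in> sets borel" by (intro borel_closed closed_Times) auto
   have rQ: "?r \<subseteq> Q" using rc K'Q by auto
   have "box_avg e (%_. k) (x, t) = k" using e box_measure[of e] by (simp add: box_avg_def set_lebesgue_integral_def)
   then have kk: "(LINT z:?r|lborel. k) = k * e\<^sup>2" using box_avg_rectangle[of e "%_. k" x t] e by (simp add: divide_eq_eq)
   have iv: "set_integrable lborel ?r v" by (rule set_integrable_subset[OF v_int]) (use rm rQ in \<open>auto simp: Q_def\<close>)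
   have ik: "set_integrable lborel ?r (%_. k)"
    unfolding set_integrable_def by (intro borel_integrable_compact compact_Times) auto
   have "(LINT z:?r|lborel. g z) = (LINT z:?r|lborel. v z - k)"
    using subsetD[OF rQ] rm by (intro set_lebesgue_integral_cong) (simp_all add: g_def del: split_paired_All)
   then show ?thesis using set_integral_diff(2)[OF iv ik] kk by simp
  qed
  finally have "box_avg_x e w (x, t) = (LINT z:{x..x+e} \<times> {t..t+e}|lborel. g z) / e\<^sup>2"
   using e by (intro iffD2[OF nonzero_eq_divide_eq]) auto
  then show ?thesis using box_avg_rectangle[of e g x t] e by simp
 qed
 have bt: "box_avg_t e w (x, t) = - box_avg e h (x, t)" if xt: "(x, t) \<in> ?K" and e: "0 < e" "e <= d" for x t e
 proof -
  note rc = rect[OF xt e]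
  have wW: "w (y, tau) = W k c (y, tau)" if "y \<in> {x..x+e}" "tau \<in> {t..t+e}" for y tau
   using subsetD[OF rc(1), of "(y, tau)"] that by (intro w(2)) simp
  have sub: "{x..x + e} \<subseteq> R" "{t..t + e} \<subseteq> {s<..<T}" using rc K'R t12 d by auto
  have cU: "continuous_on {x..x+e} (%y. U (y, tau))" if "tau \<in> {t..t+e}" for tau
  proof (rule continuous_on_compose2[OF U_cont])
   show "(%y. (y, tau)) ` {x..x+e} \<subseteq> R \<times> {s..T}" using that sub less_imp_le by fastforce
  qed (intro continuous_intros)
  have cw: "continuous_on {x..x+e} (%y. w (y, tau))" for tau
   by (rule continuous_on_comp_UNIV[OF w(1)]) (intro continuous_intros)
  have sh: "integral {0..e} (%xi. w (x + xi, tau)) = integral {x..x+e} (%y. w (y, tau))" for tau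
   using integral_shift_Icc_real[of 0 e "%y. w (y, tau)" x] by (simp add: o_def add.commute)
  have "box_avg_t e w (x, t) * e\<^sup>2 = integral {x..x+e} (%y. w (y, t + e)) - integral {x..x+e} (%y. w (y, t))"
   unfolding box_avg_t_def fst_conv snd_conv sh using e by simp
  also have "\<dots> = integral {x..x+e} (%y. w (y, t + e) - w (y, t))"
   by (intro Henstock_Kurzweil_Integration.integral_diff[symmetric] integrable_continuous_interval cw)
  also have "\<dots> = integral {x..x+e} (%y. U (y, t + e) - U (y, t) + H k * e)"
  proof (rule Henstock_Kurzweil_Integration.integral_cong)
   show "w (y, t + e) - w (y, t) = U (y, t + e) - U (y, t) + H k * e" if "y \<in> {x..x+e}" for y
    using wW[of y "t + e"] wW[of y t] that e by (simp add: W_def algebra_simps)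
  qed
  also have "\<dots> = integral {x..x+e} (%y. U (y, t + e) - U (y, t)) + integral {x..x+e} (%y. H k * e)"
   using e by (intro Henstock_Kurzweil_Integration.integral_add integrable_continuous_interval continuous_intros cU) auto
  also have "\<dots> = - (LINT z:{x..x+e} \<times> {t..t+e}|lborel. H (v z)) + H k * e\<^sup>2"
   using U_t[of x "x + e" t "t + e"] sub e by (simp add: power2_eq_square)
  also have "\<dots> = - (LINT z:{x..x+e} \<times> {t..t+e}|lborel. h z)"
  proof -
   let ?r = "{x..x+e} \<times> {t..t+e}"
   have rm [measurable]: "?r \<in> sets borel" by (intro borel_closed closed_Times) auto
   have rQ: "?r \<subseteq> Q" using rc K'Q by auto
   have "box_avg e (%_. H k) (x, t) = H k" using e box_measure[of e] by (simp add: box_avg_def set_lebesgue_integral_def)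
   then have kk: "(LINT z:?r|lborel. H k) = H k * e\<^sup>2" using box_avg_rectangle[of e "%_. H k" x t] e by (simp add: divide_eq_eq)
   have ik: "set_integrable lborel ?r (%_. a)" for a :: real
    unfolding set_integrable_def by (intro borel_integrable_compact compact_Times) auto
   have iv: "set_integrable lborel ?r (%z. H (v z))"
    by (rule set_integrable_bound[OF ik[of C]]) (auto simp: set_borel_measurable_def H_bound order_trans[OF H_bound abs_ge_self])
   have "(LINT z:?r|lborel. h z) = (LINT z:?r|lborel. H (v z) - H k)"
    using subsetD[OF rQ] rm by (intro set_lebesgue_integral_cong) (simp_all add: h_def f_def del: split_paired_All)
   then show ?thesis using set_integral_diff(2)[OF iv ik] kk by simp
  qed
  finally have "box_avg_t e w (x, t) = (- (LINT z:{x..x+e} \<times> {t..t+e}|lborel. h z)) / e\<^sup>2"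
   using e by (intro iffD2[OF nonzero_eq_divide_eq]) auto
  then show ?thesis using box_avg_rectangle[of e h x t] e by simp
 qed
 define en where "en n = d / real (Suc n)" for n
 have en: "0 < en n" "en n <= d" for n using d(1) by (auto simp: en_def field_simps)
 have en0: "en ---> 0"
  unfolding en_def using tendsto_mult[OF tendsto_const[of d] LIMSEQ_inverse_real_of_nat] by (simp add: divide_inverse)
 have L1h: "(%n. LINT z|lborel. norm (box_avg (en n) h z - h z)) ---> 0"
  using box_avg_L1[OF hi en(1) en0] by simp
 have "!!n. integ (%z. box_avg (en n) h z - h z)"
  using box_avg_abs_le(2)[OF en(1) hi] hi by auto
 from tendsto_L1_AE_subseq[OF this L1h] obtain rr :: "nat => nat" where rr: "strict_mono rr"
  and AEh: "AE z in lborel. (%n. box_avg (en (rr n)) h z - h z) ---> 0" by blast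
 define e where "e n = en (rr n)" for n
 have e: "0 < e n" "e n <= d" for n using en by (auto simp: e_def)
 have e0: "e ---> 0" unfolding e_def using LIMSEQ_subseq_LIMSEQ[OF en0 rr] by (simp add: o_def)
 have [measurable]: "?K \<in> sets borel" using Kc by (intro borel_closed compact_imp_closed)
 have KQ: "?K \<subseteq> Q" using KK' K'Q by auto
 have ibx: "integ (%z. \<bar>box_avg (e n) g z - g z\<bar>)" for n
  using box_avg_abs_le(2)[OF e(1) gi] gi by auto
 have eqx: "indicator ?K z *\<^sub>R \<bar>box_avg_x (e n) w z - (v z - k)\<bar> = indicator ?K z *\<^sub>R \<bar>box_avg (e n) g z - g z\<bar>" for n z
  using bx[of "fst z" "snd z" "e n"] e KQ by (auto simp: indicator_def g_def)
 have ixK: "integ (%z. indicator ?K z *\<^sub>R \<bar>box_avg (e n) g z - g z\<bar>)" for n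
  using ibx by (intro integrable_mult_indicator) auto
 show ?thesis
 proof (rule that[of "%n. box_avg (e n) w" "%n. box_avg_x (e n) w" "%n. box_avg_t (e n) w" B])
  show "C1_plane (box_avg (e n) w) (box_avg_x (e n) w) (box_avg_t (e n) w)" for n
   using w(1) e by (intro box_avg_C1)
  show "(%n. box_avg (e n) w z) ---> W k c z" if "z \<in> ?K" for z
   using box_avg_pointwise[OF w(1) e(1) e0, of z] w(2)[of z] that KK' by auto
  show "\<bar>box_avg (e n) w z\<bar> <= B" for n z using e w(3) wm by (intro box_avg_abs_bound)
  show "\<bar>box_avg_t (e n) w z\<bar> <= 2 * C" if "z \<in> ?K" for n z
  proof -
   have "\<bar>box_avg (e n) h z\<bar> <= 2 * C"
   proof (rule box_avg_abs_bound[OF e(1)])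
    show "\<bar>h z\<bar> <= 2 * C" for z using f_bound[of k z] C_nonneg by (auto simp: h_def indicator_def)
   qed (use hi in auto)
   then show ?thesis using bt[of "fst z" "snd z" "e n"] that e by auto
  qed
  show "AE z in lborel. z \<in> ?K --> (%n. box_avg_t (e n) w z) ---> - f k z"
   using AEh
  proof eventually_elim
   case (elim z)
   show ?case
   proof
    assume z: "z \<in> ?K"
    have "(%n. - (box_avg (e n) h z - h z) - h z) ---> - 0 - h z"
     using elim unfolding e_def by (intro tendsto_intros)
    moreover have "box_avg_t (e n) w z = - (box_avg (e n) h z - h z) - h z" for n
     using bt[of "fst z" "snd z" "e n"] z e by auto
    moreover have "h z = f k z" using z KQ by (auto simp: h_def)
    ultimately show "(%n. box_avg_t (e n) w z) ---> - f k z" by simp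
   qed
  qed
  show "set_integrable lborel ?K (%z. \<bar>box_avg_x (e n) w z - (v z - k)\<bar>)" for n
   unfolding set_integrable_def eqx by (rule ixK)
  have "(%n. LINT z:?K|lborel. \<bar>box_avg (e n) g z - g z\<bar>) ---> 0"
  proof (rule tendsto_sandwich[where f="%_. 0", rotated -1])
   show "(%n. LINT z|lborel. \<bar>box_avg (e n) g z - g z\<bar>) ---> 0" using box_avg_L1[OF gi e(1) e0] .
   show "eventually (%n. (LINT z:?K|lborel. \<bar>box_avg (e n) g z - g z\<bar>) <= (LINT z|lborel. \<bar>box_avg (e n) g z - g z\<bar>)) sequentially"
    unfolding set_lebesgue_integral_def
    by (intro always_eventually allI integral_mono ixK ibx) (auto simp: indicator_def)
  qed (auto simp: set_lebesgue_integral_def intro!: always_eventually integral_nonneg_AE)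
  then show "(%n. LINT z:?K|lborel. \<bar>box_avg_x (e n) w z - (v z - k)\<bar>) ---> 0"
   unfolding set_lebesgue_integral_def eqx .
 qed
qed

end

section \<open>Calculus with compactly supported functions\<close>

lemma bounded_on_compact:
 fixes g :: "'a::topological_space => real"
 assumes "continuous_on S g" "compact S"
 obtains M where "0 <= M" "!!x. x \<in> S ==> \<bar>g x\<bar> <= M"
proof -
 obtain b where "\<forall>y\<in>g ` S. norm y <= b"
  using compact_imp_bounded[OF compact_continuous_image[OF assms]] unfolding bounded_iff by blast
 then show ?thesis by (intro that[of "max 0 b"]) (auto simp: le_max_iff_disj)
qed

lemma bounded_compact_support:
 fixes g :: "'a::topological_space => real"
 assumes "cont g" "compact K" "!!x. x \<notin> K ==> g x = 0"
 obtains M where "0 <= M" "!!x. \<bar>g x\<bar> <= M"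
proof -
 obtain M where "0 <= M" "!!x. x \<in> K ==> \<bar>g x\<bar> <= M"
  using bounded_on_compact[OF continuous_on_subset[OF assms(1)] assms(2)] by blast
 then show ?thesis using assms(3) by (intro that[of M]) (metis abs_zero)+
qed

lemma integrable_compact_support:
 fixes g :: "'a::euclidean_space => real"
 assumes "cont g" "compact K" "!!x. x \<notin> K ==> g x = 0"
 shows "integ g"
proof -
 have "integ (%x. indicator K x *\<^sub>R g x)"
  using assms by (intro borel_integrable_compact) (auto intro: continuous_on_subset)
 moreover have "(%x. indicator K x *\<^sub>R g x) = g" using assms(3) by (auto simp: indicator_def fun_eq_iff)
 ultimately show ?thesis by simp
qed

lemma integral_deriv_compact_support:
 fixes g :: "real => real"
 assumes d: "!!x. (g has_real_derivative g' x) (at x)" and c: "cont g'"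
  and z: "!!x. x \<notin> {a..b} ==> g x = 0 \<and> g' x = 0"
 shows "(LINT x|lborel. g' x) = 0"
proof -
 define A where "A = min a b - 1"
 define B where "B = max a b + 1"
 have "has_bochner_integral lborel (%x. g' x * indicator {A..B} x) (g B - g A)"
 proof (rule has_bochner_integral_FTC_Icc_real)
  show "isCont g' x" for x using c by (simp add: continuous_on_eq_continuous_at)
 qed (use d in \<open>auto simp: A_def B_def\<close>)
 moreover have "g' x * indicator {A..B} x = g' x" for x
 proof (cases "x \<in> {A..B}")
  case False
  then have "x \<notin> {a..b}" by (auto simp: A_def B_def)
  with z[of x] show ?thesis by simp
 qed simp
 moreover have "g A = 0" "g B = 0" using z[of A] z[of B] by (auto simp: A_def B_def min_def max_def split: if_splits)
 ultimately show ?thesis by (simp add: has_bochner_integral_iff)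
qed

lemma integral_dt_zero:
 fixes g gt :: "real \<times> real => real"
 assumes d: "!!x t. ((%t. g (x, t)) has_real_derivative gt (x, t)) (at t)" and c: "cont gt"
  and K: "compact Kx" and z: "!!z. z \<notin> Kx \<times> {a..b} ==> g z = 0 \<and> gt z = 0"
 shows "(LINT z|lborel. gt z) = 0"
proof -
 have i: "integ gt"
  using integrable_compact_support[OF c compact_Times[OF K compact_Icc]] z by blast
 have "(LINT z|lborel. gt z) = (LINT x|lborel. (LINT t|lborel. gt (x, t)))"
  using lborel_pair.integral_fst[of "%x t. gt (x, t)"] i by (simp add: lborel_prod)
 also have "(%x. LINT t|lborel. gt (x, t)) = (%x. 0)"
  by (rule ext, rule integral_deriv_compact_support[OF d, where a=a and b=b])
    (use z in \<open>auto intro!: continuous_on_comp_UNIV[OF c] continuous_intros\<close>)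
 finally show ?thesis by simp
qed

lemma integrable_product_lborel:
 fixes a b :: "real => real"
 assumes "integ a" "integ b"
 shows "integ (%z. a (fst z) * b (snd z))"
  and "(LINT z|lborel. a (fst z) * b (snd z)) = (LINT x|lborel. a x) * (LINT t|lborel. b t)"
proof -
 have m [measurable]: "a \<in> BM" "b \<in> BM" using assms by auto
 have "integrable (lborel \<Otimes>\<^sub>M lborel) (%z. a (fst z) * b (snd z))"
  by (rule lborel_pair.Fubini_integrable) (use assms in \<open>auto simp: abs_mult\<close>)
 then show i: "integ (%z. a (fst z) * b (snd z))" by (simp add: lborel_prod)
 show "(LINT z|lborel. a (fst z) * b (snd z)) = (LINT x|lborel. a x) * (LINT t|lborel. b t)"
  using lborel_pair.integral_fst[of "%x t. a x * b t"] i by (simp add: lborel_prod case_prod_unfold)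
qed

lemma deriv_imp_continuous_on:
 "(!!x. (g has_real_derivative g' x) (at x)) ==> continuous_on S g" for g :: "real => real"
 by (rule DERIV_continuous_on) (rule has_field_derivative_at_within)

lemma measurable_fst_snd_continuous:
 fixes g :: "real => real"
 assumes "cont g"
 shows "(%z::real \<times> real. g (fst z)) \<in> BM"
  and "(%z::real \<times> real. g (snd z)) \<in> BM"
 by (intro borel_measurable_continuous_onI continuous_on_comp_UNIV[OF assms] continuous_on_fst continuous_on_snd continuous_on_id)+

lemma deriv_zero_off_support:
 fixes g :: "real => real"
 assumes "!!x. (g has_real_derivative g' x) (at x)" "closed K" "!!x. x \<notin> K ==> g x = 0" "x \<notin> K"
 shows "g' x = 0"
proof -
 have "((%_. 0::real) has_real_derivative 0) (at x)" by simp
 then have "(g has_real_derivative 0) (at x)"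
  by (rule has_field_derivative_transform_within_open[where S="- K"]) (use assms in auto)
 then show ?thesis using assms(1) DERIV_unique by blast
qed

lemma dominated_convergence_real:
 fixes A :: "nat => 'a => real"
 assumes "g \<in> borel_measurable M" "!!n. A n \<in> borel_measurable M" "integrable M w"
  and "AE z in M. (%n. A n z) ---> g z" and dom: "!!n z. \<bar>A n z\<bar> <= w z"
 shows "(%n. integral\<^sup>L M (A n)) ---> integral\<^sup>L M g"
  and "integrable M g" and "!!n. integrable M (A n)"
 using integral_dominated_convergence[OF assms(1-4)] integrable_dominated_convergence[OF assms(1-4)]
  integrable_dominated_convergence2[OF assms(1-4)] dom by auto

context entropy_flow begin

section \<open>The entropy inequality along the potential\<close>

lemma v_int_K:
 assumes "compact Kx" "Kx \<subseteq> R" "s < t1" "t2 < T"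
 shows "integ (%z. indicator (Kx \<times> {t1..t2}) z * \<bar>v z - k\<bar>)"
  and "integ (%z. indicator (Kx \<times> {t1..t2}) z * a :: real)"
  and "Kx \<times> {t1..t2} \<in> sets borel"
proof -
 have c: "compact (Kx \<times> {t1..t2})" using assms by (intro compact_Times) auto
 then show m [measurable]: "Kx \<times> {t1..t2} \<in> sets borel" by (intro borel_closed compact_imp_closed)
 show i: "integ (%z. indicator (Kx \<times> {t1..t2}) z * a :: real)" for a
  using borel_integrable_compact[OF c, of "%_. a"] by simp
 have "set_integrable lborel (Kx \<times> {t1..t2}) v"
  by (rule set_integrable_subset[OF v_int]) (use assms in auto)
 then have "integ (%z. \<bar>indicator (Kx \<times> {t1..t2}) z * v z - indicator (Kx \<times> {t1..t2}) z * k\<bar>)"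
  using i[of k] unfolding set_integrable_def by (intro integrable_abs Bochner_Integration.integrable_diff) simp_all
 then show "integ (%z. indicator (Kx \<times> {t1..t2}) z * \<bar>v z - k\<bar>)"
  by (rule back_subst[of "integ"]) (auto simp: indicator_def fun_eq_iff)
qed

lemma abs_f_eq: "\<bar>v z - k\<bar> * f k z = q k z * (v z - k)"
 by (simp add: q_def abs_sgn mult_ac)

text \<open>The product of Kruzkov's inequality and the chain rule: along the gradient
 \<open>(v - k, - f)\<close> of \<open>W\<close> the entropy pair \<open>(q, \<bar>v - k\<bar>)\<close> is null, so a test function of the form
 \<open>th(W) eta psi\<close> only leaves the terms in which \<open>eta\<close> or \<open>psi\<close> is differentiated.\<close>

lemma entropy_along_potential:
 assumes th: "!!x. (th has_real_derivative th' x) (at x)" "!!x. (th' has_real_derivative th'' x) (at x)"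
   "cont th''" "!!x. 0 <= th x"
  and eta: "!!x. (eta has_real_derivative eta' x) (at x)" "cont eta'" "!!x. 0 <= eta x"
  and Kx: "compact Kx" "Kx \<subseteq> R" "!!x. x \<notin> Kx ==> eta x = 0"
  and psi: "!!x. (psi has_real_derivative psi' x) (at x)" "cont psi'" "!!x. 0 <= psi x"
  and t12: "s < t1" "t2 < T" "!!t. t \<notin> {t1..t2} ==> psi t = 0"
 shows "0 <= (LINT z|lborel. \<bar>v z - k\<bar> * (th (W k c z) * eta (fst z) * psi' (snd z)) + q k z * (th (W k c z) * eta' (fst z) * psi (snd z)))"
  and "integ (%z. \<bar>v z - k\<bar> * (th (W k c z) * eta (fst z) * psi' (snd z)))"
  and "integ (%z. q k z * (th (W k c z) * eta' (fst z) * psi (snd z)))"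
proof -
 let ?K = "Kx \<times> {t1..t2}"
 obtain wn wx wt B where wC: "!!n. C1_plane (wn n) (wx n) (wt n)"
  and w_lim: "!!z. z \<in> ?K ==> (%n. wn n z) ---> W k c z" and w_bd: "!!n z. \<bar>wn n z\<bar> <= B"
  and wt_bd: "!!n z. z \<in> ?K ==> \<bar>wt n z\<bar> <= 2 * C"
  and wt_lim: "AE z in lborel. z \<in> ?K --> (%n. wt n z) ---> - f k z"
  and wx_int: "!!n. set_integrable lborel ?K (%z. \<bar>wx n z - (v z - k)\<bar>)"
  and wx_lim: "(%n. LINT z:?K|lborel. \<bar>wx n z - (v z - k)\<bar>) ---> 0"
  by (rule approximants[OF Kx(1,2) t12(1,2), of k c]) blast
 have eta0: "eta x = 0" "eta' x = 0" if "x \<notin> Kx" for x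
  using Kx(3)[OF that] deriv_zero_off_support[OF eta(1) compact_imp_closed[OF Kx(1)] Kx(3) that] by auto
 have psi0: "psi t = 0" "psi' t = 0" if "t \<notin> {t1..t2}" for t
  using t12(3)[OF that] deriv_zero_off_support[OF psi(1) closed_atLeastAtMost t12(3) that] by auto
 have cont: "cont th" "cont th'" "cont eta" "cont psi"
  by (rule deriv_imp_continuous_on[OF th(1)] deriv_imp_continuous_on[OF th(2)]
   deriv_imp_continuous_on[OF eta(1)] deriv_imp_continuous_on[OF psi(1)])+
 note [measurable] = borel_measurable_continuous_onI[OF cont(1)] borel_measurable_continuous_onI[OF cont(2)]
  measurable_fst_snd_continuous[OF cont(3)] measurable_fst_snd_continuous[OF cont(4)]
  measurable_fst_snd_continuous[OF eta(2)] measurable_fst_snd_continuous[OF psi(2)]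
 have wm [measurable]: "wn n \<in> BM" "wx n \<in> BM" "wt n \<in> BM" for n
  using wC[of n] unfolding C1_plane_def by (auto intro: borel_measurable_continuous_onI)
 obtain M1 where M1: "0 <= M1" "!!w. w \<in> {-B..B} ==> \<bar>th w\<bar> <= M1"
  using bounded_on_compact[OF continuous_on_subset[OF cont(1) subset_UNIV] compact_Icc] by metis
 obtain M2 where M2: "0 <= M2" "!!w. w \<in> {-B..B} ==> \<bar>th' w\<bar> <= M2"
  using bounded_on_compact[OF continuous_on_subset[OF cont(2) subset_UNIV] compact_Icc] by metis
 obtain M3 where M3: "0 <= M3" "!!x. \<bar>eta x\<bar> <= M3" using bounded_compact_support[OF cont(3) Kx(1,3)] by metis
 obtain M4 where M4: "0 <= M4" "!!x. \<bar>eta' x\<bar> <= M4" using bounded_compact_support[OF eta(2) Kx(1) eta0(2)] by metis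
 obtain M5 where M5: "0 <= M5" "!!x. \<bar>psi x\<bar> <= M5" using bounded_compact_support[OF cont(4) compact_Icc t12(3)] by metis
 obtain M6 where M6: "0 <= M6" "!!x. \<bar>psi' x\<bar> <= M6" using bounded_compact_support[OF psi(2) compact_Icc psi0(2)] by metis
 note vK = v_int_K[OF Kx(1,2) t12(1,2)]
 have [measurable]: "?K \<in> sets borel" by (rule vK(3))
 have thbd: "\<bar>th (wn n z)\<bar> <= M1" "\<bar>th' (wn n z)\<bar> <= M2" for n z
  using M1(2)[of "wn n z"] M2(2)[of "wn n z"] w_bd[of n z] by (auto simp: abs_le_iff)
 have prod0: "eta (fst z) * psi' (snd z) = 0" "eta' (fst z) * psi (snd z) = 0" "eta (fst z) * psi (snd z) = 0" if "z \<notin> ?K" for z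
  using that eta0[of "fst z"] psi0[of "snd z"] by (cases z, auto)+
 have thlim: "(%n. th (wn n z)) ---> th (W k c z)" if "z \<in> ?K" for z
  using isCont_tendsto_compose[OF _ w_lim[OF that], of th] cont(1) by (simp add: continuous_on_eq_continuous_at)
 define A1 where "A1 n z = \<bar>v z - k\<bar> * (th (wn n z) * eta (fst z) * psi' (snd z))" for n z
 define A2 where "A2 n z = q k z * (th (wn n z) * eta' (fst z) * psi (snd z))" for n z
 define R1 where "R1 n z = th' (wn n z) * eta (fst z) * psi (snd z) * (\<bar>v z - k\<bar> * (wt n z + f k z))" for n z
 define R2 where "R2 n z = th' (wn n z) * eta (fst z) * psi (snd z) * (q k z * (wx n z - (v z - k)))" for n z
 define A1' where "A1' z = \<bar>v z - k\<bar> * (th (W k c z) * eta (fst z) * psi' (snd z))" for z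
 define A2' where "A2' z = q k z * (th (W k c z) * eta' (fst z) * psi (snd z))" for z
 have mA: "A1 n \<in> LM" "A2 n \<in> LM" "R1 n \<in> LM"
  "R2 n \<in> LM" for n
  unfolding A1_def[abs_def] A2_def[abs_def] R1_def[abs_def] R2_def[abs_def] by measurable
 have limA: "(%n. A1 n z) ---> A1' z" "(%n. A2 n z) ---> A2' z" for z
 proof -
  have "(%n. A1 n z) ---> A1' z \<and> (%n. A2 n z) ---> A2' z"
  proof (cases "z \<in> ?K")
   case True
   show ?thesis unfolding A1_def A2_def A1'_def A2'_def
    by (intro conjI tendsto_intros thlim True)
  next
   case False
   then have "a * eta (fst z) * psi' (snd z) = 0" "a * eta' (fst z) * psi (snd z) = 0" for a
    using prod0[OF False] by auto
   then show ?thesis unfolding A1_def A2_def A1'_def A2'_def by (simp only: mult_zero_right tendsto_const simp_thms)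
  qed
  then show "(%n. A1 n z) ---> A1' z" "(%n. A2 n z) ---> A2' z" by auto
 qed
 have mA': "A1' \<in> LM" "A2' \<in> LM"
  by (rule borel_measurable_LIMSEQ_metric[OF mA(1) limA(1)] borel_measurable_LIMSEQ_metric[OF mA(2) limA(2)])+
 have A1_dom: "\<bar>A1 n z\<bar> <= indicator ?K z * \<bar>v z - k\<bar> * (M1 * M3 * M6)" for n z
 proof (cases "z \<in> ?K")
  case True
  have "\<bar>th (wn n z) * eta (fst z) * psi' (snd z)\<bar> <= M1 * M3 * M6"
   unfolding abs_mult using thbd M1 M3 M6 by (intro mult_mono) auto
  then show ?thesis using True by (auto simp: A1_def abs_mult intro!: mult_left_mono)
 qed (use prod0 in \<open>simp add: A1_def mult.assoc\<close>)
 have A2_dom: "\<bar>A2 n z\<bar> <= indicator ?K z * (2 * C * (M1 * M4 * M5))" for n z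
 proof (cases "z \<in> ?K")
  case True
  have "\<bar>q k z * (th (wn n z) * eta' (fst z) * psi (snd z))\<bar> <= 2 * C * (M1 * M4 * M5)"
   unfolding abs_mult using thbd M1 M4 M5 q_bound C_nonneg by (intro mult_mono) auto
  then show ?thesis using True by (auto simp: A2_def)
 qed (use prod0 in \<open>simp add: A2_def mult.assoc\<close>)
 have R1_dom: "\<bar>R1 n z\<bar> <= indicator ?K z * \<bar>v z - k\<bar> * (M2 * M3 * M5 * (4 * C))" for n z
 proof (cases "z \<in> ?K")
  case True
  have "\<bar>wt n z + f k z\<bar> <= 4 * C" using wt_bd[OF True, of n] f_bound[of k z] by linarith
  then have "\<bar>th' (wn n z) * eta (fst z) * psi (snd z) * (wt n z + f k z)\<bar> <= M2 * M3 * M5 * (4 * C)"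
   unfolding abs_mult using thbd M2 M3 M5 C_nonneg by (intro mult_mono) auto
  from mult_left_mono[OF this, of "\<bar>v z - k\<bar>"] show ?thesis using True by (simp add: R1_def abs_mult mult_ac)
 qed (use prod0(3) in \<open>simp add: R1_def mult.assoc\<close>, metis mult.assoc mult_zero_left mult_zero_right order_refl)
 have R2_dom: "\<bar>R2 n z\<bar> <= (M2 * M3 * M5 * (2 * C)) * (indicator ?K z *\<^sub>R \<bar>wx n z - (v z - k)\<bar>)" for n z
 proof (cases "z \<in> ?K")
  case True
  have "\<bar>th' (wn n z) * eta (fst z) * psi (snd z) * q k z\<bar> <= M2 * M3 * M5 * (2 * C)"
   unfolding abs_mult using thbd M2 M3 M5 C_nonneg q_bound by (intro mult_mono) auto
  from mult_right_mono[OF this, of "\<bar>wx n z - (v z - k)\<bar>"] show ?thesis using True by (simp add: R2_def abs_mult mult_ac)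
 qed (use prod0(3) in \<open>simp add: R2_def mult.assoc\<close>, metis mult.assoc mult_zero_left mult_zero_right order_refl)
 have i1: "integ (%z. indicator ?K z * \<bar>v z - k\<bar> * a)" for a
  using vK(1)[of k] by (rule integrable_mult_left)
 have R2_int: "integ (R2 n)" for n
  by (rule Bochner_Integration.integrable_bound[OF integrable_mult_right[OF wx_int[unfolded set_integrable_def]] mA(4)])
    (use R2_dom[of n] in \<open>auto intro!: AE_I2 order_trans[OF _ abs_ge_self] simp del: scaleR_conv_of_real real_scaleR_def\<close>)
 note lA1 = dominated_convergence_real(1)[OF mA'(1) mA(1) i1 AE_I2[OF limA(1)] A1_dom]
  and iA1' = dominated_convergence_real(2)[OF mA'(1) mA(1) i1 AE_I2[OF limA(1)] A1_dom]
  and iA1 = dominated_convergence_real(3)[OF mA'(1) mA(1) i1 AE_I2[OF limA(1)] A1_dom]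
 note lA2 = dominated_convergence_real(1)[OF mA'(2) mA(2) vK(2) AE_I2[OF limA(2)] A2_dom]
  and iA2' = dominated_convergence_real(2)[OF mA'(2) mA(2) vK(2) AE_I2[OF limA(2)] A2_dom]
  and iA2 = dominated_convergence_real(3)[OF mA'(2) mA(2) vK(2) AE_I2[OF limA(2)] A2_dom]
 have limR1: "AE z in lborel. (%n. R1 n z) ---> 0"
  using wt_lim
 proof eventually_elim
  case (elim z)
  show ?case
  proof (cases "z \<in> ?K")
   case True
   have "(%n. wt n z + f k z) ---> - f k z + f k z" using elim True by (intro tendsto_intros) auto
   moreover have "(%n. th' (wn n z)) ---> th' (W k c z)"
    using isCont_tendsto_compose[OF _ w_lim[OF True], of th'] cont(2) by (simp add: continuous_on_eq_continuous_at)
   ultimately have "(%n. R1 n z) ---> th' (W k c z) * eta (fst z) * psi (snd z) * (\<bar>v z - k\<bar> * (- f k z + f k z))"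
    unfolding R1_def by (intro tendsto_mult tendsto_const)
   then show ?thesis by simp
  next
   case False
   have "\<bar>R1 n z\<bar> <= 0" for n using R1_dom[of n z] False by simp
   then show ?thesis by simp
  qed
 qed
 note lR1 = dominated_convergence_real(1)[OF borel_measurable_const mA(3) i1 limR1 R1_dom]
  and iR1 = dominated_convergence_real(3)[OF borel_measurable_const mA(3) i1 limR1 R1_dom]
 have lR2: "(%n. integral\<^sup>L lborel (R2 n)) ---> 0"
 proof (rule Lim_null_comparison)
  show "eventually (%n. norm (integral\<^sup>L lborel (R2 n)) <= (M2 * M3 * M5 * (2 * C)) * (LINT z:?K|lborel. \<bar>wx n z - (v z - k)\<bar>)) sequentially"
  proof (intro always_eventually allI)
   fix n
   have "norm (integral\<^sup>L lborel (R2 n)) <= (LINT z|lborel. \<bar>R2 n z\<bar>)" using integral_norm_bound[of lborel "R2 n"] by simp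
   also have "\<dots> <= (LINT z|lborel. (M2 * M3 * M5 * (2 * C)) * (indicator ?K z *\<^sub>R \<bar>wx n z - (v z - k)\<bar>))"
    by (intro integral_mono integrable_abs R2_int integrable_mult_right wx_int[unfolded set_integrable_def] R2_dom)
   also have "\<dots> = (M2 * M3 * M5 * (2 * C)) * (LINT z:?K|lborel. \<bar>wx n z - (v z - k)\<bar>)"
    unfolding set_lebesgue_integral_def by (rule integral_mult_right_zero)
   finally show "norm (integral\<^sup>L lborel (R2 n)) <= \<dots>" .
  qed
  show "(%n. (M2 * M3 * M5 * (2 * C)) * (LINT z:?K|lborel. \<bar>wx n z - (v z - k)\<bar>)) ---> 0"
   using tendsto_mult_right_zero[OF wx_lim] by blast
 qed
 have E: "0 <= integral\<^sup>L lborel (A1 n) + integral\<^sup>L lborel (A2 n) + integral\<^sup>L lborel (R1 n) + integral\<^sup>L lborel (R2 n)" for n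
 proof -
  have "0 <= (LINT z|lborel. \<bar>v z - k\<bar> * (th' (wn n z) * wt n z * eta (fst z) * psi (snd z) + th (wn n z) * eta (fst z) * psi' (snd z))
    + sgn (v z - k) * (H (v z) - H k) * (th' (wn n z) * wx n z * eta (fst z) * psi (snd z) + th (wn n z) * eta' (fst z) * psi (snd z)))"
  proof (rule entropy[of ?K])
   show "compact ?K" using Kx by (intro compact_Times) auto
   show "?K \<subseteq> R \<times> {s<..<T}" using Kx t12 by auto
   show "C1_plane (%z. th (wn n z) * eta (fst z) * psi (snd z))
    (%z. th' (wn n z) * wx n z * eta (fst z) * psi (snd z) + th (wn n z) * eta' (fst z) * psi (snd z))
    (%z. th' (wn n z) * wt n z * eta (fst z) * psi (snd z) + th (wn n z) * eta (fst z) * psi' (snd z))"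
    by (rule C1_plane_mult_compose[OF wC th(1,2,3) eta(1,2) psi(1,2)])
   show "0 <= th (wn n z) * eta (fst z) * psi (snd z)" for z using th(4) eta(3) psi(3) by simp
   show "th (wn n z) * eta (fst z) * psi (snd z) = 0 \<and>
    th' (wn n z) * wx n z * eta (fst z) * psi (snd z) + th (wn n z) * eta' (fst z) * psi (snd z) = 0 \<and>
    th' (wn n z) * wt n z * eta (fst z) * psi (snd z) + th (wn n z) * eta (fst z) * psi' (snd z) = 0" if "z \<notin> ?K" for z
    using prod0[OF that] by auto
  qed
  also have "(%z. \<bar>v z - k\<bar> * (th' (wn n z) * wt n z * eta (fst z) * psi (snd z) + th (wn n z) * eta (fst z) * psi' (snd z))
    + sgn (v z - k) * (H (v z) - H k) * (th' (wn n z) * wx n z * eta (fst z) * psi (snd z) + th (wn n z) * eta' (fst z) * psi (snd z)))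
    = (%z. A1 n z + A2 n z + R1 n z + R2 n z)"
  proof
   fix z
   have "\<bar>v z - k\<bar> * (th' (wn n z) * wt n z * eta (fst z) * psi (snd z) + th (wn n z) * eta (fst z) * psi' (snd z))
    + q k z * (th' (wn n z) * wx n z * eta (fst z) * psi (snd z) + th (wn n z) * eta' (fst z) * psi (snd z))
    = A1 n z + A2 n z + R1 n z + R2 n z - th' (wn n z) * eta (fst z) * psi (snd z) * (\<bar>v z - k\<bar> * f k z - q k z * (v z - k))"
    unfolding A1_def A2_def R1_def R2_def by (simp add: algebra_simps)
   then show "\<bar>v z - k\<bar> * (th' (wn n z) * wt n z * eta (fst z) * psi (snd z) + th (wn n z) * eta (fst z) * psi' (snd z))
    + sgn (v z - k) * (H (v z) - H k) * (th' (wn n z) * wx n z * eta (fst z) * psi (snd z) + th (wn n z) * eta' (fst z) * psi (snd z))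
    = A1 n z + A2 n z + R1 n z + R2 n z" unfolding abs_f_eq by (simp add: q_def f_def)
  qed
  finally show ?thesis using iA1 iA2 iR1 R2_int by simp
 qed
 have "(%n. integral\<^sup>L lborel (A1 n) + integral\<^sup>L lborel (A2 n) + integral\<^sup>L lborel (R1 n) + integral\<^sup>L lborel (R2 n))
   ---> integral\<^sup>L lborel A1' + integral\<^sup>L lborel A2' + 0 + 0"
  using lR1 by (intro tendsto_intros lA1 lA2 lR2) simp
 then have "0 <= integral\<^sup>L lborel A1' + integral\<^sup>L lborel A2' + 0 + 0"
  using E by (intro LIMSEQ_le_const) auto
 then show "0 <= (LINT z|lborel. \<bar>v z - k\<bar> * (th (W k c z) * eta (fst z) * psi' (snd z)) + q k z * (th (W k c z) * eta' (fst z) * psi (snd z)))"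
  using iA1' iA2' unfolding A1'_def[abs_def] A2'_def[abs_def] by simp
 show "integ (%z. \<bar>v z - k\<bar> * (th (W k c z) * eta (fst z) * psi' (snd z)))"
  "integ (%z. q k z * (th (W k c z) * eta' (fst z) * psi (snd z)))"
  using iA1' iA2' unfolding A1'_def[abs_def] A2'_def[abs_def] by auto
qed

text \<open>Since \<open>- f\<close> is the time derivative of \<open>W\<close>, the integral of \<open>f th(W) psi\<close>
 in time is a boundary term of the primitive of \<open>th\<close>.\<close>

lemma time_chain_rule:
 assumes Th: "!!x. (Th has_real_derivative th x) (at x)" "cont th"
  and ga: "cont ga" and Kx: "compact Kx" "Kx \<subseteq> R" "!!x. x \<notin> Kx ==> ga x = 0"
  and psi: "!!x. (psi has_real_derivative psi' x) (at x)" "cont psi'"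
  and t12: "s < t1" "t2 < T" "!!t. t \<notin> {t1..t2} ==> psi t = 0"
 shows "(LINT z|lborel. f k z * (th (W k c z) * ga (fst z) * psi (snd z))) = (LINT z|lborel. Th (W k c z) * ga (fst z) * psi' (snd z))"
  and "integ (%z. th (W k c z) * ga (fst z) * psi (snd z))"
  and "integ (%z. Th (W k c z) * ga (fst z) * psi' (snd z))"
proof -
 let ?K = "Kx \<times> {t1..t2}"
 obtain wn wx wt B where wC: "!!n. C1_plane (wn n) (wx n) (wt n)"
  and w_lim: "!!z. z \<in> ?K ==> (%n. wn n z) ---> W k c z" and w_bd: "!!n z. \<bar>wn n z\<bar> <= B"
  and wt_bd: "!!n z. z \<in> ?K ==> \<bar>wt n z\<bar> <= 2 * C"
  and wt_lim: "AE z in lborel. z \<in> ?K --> (%n. wt n z) ---> - f k z"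
  by (rule approximants[OF Kx(1,2) t12(1,2), of k c]) blast
 have psi0: "psi t = 0" "psi' t = 0" if "t \<notin> {t1..t2}" for t
  using t12(3)[OF that] deriv_zero_off_support[OF psi(1) closed_atLeastAtMost t12(3) that] by auto
 have cont: "cont Th" "cont psi"
  by (rule deriv_imp_continuous_on[OF Th(1)] deriv_imp_continuous_on[OF psi(1)])+
 note [measurable] = borel_measurable_continuous_onI[OF cont(1)] borel_measurable_continuous_onI[OF Th(2)]
  measurable_fst_snd_continuous[OF cont(2)] measurable_fst_snd_continuous[OF ga] measurable_fst_snd_continuous[OF psi(2)]
 have wcont: "cont (wn n)" "cont (wt n)" for n
  using wC[of n] unfolding C1_plane_def by auto
 have wm [measurable]: "wn n \<in> BM" "wt n \<in> BM" for n
  using wcont by (auto intro: borel_measurable_continuous_onI)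
 obtain M1 where M1: "0 <= M1" "!!w. w \<in> {-B..B} ==> \<bar>th w\<bar> <= M1"
  using bounded_on_compact[OF continuous_on_subset[OF Th(2) subset_UNIV] compact_Icc] by metis
 obtain M2 where M2: "0 <= M2" "!!w. w \<in> {-B..B} ==> \<bar>Th w\<bar> <= M2"
  using bounded_on_compact[OF continuous_on_subset[OF cont(1) subset_UNIV] compact_Icc] by metis
 obtain M3 where M3: "0 <= M3" "!!x. \<bar>ga x\<bar> <= M3" using bounded_compact_support[OF ga Kx(1,3)] by metis
 obtain M5 where M5: "0 <= M5" "!!x. \<bar>psi x\<bar> <= M5" using bounded_compact_support[OF cont(2) compact_Icc t12(3)] by metis
 obtain M6 where M6: "0 <= M6" "!!x. \<bar>psi' x\<bar> <= M6" using bounded_compact_support[OF psi(2) compact_Icc psi0(2)] by metis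
 note vK = v_int_K[OF Kx(1,2) t12(1,2)]
 have [measurable]: "?K \<in> sets borel" by (rule vK(3))
 have thbd: "\<bar>th (wn n z)\<bar> <= M1" "\<bar>Th (wn n z)\<bar> <= M2" for n z
  using M1(2)[of "wn n z"] M2(2)[of "wn n z"] w_bd[of n z] by (auto simp: abs_le_iff)
 have prod0: "ga (fst z) * psi' (snd z) = 0" "ga (fst z) * psi (snd z) = 0" if "z \<notin> ?K" for z
  using that Kx(3)[of "fst z"] psi0[of "snd z"] by (cases z, auto)+
 have thlim: "(%n. th (wn n z)) ---> th (W k c z)" "(%n. Th (wn n z)) ---> Th (W k c z)" if "z \<in> ?K" for z
  using isCont_tendsto_compose[OF _ w_lim[OF that], of th] isCont_tendsto_compose[OF _ w_lim[OF that], of Th] cont(1) Th(2)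
  by (simp_all add: continuous_on_eq_continuous_at)
 define A where "A n z = Th (wn n z) * ga (fst z) * psi' (snd z)" for n z
 define G where "G n z = th (wn n z) * ga (fst z) * psi (snd z)" for n z
 define A' where "A' z = Th (W k c z) * ga (fst z) * psi' (snd z)" for z
 define G' where "G' z = th (W k c z) * ga (fst z) * psi (snd z)" for z
 have mA: "A n \<in> LM" "G n \<in> LM" "(%z. G n z * wt n z) \<in> LM" for n
  unfolding A_def[abs_def] G_def[abs_def] by measurable
 have limA: "(%n. A n z) ---> A' z" "(%n. G n z) ---> G' z" for z
 proof -
  have "(%n. A n z) ---> A' z \<and> (%n. G n z) ---> G' z"
  proof (cases "z \<in> ?K")
   case True
   show ?thesis unfolding A_def G_def A'_def G'_def
    by (intro conjI tendsto_intros thlim True)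
  next
   case False
   then have "a * ga (fst z) * psi' (snd z) = 0" "a * ga (fst z) * psi (snd z) = 0" for a
    using prod0[OF False] by auto
   then show ?thesis unfolding A_def G_def A'_def G'_def by (simp only: tendsto_const simp_thms)
  qed
  then show "(%n. A n z) ---> A' z" "(%n. G n z) ---> G' z" by auto
 qed
 have mA': "A' \<in> LM" "G' \<in> LM"
  by (rule borel_measurable_LIMSEQ_metric[OF mA(1) limA(1)] borel_measurable_LIMSEQ_metric[OF mA(2) limA(2)])+
 have A_dom: "\<bar>A n z\<bar> <= indicator ?K z * (M2 * M3 * M6)" for n z
 proof (cases "z \<in> ?K")
  case True
  have "\<bar>Th (wn n z) * ga (fst z) * psi' (snd z)\<bar> <= M2 * M3 * M6"
   unfolding abs_mult using thbd M2 M3 M6 by (intro mult_mono) auto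
  then show ?thesis using True by (auto simp: A_def)
 qed (use prod0 in \<open>simp add: A_def mult.assoc\<close>)
 have G_dom: "\<bar>G n z\<bar> <= indicator ?K z * (M1 * M3 * M5)" for n z
 proof (cases "z \<in> ?K")
  case True
  have "\<bar>th (wn n z) * ga (fst z) * psi (snd z)\<bar> <= M1 * M3 * M5"
   unfolding abs_mult using thbd M1 M3 M5 by (intro mult_mono) auto
  then show ?thesis using True by (auto simp: G_def)
 qed (use prod0 in \<open>simp add: G_def mult.assoc\<close>)
 have Gw_dom: "\<bar>G n z * wt n z\<bar> <= indicator ?K z * (M1 * M3 * M5 * (2 * C))" for n z
 proof (cases "z \<in> ?K")
  case True
  then show ?thesis using mult_mono[OF G_dom[of n z] wt_bd[OF True, of n]] M1 M3 M5 by (simp add: abs_mult)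
 qed (use G_dom[of n z] in simp)
 note lA = dominated_convergence_real(1)[OF mA'(1) mA(1) vK(2) AE_I2[OF limA(1)] A_dom]
  and iA' = dominated_convergence_real(2)[OF mA'(1) mA(1) vK(2) AE_I2[OF limA(1)] A_dom]
  and iA = dominated_convergence_real(3)[OF mA'(1) mA(1) vK(2) AE_I2[OF limA(1)] A_dom]
  and iG' = dominated_convergence_real(2)[OF mA'(2) mA(2) vK(2) AE_I2[OF limA(2)] G_dom]
 have limGw: "AE z in lborel. (%n. G n z * wt n z) ---> - (f k z * G' z)"
  using wt_lim
 proof eventually_elim
  case (elim z)
  show ?case
  proof (cases "z \<in> ?K")
   case True
   then have "(%n. G n z * wt n z) ---> G' z * - f k z" using elim by (intro tendsto_intros limA) auto
   then show ?thesis by (simp add: mult.commute)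
  next
   case False
   have "G n z = 0" for n using G_dom[of n z] False by simp
   moreover have "G' z = 0" using prod0(2)[OF False] by (simp add: G'_def mult.assoc)
   ultimately show ?thesis by simp
  qed
 qed
 have mfG: "(%z. - (f k z * G' z)) \<in> LM" using mA'(2) by measurable
 note lG = dominated_convergence_real(1)[OF mfG mA(3) vK(2) limGw Gw_dom]
  and iG = dominated_convergence_real(3)[OF mfG mA(3) vK(2) limGw Gw_dom]
 have Z: "(LINT z|lborel. G n z * wt n z) + integral\<^sup>L lborel (A n) = 0" for n
 proof -
  have "(LINT z|lborel. G n z * wt n z + A n z) = 0"
  proof (rule integral_dt_zero[where g="%z. Th (wn n z) * ga (fst z) * psi (snd z)", OF _ _ Kx(1)])
   show "((%t. Th (wn n (x, t)) * ga (fst (x, t)) * psi (snd (x, t))) has_real_derivative G n (x, t) * wt n (x, t) + A n (x, t)) (at t)" for x t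
    unfolding fst_conv snd_conv
   proof (rule DERIV_cong[OF DERIV_mult[OF DERIV_cmult_right[OF DERIV_chain2[OF Th(1)]] psi(1)]])
    show "((%t. wn n (x, t)) has_real_derivative wt n (x, t)) (at t)" using wC[of n] unfolding C1_plane_def by blast
   qed (simp add: G_def A_def algebra_simps)
   show "cont (%z. G n z * wt n z + A n z)"
    unfolding G_def A_def
    by (intro continuous_intros continuous_on_comp_UNIV[OF Th(2)] continuous_on_comp_UNIV[OF cont(1)]
     continuous_on_comp_UNIV[OF ga] continuous_on_comp_UNIV[OF cont(2)] continuous_on_comp_UNIV[OF psi(2)] wcont
     continuous_on_fst continuous_on_snd continuous_on_id)
   show "Th (wn n z) * ga (fst z) * psi (snd z) = 0 \<and> G n z * wt n z + A n z = 0" if "z \<notin> ?K" for z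
    using prod0[OF that] by (cases z) (auto simp: G_def A_def mult.assoc)
  qed
  then show ?thesis using iG iA by simp
 qed
 have "(%n. (LINT z|lborel. G n z * wt n z) + integral\<^sup>L lborel (A n)) ---> (LINT z|lborel. - (f k z * G' z)) + integral\<^sup>L lborel A'"
  by (intro tendsto_intros lG lA)
 then have "(LINT z|lborel. - (f k z * G' z)) + integral\<^sup>L lborel A' = 0"
  unfolding Z using LIMSEQ_unique tendsto_const by metis
 then show "(LINT z|lborel. f k z * (th (W k c z) * ga (fst z) * psi (snd z))) = (LINT z|lborel. Th (W k c z) * ga (fst z) * psi' (snd z))"
  unfolding A'_def G'_def by simp
 show "integ (%z. th (W k c z) * ga (fst z) * psi (snd z))"
  "integ (%z. Th (W k c z) * ga (fst z) * psi' (snd z))"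
  using iG' iA' unfolding G'_def[abs_def] A'_def[abs_def] by auto
qed

end

lemma integrable_bounded_mult:
 fixes a b :: "'a => real"
 assumes "integrable M b" "a \<in> borel_measurable M" "!!z. \<bar>a z\<bar> <= B"
 shows "integrable M (%z. a z * b z)"
proof (rule Bochner_Integration.integrable_bound[OF integrable_mult_right[OF integrable_abs[OF assms(1)], of B]])
 have "\<bar>a z * b z\<bar> <= B * \<bar>b z\<bar>" for z
  unfolding abs_mult using assms(3)[of z] by (rule mult_right_mono) simp
 then show "AE z in M. norm (a z * b z) <= norm (B * \<bar>b z\<bar>)"
  by (auto intro: order_trans[OF _ abs_ge_self])
 show "(%z. a z * b z) \<in> borel_measurable M" using assms by measurable
qed

lemma abs_integral_diff_le:
 fixes a b :: "'a => real"
 assumes "integrable M a" "integrable M b" "integrable M w" "!!z. \<bar>a z - b z\<bar> <= w z"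
 shows "\<bar>integral\<^sup>L M a - integral\<^sup>L M b\<bar> <= integral\<^sup>L M w"
proof -
 have "\<bar>integral\<^sup>L M a - integral\<^sup>L M b\<bar> = \<bar>LINT z|M. a z - b z\<bar>" using assms by simp
 also have "\<dots> <= (LINT z|M. \<bar>a z - b z\<bar>)" by (rule integral_abs_bound)
 also have "\<dots> <= integral\<^sup>L M w" using assms by (intro integral_mono) auto
 finally show ?thesis .
qed

lemma abs_weighted_diff:
 fixes w :: real assumes "0 <= w"
 shows "\<bar>a * w * p - w * (b * p)\<bar> = w * (\<bar>a - b\<bar> * \<bar>p\<bar>)"
  and "\<bar>g * (a * w * p) - g * (w * (b * p))\<bar> = w * (\<bar>g\<bar> * (\<bar>a - b\<bar> * \<bar>p\<bar>))"
proof -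
 have "a * w * p - w * (b * p) = w * ((a - b) * p)" by (simp add: algebra_simps)
 then show "\<bar>a * w * p - w * (b * p)\<bar> = w * (\<bar>a - b\<bar> * \<bar>p\<bar>)" using assms by (simp add: abs_mult)
 have "g * (a * w * p) - g * (w * (b * p)) = w * (g * ((a - b) * p))" by (simp add: algebra_simps)
 then show "\<bar>g * (a * w * p) - g * (w * (b * p))\<bar> = w * (\<bar>g\<bar> * (\<bar>a - b\<bar> * \<bar>p\<bar>))" using assms by (simp add: abs_mult)
qed

section \<open>Fluxes through thin layers at the singularities\<close>

text \<open>A probability density on the side \<open>sig\<close> of \<open>y\<close>, supported at distances
 between \<open>h\<close> and \<open>2 h\<close>.\<close>

definition kern :: "real => real => real => real => real" where
 "kern y sig h x = step' (sig * (x - y) / h - 1) / h"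

lemma kern_props:
 assumes "h > 0" "\<bar>sig\<bar> = (1::real)"
 shows "0 <= kern y sig h x" "integ (kern y sig h)" "(LINT x|lborel. kern y sig h x) = 1"
  "cont (kern y sig h)"
  "\<not> (h <= sig * (x - y) \<and> sig * (x - y) <= 2 * h) ==> kern y sig h x = 0"
proof -
 show "0 <= kern y sig h x" unfolding kern_def using step'_bounds assms by simp
 show "integ (kern y sig h)" "(LINT x|lborel. kern y sig h x) = 1"
  unfolding kern_def[abs_def] using step_kernel_mass[OF assms] by auto
 show "cont (kern y sig h)"
  unfolding kern_def[abs_def] using assms by (intro continuous_intros) auto
 assume "\<not> (h <= sig * (x - y) \<and> sig * (x - y) <= 2 * h)"
 then have "sig * (x - y) / h - 1 <= 0 \<or> sig * (x - y) / h - 1 \<ge> 1"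
  using assms(1) by (auto simp: field_simps)
 then show "kern y sig h x = 0" unfolding kern_def using step'_eq_0 by auto
qed

lemma sign_cases: "\<bar>sig\<bar> = (1::real) ==> sig = 1 \<or> sig = - 1" by linarith

lemma sign_abs_mult: "\<bar>sig\<bar> = (1::real) ==> \<bar>sig * a\<bar> = \<bar>a\<bar>" by (simp add: abs_mult)

lemma trace_nonpos_double:
 assumes "trace_nonpos s T y sig g" shows "trace_nonpos s T y sig (%z. 2 * g z)"
 unfolding trace_nonpos_def
proof (intro allI impI, elim conjE)
 fix bta :: "real => real" and K and e :: real
 assume b: "cont bta" "\<forall>t. 0 <= bta t" "compact K" "K \<subseteq> {s<..<T}" "\<forall>t. t \<notin> K --> bta t = 0" "0 < e"
 then obtain d where d: "d > 0" "AE x in lborel. 0 < sig * (x - y) \<and> sig * (x - y) < d --> sig * (LINT t|lborel. g (x, t) * bta t) <= e / 2"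
  using assms[unfolded trace_nonpos_def, rule_format, of bta K "e/2"] by auto
 have "AE x in lborel. 0 < sig * (x - y) \<and> sig * (x - y) < d --> sig * (LINT t|lborel. 2 * g (x, t) * bta t) <= e"
  using d(2) by eventually_elim (auto simp: mult.assoc)
 with d(1) show "\<exists>d>0. AE x in lborel. 0 < sig * (x - y) \<and> sig * (x - y) < d --> sig * (LINT t|lborel. 2 * g (x, t) * bta t) <= e"
  by blast
qed

context entropy_flow begin

lemma side_regular:
 assumes "y \<in> X"
 obtains d where "d > 0" "!!x. x \<noteq> y ==> \<bar>x - y\<bar> < d ==> x \<in> R"
proof -
 have "open ({l<..<r} - (X - {y}))" using X_fin by (intro open_Diff) (auto intro: finite_imp_closed)
 moreover have "y \<in> {l<..<r} - (X - {y})" using assms X_in by auto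
 ultimately obtain d where d: "d > 0" "ball y d \<subseteq> {l<..<r} - (X - {y})" by (meson openE)
 show ?thesis
 proof (rule that[OF d(1)])
  fix x assume "x \<noteq> y" "\<bar>x - y\<bar> < d"
  then have "x \<in> ball y d" by (simp add: dist_real_def)
  with d(2) \<open>x \<noteq> y\<close> show "x \<in> R" by auto
 qed
qed

lemma trace_lipschitz:
 assumes y: "y \<in> X" and sig: "\<bar>sig\<bar> = 1" and L: "trace_lim s T y sig U L"
  and t: "t \<in> {s..T}" "t' \<in> {s..T}"
 shows "\<bar>L t - L t'\<bar> <= C * \<bar>t - t'\<bar>"
proof (rule field_le_epsilon)
 fix e :: real assume e: "e > 0"
 obtain d1 where d1: "d1 > 0" "!!x. x \<noteq> y ==> \<bar>x - y\<bar> < d1 ==> x \<in> R" by (rule side_regular[OF y]) blast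
 obtain d2 where d2: "d2 > 0" "!!x t. 0 < sig * (x - y) ==> sig * (x - y) < d2 ==> t \<in> {s..T} ==> \<bar>U (x, t) - L t\<bar> < e / 2"
  using L[unfolded trace_lim_def] e by (metis half_gt_zero)
 define x where "x = y + sig * (min d1 d2 / 2)"
 have ss: "sig * sig = 1" using sig sign_cases by fastforce
 have sx: "sig * (x - y) = min d1 d2 / 2" unfolding x_def using ss by (simp add: mult.assoc[symmetric])
 have "\<bar>x - y\<bar> = min d1 d2 / 2" unfolding x_def using d1 d2 sig by (simp add: abs_mult)
 then have "x \<in> R" using d1 d2 by (intro d1(2)) (auto simp: min_def split: if_splits)
 then have "\<bar>U (x, t) - U (x, t')\<bar> <= C * \<bar>t - t'\<bar>" using U_lip t by blast
 moreover have "\<bar>U (x, t) - L t\<bar> < e / 2" "\<bar>U (x, t') - L t'\<bar> < e / 2"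
 proof -
  have "0 < sig * (x - y)" "sig * (x - y) < d2" using d1(1) d2(1) unfolding sx by (auto simp: min_def)
  then show "\<bar>U (x, t) - L t\<bar> < e / 2" "\<bar>U (x, t') - L t'\<bar> < e / 2" using d2(2) t by auto
 qed
 ultimately show "\<bar>L t - L t'\<bar> <= C * \<bar>t - t'\<bar> + e" by linarith
qed

lemma trace_continuous:
 assumes y: "y \<in> X" and sig: "\<bar>sig\<bar> = 1" and L: "trace_lim s T y sig U L"
 shows "continuous_on {s..T} L"
proof -
 have "C-lipschitz_on {s..T} L"
  unfolding lipschitz_on_def dist_real_def using trace_lipschitz[OF y sig L] C_nonneg by blast
 then show ?thesis by (rule lipschitz_on_continuous_on)
qed

text \<open>Where the difference of the entropy flux \<open>q\<close> and \<open>e0 * f\<close> has a trace of the right sign, the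
 entropy flux through a thin layer at \<open>y\<close> is controlled by the trace of \<open>W\<close> alone.\<close>

lemma entropy_flux_trace:
 assumes y: "y \<in> X" and sig: "\<bar>sig\<bar> = 1" and e0: "\<bar>e0\<bar> = 1" and L: "trace_lim s T y sig U L"
  and tr: "trace_nonpos s T y sig (%z. q k z - e0 * f k z)"
  and Th: "!!x. (Th has_real_derivative th x) (at x)" "cont th" "!!x. 0 <= th x"
  and psi: "!!x. (psi has_real_derivative psi' x) (at x)" "cont psi'" "!!x. 0 <= psi x"
  and t12: "s < t1" "t2 < T" "!!t. t \<notin> {t1..t2} ==> psi t = 0"
  and e: "e > 0"
 shows "\<exists>h0>0. \<forall>h. 0 < h \<and> h < h0 -->
   integ (%z. q k z * (th (W k c z) * kern y sig h (fst z) * psi (snd z))) \<and>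
   sig * (LINT z|lborel. q k z * (th (W k c z) * kern y sig h (fst z) * psi (snd z)))
   <= sig * e0 * (LINT t|lborel. Th (L t - (k * y - H k * t + c)) * psi' t) + e"
proof -
 define WL where "WL t = L (max s (min T t)) - (k * y - H k * t + c)" for t
 have ss: "sig * sig = 1" using sign_cases[OF sig] by auto
 have clamp: "max s (min T t) \<in> {s..T}" for t using sT by auto
 have cWL: "cont WL"
  unfolding WL_def
  by (intro continuous_intros continuous_on_compose2[OF trace_continuous[OF y sig L]]) (use clamp in auto)
 obtain B0 where B0: "0 <= B0" "!!t. t \<in> {s..T} ==> \<bar>WL t\<bar> <= B0"
  using bounded_on_compact[OF continuous_on_subset[OF cWL subset_UNIV] compact_Icc] by metis
 define J where "J = {- B0 - 1..B0 + 1}"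
 have cont: "cont Th" "cont psi"
  by (rule deriv_imp_continuous_on[OF Th(1)] deriv_imp_continuous_on[OF psi(1)])+
 have psi0: "psi t = 0" "psi' t = 0" if "t \<notin> {t1..t2}" for t
  using t12(3)[OF that] deriv_zero_off_support[OF psi(1) closed_atLeastAtMost t12(3) that] by auto
 have ipsi: "integ psi" "integ psi'"
  by (rule integrable_compact_support[OF cont(2) compact_Icc psi0(1)] integrable_compact_support[OF psi(2) compact_Icc psi0(2)]; assumption)+
 define M where "M = 1 + (LINT t|lborel. \<bar>psi' t\<bar>) + 4 * C * (LINT t|lborel. \<bar>psi t\<bar>)"
 have M1: "M \<ge> 1" unfolding M_def using C_nonneg by simp
 define e' where "e' = e / M"
 have e': "e' > 0" "e' * M = e" using e M1 by (auto simp: e'_def)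
 have uc: "uniformly_continuous_on J Th" "uniformly_continuous_on J th"
  unfolding J_def by (intro compact_uniformly_continuous compact_Icc continuous_on_subset[OF cont(1)] continuous_on_subset[OF Th(2)] subset_UNIV)+
 obtain dl1 where dl1: "dl1 > 0" "!!a b. a \<in> J ==> b \<in> J ==> \<bar>a - b\<bar> < dl1 ==> \<bar>Th a - Th b\<bar> < e'"
  using uc(1)[unfolded uniformly_continuous_on_def dist_real_def, rule_format, OF e'(1)] by blast
 obtain dl2 where dl2: "dl2 > 0" "!!a b. a \<in> J ==> b \<in> J ==> \<bar>a - b\<bar> < dl2 ==> \<bar>th a - th b\<bar> < e'"
  using uc(2)[unfolded uniformly_continuous_on_def dist_real_def, rule_format, OF e'(1)] by blast
 note dl12 = dl1 dl2
 define dl where "dl = min 1 (min dl1 dl2)"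
 have dl: "dl > 0" "dl <= 1" "dl <= dl1" "dl <= dl2" using dl12 by (auto simp: dl_def)
 define bta where "bta t = th (WL t) * psi t" for t
 have cbta: "cont bta"
  unfolding bta_def[abs_def] by (intro continuous_on_mult cont(2) continuous_on_comp_UNIV[OF Th(2) cWL])
 have bta0: "bta t = 0" if "t \<notin> {t1..t2}" for t using psi0(1)[OF that] by (simp add: bta_def)
 have ibta: "integ bta" by (rule integrable_compact_support[OF cbta compact_Icc bta0])
 obtain d1 where d1: "d1 > 0" "!!x. x \<noteq> y ==> \<bar>x - y\<bar> < d1 ==> x \<in> R" by (rule side_regular[OF y]) blast
 obtain d2 where d2: "d2 > 0" "!!x t. 0 < sig * (x - y) ==> sig * (x - y) < d2 ==> t \<in> {s..T} ==> \<bar>U (x, t) - L t\<bar> < dl / 2"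
  using L[unfolded trace_lim_def] dl(1) by (metis half_gt_zero)
 obtain d3 where d3: "d3 > 0" "AE x in lborel. 0 < sig * (x - y) \<and> sig * (x - y) < d3 --> sig * (LINT t|lborel. (q k (x, t) - e0 * f k (x, t)) * bta t) <= e'"
 proof -
  have "\<forall>t. 0 <= bta t" using Th(3) psi(3) by (simp add: bta_def)
  moreover have "{t1..t2} \<subseteq> {s<..<T}" using t12 by auto
  ultimately show ?thesis
   using tr[unfolded trace_nonpos_def, rule_format, of bta "{t1..t2}" e'] cbta bta0 e'(1) that by auto
 qed
 define h0 where "h0 = min (min (d1 / 2) (d2 / 2)) (min (d3 / 2) (dl / (4 * (\<bar>k\<bar> + 1))))"
 have h0: "h0 > 0" using d1 d2 d3 dl by (auto simp: h0_def)
 have "integ (%z. q k z * (th (W k c z) * kern y sig h (fst z) * psi (snd z))) \<and>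
   sig * (LINT z|lborel. q k z * (th (W k c z) * kern y sig h (fst z) * psi (snd z)))
   <= sig * e0 * (LINT t|lborel. Th (L t - (k * y - H k * t + c)) * psi' t) + e" if h: "0 < h" "h < h0" for h
 proof -
  have hh: "2 * h < d1" "2 * h < d2" "2 * h < d3" using h by (auto simp: h0_def)
  have hk: "\<bar>k\<bar> * (2 * h) < dl / 2"
  proof -
   have "h < dl / (4 * (\<bar>k\<bar> + 1))" using h by (auto simp: h0_def)
   then have "h * (4 * (\<bar>k\<bar> + 1)) < dl" by (subst (asm) pos_less_divide_eq) auto
   moreover have "4 * (\<bar>k\<bar> * h) <= h * (4 * (\<bar>k\<bar> + 1))" using h by (simp add: algebra_simps)
   ultimately show ?thesis by linarith
  qed
  let ?\<kappa> = "kern y sig h"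
  note \<kappa> = kern_props[OF h(1) sig, of y]
  define Kx where "Kx = (%xi. y + sig * xi) ` {h..2 * h}"
  have Kx_iff: "x \<in> Kx \<longleftrightarrow> h <= sig * (x - y) \<and> sig * (x - y) <= 2 * h" for x
  proof
   assume "h <= sig * (x - y) \<and> sig * (x - y) <= 2 * h"
   moreover have "x = y + sig * (sig * (x - y))" using ss by (simp add: mult.assoc[symmetric])
   ultimately show "x \<in> Kx" unfolding Kx_def by (intro image_eqI[of _ _ "sig * (x - y)"]) auto
  qed (auto simp: Kx_def mult.assoc[symmetric] ss)
  have Kc: "compact Kx" unfolding Kx_def by (intro compact_continuous_image continuous_intros) auto
  have KR: "Kx \<subseteq> R"
  proof
   fix x assume "x \<in> Kx"
   then have b: "h <= sig * (x - y)" "sig * (x - y) <= 2 * h" by (auto simp: Kx_iff)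
   then have "\<bar>x - y\<bar> < d1" "x \<noteq> y" using h hh sign_abs_mult[OF sig, of "x - y"] by auto
   then show "x \<in> R" by (intro d1(2))
  qed
  have \<kappa>0: "?\<kappa> x = 0" if "x \<notin> Kx" for x
   using that kern_props(5)[OF h(1) sig, of x y] unfolding Kx_iff by blast
  note tc = time_chain_rule[OF Th(1,2) \<kappa>(4) Kc KR \<kappa>0 psi(1,2) t12, of k c]
  have near: "\<bar>W k c (x, t) - WL t\<bar> < dl" if "x \<in> Kx" "t \<in> {t1..t2}" for x t
  proof -
   have b: "h <= sig * (x - y)" "sig * (x - y) <= 2 * h" using that by (auto simp: Kx_iff)
   have ts: "t \<in> {s..T}" using that t12 by auto
   have "\<bar>U (x, t) - L t\<bar> < dl / 2" using b h hh ts by (intro d2(2)) auto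
   moreover have "\<bar>k * (x - y)\<bar> <= \<bar>k\<bar> * (2 * h)"
    unfolding abs_mult using b h sign_abs_mult[OF sig, of "x - y"] by (intro mult_left_mono) auto
   moreover have "max s (min T t) = t" using ts by auto
   then have "W k c (x, t) - WL t = (U (x, t) - L t) - k * (x - y)" by (simp add: W_def WL_def algebra_simps)
   ultimately show ?thesis using hk by linarith
  qed
  have J: "WL t \<in> J" "W k c (x, t) \<in> J" if "x \<in> Kx" "t \<in> {t1..t2}" for x t
   using B0(2)[of t] near[OF that] that t12 dl(2) by (auto simp: J_def)
  have diff: "\<bar>Th (W k c (x, t)) - Th (WL t)\<bar> <= e'" "\<bar>th (W k c (x, t)) - th (WL t)\<bar> <= e'" if "x \<in> Kx" "t \<in> {t1..t2}" for x t
   using dl12(2)[OF J(2)[OF that] J(1)[OF that]] dl12(4)[OF J(2)[OF that] J(1)[OF that]] near[OF that] dl by auto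
  define g where "g z = q k z - e0 * f k z" for z
  have gm [measurable]: "g \<in> BM" unfolding g_def[abs_def] by measurable
  have gb: "\<bar>g z\<bar> <= 4 * C" for z
   using q_bound[of k z] f_bound[of k z] sign_abs_mult[OF e0, of "f k z"] unfolding g_def by linarith
  define P where "P z = th (W k c z) * ?\<kappa> (fst z) * psi (snd z)" for z
  have iP: "integ P" unfolding P_def[abs_def] by (rule tc(2))
  have iG: "integ (%z. g z * P z)" by (rule integrable_bounded_mult[OF iP _ gb]) measurable
  have iF: "integ (%z. f k z * P z)" by (rule integrable_bounded_mult[OF iP _ f_bound]) measurable
  have q_split: "(LINT z|lborel. q k z * P z) = e0 * (LINT z|lborel. f k z * P z) + (LINT z|lborel. g z * P z)"
  proof -
   have "(LINT z|lborel. q k z * P z) = (LINT z|lborel. e0 * (f k z * P z) + g z * P z)"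
    by (rule LINT_cong) (auto simp: g_def algebra_simps)
   then show ?thesis using iG iF by simp
  qed
  have p1: "integ (%z. ?\<kappa> (fst z) * b (snd z))"
   "(LINT z|lborel. ?\<kappa> (fst z) * b (snd z)) = (LINT t|lborel. b t)" if "integ b" for b :: "real => real"
   using integrable_product_lborel[OF \<kappa>(2) that] \<kappa>(3) by simp_all
  have iTh: "integ (%t. Th (WL t) * psi' t)"
   by (rule integrable_compact_support[OF _ compact_Icc, of _ t1 t2])
     (use psi0 in \<open>auto intro!: continuous_on_mult psi(2) continuous_on_comp_UNIV[OF cont(1) cWL]\<close>)
  have A: "\<bar>(LINT z|lborel. f k z * P z) - (LINT t|lborel. Th (WL t) * psi' t)\<bar> <= e' * (LINT t|lborel. \<bar>psi' t\<bar>)"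
  proof -
   have "\<bar>(LINT z|lborel. Th (W k c z) * ?\<kappa> (fst z) * psi' (snd z)) - (LINT z|lborel. ?\<kappa> (fst z) * (Th (WL (snd z)) * psi' (snd z)))\<bar>
     <= (LINT z|lborel. ?\<kappa> (fst z) * (e' * \<bar>psi' (snd z)\<bar>))"
   proof (rule abs_integral_diff_le[OF tc(3) p1(1)[OF iTh] p1(1)])
    show "integ (%t. e' * \<bar>psi' t\<bar>)" using ipsi by simp
    fix z :: "real \<times> real"
    have "\<bar>Th (W k c z) * ?\<kappa> (fst z) * psi' (snd z) - ?\<kappa> (fst z) * (Th (WL (snd z)) * psi' (snd z))\<bar>
     = ?\<kappa> (fst z) * (\<bar>Th (W k c z) - Th (WL (snd z))\<bar> * \<bar>psi' (snd z)\<bar>)"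
     by (rule abs_weighted_diff(1)[OF \<kappa>(1)])
    also have "\<dots> <= ?\<kappa> (fst z) * (e' * \<bar>psi' (snd z)\<bar>)"
    proof (cases "fst z \<in> Kx \<and> snd z \<in> {t1..t2}")
     case True
     then show ?thesis using diff(1)[of "fst z" "snd z"] \<kappa>(1) by (intro mult_left_mono mult_right_mono) auto
    qed (use \<kappa>0 psi0 in auto)
    finally show "\<bar>Th (W k c z) * ?\<kappa> (fst z) * psi' (snd z) - ?\<kappa> (fst z) * (Th (WL (snd z)) * psi' (snd z))\<bar>
      <= ?\<kappa> (fst z) * (e' * \<bar>psi' (snd z)\<bar>)" .
   qed
   then show ?thesis
    using p1(2)[OF iTh] p1(2)[of "%t. e' * \<bar>psi' t\<bar>"] ipsi tc(1) unfolding P_def by simp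
  qed
  have igb: "integ (%z. g z * (?\<kappa> (fst z) * bta (snd z)))"
   by (rule integrable_bounded_mult[OF p1(1)[OF ibta] _ gb]) measurable
  have Bd: "\<bar>(LINT z|lborel. g z * P z) - (LINT z|lborel. g z * (?\<kappa> (fst z) * bta (snd z)))\<bar> <= e' * (4 * C * (LINT t|lborel. \<bar>psi t\<bar>))"
  proof -
   have "\<bar>(LINT z|lborel. g z * P z) - (LINT z|lborel. g z * (?\<kappa> (fst z) * bta (snd z)))\<bar>
     <= (LINT z|lborel. ?\<kappa> (fst z) * (4 * C * (e' * \<bar>psi (snd z)\<bar>)))"
   proof (rule abs_integral_diff_le[OF iG igb p1(1)])
    show "integ (%t. 4 * C * (e' * \<bar>psi t\<bar>))" using ipsi by simp
    fix z :: "real \<times> real"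
    have "\<bar>g z * P z - g z * (?\<kappa> (fst z) * bta (snd z))\<bar>
     = ?\<kappa> (fst z) * (\<bar>g z\<bar> * (\<bar>th (W k c z) - th (WL (snd z))\<bar> * \<bar>psi (snd z)\<bar>))"
     unfolding P_def bta_def by (rule abs_weighted_diff(2)[OF \<kappa>(1)])
    also have "\<dots> <= ?\<kappa> (fst z) * (4 * C * (e' * \<bar>psi (snd z)\<bar>))"
    proof (cases "fst z \<in> Kx \<and> snd z \<in> {t1..t2}")
     case True
     then show ?thesis using diff(2)[of "fst z" "snd z"] \<kappa>(1) gb C_nonneg by (intro mult_left_mono mult_mono) auto
    qed (use \<kappa>0 psi0 in auto)
    finally show "\<bar>g z * P z - g z * (?\<kappa> (fst z) * bta (snd z))\<bar> <= ?\<kappa> (fst z) * (4 * C * (e' * \<bar>psi (snd z)\<bar>))" .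
   qed
   also have "\<dots> = e' * (4 * C * (LINT t|lborel. \<bar>psi t\<bar>))"
    using p1(2)[of "%t. 4 * C * (e' * \<bar>psi t\<bar>)"] ipsi by simp
   finally show ?thesis .
  qed
  have Cc: "sig * (LINT z|lborel. g z * (?\<kappa> (fst z) * bta (snd z))) <= e'"
  proof -
   have ig2: "integrable (lborel \<Otimes>\<^sub>M lborel) (%(x, t). g (x, t) * (?\<kappa> x * bta t))"
    using igb by (simp add: lborel_prod case_prod_unfold)
   have "sig * (LINT z|lborel. g z * (?\<kappa> (fst z) * bta (snd z))) = sig * (LINT x|lborel. (LINT t|lborel. g (x, t) * (?\<kappa> x * bta t)))"
    using lborel_pair.integral_fst[OF ig2] by (simp add: lborel_prod case_prod_unfold)
   also have "\<dots> = (LINT x|lborel. sig * (LINT t|lborel. g (x, t) * (?\<kappa> x * bta t)))" by simp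
   also have "\<dots> <= (LINT x|lborel. ?\<kappa> x * e')"
   proof (rule integral_mono_AE)
    show "integ (%x. sig * (LINT t|lborel. g (x, t) * (?\<kappa> x * bta t)))"
     using lborel_pair.integrable_fst[OF ig2] by simp
    show "integ (%x. ?\<kappa> x * e')" using \<kappa>(2) by simp
    show "AE x in lborel. sig * (LINT t|lborel. g (x, t) * (?\<kappa> x * bta t)) <= ?\<kappa> x * e'"
     using d3(2)
    proof eventually_elim
     case (elim x)
     have eq: "sig * (LINT t|lborel. g (x, t) * (?\<kappa> x * bta t)) = ?\<kappa> x * (sig * (LINT t|lborel. g (x, t) * bta t))"
     proof -
      have "(LINT t|lborel. g (x, t) * (?\<kappa> x * bta t)) = (LINT t|lborel. ?\<kappa> x * (g (x, t) * bta t))"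
       by (rule LINT_cong) auto
      then show ?thesis by simp
     qed
     show ?case
     proof (cases "x \<in> Kx")
      case True
      then have "sig * (LINT t|lborel. g (x, t) * bta t) <= e'" using elim h hh by (simp add: Kx_iff g_def)
      then show ?thesis unfolding eq using \<kappa>(1) by (intro mult_left_mono)
     qed (use \<kappa>0 eq in simp)
    qed
   qed
   also have "\<dots> = e'" using \<kappa>(2,3) by simp
   finally show ?thesis .
  qed
  have WLeq: "(LINT t|lborel. Th (WL t) * psi' t) = (LINT t|lborel. Th (L t - (k * y - H k * t + c)) * psi' t)"
  proof (rule LINT_cong)
   fix t
   show "Th (WL t) * psi' t = Th (L t - (k * y - H k * t + c)) * psi' t"
   proof (cases "t \<in> {t1..t2}")
    case True
    then have "max s (min T t) = t" using t12 by auto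
    then show ?thesis by (simp add: WL_def)
   qed (use psi0 in simp)
  qed simp
  define I1 where "I1 = (LINT z|lborel. f k z * P z)"
  define I2 where "I2 = (LINT z|lborel. g z * P z)"
  define I3 where "I3 = (LINT z|lborel. g z * (?\<kappa> (fst z) * bta (snd z)))"
  define I4 where "I4 = (LINT t|lborel. Th (WL t) * psi' t)"
  have "sig * (LINT z|lborel. q k z * P z) = sig * e0 * I4 + sig * e0 * (I1 - I4) + sig * (I2 - I3) + sig * I3"
   unfolding q_split I1_def[symmetric] I2_def[symmetric] by (simp add: algebra_simps)
  also have "\<dots> <= sig * e0 * I4 + \<bar>I1 - I4\<bar> + \<bar>I2 - I3\<bar> + sig * I3"
  proof -
   have "\<bar>sig * e0\<bar> = 1" using sig e0 by (simp add: abs_mult)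
   then have "sig * e0 * (I1 - I4) <= \<bar>I1 - I4\<bar>" using sign_abs_mult[of "sig * e0" "I1 - I4"] by linarith
   moreover have "sig * (I2 - I3) <= \<bar>I2 - I3\<bar>" using sign_abs_mult[OF sig, of "I2 - I3"] by linarith
   ultimately show ?thesis by linarith
  qed
  also have "\<dots> <= sig * e0 * I4 + e' * M"
   using A Bd Cc unfolding I1_def[symmetric] I2_def[symmetric] I3_def[symmetric] I4_def[symmetric] M_def
   by (simp add: algebra_simps)
  finally have "sig * (LINT z|lborel. q k z * P z) <= sig * e0 * I4 + e' * M" .
  moreover have "integ (%z. q k z * P z)" by (rule integrable_bounded_mult[OF iP _ q_bound]) measurable
  ultimately show ?thesis unfolding e'(2) I4_def WLeq P_def by blast
 qed
 with h0 show ?thesis by blast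
qed

end

section \<open>Comparison with affine solutions\<close>

lemma step'_sym: "step' (1 - u) = step' u"
 by (auto simp: step'_def max_def)

text \<open>A bump around \<open>y\<close> that is \<open>1\<close> within distance \<open>h\<close> and
 \<open>0\<close> beyond distance \<open>2 h\<close>.\<close>

definition bump :: "real => real => real => real" where
 "bump y h x = step ((x - y) / h + 2) - step ((x - y) / h - 1)"

lemma bump_props:
 assumes "h > 0"
 shows "(bump y h has_real_derivative kern y (- 1) h x - kern y 1 h x) (at x)"
  and "0 <= bump y h x" "bump y h x <= 1"
  and "2 * h <= \<bar>x - y\<bar> ==> bump y h x = 0" "\<bar>x - y\<bar> <= h ==> bump y h x = 1"
proof -
 have e: "- 1 * (x - y) / h - 1 = 1 - ((x - y) / h + 2)" by (simp add: diff_divide_distrib)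
 have "((%x. step ((x - y) / h + 2) - step ((x - y) / h - 1)) has_real_derivative
   step' ((x - y) / h + 2) * (1 / h) - step' ((x - y) / h - 1) * (1 / h)) (at x)"
  using assms by (auto intro!: derivative_eq_intros)
 then show "(bump y h has_real_derivative kern y (- 1) h x - kern y 1 h x) (at x)"
  unfolding kern_def e step'_sym by (simp add: bump_def[abs_def])
 show "0 <= bump y h x" unfolding bump_def using step_mono[of "(x - y) / h - 1" "(x - y) / h + 2"] by simp
 show "bump y h x <= 1" unfolding bump_def using step_bounds[of "(x - y) / h + 2"] step_bounds[of "(x - y) / h - 1"] by linarith
 show "bump y h x = 0" if b: "2 * h <= \<bar>x - y\<bar>"
 proof (cases "x \<ge> y")
  case True
  then have "(x - y) / h - 1 \<ge> 1" using b assms by (simp add: field_simps)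
  then show ?thesis unfolding bump_def using step_eq_1[of "(x - y) / h + 2"] step_eq_1[of "(x - y) / h - 1"] by simp
 next
  case False
  then have "(x - y) / h + 2 <= 0" using b assms by (simp add: field_simps)
  then show ?thesis unfolding bump_def using step_eq_0[of "(x - y) / h + 2"] step_eq_0[of "(x - y) / h - 1"] by simp
 qed
 show "bump y h x = 1" if b: "\<bar>x - y\<bar> <= h"
 proof -
  have "(x - y) / h <= 1" "- 1 <= (x - y) / h" using b assms by (auto simp: field_simps abs_le_iff)
  then show ?thesis unfolding bump_def using step_eq_1[of "(x - y) / h + 2"] step_eq_0[of "(x - y) / h - 1"] by simp
 qed
qed

context entropy_flow begin

lemma trace_le:
 assumes y: "y \<in> X" and sig: "\<bar>sig\<bar> = 1" and L: "trace_lim s T y sig U L" and t: "t \<in> {s..T}"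
  and d0: "d0 > 0" "!!x. x \<in> R ==> 0 < sig * (x - y) ==> sig * (x - y) < d0 ==> W k c (x, t) <= M"
 shows "L t - (k * y - H k * t + c) <= M"
proof (rule field_le_epsilon)
 fix e :: real assume e: "e > 0"
 obtain d1 where d1: "d1 > 0" "!!x. x \<noteq> y ==> \<bar>x - y\<bar> < d1 ==> x \<in> R" by (rule side_regular[OF y]) blast
 obtain d2 where d2: "d2 > 0" "!!x t. 0 < sig * (x - y) ==> sig * (x - y) < d2 ==> t \<in> {s..T} ==> \<bar>U (x, t) - L t\<bar> < e / 2"
  using L[unfolded trace_lim_def] e by (metis half_gt_zero)
 define K where "K = \<bar>k\<bar> + 1"
 define d where "d = min (min d0 d1) (min d2 (e / K)) / 2"
 have kp: "K > 0" by (simp add: K_def)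
 have dp: "d > 0" using d0 d1 d2 e kp by (simp add: d_def)
 have db: "d < d0" "d < d1" "d < d2" using dp by (auto simp: d_def min_def split: if_splits)
 have dk: "\<bar>k\<bar> * d <= e / 2"
 proof -
  have "d <= e / K / 2" unfolding d_def by (rule divide_right_mono) auto
  then have "K * d <= K * (e / K / 2)" using kp by (intro mult_left_mono) auto
  also have "\<dots> = e / 2" using kp by simp
  finally show ?thesis using dp by (simp add: K_def algebra_simps)
 qed
 define x where "x = y + sig * d"
 have ss: "sig * sig = 1" using sign_cases[OF sig] by auto
 have sx: "sig * (x - y) = d" unfolding x_def using ss by (simp add: mult.assoc[symmetric])
 have xy: "\<bar>x - y\<bar> = d" unfolding x_def using dp sig by (simp add: abs_mult)
 have xR: "x \<in> R" using xy db dp by (intro d1(2)) auto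
 have "W k c (x, t) <= M" using xR sx dp db by (intro d0(2)) auto
 moreover have "\<bar>U (x, t) - L t\<bar> < e / 2" using sx dp db t by (intro d2(2)) auto
 moreover have "\<bar>k * (x - y)\<bar> <= e / 2" using dk xy by (simp add: abs_mult)
 moreover have "L t - (k * y - H k * t + c) = W k c (x, t) - (U (x, t) - L t) + k * (x - y)"
  by (simp add: W_def algebra_simps)
 ultimately show "L t - (k * y - H k * t + c) <= M + e" by linarith
qed

text \<open>Since \<open>sgn = 2 sgn_minus + 1\<close> and \<open>sgn = 2 sgn_plus - 1\<close> away from zero, the
 compatibility condition compares the entropy flux \<open>q\<close> with \<open>f\<close> at positive and with
 \<open>- f\<close> at negative singularities.\<close>

lemma compat_flux:
 assumes "y \<in> X" "\<bar>sig\<bar> = 1"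
 shows "y \<in> Xp ==> trace_nonpos s T y sig (%z. q k z - 1 * f k z)"
  and "y \<in> Xn ==> trace_nonpos s T y sig (%z. q k z - (- 1) * f k z)"
proof -
 have "(%z. 2 * (sgn_minus (v z - k) * (H (v z) - H k))) = (%z. q k z - 1 * f k z)"
  by (auto simp: fun_eq_iff q_def f_def sgn_minus_def sgn_real_def indicator_def)
 then show "y \<in> Xp ==> trace_nonpos s T y sig (%z. q k z - 1 * f k z)"
  using trace_nonpos_double[OF compat_p[OF _ assms(2)], of y k] by simp
 have "(%z. 2 * (sgn_plus (v z - k) * (H (v z) - H k))) = (%z. q k z - (- 1) * f k z)"
  by (auto simp: fun_eq_iff q_def f_def sgn_plus_def sgn_real_def indicator_def)
 then show "y \<in> Xn ==> trace_nonpos s T y sig (%z. q k z - (- 1) * f k z)"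
  using trace_nonpos_double[OF compat_n[OF _ assms(2)], of y k] by simp
qed

text \<open>Comparison with the affine solution \<open>A + k (x - a) - H k (t - s)\<close>: at a positive singularity
 \<open>a\<close> the potential has slope \<open>+\<infinity>\<close> on the right, so \<open>W\<close> cannot have a positive maximum there.\<close>

lemma comparison:
 assumes a: "a \<in> Xp" and b: "a < b'" "b' < b" "b < r" and bX: "{b'..b} \<inter> X = {}"
  and init: "!!x. x \<in> R ==> a < x ==> x <= b ==> U (x, s) <= A + k * (x - a)"
  and far: "!!x t. x \<in> {b'..b} ==> t \<in> {s..T} ==> U (x, t) <= A + k * (x - a) - H k * (t - s)"
  and t: "t \<in> {s..<T}"
 shows "Ur a t <= A - H k * (t - s)"
proof -
 define c where "c = A - k * a + H k * s"
 define Wr where "Wr y tau = Ur y tau - (k * y - H k * tau + c)" for y tau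
 define Wl where "Wl y tau = Ul y tau - (k * y - H k * tau + c)" for y tau
 have "Wr a t <= \<epsilon>" if \<epsilon>: "\<epsilon> > 0" for \<epsilon>
 proof -
  define th where "th w = (max 0 (w - \<epsilon>)) ^ 3" for w :: real
  define th' where "th' w = 3 * (max 0 (w - \<epsilon>))\<^sup>2" for w :: real
  define th'' where "th'' w = 6 * max 0 (w - \<epsilon>)" for w :: real
  \<comment> \<open>\<open>th\<close> is twice differentiable and vanishes where \<open>W <= \<epsilon>\<close>; \<open>Th\<close> is its primitive\<close>
  define Th where "Th w = (max 0 (w - \<epsilon>)) ^ 4 / 4" for w :: real
  have sh: "((%w. w - \<epsilon>) has_real_derivative 1) (at w)" for w by (auto intro!: derivative_eq_intros)
  have dTh: "(Th has_real_derivative th w) (at w)" for w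
   unfolding Th_def[abs_def] th_def
   using DERIV_cdivide[OF DERIV_chain2[OF pos_power_deriv[of 2] sh], of 4 w] by (simp add: numeral_eq_Suc)
  have dth: "(th has_real_derivative th' w) (at w)" for w
   unfolding th'_def th_def[abs_def]
   using DERIV_chain2[OF pos_power_deriv[of 1] sh, of w] by (simp add: numeral_eq_Suc)
  have dth': "(th' has_real_derivative th'' w) (at w)" for w
   unfolding th''_def th'_def[abs_def]
   using DERIV_cmult[OF DERIV_chain2[OF pos_power_deriv[of 0] sh], of 3 w] by (simp add: numeral_eq_Suc)
  have cth'': "cont th''" unfolding th''_def[abs_def] by (intro continuous_intros)
  have cth: "cont th" unfolding th_def[abs_def] by (intro continuous_intros)
  have cTh: "cont Th" unfolding Th_def[abs_def] by (intro continuous_intros) auto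
  have thnn: "0 <= th w" for w by (simp add: th_def)
  have Thnn: "0 <= Th w" for w by (simp add: Th_def)
  have th0: "th w = 0" if "w <= \<epsilon>" for w using that by (simp add: th_def)
  have Th0: "Th w = 0" if "w <= \<epsilon>" for w using that by (simp add: Th_def)
  have Thmono: "Th w <= Th w'" if "w <= w'" for w w' unfolding Th_def using that by (intro divide_right_mono power_mono) auto
  define dl where "dl = min (\<epsilon> / (2 * C + 1)) ((T - s) / 2)"
  have Cp: "2 * C + 1 > 0" using C_nonneg by simp
  have dl: "dl > 0" "s + dl < T" using \<epsilon> sT Cp by (auto simp: dl_def min_def field_simps)
  have dlC: "2 * C * dl <= \<epsilon>"
  proof -
   have "dl <= \<epsilon> / (2 * C + 1)" by (simp add: dl_def)
   then have "(2 * C + 1) * dl <= \<epsilon>" using Cp by (simp add: pos_le_divide_eq mult.commute)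
   then show ?thesis using dl by (simp add: algebra_simps)
  qed
  define T' where "T' = (max t (s + dl) + T) / 2"
  have T': "t < T'" "s + dl < T'" "T' < T" using t dl by (auto simp: T'_def)
  have Wsmall: "W k c (x, tau) <= \<epsilon>" if "x \<in> R" "a < x" "x <= b" "tau \<in> {s..s + dl}" for x tau
  proof -
   have tau: "tau \<in> {s..T}" "s \<in> {s..T}" "\<bar>tau - s\<bar> <= dl" using that dl sT by auto
   have 1: "U (x, tau) <= U (x, s) + C * dl"
    using U_lip[OF that(1) tau(1,2)] mult_left_mono[OF tau(3) C_nonneg] by linarith
   have 2: "H k * (tau - s) <= C * dl"
    using mult_mono[OF H_bound[of k] tau(3) C_nonneg] by (simp add: abs_mult[symmetric])
   have "W k c (x, tau) = U (x, tau) - A - k * (x - a) + H k * (tau - s)" by (simp add: W_def c_def algebra_simps)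
   then show ?thesis using 1 2 init[OF that(1,2,3)] dlC by linarith
  qed
  have Wfar: "W k c (x, tau) <= \<epsilon>" if "x \<in> {b'..b}" "tau \<in> {s..T}" for x tau
   using far[OF that] \<epsilon> by (simp add: W_def c_def algebra_simps)
  define Y where "Y = X \<inter> {a<..<b}"
  have Yfin: "finite Y" using X_fin by (simp add: Y_def)
  have Yb: "y < b'" "a < y" "y \<in> X" if "y \<in> Y" for y
   using that bX by (auto simp: Y_def not_less) (meson atLeastAtMost_iff disjoint_iff linorder_not_less less_imp_le UnI1 UnI2)+
  have aX: "a \<in> X" using a by auto
  have trace_small: "L tau - (k * y - H k * tau + c) <= \<epsilon>"
   if y: "y \<in> X" "\<bar>sig\<bar> = 1" "trace_lim s T y sig U L" and tau: "tau \<in> {s..s + dl}" and pos: "y \<in> Y \<or> y = a \<and> sig = 1"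
   for y sig L tau
  proof (rule trace_le[OF y])
   show "tau \<in> {s..T}" using tau dl by auto
   show "min (b - y) (if y = a then 1 else y - a) > 0" using pos Yb[of y] b by (auto simp: Y_def)
   fix x assume x: "x \<in> R" "0 < sig * (x - y)" "sig * (x - y) < min (b - y) (if y = a then 1 else y - a)"
   have "a < x \<and> x <= b"
    using sign_cases[OF y(2)] pos x Yb[of y] by (auto split: if_splits)
   then show "W k c (x, tau) <= \<epsilon>" using Wsmall x(1) tau by blast
  qed
  \<comment> \<open>the time cutoff increases only while \<open>W <= \<epsilon>\<close> still holds, and decreases strictly afterwards\<close>
  define psi where "psi tau = step (2 * (tau - s) / dl - 1) * (max 0 (T' - tau))\<^sup>2" for tau
  define psi' where "psi' tau = step' (2 * (tau - s) / dl - 1) * (2 / dl) * (max 0 (T' - tau))\<^sup>2 + step (2 * (tau - s) / dl - 1) * (- 2 * max 0 (T' - tau))" for tau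
  have dpsi: "(psi has_real_derivative psi' tau) (at tau)" for tau
  proof -
   have 1: "((%tau. (max 0 (T' - tau))\<^sup>2) has_real_derivative - 2 * max 0 (T' - tau)) (at tau)"
   proof -
    have "((%tau. T' - tau) has_real_derivative - 1) (at tau)" by (auto intro!: derivative_eq_intros)
    from DERIV_chain2[OF pos_power_deriv[of 0] this] show ?thesis by (simp add: numeral_eq_Suc)
   qed
   have 2: "((%tau. step (2 * (tau - s) / dl - 1)) has_real_derivative step' (2 * (tau - s) / dl - 1) * (2 / dl)) (at tau)"
    using dl(1) by (auto intro!: derivative_eq_intros)
   show ?thesis unfolding psi_def[abs_def] psi'_def
    by (rule DERIV_cong[OF DERIV_mult[OF 2 1]]) (simp add: algebra_simps)
  qed
  have cpsi': "cont psi'" unfolding psi'_def[abs_def] using dl(1) by (intro continuous_intros) auto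
  have psinn: "0 <= psi tau" for tau unfolding psi_def using step_bounds by simp
  define t1 where "t1 = s + dl / 2"
  have t12: "s < t1" "T' < T" using dl T' by (auto simp: t1_def)
  have psi0: "psi tau = 0" if "tau \<notin> {t1..T'}" for tau
  proof (cases "tau < t1")
   case True
   then have "2 * (tau - s) / dl - 1 <= 0" using dl by (simp add: t1_def field_simps)
   then show ?thesis by (simp add: psi_def step_eq_0)
  qed (use that in \<open>simp add: psi_def\<close>)
  have psi'0: "psi' tau = 0" if "tau \<notin> {t1..T'}" for tau
   using deriv_zero_off_support[OF dpsi closed_atLeastAtMost psi0 that] .
  have late: "psi' tau = - 2 * max 0 (T' - tau)" if "s + dl <= tau" for tau
  proof -
   have "2 * (tau - s) / dl - 1 \<ge> 1" using that dl by (simp add: field_simps)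
   then show ?thesis by (simp add: psi'_def step_eq_1 step'_eq_0)
  qed
  have late_neg: "psi' tau <= 0" if "s + dl <= tau" for tau using late[OF that] by simp
  \<comment> \<open>the integrals of the traces against the derivative of the cutoff\<close>
  define G where "G L y = (LINT tau|lborel. Th (L tau - (k * y - H k * tau + c)) * psi' tau)" for L :: "real => real" and y
  have Gint: "integ (%tau. Th (L tau - (k * y - H k * tau + c)) * psi' tau)"
   and Gcont: "continuous_on {t1..T'} (%tau. Th (L tau - (k * y - H k * tau + c)) * psi' tau)"
   if "y \<in> X" "\<bar>sig\<bar> = 1" "trace_lim s T y sig U L" for y sig L
  proof -
   have "continuous_on {t1..T'} L"
    by (rule continuous_on_subset[OF trace_continuous[OF that]]) (use t12 in auto)
   then show c: "continuous_on {t1..T'} (%tau. Th (L tau - (k * y - H k * tau + c)) * psi' tau)"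
    by (intro continuous_on_mult continuous_on_comp_UNIV[OF cTh] continuous_on_subset[OF cpsi'] continuous_intros) auto
   have "integ (%tau. indicator {t1..T'} tau *\<^sub>R (Th (L tau - (k * y - H k * tau + c)) * psi' tau))"
    by (rule borel_integrable_compact[OF compact_Icc c])
   also have "(%tau. indicator {t1..T'} tau *\<^sub>R (Th (L tau - (k * y - H k * tau + c)) * psi' tau)) = (%tau. Th (L tau - (k * y - H k * tau + c)) * psi' tau)"
    using psi'0 by (auto simp: indicator_def fun_eq_iff)
   finally show "integ (%tau. Th (L tau - (k * y - H k * tau + c)) * psi' tau)" .
  qed
  have cmp: "G L y <= G L' y"
   if y: "y \<in> Y" and L: "\<bar>sig\<bar> = 1" "trace_lim s T y sig U L" and L': "\<bar>sig'\<bar> = 1" "trace_lim s T y sig' U L'"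
    and le: "!!tau. tau \<in> {s..T} ==> L' tau <= L tau" for y L L' sig sig'
   unfolding G_def
  proof (rule integral_mono[OF Gint[OF Yb(3)[OF y] L] Gint[OF Yb(3)[OF y] L']])
   fix tau
   let ?a = "L tau - (k * y - H k * tau + c)" and ?b = "L' tau - (k * y - H k * tau + c)"
   consider "tau \<notin> {t1..T'}" | "tau \<in> {s..s + dl}" | "s + dl <= tau" "tau \<in> {s..T}"
    using t12 T' by force
   then show "Th ?a * psi' tau <= Th ?b * psi' tau"
   proof cases
    case 1 then show ?thesis using psi'0 by simp
   next
    case 2
    then have "Th ?a = 0" "Th ?b = 0"
     using trace_small[OF Yb(3)[OF y] L 2] trace_small[OF Yb(3)[OF y] L' 2] y Th0 by auto
    then show ?thesis by simp
   next
    case 3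
    then have "Th ?b <= Th ?a" using le[OF 3(2)] by (intro Thmono) simp
    then show ?thesis using late_neg[OF 3(1)] by (rule mult_right_mono_neg)
   qed
  qed
  define I where "I y sig h = (LINT z|lborel. q k z * (th (W k c z) * kern y sig h (fst z) * psi (snd z)))" for y sig h
  define Ii where "Ii y sig h \<longleftrightarrow> integ (%z. q k z * (th (W k c z) * kern y sig h (fst z) * psi (snd z)))" for y sig h
  have "0 <= G (Ur a) a + e" if e: "e > 0" for e
  proof -
   define e2 where "e2 = e / (2 * real (card Y) + 1)"
   have e2: "e2 > 0" using e by (simp add: e2_def)
   note fl = entropy_flux_trace[where c=c, OF _ _ _ _ _ dTh cth thnn dpsi cpsi' psinn t12 psi0 e2]
   have fl_ev: "eventually (%h. Ii y sig h \<and> sig * I y sig h <= sig * e0 * G L y + e2) (at_right 0)"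
    if "y \<in> X" "\<bar>sig\<bar> = 1" "\<bar>e0\<bar> = 1" "trace_lim s T y sig U L" "trace_nonpos s T y sig (%z. q k z - e0 * f k z)" for y sig e0 L
    unfolding eventually_at_right_field I_def Ii_def G_def
    by (rule ex_forward[OF fl[OF that]]) simp_all
   have eva: "eventually (%h. Ii a 1 h \<and> I a 1 h <= G (Ur a) a + e2) (at_right 0)"
    using fl_ev[OF aX _ _ lim_right[OF aX], of 1] compat_flux(1)[OF aX _ a, of 1] by simp
   have evY: "eventually (%h. \<forall>y\<in>Y. Ii y 1 h \<and> Ii y (- 1) h \<and> I y 1 h - I y (- 1) h <= 2 * e2) (at_right 0)"
   proof (rule eventually_ball_finite[OF Yfin], rule ballI)
    fix y assume y: "y \<in> Y"
    note yX = Yb(3)[OF y]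
    show "eventually (%h. Ii y 1 h \<and> Ii y (- 1) h \<and> I y 1 h - I y (- 1) h <= 2 * e2) (at_right 0)"
    proof (cases "y \<in> Xp")
     case True
     have "G (Ur y) y <= G (Ul y) y"
      by (rule cmp[OF y _ lim_right[OF yX] _ lim_left[OF yX]]) (use jump_p[OF True] in auto)
     moreover have "eventually (%h. Ii y 1 h \<and> 1 * I y 1 h <= 1 * 1 * G (Ur y) y + e2) (at_right 0)"
      by (rule fl_ev[OF yX _ _ lim_right[OF yX]]) (use compat_flux(1)[OF yX _ True] in auto)
     moreover have "eventually (%h. Ii y (- 1) h \<and> - 1 * I y (- 1) h <= - 1 * 1 * G (Ul y) y + e2) (at_right 0)"
      by (rule fl_ev[OF yX _ _ lim_left[OF yX]]) (use compat_flux(1)[OF yX _ True] in auto)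
     ultimately show ?thesis by (auto elim: eventually_elim2)
    next
     case False
     then have yn: "y \<in> Xn" using yX by auto
     have "G (Ul y) y <= G (Ur y) y"
      by (rule cmp[OF y _ lim_left[OF yX] _ lim_right[OF yX]]) (use jump_n[OF yn] in auto)
     moreover have "eventually (%h. Ii y 1 h \<and> 1 * I y 1 h <= 1 * - 1 * G (Ur y) y + e2) (at_right 0)"
      by (rule fl_ev[OF yX _ _ lim_right[OF yX]]) (use compat_flux(2)[OF yX _ yn] in auto)
     moreover have "eventually (%h. Ii y (- 1) h \<and> - 1 * I y (- 1) h <= - 1 * - 1 * G (Ul y) y + e2) (at_right 0)"
      by (rule fl_ev[OF yX _ _ lim_left[OF yX]]) (use compat_flux(2)[OF yX _ yn] in auto)
     ultimately show ?thesis by (auto elim: eventually_elim2)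
    qed
   qed
   define Z where "Z = insert a Y"
   have Zfin: "finite Z" using Yfin by (simp add: Z_def)
   have ev_b: "eventually (%h. \<forall>y\<in>Z. y + 2 * h < b') (at_right 0)"
   proof (rule eventually_ball_finite[OF Zfin], rule ballI)
    fix y assume "y \<in> Z"
    then have "0 < (b' - y) / 2" using Yb b by (auto simp: Z_def)
    then show "eventually (%h. y + 2 * h < b') (at_right 0)"
     unfolding eventually_at_right_field by (intro exI[of _ "(b' - y) / 2"]) auto
   qed
   have ev_s: "eventually (%h. \<forall>y\<in>Z. \<forall>y'\<in>Z. y \<noteq> y' --> 4 * h < \<bar>y - y'\<bar>) (at_right 0)"
   proof (rule eventually_ball_finite[OF Zfin], rule ballI, rule eventually_ball_finite[OF Zfin], rule ballI)
    fix y y' assume "y \<in> Z" "y' \<in> Z"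
    show "eventually (%h. y \<noteq> y' --> 4 * h < \<bar>y - y'\<bar>) (at_right 0)"
    proof (cases "y = y'")
     case False
     then show ?thesis unfolding eventually_at_right_field by (intro exI[of _ "\<bar>y - y'\<bar> / 4"]) auto
    qed simp
   qed
   have ev0: "eventually (%h::real. 0 < h) (at_right 0)" by (simp add: eventually_at_right_less)
   define good where "good h \<longleftrightarrow> 0 < h \<and> (Ii a 1 h \<and> I a 1 h <= G (Ur a) a + e2) \<and>
    (\<forall>y\<in>Y. Ii y 1 h \<and> Ii y (- 1) h \<and> I y 1 h - I y (- 1) h <= 2 * e2) \<and>
    (\<forall>y\<in>Z. y + 2 * h < b') \<and> (\<forall>y\<in>Z. \<forall>y'\<in>Z. y \<noteq> y' --> 4 * h < \<bar>y - y'\<bar>)" for h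
   have ev: "eventually good (at_right 0)"
    unfolding good_def by (intro eventually_conj ev0 eva evY ev_b ev_s)
   obtain h where hg: "good h"
    using eventually_happens'[OF trivial_limit_at_right_real ev] by (elim exE)
   have h: "0 < h" "Ii a 1 h" "I a 1 h <= G (Ur a) a + e2"
    using hg unfolding good_def by simp_all
   have hY: "Ii y 1 h" "Ii y (- 1) h" "I y 1 h - I y (- 1) h <= 2 * e2" if "y \<in> Y" for y
    using hg that unfolding good_def by simp_all
   have hb: "y + 2 * h < b'" if "y \<in> Z" for y
    using hg that unfolding good_def by simp
   have hs: "4 * h < \<bar>y - y'\<bar>" if "y \<in> Z" "y' \<in> Z" "y \<noteq> y'" for y y'
    using hg that unfolding good_def by simp
   have aZ: "a \<in> Z" and YZ: "Y \<subseteq> Z" by (auto simp: Z_def)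
   define eta where "eta x = step ((x - a) / h - 1) - (1 - step ((b - x) / (b - b'))) - (\<Sum>y\<in>Y. bump y h x)" for x
   define eta' where "eta' x = kern a 1 h x - step' ((b - x) / (b - b')) / (b - b') - (\<Sum>y\<in>Y. kern y (- 1) h x - kern y 1 h x)" for x
   have deta: "(eta has_real_derivative eta' x) (at x)" for x
   proof -
    have 1: "((%x. step ((x - a) / h - 1)) has_real_derivative kern a 1 h x) (at x)"
     unfolding kern_def using h(1) by (auto intro!: derivative_eq_intros)
    have 2: "((%x. 1 - step ((b - x) / (b - b'))) has_real_derivative step' ((b - x) / (b - b')) / (b - b')) (at x)"
    proof -
     have "((%x. (b - x) / (b - b')) has_real_derivative (0 - 1) / (b - b')) (at x)"
      by (intro DERIV_cdivide DERIV_diff DERIV_const DERIV_ident)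
     then show ?thesis
      by (rule DERIV_cong[OF DERIV_diff[OF DERIV_const step_deriv_chain]]) simp
    qed
    show ?thesis unfolding eta_def[abs_def] eta'_def
     by (intro DERIV_diff DERIV_sum 1 2 bump_props(1)[OF h(1)])
   qed
   have ceta': "cont eta'"
    unfolding eta'_def[abs_def] using b by (intro continuous_intros kern_props(4)[OF h(1)]) auto
   have sum1: "(\<Sum>y\<in>Y. bump y h x) = bump y0 h x" if "y0 \<in> Y" "\<bar>x - y0\<bar> < 2 * h" for x y0
   proof -
    have "bump y h x = 0" if "y \<in> Y - {y0}" for y
    proof (rule bump_props(4)[OF h(1)])
     have "4 * h < \<bar>y - y0\<bar>" using that \<open>y0 \<in> Y\<close> YZ by (intro hs) auto
     then show "2 * h <= \<bar>x - y\<bar>" using \<open>\<bar>x - y0\<bar> < 2 * h\<close> by linarith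
    qed
    then show ?thesis using sum.remove[OF Yfin that(1), of "%y. bump y h x"] by simp
   qed
   have sum0: "(\<Sum>y\<in>Y. bump y h x) = 0" if "!!y. y \<in> Y ==> 2 * h <= \<bar>x - y\<bar>" for x
    using that by (intro sum.neutral ballI bump_props(4)[OF h(1)]) auto
   have stepb1: "step ((b - x) / (b - b')) = 1" if "x <= b'" for x
    using that b by (intro step_eq_1) (simp add: field_simps)
   have stepb0: "step ((b - x) / (b - b')) = 0" if "b <= x" for x
    using that b by (intro step_eq_0) (simp add: field_simps)
   have stepa1: "step ((x - a) / h - 1) = 1" if "a + 2 * h <= x" for x
    using that h by (intro step_eq_1) (simp add: field_simps)
   have stepa0: "step ((x - a) / h - 1) = 0" if "x <= a + h" for x
    using that h by (intro step_eq_0) (simp add: field_simps)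
   have nearY: "a + 2 * h <= x \<and> x <= b'" if "y \<in> Y" "\<bar>x - y\<bar> < 2 * h" for x y
   proof -
    have "4 * h < \<bar>y - a\<bar>" using that YZ aZ Yb(2)[of y] by (intro hs) auto
    moreover have "y + 2 * h < b'" using that YZ by (intro hb) auto
    ultimately show ?thesis using that Yb(2)[of y] by (auto simp: abs_less_iff abs_if split: if_splits)
   qed
   have etann: "0 <= eta x" for x
   proof (cases "\<exists>y\<in>Y. \<bar>x - y\<bar> < 2 * h")
    case True
    then obtain y where y: "y \<in> Y" "\<bar>x - y\<bar> < 2 * h" by blast
    then show ?thesis unfolding eta_def sum1[OF y] using nearY[OF y] stepa1 stepb1 bump_props(3)[OF h(1), of y x] by simp
   next
    case False
    then have s0: "(\<Sum>y\<in>Y. bump y h x) = 0" by (intro sum0) (auto simp: not_less)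
    have "a + 2 * h < b'" using hb[OF aZ] .
    then show ?thesis unfolding eta_def s0
     using stepa1[of x] stepb1[of x] step_bounds[of "(x - a) / h - 1"] step_bounds[of "(b - x) / (b - b')"]
     by (cases "x <= b'") auto
   qed
   define Kx where "Kx = {a + h..b} - (\<Union>y\<in>Y. {y - h<..<y + h})"
   have Kc: "compact Kx" unfolding Kx_def using Yfin by (intro compact_diff compact_Icc open_UN) auto
   have al: "l < a" using a X_in by auto
   have KR: "Kx \<subseteq> R"
   proof
    fix x assume x: "x \<in> Kx"
    have "x \<notin> X"
    proof
     assume "x \<in> X"
     moreover have "b \<notin> X" using disjoint_iff[THEN iffD1, OF bX, rule_format, of b] b by simp
     then have "x \<noteq> b" using \<open>x \<in> X\<close> by metis
     ultimately have "x \<in> Y" using x h by (auto simp: Kx_def Y_def)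
     then show False using x h by (auto simp: Kx_def)
    qed
    then show "x \<in> R" using x h al b by (auto simp: Kx_def)
   qed
   have Kab: "a < x" "x <= b" if "x \<in> Kx" for x using that h by (auto simp: Kx_def)
   have eta0: "eta x = 0" if "x \<notin> Kx" for x
   proof -
    consider "\<exists>y\<in>Y. \<bar>x - y\<bar> < h" | "x < a + h" "\<not> (\<exists>y\<in>Y. \<bar>x - y\<bar> < 2 * h)" | "b < x" "\<not> (\<exists>y\<in>Y. \<bar>x - y\<bar> < 2 * h)"
    proof -
     have "(\<exists>y\<in>Y. \<bar>x - y\<bar> < h) \<or> x < a + h \<or> b < x"
     proof (cases "x < a + h \<or> b < x")
      case False
      then have "x \<in> (\<Union>y\<in>Y. {y - h<..<y + h})" using \<open>x \<notin> Kx\<close> by (simp add: Kx_def)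
      then obtain y where "y \<in> Y" "y - h < x" "x < y + h" by auto
      then have "\<bar>x - y\<bar> < h" by linarith
      with \<open>y \<in> Y\<close> show ?thesis by blast
     qed simp
     moreover have "\<not> (\<exists>y\<in>Y. \<bar>x - y\<bar> < 2 * h)" if out: "x < a + h \<or> b < x"
     proof
      assume "\<exists>y\<in>Y. \<bar>x - y\<bar> < 2 * h"
      then obtain y where "y \<in> Y" "\<bar>x - y\<bar> < 2 * h" by blast
      then have "a + 2 * h <= x \<and> x <= b'" by (rule nearY)
      with out h(1) b show False by linarith
     qed
     ultimately show ?thesis using that by blast
    qed
    then show ?thesis
    proof cases
     case 1
     then obtain y where y: "y \<in> Y" "\<bar>x - y\<bar> < h" by blast
     then have y2: "\<bar>x - y\<bar> < 2 * h" using h by linarith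
     show ?thesis unfolding eta_def sum1[OF y(1) y2]
      using nearY[OF y(1) y2] stepa1 stepb1 bump_props(5)[OF h(1), of x y] y by simp
    next
     case 2
     have "x <= b'" using 2 hb[OF aZ] h by linarith
     moreover have "(\<Sum>y\<in>Y. bump y h x) = 0" using 2 by (intro sum0) (auto simp: not_less)
     ultimately show ?thesis unfolding eta_def using stepa0[of x] stepb1[of x] 2 by simp
    next
     case 3
     have "a + 2 * h <= x" using 3 hb[OF aZ] b by linarith
     moreover have "(\<Sum>y\<in>Y. bump y h x) = 0" using 3 by (intro sum0) (auto simp: not_less)
     ultimately show ?thesis unfolding eta_def using stepa1[of x] stepb0[of x] 3 by simp
    qed
   qed
   note ent = entropy_along_potential[OF dth dth' cth'' thnn deta ceta' etann Kc KR eta0 dpsi cpsi' psinn t12 psi0, of k c]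
   have E1: "\<bar>v z - k\<bar> * (th (W k c z) * eta (fst z) * psi' (snd z)) <= 0" for z
   proof -
    consider "fst z \<notin> Kx" | "snd z \<notin> {t1..T'}" | "fst z \<in> Kx" "snd z \<in> {s..s + dl}" | "s + dl <= snd z"
     using t12 by force
    then show ?thesis
    proof cases
     case 3
     then have "W k c (fst z, snd z) <= \<epsilon>" using KR Kab by (intro Wsmall) auto
     then show ?thesis using th0 by simp
    next
     case 4
     then show ?thesis using late_neg[OF 4] thnn etann by (intro mult_nonneg_nonpos) auto
    qed (use eta0 psi'0 in auto)
   qed
   have "(LINT z|lborel. \<bar>v z - k\<bar> * (th (W k c z) * eta (fst z) * psi' (snd z))) <= 0"
    using integral_mono[OF ent(2) integrable_zero, of] E1 by simp
   then have "0 <= (LINT z|lborel. q k z * (th (W k c z) * eta' (fst z) * psi (snd z)))"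
    using ent by simp
   also have "\<dots> = (LINT z|lborel. q k z * (th (W k c z) * kern a 1 h (fst z) * psi (snd z))
     + (\<Sum>y\<in>Y. q k z * (th (W k c z) * kern y 1 h (fst z) * psi (snd z)) - q k z * (th (W k c z) * kern y (- 1) h (fst z) * psi (snd z))))"
   proof (rule LINT_cong)
    fix z :: "real \<times> real"
    have b0: "th (W k c z) * (step' ((b - fst z) / (b - b')) / (b - b')) * psi (snd z) = 0"
    proof (cases "fst z \<in> {b'..b} \<and> snd z \<in> {s..T}")
     case True
     then have "W k c (fst z, snd z) <= \<epsilon>" by (intro Wfar) auto
     then show ?thesis using th0 by simp
    next
     case False
     have "step' ((b - fst z) / (b - b')) = 0" if "fst z \<notin> {b'..b}"
      using that b by (intro step'_eq_0) (auto simp: field_simps)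
     moreover have "psi (snd z) = 0" if "snd z \<notin> {s..T}" using that t12 by (intro psi0) auto
     ultimately show ?thesis using False by auto
    qed
    have "th (W k c z) * eta' (fst z) * psi (snd z) = th (W k c z) * kern a 1 h (fst z) * psi (snd z)
      - th (W k c z) * (step' ((b - fst z) / (b - b')) / (b - b')) * psi (snd z)
      + (\<Sum>y\<in>Y. th (W k c z) * kern y 1 h (fst z) * psi (snd z) - th (W k c z) * kern y (- 1) h (fst z) * psi (snd z))"
     unfolding eta'_def by (simp add: algebra_simps sum_subtractf sum_distrib_left sum_distrib_right)
    then show "q k z * (th (W k c z) * eta' (fst z) * psi (snd z)) = q k z * (th (W k c z) * kern a 1 h (fst z) * psi (snd z))
     + (\<Sum>y\<in>Y. q k z * (th (W k c z) * kern y 1 h (fst z) * psi (snd z)) - q k z * (th (W k c z) * kern y (- 1) h (fst z) * psi (snd z)))"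
     unfolding b0 by (simp add: distrib_left sum_distrib_left right_diff_distrib)
   qed simp
   also have "\<dots> = I a 1 h + (\<Sum>y\<in>Y. I y 1 h - I y (- 1) h)"
    using h(2) hY(1,2) unfolding I_def Ii_def by (simp add: Bochner_Integration.integral_sum)
   also have "\<dots> <= (G (Ur a) a + e2) + (\<Sum>y\<in>Y. 2 * e2)"
    by (intro add_mono h(3) sum_mono hY(3))
   also have "\<dots> = G (Ur a) a + e2 * (2 * real (card Y) + 1)" by (simp add: algebra_simps)
   also have "e2 * (2 * real (card Y) + 1) = e" unfolding e2_def by (simp add: add_nonneg_eq_0_iff)
   finally show "0 <= G (Ur a) a + e" .
  qed
  then have G0: "0 <= G (Ur a) a" by (rule field_le_epsilon)
  note ar = aX _ lim_right[OF aX]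
  let ?g = "%tau. - (Th (Wr a tau) * psi' tau)"
  have ti: "?g tau \<ge> 0" for tau
  proof -
   consider "tau \<notin> {t1..T'}" | "tau \<in> {s..s + dl}" | "s + dl <= tau"
    using t12 by force
   then show ?thesis
   proof cases
    case 2
    have "Wr a tau <= \<epsilon>" unfolding Wr_def by (rule trace_small[OF ar 2]) auto
    then show ?thesis using Th0 by simp
   next
    case 3
    then show ?thesis using late_neg[OF 3] Thnn by (simp add: mult_nonneg_nonpos)
   qed (use psi'0 in auto)
  qed
  show ?thesis
  proof (cases "s + dl <= t")
   case False
   then show ?thesis unfolding Wr_def using t by (intro trace_small[OF ar]) auto
  next
   case True
   have gi: "integ ?g" unfolding Wr_def using Gint[OF ar] by simp
   have gc: "continuous_on (cbox t1 T') ?g" unfolding Wr_def using Gcont[OF ar] by (auto intro!: continuous_intros)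
   have "(LINT tau|lborel. ?g tau) = 0"
   proof -
    have "(LINT tau|lborel. ?g tau) = - G (Ur a) a" unfolding G_def Wr_def by simp
    moreover have "0 <= (LINT tau|lborel. ?g tau)" using ti by (intro integral_nonneg_AE) auto
    ultimately show ?thesis using G0 by linarith
   qed
   moreover have "(?g has_integral (LINT tau|lborel. ?g tau)) UNIV" by (rule has_integral_integral_lborel[OF gi])
   ultimately have "(?g has_integral 0) UNIV" by simp
   moreover have "(%tau. if tau \<in> cbox t1 T' then ?g tau else 0) = ?g" using psi'0 by (auto simp: fun_eq_iff)
   ultimately have "(?g has_integral 0) (cbox t1 T')" using has_integral_restrict_UNIV[of "cbox t1 T'" ?g 0] by simp
   moreover have tt: "t \<in> cbox t1 T'" using True T' dl by (auto simp: t1_def)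
   moreover have "box t1 T' \<noteq> {}" using T' dl by (auto simp: t1_def)
   ultimately have "?g t = 0" using has_integral_0_cbox_imp_0[OF gc _ _ _ tt] ti by blast
   moreover have "psi' t < 0" using late[OF True] T'(1) by simp
   ultimately have "Th (Wr a t) = 0" by simp
   then show ?thesis by (auto simp: Th_def)
  qed
 qed
 then have "Wr a t <= 0 + e" if "e > 0" for e using that by simp
 then have "Wr a t <= 0" by (rule field_le_epsilon)
 then show ?thesis by (simp add: Wr_def c_def algebra_simps)
qed

end

section \<open>Symmetries\<close>

lemma reflect_lborel: "distr lborel borel (%z::real \<times> real. (- fst z, snd z)) = lborel"
proof (rule lborel_eqI[symmetric])
 fix lo hi :: "real \<times> real"
 assume le: "!!b. b \<in> Basis ==> lo \<bullet> b <= hi \<bullet> b"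
 let ?T = "%z::real \<times> real. (- fst z, snd z)"
 have T [measurable]: "?T \<in> BM"
  by (intro borel_measurable_continuous_onI continuous_intros)
 have "?T -` box lo hi = box (- fst hi, snd lo) (- fst lo, snd hi)"
  by (cases lo; cases hi) (auto simp: box_def Basis_prod_def)
 then have "emeasure (distr lborel borel ?T) (box lo hi) = emeasure lborel (box (- fst hi, snd lo) (- fst lo, snd hi))"
  using T by (simp add: emeasure_distr)
 also have "\<dots> = ennreal (\<Prod>b\<in>Basis. ((- fst lo, snd hi) - (- fst hi, snd lo)) \<bullet> b)"
 proof (rule emeasure_lborel_box)
  fix b :: "real \<times> real" assume "b \<in> Basis"
  then show "(- fst hi, snd lo) \<bullet> b <= (- fst lo, snd hi) \<bullet> b"
   using le[of "(1, 0)"] le[of "(0, 1)"] by (cases lo; cases hi) (auto simp: Basis_prod_def)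
 qed
 also have "(\<Prod>b\<in>Basis. ((- fst lo, snd hi) - (- fst hi, snd lo)) \<bullet> b) = (\<Prod>b\<in>Basis. (hi - lo) \<bullet> b)"
 proof (rule prod.cong)
  fix b :: "real \<times> real" assume "b \<in> Basis"
  then show "((- fst lo, snd hi) - (- fst hi, snd lo)) \<bullet> b = (hi - lo) \<bullet> b"
   by (cases lo; cases hi) (auto simp: Basis_prod_def)
 qed simp
 finally show "emeasure (distr lborel borel ?T) (box lo hi) = ennreal (\<Prod>b\<in>Basis. (hi - lo) \<bullet> b)" .
qed simp

lemma lborel_reflect_x:
 fixes g :: "real \<times> real => real"
 assumes "g \<in> BM"
 shows "integ (%z. g (- fst z, snd z)) \<longleftrightarrow> integ g"
  and "(LINT z|lborel. g (- fst z, snd z)) = (LINT z|lborel. g z)"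
proof -
 have T: "(%z::real \<times> real. (- fst z, snd z)) \<in> LM"
  by (simp, intro borel_measurable_continuous_onI continuous_intros)
 show "integ (%z. g (- fst z, snd z)) \<longleftrightarrow> integ g"
  using integrable_distr_eq[OF T assms] by (simp add: reflect_lborel)
 show "(LINT z|lborel. g (- fst z, snd z)) = (LINT z|lborel. g z)"
  using integral_distr[OF T assms] by (simp add: reflect_lborel)
qed

lemma AE_lborel_uminus:
 assumes "AE x in lborel. P (x::real)"
 shows "AE x in lborel. P (- x)"
proof -
 have "AE x in distr lborel borel uminus. P (x::real)" by (subst lborel_distr_uminus) (rule assms)
 then show ?thesis by (rule AE_distrD[rotated]) simp
qed

context entropy_flow begin

text \<open>Changing the sign of the solution reflects the flux function and exchanges the two kinds of singularities.\<close>

lemma flip_sign: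
 "entropy_flow (%xi. - H (- xi)) (%z. - v z) (%z. - U z) s T l r C Xn Xp (%y t. - Ur y t) (%y t. - Ul y t)"
proof
 show "cont (%xi. - H (- xi))"
  by (intro continuous_on_minus continuous_on_comp_UNIV[OF H_cont] continuous_on_id)
 show "\<bar>- H (- xi)\<bar> <= C" for xi using H_bound by simp
 show "set_integrable lborel ({l..r} \<times> {s..T}) (%z. - v z)"
  using v_int unfolding set_integrable_def by simp
 fix k K ze zex zet
 assume a: "compact K" "K \<subseteq> ({l<..<r} - (Xn \<union> Xp)) \<times> {s<..<T}" "C1_plane ze zex zet" "!!z. 0 <= ze z"
  "!!z. z \<notin> K ==> ze z = 0 \<and> zex z = 0 \<and> zet z = 0"
 have "0 <= (LINT z|lborel. \<bar>v z - (- k)\<bar> * zet z + sgn (v z - (- k)) * (H (v z) - H (- k)) * zex z)"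
  by (rule entropy[OF a(1) _ a(3,4,5)]) (use a(2) in \<open>simp_all add: Un_commute\<close>)
 also have "(%z. \<bar>v z - (- k)\<bar> * zet z + sgn (v z - (- k)) * (H (v z) - H (- k)) * zex z)
  = (%z. \<bar>- v z - k\<bar> * zet z + sgn (- v z - k) * (- H (- (- v z)) - - H (- k)) * zex z)"
 proof
  fix z
  have "- v z - k = - (v z - (- k))" by simp
  then have "\<bar>- v z - k\<bar> = \<bar>v z - (- k)\<bar>" "sgn (- v z - k) = - sgn (v z - (- k))"
   by (simp_all only: abs_minus_cancel sgn_minus)
  then show "\<bar>v z - (- k)\<bar> * zet z + sgn (v z - (- k)) * (H (v z) - H (- k)) * zex z
   = \<bar>- v z - k\<bar> * zet z + sgn (- v z - k) * (- H (- (- v z)) - - H (- k)) * zex z"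
   by (simp add: algebra_simps)
 qed
 finally show "0 <= (LINT z|lborel. \<bar>- v z - k\<bar> * zet z + sgn (- v z - k) * (- H (- (- v z)) - - H (- k)) * zex z)" .
next
 show "continuous_on (({l<..<r} - (Xn \<union> Xp)) \<times> {s..T}) (%z. - U z)"
  using U_cont by (simp add: Un_commute continuous_on_minus)
 show "\<bar>- U (x, t) - - U (x, t')\<bar> <= C * \<bar>t - t'\<bar>"
  if "x \<in> {l<..<r} - (Xn \<union> Xp)" "t \<in> {s..T}" "t' \<in> {s..T}" for x t t'
  using U_lip[of x t t'] that by (auto simp: abs_minus_commute)
 fix x y t t' :: real
 assume a: "x <= y" "t <= t'" "{x..y} \<subseteq> {l<..<r} - (Xn \<union> Xp)" "{t..t'} \<subseteq> {s<..<T}"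
 have a3: "{x..y} \<subseteq> {l<..<r} - (Xp \<union> Xn)" using a(3) by (simp add: Un_commute)
 have "integral {t..t'} (%tau. - U (y, tau) - - U (x, tau)) = integral {t..t'} (%tau. - (U (y, tau) - U (x, tau)))"
  by (simp add: algebra_simps)
 also have "\<dots> = - (LINT z:{x..y} \<times> {t..t'}|lborel. v z)"
  unfolding integral_neg U_x[OF a(1,2) a3 a(4)] ..
 finally show "integral {t..t'} (%tau. - U (y, tau) - - U (x, tau)) = (LINT z:{x..y} \<times> {t..t'}|lborel. - v z)"
  by (simp add: set_lebesgue_integral_def)
 have "integral {x..y} (%xi. - U (xi, t') - - U (xi, t)) = integral {x..y} (%xi. - (U (xi, t') - U (xi, t)))"
  by (simp add: algebra_simps)
 also have "\<dots> = (LINT z:{x..y} \<times> {t..t'}|lborel. H (v z))"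
  unfolding integral_neg U_t[OF a(1,2) a3 a(4)] by simp
 finally show "integral {x..y} (%xi. - U (xi, t') - - U (xi, t)) = - (LINT z:{x..y} \<times> {t..t'}|lborel. - H (- (- v z)))"
  by (simp add: set_lebesgue_integral_def)
next
 have e: "\<bar>- U (x, t) - - L t\<bar> = \<bar>U (x, t) - L t\<bar>" for x t and L :: "real => real" by (simp add: abs_minus_commute)
 show "trace_lim s T y 1 (%z. - U z) (%t. - Ur y t)" if "y \<in> Xn \<union> Xp" for y
  using lim_right[of y] that unfolding trace_lim_def e by blast
 show "trace_lim s T y (- 1) (%z. - U z) (%t. - Ul y t)" if "y \<in> Xn \<union> Xp" for y
  using lim_left[of y] that unfolding trace_lim_def e by blast
 fix y k sig :: real assume sig: "\<bar>sig\<bar> = 1"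
 have "(%z. sgn_minus (- v z - k) * (- H (- (- v z)) - - H (- k))) = (%z. sgn_plus (v z - (- k)) * (H (v z) - H (- k)))"
  by (auto simp: fun_eq_iff sgn_minus_def sgn_plus_def indicator_def)
 then show "y \<in> Xn ==> trace_nonpos s T y sig (%z. sgn_minus (- v z - k) * (- H (- (- v z)) - - H (- k)))"
  using compat_n[OF _ sig, of y "- k"] by simp
 have "(%z. sgn_plus (- v z - k) * (- H (- (- v z)) - - H (- k))) = (%z. sgn_minus (v z - (- k)) * (H (v z) - H (- k)))"
  by (auto simp: fun_eq_iff sgn_minus_def sgn_plus_def indicator_def)
 then show "y \<in> Xp ==> trace_nonpos s T y sig (%z. sgn_plus (- v z - k) * (- H (- (- v z)) - - H (- k)))"
  using compat_p[OF _ sig, of y "- k"] by simp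
qed (use sT X_fin X_disj X_in jump_p jump_n in auto)

lemma rect_reflect:
 fixes g :: "real \<times> real => real"
 assumes [measurable]: "g \<in> BM"
 shows "(LINT z:{x..y} \<times> {t..t'}|lborel. g (- fst z, snd z)) = (LINT z:{- y..- x} \<times> {t..t'}|lborel. g z)"
proof -
 have [measurable]: "{- y..- x} \<times> {t..t'} \<in> sets borel" by (intro borel_closed closed_Times) auto
 have "(LINT z|lborel. indicator ({- y..- x} \<times> {t..t'}) (- fst z, snd z) *\<^sub>R g (- fst z, snd z))
   = (LINT z|lborel. indicator ({- y..- x} \<times> {t..t'}) z *\<^sub>R g z)"
  by (rule lborel_reflect_x(2)[of "%z. indicator ({- y..- x} \<times> {t..t'}) z *\<^sub>R g z"]) measurable
 moreover have "indicator ({- y..- x} \<times> {t..t'}) (- fst z, snd z) = (indicator ({x..y} \<times> {t..t'}) z :: real)" for z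
  by (cases z) (auto simp: indicator_def)
 ultimately show ?thesis by (simp add: set_lebesgue_integral_def)
qed

text \<open>Reflecting space changes the sign of the flux. The potential changes its sign as well, so that its
 derivative remains the solution; upward jumps remain upward, but the two traces are exchanged.\<close>

lemma flip_space:
 "entropy_flow (%xi. - H xi) (%z. v (- fst z, snd z)) (%z. - U (- fst z, snd z)) s T (- r) (- l) C
   (uminus ` Xp) (uminus ` Xn) (%y t. - Ul (- y) t) (%y t. - Ur (- y) t)"
proof
 let ?R' = "{- r<..<- l} - (uminus ` Xp \<union> uminus ` Xn)"
 have Rx: "- x \<in> R" if "x \<in> ?R'" for x using that by (auto simp: image_iff)
 have cm: "continuous_on S (%z::real \<times> real. (- fst z, snd z))" for S by (intro continuous_intros)
 show "cont (%xi. - H xi)" using H_cont by (rule continuous_on_minus)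
 show "\<bar>- H xi\<bar> <= C" for xi using H_bound by simp
 show vm: "(%z. v (- fst z, snd z)) \<in> BM"
  by (rule measurable_compose[OF _ v_meas]) (intro borel_measurable_continuous_onI cm)
 have "integ (%z. indicator ({l..r} \<times> {s..T}) (- fst z, snd z) *\<^sub>R v (- fst z, snd z))"
 proof (subst lborel_reflect_x(1)[of "%z. indicator ({l..r} \<times> {s..T}) z *\<^sub>R v z"])
  show "integ (%z. indicator ({l..r} \<times> {s..T}) z *\<^sub>R v z)"
   using v_int unfolding set_integrable_def .
  then show "(%z. indicator ({l..r} \<times> {s..T}) z *\<^sub>R v z) \<in> BM"
   using borel_measurable_integrable by fastforce
 qed
 moreover have "indicator ({l..r} \<times> {s..T}) (- fst z, snd z) = (indicator ({- r..- l} \<times> {s..T}) z :: real)" for z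
  by (cases z) (auto simp: indicator_def)
 ultimately show "set_integrable lborel ({- r..- l} \<times> {s..T}) (%z. v (- fst z, snd z))"
  by (simp add: set_integrable_def)
 fix k K ze zex zet
 assume a: "compact K" "K \<subseteq> ?R' \<times> {s<..<T}" "C1_plane ze zex zet" "!!z. 0 <= ze z"
  "!!z. z \<notin> K ==> ze z = 0 \<and> zex z = 0 \<and> zet z = 0"
 have C1: "C1_plane (%z. ze (- fst z, snd z)) (%z. - zex (- fst z, snd z)) (%z. zet (- fst z, snd z))"
 proof -
  obtain zetx where z: "cont ze" "cont zex" "cont zet" "cont zetx"
   and d: "!!x t. ((%y. ze (y, t)) has_real_derivative zex (x, t)) (at x)"
    "!!x t. ((%s. ze (x, s)) has_real_derivative zet (x, t)) (at t)"
    "!!x t. ((%y. zet (y, t)) has_real_derivative zetx (x, t)) (at x)"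
   using a(3) unfolding C1_plane_def by blast
  have m: "(uminus has_real_derivative - 1) (at x)" for x :: real by (auto intro!: derivative_eq_intros)
  show ?thesis unfolding C1_plane_def fst_conv snd_conv
  proof (intro conjI exI[of _ "%z. - zetx (- fst z, snd z)"] allI)
   fix x t
   show "((%y. ze (- y, t)) has_real_derivative - zex (- x, t)) (at x)"
    using DERIV_chain2[OF d(1) m, of t x] by simp
   show "((%s. ze (- x, s)) has_real_derivative zet (- x, t)) (at t)" by (rule d(2))
   show "((%y. zet (- y, t)) has_real_derivative - zetx (- fst (x, t), snd (x, t))) (at x)"
    using DERIV_chain2[OF d(3) m, of t x] by simp
  qed (intro continuous_on_minus continuous_on_comp_UNIV[OF z(1)] continuous_on_comp_UNIV[OF z(2)]
    continuous_on_comp_UNIV[OF z(3)] continuous_on_comp_UNIV[OF z(4)] cm)+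
 qed
 define K' where "K' = (%z. (- fst z, snd z)) ` K"
 have K': "z \<in> K' \<longleftrightarrow> (- fst z, snd z) \<in> K" for z
 proof
  assume "(- fst z, snd z) \<in> K"
  then show "z \<in> K'" unfolding K'_def by (intro image_eqI[of _ _ "(- fst z, snd z)"]) auto
 qed (auto simp: K'_def)
 have "0 <= (LINT z|lborel. \<bar>v z - k\<bar> * zet (- fst z, snd z) + sgn (v z - k) * (H (v z) - H k) * (- zex (- fst z, snd z)))"
 proof (rule entropy[of K', OF _ _ C1])
  show "compact K'" unfolding K'_def using a(1) by (intro compact_continuous_image cm)
  show "K' \<subseteq> R \<times> {s<..<T}"
  proof
   fix z assume "z \<in> K'"
   then have "(- fst z, snd z) \<in> ?R' \<times> {s<..<T}" using a(2) K' by blast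
   then show "z \<in> R \<times> {s<..<T}" using Rx[of "- fst z"] by (cases z) auto
  qed
 qed (use a(4,5) K' in auto)
 also have "\<dots> = (LINT z|lborel. \<bar>v (- fst z, snd z) - k\<bar> * zet z + sgn (v (- fst z, snd z) - k) * (H (v (- fst z, snd z)) - H k) * (- zex z))"
 proof -
  have m [measurable]: "zet \<in> BM" "zex \<in> BM"
   using a(3) unfolding C1_plane_def by (auto intro: borel_measurable_continuous_onI)
  have [measurable]: "(%z. v (- fst z, snd z)) \<in> BM" by (rule vm)
  show ?thesis
   using lborel_reflect_x(2)[of "%z. \<bar>v (- fst z, snd z) - k\<bar> * zet z + sgn (v (- fst z, snd z) - k) * (H (v (- fst z, snd z)) - H k) * (- zex z)"]
   by simp
 qed
 also have "\<dots> = (LINT z|lborel. \<bar>v (- fst z, snd z) - k\<bar> * zet z + sgn (v (- fst z, snd z) - k) * (- H (v (- fst z, snd z)) - - H k) * zex z)"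
  by (rule LINT_cong) (auto simp: algebra_simps)
 finally show "0 <= (LINT z|lborel. \<bar>v (- fst z, snd z) - k\<bar> * zet z + sgn (v (- fst z, snd z) - k) * (- H (v (- fst z, snd z)) - - H k) * zex z)" .
next
 let ?R' = "{- r<..<- l} - (uminus ` Xp \<union> uminus ` Xn)"
 have Rx: "- x \<in> R" if "x \<in> ?R'" for x using that by (auto simp: image_iff)
 show "continuous_on (?R' \<times> {s..T}) (%z. - U (- fst z, snd z))"
  by (intro continuous_on_minus continuous_on_compose2[OF U_cont] continuous_intros) (use Rx in force)
 show "\<bar>- U (- fst (x, t), snd (x, t)) - - U (- fst (x, t'), snd (x, t'))\<bar> <= C * \<bar>t - t'\<bar>"
  if "x \<in> ?R'" "t \<in> {s..T}" "t' \<in> {s..T}" for x t t'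
  using U_lip[OF Rx[OF that(1)] that(2,3)] by (simp add: abs_minus_commute)
 fix x y t t' :: real
 assume a: "x <= y" "t <= t'" "{x..y} \<subseteq> ?R'" "{t..t'} \<subseteq> {s<..<T}"
 have sub: "{- y..- x} \<subseteq> R"
 proof
  fix z assume "z \<in> {- y..- x}"
  then have "- z \<in> {x..y}" by auto
  then have "- z \<in> ?R'" using a(3) by blast
  then show "z \<in> R" using Rx[of "- z"] by simp
 qed
 have le: "- y <= - x" using a by simp
 have "integral {t..t'} (%tau. - U (- fst (y, tau), snd (y, tau)) - - U (- fst (x, tau), snd (x, tau)))
   = integral {t..t'} (%tau. U (- x, tau) - U (- y, tau))" by simp
 also have "\<dots> = (LINT z:{- y..- x} \<times> {t..t'}|lborel. v z)" by (rule U_x[OF le a(2) sub a(4)])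
 finally show "integral {t..t'} (%tau. - U (- fst (y, tau), snd (y, tau)) - - U (- fst (x, tau), snd (x, tau)))
   = (LINT z:{x..y} \<times> {t..t'}|lborel. v (- fst z, snd z))"
  using rect_reflect[OF v_meas] by simp
 have "integral {x..y} (%xi. - U (- fst (xi, t'), snd (xi, t')) - - U (- fst (xi, t), snd (xi, t)))
   = integral {x..y} (%xi. - (U (- xi, t') - U (- xi, t)))" by (simp add: algebra_simps)
 also have "\<dots> = - integral {x..y} (%xi. U (- xi, t') - U (- xi, t))" by (rule integral_neg)
 also have "integral {x..y} (%xi. U (- xi, t') - U (- xi, t)) = integral {- y..- x} (%xi. U (xi, t') - U (xi, t))"
  using Henstock_Kurzweil_Integration.integral_reflect_real[of "- x" "- y" "%xi. U (xi, t') - U (xi, t)"] by simp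
 also have "\<dots> = - (LINT z:{- y..- x} \<times> {t..t'}|lborel. H (v z))" by (rule U_t[OF le a(2) sub a(4)])
 finally show "integral {x..y} (%xi. - U (- fst (xi, t'), snd (xi, t')) - - U (- fst (xi, t), snd (xi, t)))
   = - (LINT z:{x..y} \<times> {t..t'}|lborel. - H (v (- fst z, snd z)))"
  using rect_reflect[of "%z. H (v z)" x y t t'] by (simp add: set_lebesgue_integral_def)
next
 have e: "\<bar>- U (- fst (x, t), snd (x, t)) - - L t\<bar> = \<bar>U (- x, t) - L t\<bar>" for x t and L :: "real => real"
  by (simp add: abs_minus_commute)
 have tl: "trace_lim s T y (- sig) (%z. - U (- fst z, snd z)) (%t. - L t)" if L: "trace_lim s T (- y) sig U L" for y sig L
  unfolding trace_lim_def e
 proof (intro allI impI)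
  fix \<epsilon> :: real assume "\<epsilon> > 0"
  then obtain d where d: "d > 0" "!!x t. 0 < sig * (x - - y) ==> sig * (x - - y) < d ==> t \<in> {s..T} ==> \<bar>U (x, t) - L t\<bar> < \<epsilon>"
   using L unfolding trace_lim_def by meson
  show "\<exists>d>0. \<forall>x t. 0 < - sig * (x - y) --> - sig * (x - y) < d --> t \<in> {s..T} --> \<bar>U (- x, t) - L t\<bar> < \<epsilon>"
  proof (intro exI[of _ d] conjI allI impI)
   fix x t assume "0 < - sig * (x - y)" "- sig * (x - y) < d" "t \<in> {s..T}"
   then show "\<bar>U (- x, t) - L t\<bar> < \<epsilon>" by (intro d(2)) (simp_all add: algebra_simps)
  qed (rule d)
 qed
 show "trace_lim s T y 1 (%z. - U (- fst z, snd z)) (%t. - Ul (- y) t)" if "y \<in> uminus ` Xp \<union> uminus ` Xn" for y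
  using tl[of y "- 1" "Ul (- y)"] lim_left[of "- y"] that by auto
 show "trace_lim s T y (- 1) (%z. - U (- fst z, snd z)) (%t. - Ur (- y) t)" if "y \<in> uminus ` Xp \<union> uminus ` Xn" for y
  using tl[of y 1 "Ur (- y)"] lim_right[of "- y"] that by auto
 fix y k sig :: real assume sig: "\<bar>sig\<bar> = 1"
 have tn: "trace_nonpos s T y sig (%z. - g (- fst z, snd z))" if g: "trace_nonpos s T (- y) (- sig) g" for g
  unfolding trace_nonpos_def
 proof (intro allI impI, elim conjE)
  fix bta :: "real => real" and K and e :: real
  assume b: "cont bta" "\<forall>t. 0 <= bta t" "compact K" "K \<subseteq> {s<..<T}" "\<forall>t. t \<notin> K --> bta t = 0" "0 < e"
  then obtain d where d: "d > 0" "AE x in lborel. 0 < - sig * (x - - y) \<and> - sig * (x - - y) < d --> - sig * (LINT t|lborel. g (x, t) * bta t) <= e"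
   using g[unfolded trace_nonpos_def, rule_format, of bta K e] by auto
  have "AE x in lborel. 0 < sig * (x - y) \<and> sig * (x - y) < d --> sig * (LINT t|lborel. - g (- fst (x, t), snd (x, t)) * bta t) <= e"
   using AE_lborel_uminus[OF d(2)] by eventually_elim (simp add: algebra_simps)
  with d(1) show "\<exists>d>0. AE x in lborel. 0 < sig * (x - y) \<and> sig * (x - y) < d --> sig * (LINT t|lborel. - g (- fst (x, t), snd (x, t)) * bta t) <= e"
   by blast
 qed
 have sig': "\<bar>- sig\<bar> = 1" using sig by simp
 show "trace_nonpos s T y sig (%z. sgn_minus (v (- fst z, snd z) - k) * (- H (v (- fst z, snd z)) - - H k))" if "y \<in> uminus ` Xp"
  using tn[OF compat_p[OF _ sig', of "- y" k]] that by (auto simp: algebra_simps)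
 show "trace_nonpos s T y sig (%z. sgn_plus (v (- fst z, snd z) - k) * (- H (v (- fst z, snd z)) - - H k))" if "y \<in> uminus ` Xn"
  using tn[OF compat_n[OF _ sig', of "- y" k]] that by (auto simp: algebra_simps)
qed (use sT X_fin X_disj X_in jump_p jump_n in \<open>auto simp: image_iff\<close>)

text \<open>The comparison bounds the right trace from above and, applied to the reflected flow, the left trace from
 below. The assumptions on \<open>{b'..b}\<close> and \<open>{d..d'}\<close> separate potential and affine solution at
 the ends for the whole time, since both are Lipschitz in time.\<close>

lemma jump_decay:
 assumes a: "a \<in> Xp" and b: "a < b'" "b' < b" "b < r" "{b'..b} \<inter> X = {}"
  and d: "l < d" "d < d'" "d' < a" "{d..d'} \<inter> X = {}"
  and init_r: "!!x. x \<in> R ==> a < x ==> x <= b ==> U (x, s) <= Ur a s + A + k * (x - a)"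
  and init_l: "!!x. x \<in> R ==> d <= x ==> x < a ==> Ul a s - A - k' * (a - x) <= U (x, s)"
  and far_r: "!!x. x \<in> {b'..b} ==> U (x, s) + 2 * C * (T - s) <= Ur a s + A + k * (x - a)"
  and far_l: "!!x. x \<in> {d..d'} ==> Ul a s - A - k' * (a - x) <= U (x, s) - 2 * C * (T - s)"
  and t: "t \<in> {s..<T}"
 shows "Ur a t - Ul a t <= Ur a s - Ul a s + 2 * A - (H k - H k') * (t - s)"
proof -
 have Hb: "\<bar>H \<kappa> * (tau - s)\<bar> <= C * (T - s)" if "tau \<in> {s..T}" for \<kappa> tau
  unfolding abs_mult using H_bound that C_nonneg by (intro mult_mono) auto
 have Ub: "\<bar>U (x, tau) - U (x, s)\<bar> <= C * (T - s)" if "x \<in> R" "tau \<in> {s..T}" for x tau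
 proof -
  have "\<bar>U (x, tau) - U (x, s)\<bar> <= C * \<bar>tau - s\<bar>" using that sT by (intro U_lip) auto
  also have "\<dots> <= C * (T - s)" using that C_nonneg by (intro mult_left_mono) auto
  finally show ?thesis .
 qed
 have ar: "l < a" "a < r" using a X_in by auto
 have 1: "Ur a t <= Ur a s + A - H k * (t - s)"
 proof (rule comparison[OF a b init_r])
  fix x tau assume x: "x \<in> {b'..b}" and tau: "tau \<in> {s..T}"
  have "x \<notin> X" using b(4) x by blast
  then have "x \<in> R" using x b ar by auto
  then show "U (x, tau) <= Ur a s + A + k * (x - a) - H k * (tau - s)"
   using Ub[OF _ tau, of x] Hb[OF tau, of k] far_r[OF x] by (auto simp: abs_le_iff)
 qed (use t in auto)
 interpret F: entropy_flow "%xi. - H xi" "%z. v (- fst z, snd z)" "%z. - U (- fst z, snd z)" s T "- r" "- l" C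
   "uminus ` Xp" "uminus ` Xn" "%y t. - Ul (- y) t" "%y t. - Ur (- y) t"
  by (rule flip_space)
 have "- Ul (- (- a)) t <= (A - Ul a s) - - H k' * (t - s)"
 proof (rule F.comparison[where b'="- d'" and b="- d"])
  show "- a \<in> uminus ` Xp" using a by simp
  show "{- d'..- d} \<inter> (uminus ` Xp \<union> uminus ` Xn) = {}"
  proof -
   have "x \<notin> {- d'..- d}" if "- x \<in> Xp \<union> Xn" for x
   proof
    assume "x \<in> {- d'..- d}"
    then have "- x \<in> {d..d'}" by auto
    then show False using d(4) that by blast
   qed
   then show ?thesis by (auto simp del: atLeastAtMost_iff)
  qed
  fix x
  show "- U (- fst (x, s), snd (x, s)) <= A - Ul a s + k' * (x - - a)"
   if "x \<in> {- r<..<- l} - (uminus ` Xp \<union> uminus ` Xn)" "- a < x" "x <= - d"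
  proof -
   have "- x \<in> R" using that(1) by (auto simp: image_iff)
   from init_l[OF this] show ?thesis using that by (simp add: algebra_simps)
  qed
  fix tau assume x: "x \<in> {- d'..- d}" and tau: "tau \<in> {s..T}"
  have x': "- x \<in> {d..d'}" using x by auto
  then have "- x \<notin> X" using d(4) by blast
  then have "- x \<in> R" using x' d ar by auto
  from Ub[OF this tau] Hb[OF tau, of k'] far_l[OF x']
  show "- U (- fst (x, tau), snd (x, tau)) <= A - Ul a s + k' * (x - - a) - - H k' * (tau - s)"
   by (simp add: abs_le_iff algebra_simps)
 qed (use d t in auto)
 with 1 show ?thesis by (simp add: algebra_simps)
qed

end

section \<open>Flows with finitely many singularities\<close>

text \<open>One solution on the whole half plane, with waiting times \<open>tau\<close>. It is an entropy flow in
 every window in which no mass disappears at an intermediate time; only such windows are needed, because the estimates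
 can be started at the last of finitely many waiting times.\<close>

locale flow_family =
 fixes H :: "real => real" and v U :: "real \<times> real => real" and C :: real
  and Xp Xn :: "real set" and tau :: "real => ereal" and Ur Ul :: "real => real => real"
 assumes fin: "finite Xp" "finite Xn"
  and C0: "0 <= C"
  and lip: "!!x t t'. 0 <= t ==> 0 <= t' ==> \<bar>U (x, t) - U (x, t')\<bar> <= C * \<bar>t - t'\<bar>"
  and window: "!!s T l r. 0 <= s ==> s < T ==> l < r ==>
    (!!y. y \<in> Xp \<union> Xn ==> y \<in> {l<..<r} ==> ereal T <= tau y \<or> tau y <= ereal s) ==>
    entropy_flow H v U s T l r C {y \<in> Xp. y \<in> {l<..<r} \<and> ereal T <= tau y} {y \<in> Xn. y \<in> {l<..<r} \<and> ereal T <= tau y} Ur Ul"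
begin

lemma flip_family:
 "flow_family (%xi. - H (- xi)) (%z. - v z) (%z. - U z) C Xn Xp tau (%y t. - Ur y t) (%y t. - Ul y t)"
proof (rule flow_family.intro)
 show "\<bar>- U (x, t) - - U (x, t')\<bar> <= C * \<bar>t - t'\<bar>" if "0 <= t" "0 <= t'" for x t t'
  using lip[OF that, of x] by linarith
 fix s T l r :: real
 assume a: "0 <= s" "s < T" "l < r"
  "!!y. y \<in> Xn \<union> Xp ==> y \<in> {l<..<r} ==> ereal T <= tau y \<or> tau y <= ereal s"
 show "entropy_flow (%xi. - H (- xi)) (%z. - v z) (%z. - U z) s T l r C
   {y \<in> Xn. y \<in> {l<..<r} \<and> ereal T <= tau y} {y \<in> Xp. y \<in> {l<..<r} \<and> ereal T <= tau y} (%y t. - Ur y t) (%y t. - Ul y t)"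
  by (rule entropy_flow.flip_sign[OF window[OF a(1,2,3)]]) (use a(4) in blast)
qed (use fin C0 in auto)

text \<open>On a short interval around \<open>a\<close> the potential is within \<open>e / 2\<close> of its traces, and
 every slope beyond a threshold keeps the affine solutions away from it at the ends. Above any threshold there are
 slopes \<open>k\<close>, \<open>k'\<close> with \<open>H k \<ge> h1\<close> and \<open>H k' <= h2\<close>.\<close>

lemma waiting_rate:
 assumes a: "a \<in> Xp" and h1: "frequently (%xi. h1 <= H xi) at_top" and h2: "frequently (%xi. H xi <= h2) at_top"
  and t: "0 <= t" "ereal t < tau a"
 shows "(h1 - h2) * t <= Ur a 0 - Ul a 0"
proof -
 obtain T where T: "t < T" "ereal T < tau a" using ereal_dense2[OF t(2)] by auto
 have T0: "0 < T" using T t by simp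
 have "finite ((Xp \<union> Xn) - {a})" using fin by simp
 then obtain \<rho> where \<rho>: "\<rho> > 0" "!!y. y \<in> Xp \<union> Xn ==> y \<noteq> a ==> \<rho> <= \<bar>y - a\<bar>"
  using finite_set_avoid[of "(Xp \<union> Xn) - {a}" a] by (auto simp: dist_real_def abs_minus_commute)
 let ?P = "{y \<in> Xp. y \<in> {a - \<rho><..<a + \<rho>} \<and> ereal T <= tau y}" and ?N = "{y \<in> Xn. y \<in> {a - \<rho><..<a + \<rho>} \<and> ereal T <= tau y}"
 have only: "y = a" if "y \<in> Xp \<union> Xn" "y \<in> {a - \<rho><..<a + \<rho>}" for y
 proof (rule ccontr)
  assume "y \<noteq> a"
  then have "\<rho> <= \<bar>y - a\<bar>" using \<rho>(2) that(1) by blast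
  with that(2) show False by (auto simp: abs_if split: if_splits)
 qed
 interpret E: entropy_flow H v U 0 T "a - \<rho>" "a + \<rho>" C ?P ?N Ur Ul
 proof (rule window)
  show "ereal T <= tau y \<or> tau y <= ereal 0" if "y \<in> Xp \<union> Xn" "y \<in> {a - \<rho><..<a + \<rho>}" for y
   using only[OF that] T by (simp add: less_imp_le)
 qed (use T0 \<rho> in auto)
 have aP: "a \<in> ?P" using a \<rho> T by (simp add: less_imp_le)
 have Xa: "?P \<union> ?N \<subseteq> {a}" using only by blast
 have "(h1 - h2) * t <= Ur a 0 - Ul a 0 + e" if e: "e > 0" for e
 proof -
  have tr: "trace_lim 0 T a 1 U (Ur a)" "trace_lim 0 T a (- 1) U (Ul a)"
   using E.lim_right[of a] E.lim_left[of a] aP by auto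
  obtain m1 where m1: "m1 > 0" "!!x. 0 < x - a ==> x - a < m1 ==> \<bar>U (x, 0) - Ur a 0\<bar> < e / 2"
   using tr(1)[unfolded trace_lim_def, rule_format, of "e/2"] e T0 by auto
  obtain m2 where m2: "m2 > 0" "!!x. 0 < a - x ==> a - x < m2 ==> \<bar>U (x, 0) - Ul a 0\<bar> < e / 2"
   using tr(2)[unfolded trace_lim_def, rule_format, of "e/2"] e T0 by auto
  define m where "m = min (min m1 m2) \<rho> / 2"
  have m: "m > 0" "m < m1" "m < m2" "m < \<rho>"
  proof -
   show p: "m > 0" using m1 m2 \<rho> by (simp add: m_def)
   have "2 * m <= m1" "2 * m <= m2" "2 * m <= \<rho>" by (auto simp: m_def)
   with p show "m < m1" "m < m2" "m < \<rho>" by auto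
  qed
  \<comment> \<open>a slope of at least \<open>K0\<close> rises by \<open>2 C T\<close> over half of the interval, the most that
   the potential and the affine solution together can move until \<open>T\<close>\<close>
  define K0 where "K0 = 2 * C * T * 2 / m"
  have K00: "0 <= K0" using C0 T0 m by (simp add: K0_def)
  have K0m: "2 * C * T <= k * (m / 2)" if "K0 <= k" for k
  proof -
   have "K0 * (m / 2) <= k * (m / 2)" using that m by (intro mult_right_mono) auto
   moreover have "K0 * (m / 2) = 2 * C * T" using m by (simp add: K0_def)
   ultimately show ?thesis by simp
  qed
  obtain k where k: "K0 <= k" "h1 <= H k"
   using h1[unfolded frequently_def eventually_at_top_linorder] by (metis linorder_not_le order_refl)
  obtain k' where k': "K0 <= k'" "H k' <= h2"
   using h2[unfolded frequently_def eventually_at_top_linorder] by (metis linorder_not_le order_refl)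
  have "Ur a t - Ul a t <= Ur a 0 - Ul a 0 + 2 * (e / 2) - (H k - H k') * (t - 0)"
  proof (rule E.jump_decay[OF aP, where b'="a + m/2" and b="a + m" and d="a - m" and d'="a - m/2"])
   show "{a + m/2..a + m} \<inter> (?P \<union> ?N) = {}" "{a - m..a - m/2} \<inter> (?P \<union> ?N) = {}" using Xa m by auto
   show "U (x, 0) <= Ur a 0 + e / 2 + k * (x - a)" if "a < x" "x <= a + m" for x
   proof -
    have "\<bar>U (x, 0) - Ur a 0\<bar> < e / 2" using that m by (intro m1(2)) auto
    moreover have "0 <= k * (x - a)" using k K00 that by simp
    ultimately show ?thesis by linarith
   qed
   show "Ul a 0 - e / 2 - k' * (a - x) <= U (x, 0)" if "a - m <= x" "x < a" for x
   proof -
    have "\<bar>U (x, 0) - Ul a 0\<bar> < e / 2" using that m by (intro m2(2)) auto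
    moreover have "0 <= k' * (a - x)" using k' K00 that by simp
    ultimately show ?thesis by linarith
   qed
   show "U (x, 0) + 2 * C * (T - 0) <= Ur a 0 + e / 2 + k * (x - a)" if "x \<in> {a + m/2..a + m}" for x
   proof -
    have "\<bar>U (x, 0) - Ur a 0\<bar> < e / 2" using that m by (intro m1(2)) auto
    moreover have "k * (m / 2) <= k * (x - a)" using k K00 that by (intro mult_left_mono) auto
    ultimately show ?thesis using K0m[OF k(1)] unfolding diff_0_right by linarith
   qed
   show "Ul a 0 - e / 2 - k' * (a - x) <= U (x, 0) - 2 * C * (T - 0)" if "x \<in> {a - m..a - m/2}" for x
   proof -
    have "\<bar>U (x, 0) - Ul a 0\<bar> < e / 2" using that m by (intro m2(2)) auto
    moreover have "k' * (m / 2) <= k' * (a - x)" using k' K00 that by (intro mult_left_mono) auto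
    ultimately show ?thesis using K0m[OF k'(1)] unfolding diff_0_right by linarith
   qed
  qed (use m T t in auto)
  moreover have "Ul a t <= Ur a t" using T t by (intro E.jump_p[OF aP]) auto
  moreover have "(h1 - h2) * t <= (H k - H k') * t" using k k' t by (intro mult_right_mono) auto
  ultimately show ?thesis by simp
 qed
 then show ?thesis by (rule field_le_epsilon)
qed

lemma last_finite_time: "finite S ==> \<exists>s\<ge>0. \<forall>y\<in>S. tau y = \<infinity> \<or> tau y <= ereal s"
proof (induction S rule: finite_induct)
 case (insert y S)
 then obtain s where s: "s \<ge> 0" "\<forall>y\<in>S. tau y = \<infinity> \<or> tau y <= ereal s" by blast
 obtain s' where "tau y = \<infinity> \<or> tau y <= ereal s'" by (cases "tau y") auto
 then have "\<forall>y\<in>insert y S. tau y = \<infinity> \<or> tau y <= ereal (max s s')"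
  using s by (auto intro: order_trans)
 then show ?case using s(1) by (intro exI[of _ "max s s'"]) auto
qed auto

text \<open>Once the mortal singularities have vanished, an immortal positive one would lose mass at the
 rate \<open>H k - H k'\<close> for all slopes \<open>k\<close>, \<open>k'\<close> that exceed the growth rate of the potential.\<close>

lemma immortal_flux_constant:
 assumes a: "a \<in> Xp" "tau a = \<infinity>" and g: "!!x. \<bar>U (x, 0)\<bar> <= A + B * \<bar>x\<bar>" and B: "0 <= B"
  and k: "B < k" "B < k'"
 shows "H k <= H k'"
proof (rule ccontr)
 assume "\<not> H k <= H k'"
 then have \<Delta>: "H k - H k' > 0" by simp
 obtain s where s: "s \<ge> 0" "!!y. y \<in> Xp \<union> Xn ==> tau y = \<infinity> \<or> tau y <= ereal s"
  using last_finite_time[of "Xp \<union> Xn"] fin by blast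
 \<comment> \<open>\<open>t\<close> is chosen so late that the jump at \<open>a\<close> would have become negative\<close>
 define A1 where "A1 = A + C * s + B * \<bar>a\<bar> + \<bar>Ur a s\<bar> + \<bar>Ul a s\<bar>"
 define t where "t = s + (\<bar>Ur a s - Ul a s\<bar> + 2 * \<bar>A1\<bar> + 1) / (H k - H k')"
 have ts: "s < t" unfolding t_def using \<Delta> by (simp add: add_nonneg_pos)
 define T where "T = t + 1"
 have sT: "s < T" "t < T" using ts by (auto simp: T_def)
 obtain M where M: "!!y. y \<in> Xp \<union> Xn ==> \<bar>y\<bar> < M"
 proof -
  have "bounded (Xp \<union> Xn)" using fin by (intro finite_imp_bounded) simp
  then obtain M where "!!y. y \<in> Xp \<union> Xn ==> \<bar>y\<bar> <= M" unfolding bounded_iff by auto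
  then show ?thesis by (intro that[of "M + 1"]) (meson less_add_one order_le_less_trans)
 qed
 define L where "L = \<bar>M\<bar> + \<bar>a\<bar> + 1 + 2 * C * (T - s) / (k - B) + 2 * C * (T - s) / (k' - B)"
 have Lk: "2 * C * (T - s) <= (k - B) * y" "2 * C * (T - s) <= (k' - B) * y" if "L - \<bar>a\<bar> <= y" for y
 proof -
  have nn: "0 <= 2 * C * (T - s) / (k - B)" "0 <= 2 * C * (T - s) / (k' - B)" using C0 sT k by auto
  have "2 * C * (T - s) / (k - B) <= y" "2 * C * (T - s) / (k' - B) <= y" using that nn by (auto simp: L_def)
  then show "2 * C * (T - s) <= (k - B) * y" "2 * C * (T - s) <= (k' - B) * y"
   using k by (simp_all add: pos_divide_le_eq mult.commute)
 qed
 have Lb: "\<bar>M\<bar> + \<bar>a\<bar> < L"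
 proof -
  have nn: "0 <= 2 * C * (T - s) / (k - B)" "0 <= 2 * C * (T - s) / (k' - B)" using C0 sT k by auto
  then show ?thesis by (simp add: L_def)
 qed
 define b where "b = L + 1"
 let ?P = "{y \<in> Xp. y \<in> {- b - 1<..<b + 1} \<and> ereal T <= tau y}" and ?N = "{y \<in> Xn. y \<in> {- b - 1<..<b + 1} \<and> ereal T <= tau y}"
 interpret E: entropy_flow H v U s T "- b - 1" "b + 1" C ?P ?N Ur Ul
 proof (rule window)
  show "ereal T <= tau y \<or> tau y <= ereal s" if "y \<in> Xp \<union> Xn" for y
   using s(2)[OF that] by auto
 qed (use s sT Lb in \<open>auto simp: b_def\<close>)
 have aP: "a \<in> ?P" using a M[of a] Lb by (auto simp: b_def)
 have Us: "\<bar>U (x, s)\<bar> <= A + C * s + B * \<bar>a\<bar> + B * \<bar>x - a\<bar>" for x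
 proof -
  have "\<bar>U (x, s) - U (x, 0)\<bar> <= C * s" using lip[of s 0 x] s by simp
  moreover have "B * \<bar>x\<bar> <= B * (\<bar>a\<bar> + \<bar>x - a\<bar>)" using B by (intro mult_left_mono) auto
  ultimately show ?thesis using g[of x] by (simp add: algebra_simps)
 qed
 have sub: "{L..b} \<inter> (?P \<union> ?N) = {}" "{- b..- L} \<inter> (?P \<union> ?N) = {}"
  using M Lb by fastforce+
 have "Ur a t - Ul a t <= Ur a s - Ul a s + 2 * A1 - (H k - H k') * (t - s)"
 proof (rule E.jump_decay[OF aP, where b'=L and b=b and d="- b" and d'="- L"])
  show "U (x, s) <= Ur a s + A1 + k * (x - a)" if "a < x" for x
  proof -
   have "B * \<bar>x - a\<bar> <= k * (x - a)" using that k by (simp add: mult_right_mono)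
   then show ?thesis using Us[of x] unfolding A1_def by linarith
  qed
  show "Ul a s - A1 - k' * (a - x) <= U (x, s)" if "x < a" for x
  proof -
   have "B * \<bar>x - a\<bar> <= k' * (a - x)" using that k by (simp add: mult_right_mono)
   then show ?thesis using Us[of x] unfolding A1_def by linarith
  qed
  show "U (x, s) + 2 * C * (T - s) <= Ur a s + A1 + k * (x - a)" if x: "x \<in> {L..b}" for x
  proof -
   have "\<bar>x - a\<bar> = x - a" using x Lb by auto
   then have "B * \<bar>x - a\<bar> + (k - B) * (x - a) = k * (x - a)" by (simp add: algebra_simps)
   moreover have "2 * C * (T - s) <= (k - B) * (x - a)" using x by (intro Lk(1)) auto
   ultimately show ?thesis using Us[of x] unfolding A1_def by linarith
  qed
  show "Ul a s - A1 - k' * (a - x) <= U (x, s) - 2 * C * (T - s)" if x: "x \<in> {- b..- L}" for x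
  proof -
   have "\<bar>x - a\<bar> = a - x" using x Lb by auto
   then have "B * \<bar>x - a\<bar> + (k' - B) * (a - x) = k' * (a - x)" by (simp add: algebra_simps)
   moreover have "2 * C * (T - s) <= (k' - B) * (a - x)" using x by (intro Lk(2)) auto
   ultimately show ?thesis using Us[of x] unfolding A1_def by linarith
  qed
 qed (use Lb ts sT sub in \<open>auto simp: b_def\<close>)
 moreover have "Ul a t <= Ur a t" using ts sT by (intro E.jump_p[OF aP]) auto
 moreover have "(H k - H k') * (t - s) = \<bar>Ur a s - Ul a s\<bar> + 2 * \<bar>A1\<bar> + 1" using \<Delta> by (simp add: t_def)
 ultimately show False by linarith
qed

end

section \<open>Signed Radon measures on the line\<close>

abbreviation radon :: "real measure => bool" where "radon \<equiv> radon_on UNIV"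

lemma radonD:
 assumes "radon M"
 shows "sets M = sets borel" "space M = UNIV" "compact K ==> emeasure M K < \<infinity>"
proof -
 show s: "sets M = sets borel" using assms unfolding radon_on_def by (simp add: sets_restrict_space)
 show "space M = UNIV" using sets_eq_imp_space_eq[OF s] by simp
 show "compact K ==> emeasure M K < \<infinity>" using assms unfolding radon_on_def by simp
qed

lemma radonI:
 assumes "sets M = sets borel" "!!K. compact K ==> emeasure M K < \<infinity>"
 shows "radon M"
 using assms unfolding radon_on_def by (simp add: sets_restrict_space)

lemma radon_bounded_finite:
 assumes "radon M" shows "emeasure M (A \<inter> {- real n..real n}) \<noteq> \<infinity>"
proof -
 have "emeasure M (A \<inter> {- real n..real n}) <= emeasure M {- real n..real n}"
  using radonD[OF assms] by (intro emeasure_mono) auto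
 also have "\<dots> < \<infinity>" by (rule radonD(3)[OF assms]) simp
 finally show ?thesis by simp
qed

lemma UN_Icc_real: "(\<Union>n. {- real n..real n}) = UNIV"
proof -
 have "\<exists>n. x \<in> {- real n..real n}" for x
 proof -
  obtain n where "\<bar>x\<bar> <= real n" using real_arch_simple by blast
  then show ?thesis by (intro exI[of _ n]) auto
 qed
 then show ?thesis by blast
qed

lemma radon_sigma_finite: assumes "radon M" shows "sigma_finite_measure M"
proof
 show "\<exists>A. countable A \<and> A \<subseteq> sets M \<and> \<Union> A = space M \<and> (\<forall>a\<in>A. emeasure M a \<noteq> \<infinity>)"
 proof (intro exI[of _ "range (%n. {- real n..real n})"] conjI)
  show "\<Union> (range (%n. {- real n..real n})) = space M"
   using radonD(2)[OF assms] UN_Icc_real by simp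
  show "\<forall>a\<in>range (%n. {- real n..real n}). emeasure M a \<noteq> \<infinity>"
   using radon_bounded_finite[OF assms, of UNIV] by auto
 qed (use radonD[OF assms] in auto)
qed

text \<open>A set function that is a difference of Radon measures is determined on bounded Borel sets by its values on
 compact sets.\<close>

lemma radon_diff_determined:
 fixes n :: nat
 assumes r: "radon P" "radon N" "radon P'" "radon N'"
  and eq: "!!K. compact K ==> measure P K - measure N K = measure P' K - measure N' K"
  and A: "A \<in> sets borel"
 defines "I \<equiv> {- real n..real n}"
 shows "measure P (A \<inter> I) - measure N (A \<inter> I) = measure P' (A \<inter> I) - measure N' (A \<inter> I)"
 using A
proof (induction rule: borel_set_induct)
 case empty then show ?case by simp
next
 case (interval a b)
 then show ?case by (intro eq) (simp add: I_def Int_atLeastAtMost)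
next
 case (compl A)
 have d: "measure M (- A \<inter> I) = measure M I - measure M (A \<inter> I)" if M: "radon M" for M
 proof -
  have "- A \<inter> I = I - A \<inter> I" by auto
  then show ?thesis
   using radon_bounded_finite[OF M, of UNIV n] radonD[OF M] compl(1)
   by (simp add: I_def) (subst measure_Diff, auto)
 qed
 have "measure P I - measure N I = measure P' I - measure N' I" by (rule eq) (simp add: I_def)
 then show ?case using compl by (simp add: d r)
next
 case (union f)
 have s: "(%i. measure M (f i \<inter> I)) sums measure M ((\<Union>i. f i) \<inter> I)" if M: "radon M" for M
 proof -
  have "(%i. measure M (f i \<inter> I)) sums measure M (\<Union>i. f i \<inter> I)"
  proof (rule measure_UNION)
   show "range (%i. f i \<inter> I) \<subseteq> sets M" using union(2) radonD[OF M] by (auto simp: I_def)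
   show "disjoint_family (%i. f i \<inter> I)" using union(1) by (auto simp: disjoint_family_on_def)
   show "emeasure M (\<Union>i. f i \<inter> I) \<noteq> \<infinity>"
    using radon_bounded_finite[OF M, of "\<Union>i. f i" n] by (simp add: I_def Int_UN_distrib2)
  qed
  then show ?thesis by (simp add: Int_UN_distrib2)
 qed
 have "(%i. measure P (f i \<inter> I) - measure N (f i \<inter> I)) sums (measure P ((\<Union>i. f i) \<inter> I) - measure N ((\<Union>i. f i) \<inter> I))"
  by (intro sums_diff s r)
 moreover have "(%i. measure P (f i \<inter> I) - measure N (f i \<inter> I)) sums (measure P' ((\<Union>i. f i) \<inter> I) - measure N' ((\<Union>i. f i) \<inter> I))"
  unfolding union(3) by (intro sums_diff s r)
 ultimately show ?case by (rule sums_unique2)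
qed

lemma radon_eqI:
 assumes r: "radon P" "radon P'" and eq: "!!a b n. measure P ({a..b} \<inter> {- real n..real n}) = measure P' ({a..b} \<inter> {- real n..real n})"
 shows "P = P'"
proof (rule measure_eqI_generator_eq[where E="range (%(a, b). {a..b::real})" and \<Omega>=UNIV and A="%n. {- real n..real n}"])
 have "sets borel = sigma_sets UNIV (range (%(a, b). {a..b::real}))" by (simp add: borel_eq_atLeastAtMost)
 then show "sets P = sigma_sets UNIV (range (%(a, b). {a..b::real}))" "sets P' = sigma_sets UNIV (range (%(a, b). {a..b::real}))"
  using radonD r by metis+
 show "Int_stable (range (%(a, b). {a..b::real}))" by (auto simp: Int_stable_def)
 show "(\<Union>n. {- real n..real n}) = UNIV"
  by (rule UN_Icc_real)
 show "emeasure P {- real i..real i} \<noteq> \<infinity>" for i using radonD(3)[OF r(1), of "{- real i..real i}"] by simp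
 fix X :: "real set" assume "X \<in> range (%(a, b). {a..b})"
 then obtain a b where X: "X = {a..b}" by auto
 obtain n where n: "\<bar>a\<bar> + \<bar>b\<bar> <= real n" using real_arch_simple by blast
 have I: "{a..b} \<inter> {- real n..real n} = {a..b}" using n by auto
 have "measure P {a..b} = measure P' {a..b}" using eq[of a b n] unfolding I .
 then show "emeasure P X = emeasure P' X"
  using radonD(3)[OF r(1), of "{a..b}"] radonD(3)[OF r(2), of "{a..b}"]
  by (simp add: X emeasure_eq_ennreal_measure)
qed auto

lemma jordan_le:
 fixes n :: nat
 assumes j: "jordan_decomp_on UNIV \<mu> P N" "jordan_decomp_on UNIV \<mu> P' N'" and B: "B \<in> sets borel"
 defines "I \<equiv> {- real n..real n}"
 shows "measure P (B \<inter> I) <= measure P' (B \<inter> I)"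
proof -
 have r: "radon P" "radon N" "radon P'" "radon N'" using j unfolding jordan_decomp_on_def by auto
 obtain A where A: "A \<in> sets P" "emeasure P A = 0" "emeasure N (UNIV - A) = 0"
  using j(1) unfolding jordan_decomp_on_def by blast
 have eq: "measure P K - measure N K = measure P' K - measure N' K" if "compact K" for K
  using j that unfolding jordan_decomp_on_def by auto
 have Ab: "A \<in> sets borel" using A radonD[OF r(1)] by simp
 have Im: "I \<in> sets borel" by (simp add: I_def)
 have "emeasure P (B \<inter> I \<inter> A) <= emeasure P A" using A by (intro emeasure_mono) auto
 then have "measure P (B \<inter> I \<inter> A) = 0" using A by (simp add: measure_def)
 moreover have "measure P (B \<inter> I) = measure P (B \<inter> I \<inter> A) + measure P (B \<inter> I - A)"
 proof -
  have "measure P ((B \<inter> I \<inter> A) \<union> (B \<inter> I - A)) = measure P (B \<inter> I \<inter> A) + measure P (B \<inter> I - A)"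
  proof (rule measure_Union)
   have 1: "emeasure P C \<noteq> \<infinity>" if "C \<subseteq> I" for C
    using radon_bounded_finite[OF r(1), of C n] that by (simp add: I_def Int_absorb2)
   show "emeasure P (B \<inter> I \<inter> A) \<noteq> \<infinity>" "emeasure P (B \<inter> I - A) \<noteq> \<infinity>" by (intro 1; auto)+
  qed (use B Ab Im radonD[OF r(1)] in auto)
  moreover have "(B \<inter> I \<inter> A) \<union> (B \<inter> I - A) = B \<inter> I" by auto
  ultimately show ?thesis by simp
 qed
 moreover have "measure P (B \<inter> I - A) = measure P' (B \<inter> I - A) - measure N' (B \<inter> I - A)"
 proof -
  have "emeasure N (B \<inter> I - A) <= emeasure N (UNIV - A)"
   using Ab radonD[OF r(2)] by (intro emeasure_mono) auto
  then have "measure N (B \<inter> I - A) = 0" using A by (simp add: measure_def)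
  moreover have "B \<inter> I - A = (B - A) \<inter> I" by auto
  ultimately show ?thesis
   using radon_diff_determined[OF r eq, of "B - A" n] B Ab by (simp add: I_def)
 qed
 moreover have "measure P' (B \<inter> I - A) <= measure P' (B \<inter> I)"
  using B Im Ab radonD[OF r(3)] radon_bounded_finite[OF r(3), of B n]
  by (intro measure_mono_fmeasurable) (auto simp: fmeasurable_def I_def less_top)
 ultimately show ?thesis using measure_nonneg[of N' "B \<inter> I - A"] by linarith
qed

lemma jordan_uminus:
 fixes \<mu> :: "real set => real"
 shows "jordan_decomp_on UNIV \<mu> P N ==> jordan_decomp_on UNIV (%K. - \<mu> K) N P"
 unfolding jordan_decomp_on_def
proof (elim conjE bexE, intro conjI)
 fix A assume "radon P" "radon N" "A \<in> sets P" "emeasure P A = 0" "emeasure N (UNIV - A) = 0"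
 then show "\<exists>A\<in>sets N. emeasure N A = 0 \<and> emeasure P (UNIV - A) = 0"
  using radonD by (intro bexI[of _ "UNIV - A"]) (auto simp: double_diff)
qed auto

lemma jordan_unique:
 fixes \<mu> :: "real set => real"
 assumes "jordan_decomp_on UNIV \<mu> P N" "jordan_decomp_on UNIV \<mu> P' N'"
 shows "P = P'" "N = N'"
proof -
 have *: "P = P'" if "jordan_decomp_on UNIV \<mu> P N" "jordan_decomp_on UNIV \<mu> P' N'" for \<mu> and P N P' N' :: "real measure"
 proof (rule radon_eqI)
  show "radon P" "radon P'" using that unfolding jordan_decomp_on_def by auto
  show "measure P ({a..b} \<inter> {- real n..real n}) = measure P' ({a..b} \<inter> {- real n..real n})" for a b n
   using jordan_le[OF that, of "{a..b}" n] jordan_le[OF that(2,1), of "{a..b}" n] by simp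
 qed
 show "P = P'" by (rule *[OF assms])
 show "N = N'" by (rule *[OF jordan_uminus[OF assms(1)] jordan_uminus[OF assms(2)]])
qed

text \<open>Relative to a density the Jordan decomposition is pointwise, so that pairings and variations become
 integrals. The set function is only constrained on compact sets, where signed Radon measures are defined.\<close>

definition has_dens :: "(real set => real) => real measure => (real => real) => bool" where
 "has_dens \<mu> m g \<longleftrightarrow> radon m \<and> g \<in> BM \<and>
   (\<forall>K. compact K --> set_integrable m K g \<and> \<mu> K = (LINT x:K|m. g x))"

lemma has_densD:
 assumes "has_dens \<mu> m g"
 shows "radon m" "g \<in> BM" "compact K ==> set_integrable m K g" "compact K ==> \<mu> K = (LINT x:K|m. g x)"
 using assms unfolding has_dens_def by auto

lemma measurable_radon: "radon m ==> borel_measurable m = BM"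
 by (rule measurable_cong_sets) (auto simp: radonD)

lemma signed_radon_iff_dens: "signed_radon \<mu> \<longleftrightarrow> (\<exists>m g. has_dens \<mu> m g)"
 unfolding signed_radon_on_def has_dens_def using measurable_radon by auto

lemma density_measure_compact:
 assumes d: "has_dens \<mu> m g" and K: "compact K"
 shows "measure (density m (%x. ennreal (g x))) K = (LINT x:K|m. max 0 (g x))"
  and "emeasure (density m (%x. ennreal (g x))) K < \<infinity>"
  and "set_integrable m K (%x. max 0 (g x))"
proof -
 note D = has_densD[OF d]
 have gm: "g \<in> borel_measurable m" using D(2) unfolding measurable_radon[OF D(1)] .
 have Km: "K \<in> sets m" using K D(1) by (simp add: radonD compact_imp_closed borel_closed)
 have "integrable m (%x. max 0 (indicator K x *\<^sub>R g x))"
  using D(3)[OF K] unfolding set_integrable_def by (intro integrable_max) auto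
 moreover have "(%x. max 0 (indicator K x *\<^sub>R g x)) = (%x. indicator K x *\<^sub>R max 0 (g x))"
  by (auto simp: indicator_def fun_eq_iff)
 ultimately show i: "set_integrable m K (%x. max 0 (g x))" unfolding set_integrable_def by simp
 have "emeasure (density m (%x. ennreal (g x))) K = (\<integral>\<^sup>+x. ennreal (g x) * indicator K x \<partial>m)"
  using gm Km by (intro emeasure_density) auto
 also have "\<dots> = (\<integral>\<^sup>+x. ennreal (indicator K x *\<^sub>R max 0 (g x)) \<partial>m)"
  by (intro nn_integral_cong) (auto simp: indicator_def max_def ennreal_neg)
 also have "\<dots> = ennreal (LINT x:K|m. max 0 (g x))"
  unfolding set_lebesgue_integral_def using i unfolding set_integrable_def
  by (intro nn_integral_eq_integral) (auto intro!: AE_I2)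
 finally have e: "emeasure (density m (%x. ennreal (g x))) K = ennreal (LINT x:K|m. max 0 (g x))" .
 then show "emeasure (density m (%x. ennreal (g x))) K < \<infinity>" by simp
 have "0 <= (LINT x:K|m. max 0 (g x))" unfolding set_lebesgue_integral_def by (intro integral_nonneg_AE) auto
 with e show "measure (density m (%x. ennreal (g x))) K = (LINT x:K|m. max 0 (g x))" by (simp add: measure_def)
qed

lemma has_dens_uminus: "has_dens \<mu> m g ==> has_dens (%K. - \<mu> K) m (%x. - g x)"
 unfolding has_dens_def set_integrable_def set_lebesgue_integral_def by simp

text \<open>The positive and the negative part of the density are carried by the disjoint sets where the density is
 positive and where it is not.\<close>

lemma has_dens_jordan:
 assumes d: "has_dens \<mu> m g"
 shows "jordan_decomp_on UNIV \<mu> (density m (%x. ennreal (g x))) (density m (%x. ennreal (- g x)))"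
 unfolding jordan_decomp_on_def
proof (intro conjI allI impI)
 note D = has_densD[OF d] and d' = has_dens_uminus[OF d]
 have gm: "g \<in> borel_measurable m" using D(2) unfolding measurable_radon[OF D(1)] .
 show "radon (density m (%x. ennreal (g x)))" "radon (density m (%x. ennreal (- g x)))"
  using density_measure_compact(2)[OF d] density_measure_compact(2)[OF d'] D(1) by (auto intro!: radonI simp: radonD)
 have s: "{x. g x <= 0} \<in> sets m"
  using D(1,2) by (simp add: radonD) measurable
 show "\<exists>A\<in>sets (density m (%x. ennreal (g x))). emeasure (density m (%x. ennreal (g x))) A = 0 \<and>
   emeasure (density m (%x. ennreal (- g x))) (UNIV - A) = 0"
 proof (intro bexI conjI)
  show "{x. g x <= 0} \<in> sets (density m (%x. ennreal (g x)))" using s by simp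
  have "emeasure (density m (%x. ennreal (g x))) {x. g x <= 0} = (\<integral>\<^sup>+x. ennreal (g x) * indicator {x. g x <= 0} x \<partial>m)"
   using gm s by (intro emeasure_density) auto
  also have "\<dots> = (\<integral>\<^sup>+x. 0 \<partial>m)" by (intro nn_integral_cong) (auto simp: indicator_def ennreal_neg)
  finally show "emeasure (density m (%x. ennreal (g x))) {x. g x <= 0} = 0" by simp
  have s': "UNIV - {x. g x <= 0} \<in> sets m" using s D(1) by (metis radonD(2) sets.compl_sets)
  have "emeasure (density m (%x. ennreal (- g x))) (UNIV - {x. g x <= 0}) = (\<integral>\<^sup>+x. ennreal (- g x) * indicator (UNIV - {x. g x <= 0}) x \<partial>m)"
   using gm s' by (intro emeasure_density) auto
  also have "\<dots> = (\<integral>\<^sup>+x. 0 \<partial>m)" by (intro nn_integral_cong) (auto simp: indicator_def ennreal_neg)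
  finally show "emeasure (density m (%x. ennreal (- g x))) (UNIV - {x. g x <= 0}) = 0" by simp
 qed
 fix K :: "real set" assume "compact K \<and> K \<subseteq> UNIV"
 then have K: "compact K" by simp
 have "(LINT x:K|m. g x) = (LINT x:K|m. max 0 (g x) - max 0 (- g x))"
  by (rule arg_cong[where f="set_lebesgue_integral m K"]) (auto simp: max_def)
 also have "\<dots> = (LINT x:K|m. max 0 (g x)) - (LINT x:K|m. max 0 (- g x))"
  by (rule set_integral_diff(2)[OF density_measure_compact(3)[OF d K] density_measure_compact(3)[OF d' K]])
 finally show "\<mu> K = measure (density m (%x. ennreal (g x))) K - measure (density m (%x. ennreal (- g x))) K"
  using D(4)[OF K] density_measure_compact(1)[OF d K] density_measure_compact(1)[OF d' K] by simp
qed

lemma pos_neg_part_dens: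
 assumes d: "has_dens \<mu> m g"
 shows "pos_part_on UNIV \<mu> = density m (%x. ennreal (g x))" "neg_part_on UNIV \<mu> = density m (%x. ennreal (- g x))"
proof -
 note j = has_dens_jordan[OF d]
 show "pos_part_on UNIV \<mu> = density m (%x. ennreal (g x))"
  unfolding pos_part_on_def
 proof (rule the_equality)
  show "P = density m (%x. ennreal (g x))" if "\<exists>N. jordan_decomp_on UNIV \<mu> P N" for P
   using that by (elim exE) (rule jordan_unique(1)[OF _ j])
 qed (rule exI, rule j)
 show "neg_part_on UNIV \<mu> = density m (%x. ennreal (- g x))"
  unfolding neg_part_on_def
 proof (rule the_equality)
  show "N = density m (%x. ennreal (- g x))" if "\<exists>P. jordan_decomp_on UNIV \<mu> P N" for N
   using that by (elim exE) (rule jordan_unique(2)[OF _ j])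
 qed (rule exI, rule j)
qed

definition bdd_supp :: "real set => real => (real => real) => bool" where
 "bdd_supp K M ph \<longleftrightarrow> compact K \<and> ph \<in> BM \<and> (\<forall>x. \<bar>ph x\<bar> <= M) \<and> (\<forall>x. x \<notin> K --> ph x = 0)"

lemma bdd_suppD:
 assumes "bdd_supp K M ph"
 shows "compact K" "ph \<in> BM" "\<bar>ph x\<bar> <= M" "x \<notin> K ==> ph x = 0" "0 <= M"
 using assms unfolding bdd_supp_def by (auto intro: order_trans[OF abs_ge_zero])

lemma dens_integrable:
 assumes d: "has_dens \<mu> m g" and ph: "bdd_supp K M ph"
 shows "integrable m (%x. g x * ph x)"
proof -
 note D = has_densD[OF d] and P = bdd_suppD[OF ph]
 have m [measurable]: "g \<in> borel_measurable m" "ph \<in> borel_measurable m" using D(2) P(2) unfolding measurable_radon[OF D(1)] by auto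
 show ?thesis
 proof (rule Bochner_Integration.integrable_bound[where f="%x. M * (indicator K x *\<^sub>R g x)"])
  show "integrable m (%x. M * (indicator K x *\<^sub>R g x))"
   using D(3)[OF P(1)] unfolding set_integrable_def by simp
  show "AE x in m. norm (g x * ph x) <= norm (M * (indicator K x *\<^sub>R g x))"
  proof (rule AE_I2)
   fix x
   show "norm (g x * ph x) <= norm (M * (indicator K x *\<^sub>R g x))"
    using P(3)[of x] P(4)[of x] P(5) mult_left_mono[OF P(3)[of x], of "\<bar>g x\<bar>"]
    by (cases "x \<in> K") (auto simp: abs_mult mult.commute)
  qed
 qed measurable
qed

lemma has_dens_abs: "has_dens \<mu> m g ==> has_dens (%K. LINT x:K|m. \<bar>g x\<bar>) m (%x. \<bar>g x\<bar>)"
 unfolding has_dens_def by (auto intro: set_integrable_abs)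

lemma integral_pos_part:
 assumes d: "has_dens \<mu> m g" and ph: "bdd_supp K M ph"
 shows "(LINT x|density m (%x. ennreal (g x)). ph x) = (LINT x|m. max 0 (g x) * ph x)"
  and "integrable m (%x. max 0 (g x) * ph x)"
proof -
 note D = has_densD[OF d] and P = bdd_suppD[OF ph]
 have m: "g \<in> borel_measurable m" "ph \<in> borel_measurable m" using D(2) P(2) unfolding measurable_radon[OF D(1)] by auto
 have "density m (%x. ennreal (g x)) = density m (%x. ennreal (max 0 (g x)))"
  by (rule arg_cong[where f="density m"]) (auto simp: max_def ennreal_neg)
 then show "(LINT x|density m (%x. ennreal (g x)). ph x) = (LINT x|m. max 0 (g x) * ph x)"
  using m by (simp add: integral_density)
 have "integrable m (%x. (g x * ph x + \<bar>g x\<bar> * ph x) / 2)"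
  using dens_integrable[OF d ph] dens_integrable[OF has_dens_abs[OF d] ph] by simp
 moreover have "(%x. (g x * ph x + \<bar>g x\<bar> * ph x) / 2) = (%x. max 0 (g x) * ph x)"
  by (auto simp: max_def abs_if fun_eq_iff)
 ultimately show "integrable m (%x. max 0 (g x) * ph x)" by simp
qed

lemma pairing_dens:
 assumes d: "has_dens \<mu> m g" and ph: "bdd_supp K M ph"
 shows "pairing \<mu> ph = (LINT x|m. g x * ph x)" "abs_pairing \<mu> ph = (LINT x|m. \<bar>g x\<bar> * ph x)"
proof -
 note i = integral_pos_part[OF d ph] integral_pos_part[OF has_dens_uminus[OF d] ph]
 have "pairing \<mu> ph = (LINT x|m. max 0 (g x) * ph x - max 0 (- g x) * ph x)"
  unfolding pairing_def pos_neg_part_dens[OF d] using i by simp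
 also have "(%x. max 0 (g x) * ph x - max 0 (- g x) * ph x) = (%x. g x * ph x)" by (auto simp: max_def fun_eq_iff)
 finally show "pairing \<mu> ph = (LINT x|m. g x * ph x)" .
 have "abs_pairing \<mu> ph = (LINT x|m. max 0 (g x) * ph x + max 0 (- g x) * ph x)"
  unfolding abs_pairing_def pos_neg_part_dens[OF d] using i by simp
 also have "(%x. max 0 (g x) * ph x + max 0 (- g x) * ph x) = (%x. \<bar>g x\<bar> * ph x)" by (auto simp: max_def fun_eq_iff)
 finally show "abs_pairing \<mu> ph = (LINT x|m. \<bar>g x\<bar> * ph x)" .
qed

lemma var_norm_dens:
 assumes d: "has_dens \<mu> m g" and K: "compact K"
 shows "var_norm K \<mu> = (LINT x:K|m. \<bar>g x\<bar>)"
proof -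
 note c = density_measure_compact[OF d K] density_measure_compact[OF has_dens_uminus[OF d] K]
 have "var_norm K \<mu> = (LINT x:K|m. max 0 (g x) + max 0 (- g x))"
  unfolding var_norm_def pos_neg_part_dens[OF d] using c set_integral_add(2)[OF c(3) c(6)] by simp
 also have "(%x. max 0 (g x) + max 0 (- g x)) = (%x. \<bar>g x\<bar>)" by (auto simp: max_def fun_eq_iff)
 finally show ?thesis .
qed

lemma has_dens_diff:
 assumes "has_dens \<mu> m g" "has_dens \<nu> m h"
 shows "has_dens (%K. \<mu> K - \<nu> K) m (%x. g x - h x)"
 unfolding has_dens_def
proof (intro conjI allI impI)
 show "radon m" "(%x. g x - h x) \<in> BM" using has_densD[OF assms(1)] has_densD[OF assms(2)] by auto
 fix K :: "real set" assume K: "compact K"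
 show "set_integrable m K (%x. g x - h x)" "\<mu> K - \<nu> K = (LINT x:K|m. g x - h x)"
  using has_densD(3,4)[OF assms(1) K] has_densD(3,4)[OF assms(2) K] set_integral_diff[of m K g h] by auto
qed

section \<open>Lebesgue decomposition\<close>

text \<open>The sum of two measures dominates both of them.\<close>

definition msum :: "real measure => real measure => real measure" where
 "msum M N = measure_of UNIV (sets borel) (%A. emeasure M A + emeasure N A)"

lemma sets_msum [simp]: "sets (msum M N) = sets borel"
 unfolding msum_def by (metis sets.sets_measure_of_eq space_borel)

lemma emeasure_msum:
 assumes "sets M = sets borel" "sets N = sets borel" "A \<in> sets borel"
 shows "emeasure (msum M N) A = emeasure M A + emeasure N A"
proof (rule emeasure_measure_of[OF msum_def])
 show "countably_additive (sets (msum M N)) (%A. emeasure M A + emeasure N A)"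
 proof (rule countably_additiveI)
  fix A :: "nat => real set" assume A: "range A \<subseteq> sets (msum M N)" "disjoint_family A" "\<Union> (range A) \<in> sets (msum M N)"
  have "(\<Sum>i. emeasure M (A i) + emeasure N (A i)) = (\<Sum>i. emeasure M (A i)) + (\<Sum>i. emeasure N (A i))"
   by (rule suminf_add[symmetric]) auto
  also have "\<dots> = emeasure M (\<Union> (range A)) + emeasure N (\<Union> (range A))"
   using A assms by (simp add: suminf_emeasure)
  finally show "(\<Sum>i. emeasure M (A i) + emeasure N (A i)) = emeasure M (\<Union> (range A)) + emeasure N (\<Union> (range A))" .
 qed
qed (use assms sets.sets_into_space in \<open>auto simp: positive_def\<close>)

lemma radon_msum: "radon M ==> radon N ==> radon (msum M N)"
 by (rule radonI)
   (auto simp: emeasure_msum radonD(1) borel_closed compact_imp_closed ennreal_add_less_top radonD(3)[unfolded infinity_ennreal_def])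

lemma radon_lborel: "radon lborel"
 by (rule radonI) (simp, rule emeasure_compact_finite)

lemma ac_msum:
 assumes "radon M" "radon N"
 shows "absolutely_continuous (msum M N) M" "absolutely_continuous (msum M N) N"
 unfolding absolutely_continuous_def null_sets_def
 using assms by (auto simp: radonD emeasure_msum)

lemma ac_trans: "absolutely_continuous A B ==> absolutely_continuous B C ==> absolutely_continuous A C"
 unfolding absolutely_continuous_def by auto

text \<open>Passing to a dominating Radon measure multiplies densities by a Radon-Nikodym derivative.\<close>

lemma has_dens_dominated:
 assumes d: "has_dens \<mu> n f" and m: "radon m" "absolutely_continuous m n"
 shows "has_dens \<mu> m (%x. enn2real (RN_deriv m n x) * f x)"
 unfolding has_dens_def
proof (intro conjI allI impI)
 note D = has_densD[OF d]
 interpret sigma_finite_measure m by (rule radon_sigma_finite[OF m(1)])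
 have se: "sets n = sets m" using D m radonD by metis
 note RN = RN_deriv_integrable[OF radon_sigma_finite[OF D(1)] m(2) se] RN_deriv_integral[OF radon_sigma_finite[OF D(1)] m(2) se]
 show "radon m" by (rule m)
 have "(%x. enn2real (RN_deriv m n x)) \<in> BM"
  unfolding measurable_radon[OF m(1), symmetric] by measurable
 then show "(%x. enn2real (RN_deriv m n x) * f x) \<in> BM" using D(2) by measurable
 fix K :: "real set" assume K: "compact K"
 then have Kb: "K \<in> sets borel" by (simp add: borel_closed compact_imp_closed)
 have mm: "(%x. indicator K x *\<^sub>R f x) \<in> borel_measurable m"
  unfolding measurable_radon[OF m(1)] using Kb D(2) by measurable
 have eq: "(%x. enn2real (RN_deriv m n x) * (indicator K x *\<^sub>R f x)) = (%x. indicator K x *\<^sub>R (enn2real (RN_deriv m n x) * f x))"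
  by auto
 show "set_integrable m K (%x. enn2real (RN_deriv m n x) * f x)"
  using D(3)[OF K] RN(1)[OF mm] unfolding set_integrable_def eq by simp
 show "\<mu> K = (LINT x:K|m. enn2real (RN_deriv m n x) * f x)"
  using D(4)[OF K] RN(2)[OF mm] unfolding set_lebesgue_integral_def eq by simp
qed

text \<open>Once \<open>m\<close> dominates Lebesgue measure, the set where \<open>l\<close> vanishes carries the
 singular parts of all measures with a density with respect to \<open>m\<close>.\<close>

definition lebesgue_dens :: "real measure => (real => real) => bool" where
 "lebesgue_dens m l \<longleftrightarrow> radon m \<and> l \<in> BM \<and> (\<forall>x. 0 <= l x) \<and> absolutely_continuous m lborel \<and>
   (\<forall>ph\<in>BM. (integ ph \<longleftrightarrow> integrable m (%x. l x * ph x)) \<and>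
    integral\<^sup>L lborel ph = (LINT x|m. l x * ph x))"

lemma lebesgue_densD:
 assumes "lebesgue_dens m l"
 shows "radon m" "l \<in> BM" "0 <= l x" "absolutely_continuous m lborel"
  and "ph \<in> BM ==> integ ph \<longleftrightarrow> integrable m (%x. l x * ph x)"
  and "ph \<in> BM ==> integral\<^sup>L lborel ph = (LINT x|m. l x * ph x)"
 using assms unfolding lebesgue_dens_def by blast+

lemma common_density:
 assumes "signed_radon \<mu>" "signed_radon \<nu>"
 obtains m g h l where "has_dens \<mu> m g" "has_dens \<nu> m h" "lebesgue_dens m l"
proof -
 obtain n1 f1 n2 f2 where d: "has_dens \<mu> n1 f1" "has_dens \<nu> n2 f2"
  using assms unfolding signed_radon_iff_dens by blast
 note r = has_densD(1)[OF d(1)] has_densD(1)[OF d(2)]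
 define m where "m = msum lborel (msum n1 n2)"
 have m: "radon m" unfolding m_def by (intro radon_msum radon_lborel r)
 have ac: "absolutely_continuous m lborel" "absolutely_continuous m n1" "absolutely_continuous m n2"
  unfolding m_def using ac_msum[OF radon_lborel radon_msum[OF r]] ac_msum[OF r] ac_trans by blast+
 interpret sigma_finite_measure m by (rule radon_sigma_finite[OF m])
 have "lebesgue_dens m (%x. enn2real (RN_deriv m lborel x))"
  unfolding lebesgue_dens_def
 proof (intro conjI ballI allI)
  show "(%x. enn2real (RN_deriv m lborel x)) \<in> BM"
   unfolding measurable_radon[OF m, symmetric] by measurable
  fix ph :: "real => real" assume "ph \<in> BM"
  then have ph: "ph \<in> borel_measurable m" unfolding measurable_radon[OF m] .
  have se: "sets lborel = sets m" using m by (simp add: radonD)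
  show "integ ph \<longleftrightarrow> integrable m (%x. enn2real (RN_deriv m lborel x) * ph x)"
   "integral\<^sup>L lborel ph = (LINT x|m. enn2real (RN_deriv m lborel x) * ph x)"
   using RN_deriv_integrable[OF sigma_finite_lborel ac(1) se ph] RN_deriv_integral[OF sigma_finite_lborel ac(1) se ph] by auto
 qed (use m ac in auto)
 then show ?thesis using that has_dens_dominated[OF d(1) m ac(2)] has_dens_dominated[OF d(2) m ac(3)] by blast
qed

lemma lebesgue_dens_zero:
 assumes l: "lebesgue_dens m l"
 shows "{x. l x = 0} \<in> null_sets lborel"
proof -
 have lm [measurable]: "l \<in> BM" using l unfolding lebesgue_dens_def by auto
 have s: "{x. l x = 0} \<in> sets borel" by measurable
 have z: "(%x. l x * indicator {x. l x = 0} x) = (%x. 0::real)" by (auto simp: indicator_def)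
 have "integ (indicator {x. l x = 0} :: real => real)" "(LINT x|lborel. indicator {x. l x = 0} x :: real) = 0"
  using lebesgue_densD(5,6)[OF l, of "indicator {x. l x = 0}"] s unfolding z by simp_all
 then have "emeasure lborel {x. l x = 0} < \<infinity>" "measure lborel {x. l x = 0} = 0"
  using s by (simp_all add: integrable_indicator_iff)
 then have "emeasure lborel {x. l x = 0} = 0"
  by (subst emeasure_eq_ennreal_measure) auto
 then show ?thesis using s by (simp add: null_sets_def)
qed

text \<open>The property by which the regular part is selected.\<close>

definition regular_spec :: "(real set => real) => (real => real) => bool" where
 "regular_spec \<mu> f \<longleftrightarrow> f \<in> BM \<and> (\<forall>K. compact K --> set_integrable lborel K f) \<and>
   lebesgue_singular (%K. \<mu> K - (LINT x:K|lborel. f x))"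

lemma dens_lebesgue:
 assumes l: "lebesgue_dens m l" and f: "f \<in> BM" "!!K. compact K ==> set_integrable lborel K f"
 shows "has_dens (%K. LINT x:K|lborel. f x) m (%x. l x * f x)"
 unfolding has_dens_def
proof (intro conjI allI impI)
 show "radon m" "(%x. l x * f x) \<in> BM" using l f unfolding lebesgue_dens_def by auto
 fix K :: "real set" assume K: "compact K"
 have m: "(%x. indicator K x *\<^sub>R f x) \<in> BM"
  using f(1) K by (simp add: borel_closed compact_imp_closed)
 have eq: "(%x. l x * (indicator K x *\<^sub>R f x)) = (%x. indicator K x *\<^sub>R (l x * f x))" by auto
 show "set_integrable m K (%x. l x * f x)" "(LINT x:K|lborel. f x) = (LINT x:K|m. l x * f x)"
  using l m f(2)[OF K] unfolding lebesgue_dens_def set_integrable_def set_lebesgue_integral_def eq[symmetric] by auto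
qed

text \<open>On the set where \<open>l\<close> is positive \<open>m\<close> is equivalent to Lebesgue measure, so there
 the density with respect to Lebesgue measure is the quotient of the densities.\<close>

lemma regular_dens:
 assumes d: "has_dens \<mu> m g" and l: "lebesgue_dens m l"
 shows "regular_spec \<mu> (%x. g x / l x)"
  and "regular_spec \<mu> f ==> AE x in lborel. f x = g x / l x"
proof -
 note D = has_densD[OF d]
 have lm [measurable]: "l \<in> BM" and gm [measurable]: "g \<in> BM"
  using l D unfolding lebesgue_dens_def by auto
 let ?Z = "{x. l x = 0}"
 have Zm [measurable]: "?Z \<in> sets borel" by measurable
 have ri: "set_integrable lborel K (%x. g x / l x)" if K: "compact K" for K
 proof -
  have Kb [measurable]: "K \<in> sets borel" using K by (simp add: borel_closed compact_imp_closed)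
  have "integrable m (%x. l x * (indicator K x *\<^sub>R (g x / l x)))"
  proof (rule Bochner_Integration.integrable_bound[OF D(3)[OF K, unfolded set_integrable_def]])
   show "(%x. l x * (indicator K x *\<^sub>R (g x / l x))) \<in> borel_measurable m"
    unfolding measurable_radon[OF D(1)] by measurable
  qed (auto simp: indicator_def)
  moreover have "(%x. indicator K x *\<^sub>R (g x / l x)) \<in> BM" by measurable
  ultimately show ?thesis using lebesgue_densD(5)[OF l] unfolding set_integrable_def by blast
 qed
 have rl: "has_dens (%K. LINT x:K|lborel. g x / l x) m (%x. l x * (g x / l x))"
  by (rule dens_lebesgue[OF l _ ri]) measurable
 show "regular_spec \<mu> (%x. g x / l x)"
  unfolding regular_spec_def
 proof (intro conjI allI impI ri)
  note dd = has_dens_diff[OF d rl]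
  have z: "emeasure (density m (%x. ennreal (b * (g x - l x * (g x / l x))))) (- ?Z) = 0" for b
  proof -
   have r: "(%x. b * (g x - l x * (g x / l x))) \<in> borel_measurable m"
    unfolding measurable_radon[OF D(1)] by measurable
   have mm: "(%x. ennreal (b * (g x - l x * (g x / l x)))) \<in> borel_measurable m"
    by (rule measurable_compose[OF r measurable_ennreal])
   have "emeasure (density m (%x. ennreal (b * (g x - l x * (g x / l x))))) (- ?Z)
    = (\<integral>\<^sup>+x. ennreal (b * (g x - l x * (g x / l x))) * indicator (- ?Z) x \<partial>m)"
    using mm D(1) Zm by (intro emeasure_density) (auto simp: radonD)
   also have "\<dots> = (\<integral>\<^sup>+x. 0 \<partial>m)" by (intro nn_integral_cong) (auto simp: indicator_def)
   finally show ?thesis by simp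
  qed
  show "lebesgue_singular (%K. \<mu> K - (LINT x:K|lborel. g x / l x))"
   unfolding lebesgue_singular_def pos_neg_part_dens[OF dd]
   using z[of 1] z[of "- 1"] by (intro bexI[OF _ lebesgue_dens_zero[OF l]]) simp
 qed measurable
 assume f: "regular_spec \<mu> f"
 then have fm [measurable]: "f \<in> BM" and fi: "!!K. compact K ==> set_integrable lborel K f"
  unfolding regular_spec_def by auto
 have fl: "has_dens (%K. LINT x:K|lborel. f x) m (%x. l x * f x)" by (rule dens_lebesgue[OF l fm fi])
 note dd = has_dens_diff[OF d fl]
 obtain N where N: "N \<in> null_sets lborel" and e: "emeasure (density m (%x. ennreal (g x - l x * f x))) (- N) = 0"
  "emeasure (density m (%x. ennreal (- (g x - l x * f x)))) (- N) = 0"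
 proof -
  have "lebesgue_singular (%K. \<mu> K - (LINT x:K|lborel. f x))" using f unfolding regular_spec_def by (elim conjE)
  then show ?thesis unfolding lebesgue_singular_def pos_neg_part_dens[OF dd] by (elim bexE conjE) (rule that)
 qed
 have Nb: "N \<in> sets borel" using N by auto
 have ae: "AE x in m. x \<notin> N --> ennreal (b x) = 0" if b: "b \<in> BM" and e: "emeasure (density m (%x. ennreal (b x))) (- N) = 0" for b :: "real => real"
 proof -
  have bm: "b \<in> borel_measurable m" using b unfolding measurable_radon[OF D(1)] .
  have Nm: "- N \<in> sets m" using Nb D(1) by (simp add: radonD)
  have "(\<integral>\<^sup>+x. ennreal (b x) * indicator (- N) x \<partial>m) = 0"
   using e emeasure_density[of "%x. ennreal (b x)" m "- N"] bm Nm by simp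
  then have "AE x in m. ennreal (b x) * indicator (- N) x = 0"
   using bm Nm by (subst (asm) nn_integral_0_iff_AE) auto
  then show ?thesis by eventually_elim (auto simp: indicator_def split: if_splits)
 qed
 have "AE x in m. x \<notin> N --> g x = l x * f x"
  using ae[OF _ e(1)] ae[OF _ e(2)]
  by (auto simp: ennreal_eq_0_iff elim!: eventually_elim2)
 then have "AE x in lborel. x \<notin> N --> g x = l x * f x"
  using l D(1) unfolding lebesgue_dens_def by (intro absolutely_continuous_AE[of lborel m]) (auto simp: radonD)
 moreover have "AE x in lborel. x \<notin> N" by (rule AE_not_in[OF N])
 moreover have "AE x in lborel. x \<notin> ?Z" by (rule AE_not_in[OF lebesgue_dens_zero[OF l]])
 ultimately show "AE x in lborel. f x = g x / l x" by eventually_elim auto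
qed

lemma regular_part_spec:
 assumes "signed_radon \<mu>" shows "regular_spec \<mu> (regular_part \<mu>)"
proof -
 obtain m g h l where d: "has_dens \<mu> m g" "has_dens \<mu> m h" "lebesgue_dens m l" by (rule common_density[OF assms assms])
 have "regular_part \<mu> = (SOME f. regular_spec \<mu> f)" unfolding regular_part_def regular_spec_def ..
 then show ?thesis using someI[of "regular_spec \<mu>", OF regular_dens(1)[OF d(1,3)]] by simp
qed

lemma singular_part_dens:
 assumes d: "has_dens \<mu> m g" and l: "lebesgue_dens m l"
 shows "has_dens (singular_part \<mu>) m (%x. g x * indicator {x. l x = 0} x)"
  and "AE x in lborel. regular_part \<mu> x = g x / l x"
proof -
 note D = has_densD[OF d]
 have s: "signed_radon \<mu>" using d signed_radon_iff_dens by blast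
 show ae: "AE x in lborel. regular_part \<mu> x = g x / l x" by (rule regular_dens(2)[OF d l regular_part_spec[OF s]])
 have r1: "regular_spec \<mu> (%x. g x / l x)" and r2: "regular_spec \<mu> (regular_part \<mu>)"
  using regular_dens(1)[OF d l] regular_part_spec[OF s] by auto
 have "has_dens (%K. \<mu> K - (LINT x:K|lborel. g x / l x)) m (%x. g x - l x * (g x / l x))"
  by (rule has_dens_diff[OF d dens_lebesgue[OF l]]) (use r1 in \<open>auto simp: regular_spec_def\<close>)
 moreover have "(%x. g x - l x * (g x / l x)) = (%x. g x * indicator {x. l x = 0} x)"
  by (auto simp: indicator_def fun_eq_iff)
 moreover have "(LINT x:K|lborel. g x / l x) = (LINT x:K|lborel. regular_part \<mu> x)" if K: "compact K" for K
 proof -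
  have "K \<in> sets borel" using K by (simp add: borel_closed compact_imp_closed)
  then show ?thesis
   by (intro set_lebesgue_integral_cong_AE) (use ae r1 r2 in \<open>auto simp: regular_spec_def\<close>)
 qed
 ultimately show "has_dens (singular_part \<mu>) m (%x. g x * indicator {x. l x = 0} x)"
  unfolding has_dens_def singular_part_def by auto
qed

section \<open>Continuity in variation and point masses\<close>

lemma bdd_supp_le_indicator:
 assumes "bdd_supp K M ph" shows "\<bar>ph x\<bar> <= M * indicator K x"
 using bdd_suppD(3,4)[OF assms, of x] by (cases "x \<in> K") auto

text \<open>All quantities attached to \<open>\<mu>\<close> are integrals of functions of its density, so each of them is
 Lipschitz for the variation norm.\<close>

lemma var_norm_bounds:
 assumes s: "signed_radon \<mu>" "signed_radon \<nu>" and ph: "bdd_supp K M ph"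
 shows "\<bar>pairing \<mu> ph - pairing \<nu> ph\<bar> <= M * var_norm K (%E. \<mu> E - \<nu> E)"
  and "\<bar>pairing (singular_part \<mu>) ph - pairing (singular_part \<nu>) ph\<bar> <= M * var_norm K (%E. \<mu> E - \<nu> E)"
  and "\<bar>abs_pairing (singular_part \<mu>) ph - abs_pairing (singular_part \<nu>) ph\<bar> <= M * var_norm K (%E. \<mu> E - \<nu> E)"
  and "\<bar>var_norm K \<mu> - var_norm K \<nu>\<bar> <= var_norm K (%E. \<mu> E - \<nu> E)"
  and "\<bar>\<mu> K - \<nu> K\<bar> <= var_norm K (%E. \<mu> E - \<nu> E)"
proof -
 obtain m g h l where d: "has_dens \<mu> m g" "has_dens \<nu> m h" "lebesgue_dens m l" by (rule common_density[OF s])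
 let ?Z = "indicator {x. l x = 0} :: real => real"
 note sd = singular_part_dens(1)[OF d(1,3)] singular_part_dens(1)[OF d(2,3)]
 note K = bdd_suppD(1)[OF ph]
 note df = has_dens_diff[OF d(1,2)]
 have vi: "integrable m (%x. M * (indicator K x *\<^sub>R \<bar>g x - h x\<bar>))"
  using has_densD(3)[OF has_dens_abs[OF df] K] unfolding set_integrable_def by simp
 have vn: "M * var_norm K (%E. \<mu> E - \<nu> E) = (LINT x|m. M * (indicator K x *\<^sub>R \<bar>g x - h x\<bar>))"
  using var_norm_dens[OF df K] by (simp add: set_lebesgue_integral_def)
 have key: "\<bar>(LINT x|m. a x * ph x) - (LINT x|m. b x * ph x)\<bar> <= M * var_norm K (%E. \<mu> E - \<nu> E)"
  if i: "integrable m (%x. a x * ph x)" "integrable m (%x. b x * ph x)" and le: "!!x. \<bar>a x - b x\<bar> <= \<bar>g x - h x\<bar>" for a b :: "real => real"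
 proof -
  have "\<bar>(LINT x|m. a x * ph x) - (LINT x|m. b x * ph x)\<bar> = \<bar>LINT x|m. a x * ph x - b x * ph x\<bar>" using i by simp
  also have "\<dots> <= (LINT x|m. \<bar>a x * ph x - b x * ph x\<bar>)" by (rule integral_abs_bound)
  also have "\<dots> <= (LINT x|m. M * (indicator K x *\<^sub>R \<bar>g x - h x\<bar>))"
  proof (rule integral_mono)
   show "integrable m (%x. \<bar>a x * ph x - b x * ph x\<bar>)" using i by auto
   fix x
   have "\<bar>a x * ph x - b x * ph x\<bar> = \<bar>a x - b x\<bar> * \<bar>ph x\<bar>" by (simp add: left_diff_distrib[symmetric] abs_mult)
   also have "\<dots> <= \<bar>g x - h x\<bar> * (M * indicator K x)" by (intro mult_mono le bdd_supp_le_indicator[OF ph]) auto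
   finally show "\<bar>a x * ph x - b x * ph x\<bar> <= M * (indicator K x *\<^sub>R \<bar>g x - h x\<bar>)" by (simp add: mult_ac)
  qed (rule vi)
  finally show ?thesis by (simp add: vn)
 qed
 show "\<bar>pairing \<mu> ph - pairing \<nu> ph\<bar> <= M * var_norm K (%E. \<mu> E - \<nu> E)"
  unfolding pairing_dens[OF d(1) ph] pairing_dens[OF d(2) ph]
  by (rule key[OF dens_integrable[OF d(1) ph] dens_integrable[OF d(2) ph]]) simp
 show "\<bar>pairing (singular_part \<mu>) ph - pairing (singular_part \<nu>) ph\<bar> <= M * var_norm K (%E. \<mu> E - \<nu> E)"
  unfolding pairing_dens[OF sd(1) ph] pairing_dens[OF sd(2) ph]
  by (rule key[OF dens_integrable[OF sd(1) ph] dens_integrable[OF sd(2) ph]]) (auto simp: indicator_def)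
 show "\<bar>abs_pairing (singular_part \<mu>) ph - abs_pairing (singular_part \<nu>) ph\<bar> <= M * var_norm K (%E. \<mu> E - \<nu> E)"
  unfolding pairing_dens[OF sd(1) ph] pairing_dens[OF sd(2) ph]
  by (rule key[OF dens_integrable[OF has_dens_abs[OF sd(1)] ph] dens_integrable[OF has_dens_abs[OF sd(2)] ph]])
    (auto simp: indicator_def)
 have ig: "set_integrable m K g" "set_integrable m K h" using has_densD(3)[OF d(1) K] has_densD(3)[OF d(2) K] .
 have vd: "var_norm K (%E. \<mu> E - \<nu> E) = (LINT x:K|m. \<bar>g x - h x\<bar>)" by (rule var_norm_dens[OF df K])
 have id: "set_integrable m K (%x. \<bar>g x - h x\<bar>)" using has_densD(3)[OF has_dens_abs[OF df] K] .
 have ia: "set_integrable m K (%x. \<bar>g x\<bar>)" "set_integrable m K (%x. \<bar>h x\<bar>)"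
  using has_densD(3)[OF has_dens_abs[OF d(1)] K] has_densD(3)[OF has_dens_abs[OF d(2)] K] .
 have le: "\<bar>(LINT x:K|m. a x) - (LINT x:K|m. b x)\<bar> <= var_norm K (%E. \<mu> E - \<nu> E)"
  if i: "set_integrable m K a" "set_integrable m K b" and le: "!!x. \<bar>a x - b x\<bar> <= \<bar>g x - h x\<bar>" for a b :: "real => real"
 proof -
  have "\<bar>(LINT x:K|m. a x) - (LINT x:K|m. b x)\<bar> = \<bar>LINT x:K|m. a x - b x\<bar>" using set_integral_diff[OF i] by simp
  also have "\<dots> <= (LINT x:K|m. \<bar>a x - b x\<bar>)"
   unfolding set_lebesgue_integral_def by (rule order_trans[OF integral_abs_bound]) (simp add: abs_mult)
  also have "\<dots> <= (LINT x:K|m. \<bar>g x - h x\<bar>)"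
   by (intro set_integral_mono set_integrable_abs set_integral_diff(1) i id le)
  finally show ?thesis by (simp add: vd)
 qed
 show "\<bar>var_norm K \<mu> - var_norm K \<nu>\<bar> <= var_norm K (%E. \<mu> E - \<nu> E)"
  unfolding var_norm_dens[OF d(1) K] var_norm_dens[OF d(2) K] by (rule le[OF ia]) auto
 show "\<bar>\<mu> K - \<nu> K\<bar> <= var_norm K (%E. \<mu> E - \<nu> E)"
  unfolding has_densD(4)[OF d(1) K] has_densD(4)[OF d(2) K] by (rule le[OF ig]) auto
qed

lemma regular_part_facts:
 assumes s: "signed_radon \<mu>"
 shows "regular_part \<mu> \<in> BM" "compact K ==> set_integrable lborel K (regular_part \<mu>)"
  and "compact K ==> (LINT x:K|lborel. \<bar>regular_part \<mu> x\<bar>) <= var_norm K \<mu>"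
  and "bdd_supp K M ph ==> pairing \<mu> ph = (LINT x|lborel. regular_part \<mu> x * ph x) + pairing (singular_part \<mu>) ph"
  and "bdd_supp K M ph ==> integ (%x. regular_part \<mu> x * ph x)"
  and "singular_part \<mu> {x} = \<mu> {x}"
  and "signed_radon (singular_part \<mu>)"
proof -
 obtain m g h l where d: "has_dens \<mu> m g" "has_dens \<mu> m h" and l: "lebesgue_dens m l" by (rule common_density[OF s s])
 note sd = singular_part_dens[OF d(1) l]
 have [measurable]: "g \<in> BM" "l \<in> BM"
  using has_densD(2)[OF d(1)] lebesgue_densD(2)[OF l] .
 have r: "regular_spec \<mu> (regular_part \<mu>)" by (rule regular_part_spec[OF s])
 show rm: "regular_part \<mu> \<in> BM" and ri: "!!K. compact K ==> set_integrable lborel K (regular_part \<mu>)"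
  using r unfolding regular_spec_def by auto
 show "signed_radon (singular_part \<mu>)" using sd(1) signed_radon_iff_dens by blast
 show "singular_part \<mu> {x} = \<mu> {x}"
 proof -
  have "(LINT y:{x}|lborel. regular_part \<mu> y) = 0"
  proof -
   have "(%y. indicator {x} y *\<^sub>R regular_part \<mu> y) = (%y. regular_part \<mu> x * indicator {x} y)"
    by (auto simp: indicator_def fun_eq_iff)
   then show ?thesis unfolding set_lebesgue_integral_def by simp
  qed
  then show ?thesis by (simp add: singular_part_def)
 qed
 have rl: "has_dens (%K. LINT x:K|lborel. regular_part \<mu> x) m (%x. l x * regular_part \<mu> x)"
  by (rule dens_lebesgue[OF l rm ri])
 have rl': "has_dens (%K. LINT x:K|lborel. g x / l x) m (%x. l x * (g x / l x))"
  by (rule dens_lebesgue[OF l]) (use regular_dens(1)[OF d(1) l] in \<open>auto simp: regular_spec_def\<close>)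
 have quot_m: "(%x. g x / l x) \<in> BM" using regular_dens(1)[OF d(1) l] by (simp add: regular_spec_def)
 show "(LINT x:K|lborel. \<bar>regular_part \<mu> x\<bar>) <= var_norm K \<mu>" if K: "compact K"
 proof -
  have Kb [measurable]: "K \<in> sets borel" using K by (simp add: borel_closed compact_imp_closed)
  have [measurable]: "(%x. g x / l x) \<in> BM" by (rule quot_m)
  have "(LINT x:K|lborel. \<bar>regular_part \<mu> x\<bar>) = (LINT x:K|lborel. \<bar>g x / l x\<bar>)"
   by (intro set_lebesgue_integral_cong_AE) (use sd(2) rm Kb in auto)
  also have "\<dots> = (LINT x|m. l x * (indicator K x *\<^sub>R \<bar>g x / l x\<bar>))"
   unfolding set_lebesgue_integral_def by (rule lebesgue_densD(6)[OF l]) measurable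
  also have "\<dots> <= (LINT x:K|m. \<bar>g x\<bar>)"
   unfolding set_lebesgue_integral_def
  proof (rule integral_mono)
   show i: "integrable m (%x. indicator K x *\<^sub>R \<bar>g x\<bar>)"
    using has_densD(3)[OF has_dens_abs[OF d(1)] K] unfolding set_integrable_def .
   show le: "l x * (indicator K x *\<^sub>R \<bar>g x / l x\<bar>) <= indicator K x *\<^sub>R \<bar>g x\<bar>" for x
    using lebesgue_densD(3)[OF l, of x] by (auto simp: indicator_def abs_divide)
   show "integrable m (%x. l x * (indicator K x *\<^sub>R \<bar>g x / l x\<bar>))"
   proof (rule Bochner_Integration.integrable_bound[OF i])
    show "(%x. l x * (indicator K x *\<^sub>R \<bar>g x / l x\<bar>)) \<in> borel_measurable m"
     unfolding measurable_radon[OF lebesgue_densD(1)[OF l]] using lebesgue_densD(2)[OF l] by measurable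
    show "AE x in m. norm (l x * (indicator K x *\<^sub>R \<bar>g x / l x\<bar>)) <= norm (indicator K x *\<^sub>R \<bar>g x\<bar>)"
     using le lebesgue_densD(3)[OF l] by (auto intro!: AE_I2)
   qed
  qed
  finally show ?thesis using var_norm_dens[OF d(1) K] by simp
 qed
 show riph: "integ (%x. regular_part \<mu> x * ph x)" if ph: "bdd_supp K M ph"
 proof (rule Bochner_Integration.integrable_bound[where f="%x. M * (indicator K x *\<^sub>R regular_part \<mu> x)"])
  show "integ (%x. M * (indicator K x *\<^sub>R regular_part \<mu> x))"
   using ri[OF bdd_suppD(1)[OF ph]] unfolding set_integrable_def by simp
  show "(%x. regular_part \<mu> x * ph x) \<in> LM" using rm bdd_suppD(2)[OF ph] by simp
  show "AE x in lborel. norm (regular_part \<mu> x * ph x) <= norm (M * (indicator K x *\<^sub>R regular_part \<mu> x))"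
  proof (rule AE_I2)
   fix x
   have "\<bar>regular_part \<mu> x\<bar> * \<bar>ph x\<bar> <= \<bar>regular_part \<mu> x\<bar> * (M * indicator K x)"
    by (intro mult_left_mono bdd_supp_le_indicator[OF ph]) auto
   then show "norm (regular_part \<mu> x * ph x) <= norm (M * (indicator K x *\<^sub>R regular_part \<mu> x))"
    using bdd_suppD(5)[OF ph] by (simp add: abs_mult mult_ac)
  qed
 qed
 show "pairing \<mu> ph = (LINT x|lborel. regular_part \<mu> x * ph x) + pairing (singular_part \<mu>) ph" if ph: "bdd_supp K M ph"
 proof -
  let ?Z = "indicator {x. l x = 0} :: real => real"
  have phm [measurable]: "ph \<in> BM" by (rule bdd_suppD(2)[OF ph])
  have [measurable]: "(%x. g x / l x) \<in> BM" by (rule quot_m)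
  have "(LINT x|lborel. regular_part \<mu> x * ph x) = (LINT x|lborel. (g x / l x) * ph x)"
   by (rule integral_cong_AE) (use sd(2) rm in auto)
  also have "\<dots> = (LINT x|m. l x * ((g x / l x) * ph x))" by (rule lebesgue_densD(6)[OF l]) measurable
  also have "(%x. l x * ((g x / l x) * ph x)) = (%x. l x * (g x / l x) * ph x)" by (intro ext) (rule mult.assoc[symmetric])
  finally have 1: "(LINT x|lborel. regular_part \<mu> x * ph x) = (LINT x|m. l x * (g x / l x) * ph x)" .
  have "(LINT x|lborel. regular_part \<mu> x * ph x) + pairing (singular_part \<mu>) ph = (LINT x|m. l x * (g x / l x) * ph x + g x * ?Z x * ph x)"
   unfolding 1 pairing_dens[OF sd(1) ph] using dens_integrable[OF rl' ph] dens_integrable[OF sd(1) ph] by simp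
  also have "(%x. l x * (g x / l x) * ph x + g x * ?Z x * ph x) = (%x. g x * ph x)"
  proof
   fix x show "l x * (g x / l x) * ph x + g x * ?Z x * ph x = g x * ph x" by (cases "l x = 0") auto
  qed
  finally show ?thesis using pairing_dens(1)[OF d(1) ph] by simp
 qed
qed

lemma finite_support_integral:
 assumes d: "has_dens \<nu> m g" and ph: "bdd_supp K M ph" and X: "finite X"
  and ae: "AE x in m. x \<notin> X --> g x = 0"
 shows "(LINT x|m. g x * ph x) = (\<Sum>y\<in>X. \<nu> {y} * ph y)"
proof -
 note D = has_densD[OF d]
 have Xm: "{y} \<in> sets m" for y using D(1) by (simp add: radonD)
 have gm: "g \<in> borel_measurable m" "ph \<in> borel_measurable m"
  using D(2) bdd_suppD(2)[OF ph] unfolding measurable_radon[OF D(1)] by auto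
 have "(LINT x|m. g x * ph x) = (LINT x|m. (\<Sum>y\<in>X. ph y * (indicator {y} x *\<^sub>R g x)))"
 proof (rule integral_cong_AE)
  show "AE x in m. g x * ph x = (\<Sum>y\<in>X. ph y * (indicator {y} x *\<^sub>R g x))"
   using ae
  proof eventually_elim
   case (elim x)
   have "(\<Sum>y\<in>X. ph y * (indicator {y} x *\<^sub>R g x)) = (\<Sum>y\<in>X. if y = x then ph x * g x else 0)"
    by (intro sum.cong) (auto simp: indicator_def)
   then show ?case using elim X by (cases "x \<in> X") auto
  qed
  show "(%x. \<Sum>y\<in>X. ph y * (indicator {y} x *\<^sub>R g x)) \<in> borel_measurable m"
   using gm Xm by measurable
 qed (use gm in measurable)
 also have "\<dots> = (\<Sum>y\<in>X. ph y * (LINT x:{y}|m. g x))"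
  unfolding set_lebesgue_integral_def
  using D(3)[of "{y}" for y] by (subst Bochner_Integration.integral_sum) (auto simp: set_integrable_def)
 finally show ?thesis using D(4)[of "{y}" for y] by (simp add: mult.commute)
qed

lemma point_mass_abs:
 assumes d: "has_dens \<nu> m g"
 shows "(LINT x:{y}|m. \<bar>g x\<bar>) = \<bar>\<nu> {y}\<bar>"
proof -
 have i: "(%x. indicator {y} x *\<^sub>R c x) = (%x. c y * indicator {y} x)" for c :: "real => real"
  by (auto simp: indicator_def fun_eq_iff)
 have "(LINT x:{y}|m. c x) = c y * measure m {y}" for c :: "real => real"
  unfolding set_lebesgue_integral_def i using radonD[OF has_densD(1)[OF d]] by simp
 then show ?thesis using has_densD(4)[OF d, of "{y}"] by (simp add: abs_mult)
qed

text \<open>If the positive part charges only \<open>Xp\<close> and the negative part only \<open>Xn\<close>, the measure is a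
 combination of point masses.\<close>

lemma singular_concentrated:
 assumes s: "signed_radon \<mu>" and X: "finite Xp" "finite Xn" "Xp \<inter> Xn = {}"
  and bp: "!!n. bdd_supp (Kp n) (Mp n) (p n)" "!!n x. 0 <= p n x" "!!x. x \<notin> Xp ==> \<exists>n::nat. 0 < p n x"
  and bq: "!!n. bdd_supp (Kq n) (Mq n) (q n)" "!!n x. 0 <= q n x" "!!x. x \<notin> Xn ==> \<exists>n::nat. 0 < q n x"
  and zp: "!!n. abs_pairing (singular_part \<mu>) (p n) + pairing (singular_part \<mu>) (p n) = 0"
  and zq: "!!n. abs_pairing (singular_part \<mu>) (q n) - pairing (singular_part \<mu>) (q n) = 0"
 shows "bdd_supp K M ph ==> pairing (singular_part \<mu>) ph = (\<Sum>y\<in>Xp \<union> Xn. \<mu> {y} * ph y)"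
  and "bdd_supp K M ph ==> abs_pairing (singular_part \<mu>) ph = (\<Sum>y\<in>Xp \<union> Xn. \<bar>\<mu> {y}\<bar> * ph y)"
  and "y \<in> Xp ==> 0 <= \<mu> {y}" "y \<in> Xn ==> \<mu> {y} <= 0"
proof -
 obtain m g where d: "has_dens (singular_part \<mu>) m g"
  using regular_part_facts(7)[OF s] signed_radon_iff_dens by blast
 note D = has_densD[OF d]
 have one: "AE x in m. x \<notin> Y --> b * g x <= 0"
  if b: "\<bar>b\<bar> = 1" and p: "!!n. bdd_supp (Kp n) (Mp n) (p n)" "!!n x. 0 <= p n x" "!!x. x \<notin> Y ==> \<exists>n::nat. 0 < p n x"
   and z: "!!n. abs_pairing (singular_part \<mu>) (p n) + b * pairing (singular_part \<mu>) (p n) = 0" for b Y p Kp Mp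
 proof -
  have "AE x in m. (\<bar>g x\<bar> + b * g x) * p n x = 0" for n
  proof -
   have i: "integrable m (%x. (\<bar>g x\<bar> + b * g x) * p n x)"
    using dens_integrable[OF has_dens_abs[OF d] p(1)[of n]] dens_integrable[OF d p(1)[of n]]
    by (simp add: distrib_right mult.assoc)
   have "(LINT x|m. (\<bar>g x\<bar> + b * g x) * p n x) = 0"
    using z[of n] dens_integrable[OF has_dens_abs[OF d] p(1)[of n]] dens_integrable[OF d p(1)[of n]]
    unfolding pairing_dens[OF d p(1)[of n]] by (simp add: distrib_right mult.assoc)
   moreover have "0 <= (\<bar>g x\<bar> + b * g x) * p n x" for x
   proof -
    have "\<bar>b * g x\<bar> = \<bar>g x\<bar>" using b by (simp add: abs_mult)
    then have "0 <= \<bar>g x\<bar> + b * g x" by linarith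
    then show ?thesis using p(2)[of n x] by simp
   qed
   ultimately show ?thesis using integral_nonneg_eq_0_iff_AE[OF i] by auto
  qed
  then have "AE x in m. \<forall>n. (\<bar>g x\<bar> + b * g x) * p n x = 0" unfolding AE_all_countable by blast
  then show ?thesis
  proof eventually_elim
   case (elim x)
   show ?case
   proof
    assume "x \<notin> Y"
    then obtain n where "0 < p n x" using p(3) by blast
    with elim have "\<bar>g x\<bar> + b * g x = 0" by (metis less_irrefl mult_eq_0_iff)
    then show "b * g x <= 0" using abs_ge_zero[of "g x"] by linarith
   qed
  qed
 qed
 have aep: "AE x in m. x \<notin> Xp --> 1 * g x <= 0"
  by (rule one[of 1 Kp Mp p]) (use bp zp in auto)
 have aen: "AE x in m. x \<notin> Xn --> - 1 * g x <= 0"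
  by (rule one[of "- 1" Kq Mq q]) (use bq zq in auto)
 have ae0: "AE x in m. x \<notin> Xp \<union> Xn --> g x = 0"
  using aep aen by eventually_elim auto
 have fX: "finite (Xp \<union> Xn)" using X by simp
 note pt = regular_part_facts(6)[OF s]
 show "pairing (singular_part \<mu>) ph = (\<Sum>y\<in>Xp \<union> Xn. \<mu> {y} * ph y)" if "bdd_supp K M ph"
  using finite_support_integral[OF d that fX ae0] pairing_dens(1)[OF d that] by (simp add: pt)
 show "abs_pairing (singular_part \<mu>) ph = (\<Sum>y\<in>Xp \<union> Xn. \<bar>\<mu> {y}\<bar> * ph y)" if ph: "bdd_supp K M ph"
 proof -
  have "AE x in m. x \<notin> Xp \<union> Xn --> \<bar>g x\<bar> = 0" using ae0 by eventually_elim auto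
  from finite_support_integral[OF has_dens_abs[OF d] ph fX this] pairing_dens(2)[OF d ph]
  show ?thesis by (simp add: point_mass_abs[OF d] pt)
 qed
 have pm: "\<mu> {y} = g y * measure m {y}" for y
 proof -
  have i: "(%x. indicator {y} x *\<^sub>R g x) = (%x. g y * indicator {y} x)" by (auto simp: indicator_def fun_eq_iff)
  have "singular_part \<mu> {y} = (LINT x:{y}|m. g x)" by (rule D(4)) simp
  also have "\<dots> = g y * measure m {y}" unfolding set_lebesgue_integral_def i using radonD[OF D(1)] by simp
  finally show ?thesis by (simp add: pt)
 qed
 have atom: "Q y" if aeQ: "AE x in m. Q x" and nz: "measure m {y} \<noteq> 0" for Q y
 proof (rule ccontr)
  assume n: "\<not> Q y"
  obtain N where N: "{x \<in> space m. \<not> Q x} \<subseteq> N" "emeasure m N = 0" "N \<in> sets m" using aeQ by (rule AE_E)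
  have "y \<in> N" using N n radonD[OF D(1)] by auto
  then have "emeasure m {y} <= emeasure m N" using N by (intro emeasure_mono) auto
  then show False using N nz by (simp add: measure_def)
 qed
 show "0 <= \<mu> {y}" if "y \<in> Xp"
 proof (cases "measure m {y} = 0")
  case False
  from atom[OF aen this] that X have "0 <= g y" by auto
  then show ?thesis unfolding pm by simp
 qed (simp add: pm)
 show "\<mu> {y} <= 0" if "y \<in> Xn"
 proof (cases "measure m {y} = 0")
  case False
  from atom[OF aep this] that X have "g y <= 0" by auto
  then show ?thesis unfolding pm by (simp add: mult_nonpos_nonneg)
 qed (simp add: pm)
qed

lemma point_masses_pairing:
 assumes X: "finite X" and \<nu>: "!!K. compact K ==> \<nu> K = (\<Sum>y\<in>X. c y * indicator K y)" and ph: "bdd_supp K M ph"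
 shows "pairing \<nu> ph = (\<Sum>y\<in>X. c y * ph y)" "abs_pairing \<nu> ph = (\<Sum>y\<in>X. \<bar>c y\<bar> * ph y)"
proof -
 define m where "m = distr (count_space X) borel (%x. x :: real)"
 have idm: "(%x. x) \<in> measurable (count_space X) (borel :: real measure)" by simp
 have int: "integrable m b" "integral\<^sup>L m b = (\<Sum>y\<in>X. b y)" if "b \<in> BM" for b :: "real => real"
  unfolding m_def using that X integrable_distr_eq[OF idm that] integral_distr[OF idm that]
  by (simp_all add: integrable_count_space lebesgue_integral_count_space_finite)
 have mr: "radon m"
 proof (rule radonI)
  fix K :: "real set" assume "compact K"
  then have "K \<in> sets borel" by (simp add: borel_closed compact_imp_closed)
  then show "emeasure m K < \<infinity>" unfolding m_def using X by (simp add: emeasure_distr emeasure_count_space less_top[symmetric])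
 qed (simp add: m_def)
 define g where "g x = (if x \<in> X then c x else 0)" for x
 have gm: "g \<in> BM"
 proof -
  have "g = (%x. \<Sum>y\<in>X. c y * indicator {y} x)"
  proof
   fix x
   have "(\<Sum>y\<in>X. c y * indicator {y} x) = (\<Sum>y\<in>X. if y = x then c x else 0)" by (intro sum.cong) (auto simp: indicator_def)
   then show "g x = (\<Sum>y\<in>X. c y * indicator {y} x)" using X by (simp add: g_def)
  qed
  then show ?thesis by simp
 qed
 have d: "has_dens \<nu> m g"
  unfolding has_dens_def
 proof (intro conjI allI impI mr gm)
  fix K :: "real set" assume K: "compact K"
  then have mm: "(%x. indicator K x *\<^sub>R g x) \<in> BM" using gm by (simp add: borel_closed compact_imp_closed)
  show "set_integrable m K g" "\<nu> K = (LINT x:K|m. g x)"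
   using int[OF mm] \<nu>[OF K] unfolding set_integrable_def set_lebesgue_integral_def
   by (auto simp: g_def mult.commute intro!: sum.cong)
 qed
 have phm: "ph \<in> BM" by (rule bdd_suppD(2)[OF ph])
 have "(%x. g x * ph x) \<in> BM" "(%x. \<bar>g x\<bar> * ph x) \<in> BM"
  using gm phm by measurable
 then show "pairing \<nu> ph = (\<Sum>y\<in>X. c y * ph y)" "abs_pairing \<nu> ph = (\<Sum>y\<in>X. \<bar>c y\<bar> * ph y)"
  unfolding pairing_dens[OF d ph] by (simp_all only: int(2)) (simp_all add: g_def)
qed

section \<open>The potential of a conservation law with point masses\<close>

lemma half_open_integral:
 fixes f :: "real => real"
 assumes "set_integrable lborel {a..b} f"
 shows "(LINT x:{a<..b}|lborel. f x) = integral {a..b} f"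
proof -
 have i: "set_integrable lborel {a<..b} f" by (rule set_integrable_subset[OF assms]) auto
 have "(LINT x:{a<..b}|lborel. f x) = (LINT x:{a..b}|lborel. f x)"
  unfolding set_lebesgue_integral_def
 proof (rule integral_cong_AE)
  show "AE x in lborel. indicator {a<..b} x *\<^sub>R f x = indicator {a..b} x *\<^sub>R f x"
   using AE_lborel_singleton[of a] by eventually_elim (auto simp: indicator_def)
 qed (use i assms in \<open>auto simp: set_integrable_def\<close>)
 then show ?thesis using set_borel_integral_eq_integral(2)[OF assms] by simp
qed

lemma right_neighbourhood:
 assumes "eventually P (at_right (y::real))"
 shows "\<exists>d>0. \<forall>x. 0 < 1 * (x - y) --> 1 * (x - y) < d --> P x"
proof -
 obtain b where b: "b > y" "!!x. y < x ==> x < b ==> P x"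
  using assms unfolding eventually_at_right_field by auto
 show ?thesis using b by (intro exI[of _ "b - y"]) auto
qed

lemma left_neighbourhood:
 assumes "eventually P (at_left (y::real))"
 shows "\<exists>d>0. \<forall>x. 0 < - 1 * (x - y) --> - 1 * (x - y) < d --> P x"
proof -
 obtain b where b: "b < y" "!!x. b < x ==> x < y ==> P x"
  using assms unfolding eventually_at_left_field by auto
 show ?thesis using b by (intro exI[of _ "y - b"]) auto
qed

text \<open>A common Lipschitz bound in time upgrades pointwise limits to uniform ones, by a finite net of times.\<close>

lemma uniform_trace:
 fixes f :: "real \<times> real => real"
 assumes nb: "!!P. eventually P F ==> \<exists>d>0. \<forall>x. 0 < sig * (x - y) --> sig * (x - y) < d --> P x"
  and F: "F \<noteq> bot" and C: "0 <= C"
  and lip: "!!x t t'. t \<in> {s..T} ==> t' \<in> {s..T} ==> \<bar>f (x, t) - f (x, t')\<bar> <= C * \<bar>t - t'\<bar>"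
  and lim: "!!t. t \<in> {s..T} ==> ((%x. f (x, t)) \<longlongrightarrow> L t) F"
 shows "trace_lim s T y sig f L"
  and "t \<in> {s..T} ==> t' \<in> {s..T} ==> \<bar>L t - L t'\<bar> <= C * \<bar>t - t'\<bar>"
proof -
 have Ll: "\<bar>L t - L t'\<bar> <= C * \<bar>t - t'\<bar>" if "t \<in> {s..T}" "t' \<in> {s..T}" for t t'
 proof (rule tendsto_upperbound[OF _ _ F])
  show "((%x. \<bar>f (x, t) - f (x, t')\<bar>) \<longlongrightarrow> \<bar>L t - L t'\<bar>) F"
   by (intro tendsto_rabs tendsto_diff lim that)
  show "eventually (%x. \<bar>f (x, t) - f (x, t')\<bar> <= C * \<bar>t - t'\<bar>) F"
   by (intro always_eventually allI lip that)
 qed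
 show "t \<in> {s..T} ==> t' \<in> {s..T} ==> \<bar>L t - L t'\<bar> <= C * \<bar>t - t'\<bar>" by (rule Ll)
 show "trace_lim s T y sig f L"
  unfolding trace_lim_def
 proof (intro allI impI)
  fix e :: real assume e: "e > 0"
  define dl where "dl = e / (3 * C + 3)"
  have dl: "dl > 0" using e C by (simp add: dl_def)
  have Cdl: "C * dl <= e / 3" using e C by (simp add: dl_def field_simps)
  obtain N where N: "N \<subseteq> {s..T}" "finite N" "{s..T} \<subseteq> (\<Union>c\<in>N. ball c dl)"
   by (rule compactE_image[of "{s..T}" "{s..T}" "%c. ball c dl"]) (use dl in \<open>auto\<close>)
  have "eventually (%x. \<forall>c\<in>N. \<bar>f (x, c) - L c\<bar> < e / 3) F"
  proof (rule eventually_ball_finite[OF N(2)], intro ballI)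
   fix c assume "c \<in> N"
   then have "((%x. f (x, c)) \<longlongrightarrow> L c) F" using N(1) lim by auto
   then show "eventually (%x. \<bar>f (x, c) - L c\<bar> < e / 3) F"
    using e tendstoD[of "%x. f (x, c)" "L c" F "e / 3"] by (simp add: dist_real_def)
  qed
  from nb[OF this] obtain d where d0: "d > 0" "\<forall>x. 0 < sig * (x - y) --> sig * (x - y) < d --> (\<forall>c\<in>N. \<bar>f (x, c) - L c\<bar> < e / 3)"
   by (elim exE conjE)
  note d = d0(1) d0(2)[rule_format]
  show "\<exists>d>0. \<forall>x t. 0 < sig * (x - y) --> sig * (x - y) < d --> t \<in> {s..T} --> \<bar>f (x, t) - L t\<bar> < e"
  proof (intro exI[of _ d] conjI allI impI d(1))
   fix x t assume x: "0 < sig * (x - y)" "sig * (x - y) < d" and t: "t \<in> {s..T}"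
   obtain c where c: "c \<in> N" "\<bar>c - t\<bar> < dl" using N(3) t by (auto simp: dist_real_def)
   have cm: "c \<in> {s..T}" using N(1) c(1) by auto
   have "C * \<bar>c - t\<bar> <= C * dl" using c(2) C by (intro mult_left_mono) auto
   then have le: "C * \<bar>c - t\<bar> <= e / 3" using Cdl by linarith
   have "\<bar>f (x, c) - f (x, t)\<bar> <= e / 3" by (rule order_trans[OF lip[OF cm t] le])
   moreover have "\<bar>L c - L t\<bar> <= e / 3" by (rule order_trans[OF Ll[OF cm t] le])
   moreover have "\<bar>f (x, c) - L c\<bar> < e / 3" by (rule d(2)[OF x c(1)])
   ultimately show "\<bar>f (x, t) - L t\<bar> < e" by linarith
  qed
 qed
qed

lemma fst_snd_borel:
 "(%z::real \<times> real. fst z) \<in> BM" "(%z::real \<times> real. snd z) \<in> BM"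
 by (intro borel_measurable_continuous_onI continuous_intros)+

lemma AE_off_lines: "AE z in (lborel :: (real \<times> real) measure). fst z \<noteq> a \<and> snd z \<noteq> b"
proof -
 have "AE z in lborel \<Otimes>\<^sub>M lborel. fst z \<noteq> a \<and> snd z \<noteq> (b::real)"
 proof (rule lborel_pair.AE_pair_measure)
  show "{z \<in> space (lborel \<Otimes>\<^sub>M lborel). fst z \<noteq> a \<and> snd z \<noteq> b} \<in> sets (lborel \<Otimes>\<^sub>M lborel)" by measurable
  have "AE t in lborel. t \<noteq> b" by (rule AE_lborel_singleton)
  then show "AE x in lborel. AE t in lborel. fst (x, t) \<noteq> a \<and> snd (x, t) \<noteq> b"
   using AE_lborel_singleton[of a] by auto
 qed
 then show ?thesis unfolding lborel_prod .
qed

lemma interval_measure: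
 "emeasure lborel {a..b::real} < \<infinity>" "emeasure lborel {a<..b::real} < \<infinity>" "integ (indicator {a..b} :: real => real)"
 "integ (indicator {a<..b} :: real => real)"
proof -
 show 1: "emeasure lborel {a..b::real} < \<infinity>" by (simp add: emeasure_lborel_Icc_eq)
 have "emeasure lborel {a<..b} <= emeasure lborel {a..b::real}" by (intro emeasure_mono) auto
 then show "emeasure lborel {a<..b::real} < \<infinity>" using 1 by (rule order.strict_trans1)
 show "integ (indicator {a..b} :: real => real)" using 1 by simp
 show "integ (indicator {a<..b} :: real => real)" using \<open>emeasure lborel {a<..b} < \<infinity>\<close> by simp
qed

text \<open>\<open>ker n z\<close> is a mollifier supported on the right of \<open>z\<close>, and \<open>z\<close>
 itself is approached from that side.\<close>

abbreviation wid :: "nat => real" where "wid n \<equiv> 1 / real (Suc n)"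
abbreviation ker :: "nat => real => real => real" where "ker n z y \<equiv> step' ((y - z) / wid n - 1) / wid n"

lemma ker: "integ (ker n z)" "(LINT y|lborel. ker n z y) = 1" "0 <= ker n z y"
 using step_kernel_mass[of "wid n" 1 z] step'_bounds(1) by auto

lemma step_limit: "(%n. step ((y - z) / wid n - 1)) ---> indicator {z<..} y"
proof (cases "z < y")
 case True
 obtain N :: nat where N: "2 / (y - z) < real N" using reals_Archimedean2 by blast
 have "step ((y - z) / wid n - 1) = 1" if "n \<ge> N" for n
 proof (rule step_eq_1)
  have "2 < (y - z) * real N" using N True by (simp add: field_simps)
  also have "\<dots> <= (y - z) * real (Suc n)" using True that by (intro mult_left_mono) auto
  finally show "1 <= (y - z) / wid n - 1" by simp
 qed
 then have "eventually (%n. step ((y - z) / wid n - 1) = 1) sequentially"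
  unfolding eventually_sequentially by blast
 then show ?thesis using True by (simp add: tendsto_eventually)
next
 case False
 have "step ((y - z) / wid n - 1) = 0" for n
 proof (rule step_eq_0)
  have "(y - z) * real (Suc n) <= 0" using False by (intro mult_nonpos_nonneg) auto
  then show "(y - z) / wid n - 1 <= 0" by simp
 qed
 then show ?thesis using False by simp
qed

lemma step_shift_eq_1: "z + 2 <= y ==> step ((y - z) / wid n - 1) = 1"
proof (rule step_eq_1)
 assume "z + 2 <= y"
 then have "2 * 1 <= (y - z) * real (Suc n)" by (intro mult_mono) auto
 then show "1 <= (y - z) / wid n - 1" by simp
qed

lemma step_shift_eq_0: "y <= z ==> step ((y - z) / wid n - 1) = 0"
proof (rule step_eq_0)
 assume "y <= z"
 then have "(y - z) * real (Suc n) <= 0" by (intro mult_nonpos_nonneg) auto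
 then show "(y - z) / wid n - 1 <= 0" by simp
qed

text \<open>A density \<open>r\<close> and point masses \<open>m\<close> on \<open>X\<close> that evolve by a balance
 law with the flux \<open>H v\<close>. Here \<open>v\<close> is a jointly measurable representative of
 \<open>r\<close>.\<close>

locale mass_flow =
 fixes H :: "real => real" and v :: "real \<times> real => real" and C :: real and X :: "real set"
  and r m :: "real => real => real"
 assumes H_cont: "cont H" and H_bound: "!!xi. \<bar>H xi\<bar> <= C" and X_fin: "finite X"
  and v_meas [measurable]: "v \<in> BM"
  and r_meas: "!!t. 0 <= t ==> r t \<in> BM"
  and r_int: "!!t K. 0 <= t ==> compact K ==> set_integrable lborel K (r t)"
  and v_int: "!!a b T. set_integrable lborel ({a..b} \<times> {0..T}) v"
  and v_slice: "AE t in lborel. 0 < t --> (AE x in lborel. v (x, t) = r t x)"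
  and balance: "!!t ph ph' K. 0 <= t ==> (!!x. (ph has_real_derivative ph' x) (at x)) ==> cont ph' ==>
    compact K ==> (!!x. x \<notin> K ==> ph x = 0) ==>
    (LINT x|lborel. r t x * ph x) + (\<Sum>y\<in>X. m y t * ph y)
    = (LINT x|lborel. r 0 x * ph x) + (\<Sum>y\<in>X. m y 0 * ph y)
     + (LINT z|lborel. indicator {0..t} (snd z) * (H (v z) * ph' (fst z)))"
begin

lemma H_meas [measurable]: "H \<in> BM"
 by (rule borel_measurable_continuous_onI[OF H_cont])

lemma C_nonneg: "0 <= C" using H_bound[of 0] by linarith

text \<open>The indicator of \<open>{x<..}\<close> is not a test function; subtracting it from a smooth step leaves a
 compactly supported function, at the price of the flux of the step, which does not depend on
 \<open>x\<close>.\<close>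

definition cut :: "real => real => real" where "cut x y = step y - indicator {x<..} y"

definition space_flux :: "real set => (real => real) => real" where
 "space_flux A a = (LINT w|lborel. indicator A (snd w) * (H (v w) * a (fst w)))"

definition pot :: "real \<times> real => real" where
 "pot z = (LINT y|lborel. r (snd z) y * cut (fst z) y) + (\<Sum>y\<in>X. m y (snd z) * cut (fst z) y)
   - space_flux {0..snd z} step'"

lemma space_flux:
 assumes A: "A \<in> sets borel" "emeasure lborel A < \<infinity>" and a: "integ a"
 shows "integ (%w. indicator A (snd w) * (H (v w) * a (fst w)))"
  and "\<bar>space_flux A a\<bar> <= C * measure lborel A * (LINT x|lborel. \<bar>a x\<bar>)"
proof -
 have iA: "integ (indicator A :: real => real)" using A by simp
 have Hv: "(%w. H (v w)) \<in> LM" by measurable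
 have "integ (%w. H (v w) * (a (fst w) * indicator A (snd w)))"
  by (rule integrable_bounded_mult[OF integrable_product_lborel(1)[OF a iA] Hv H_bound])
 then show i: "integ (%w. indicator A (snd w) * (H (v w) * a (fst w)))" by (simp add: mult_ac)
 have ip: "integ (%w. \<bar>a (fst w)\<bar> * indicator A (snd w))"
  by (rule integrable_product_lborel(1)[OF integrable_abs[OF a] iA])
 have "\<bar>space_flux A a\<bar> <= (LINT w|lborel. \<bar>indicator A (snd w) * (H (v w) * a (fst w))\<bar>)"
  unfolding space_flux_def by (rule integral_abs_bound)
 also have "\<dots> <= (LINT w|lborel. C * (\<bar>a (fst w)\<bar> * indicator A (snd w)))"
 proof (rule integral_mono)
  show "integ (%w. \<bar>indicator A (snd w) * (H (v w) * a (fst w))\<bar>)" by (rule integrable_abs[OF i])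
  show "integ (%w. C * (\<bar>a (fst w)\<bar> * indicator A (snd w)))" using ip by simp
  fix w :: "real \<times> real"
  have "\<bar>H (v w)\<bar> * \<bar>a (fst w)\<bar> <= C * \<bar>a (fst w)\<bar>" by (rule mult_right_mono[OF H_bound]) simp
  then show "\<bar>indicator A (snd w) * (H (v w) * a (fst w))\<bar> <= C * (\<bar>a (fst w)\<bar> * indicator A (snd w))"
   by (simp add: abs_mult indicator_def)
 qed
 also have "\<dots> = C * measure lborel A * (LINT x|lborel. \<bar>a x\<bar>)"
  using integrable_product_lborel(2)[OF integrable_abs[OF a] iA] A by simp
 finally show "\<bar>space_flux A a\<bar> <= C * measure lborel A * (LINT x|lborel. \<bar>a x\<bar>)" .
qed

lemma space_flux_diff:
 assumes "0 <= t" "t <= t'" and a: "integ a"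
 shows "space_flux {0..t'} a - space_flux {0..t} a = space_flux {t<..t'} a"
proof -
 have "space_flux {0..t'} a - space_flux {0..t} a
   = (LINT w|lborel. indicator {0..t'} (snd w) * (H (v w) * a (fst w)) - indicator {0..t} (snd w) * (H (v w) * a (fst w)))"
  unfolding space_flux_def
  by (rule Bochner_Integration.integral_diff[symmetric]) (intro space_flux(1) interval_measure a; simp)+
 also have "\<dots> = space_flux {t<..t'} a"
  unfolding space_flux_def using assms(1,2) by (intro LINT_cong) (auto simp: indicator_def)
 finally show ?thesis .
qed

lemma r_mult:
 assumes "0 <= t" "compact K" and ph: "ph \<in> BM" "!!x. \<bar>ph x\<bar> <= M" "!!x. x \<notin> K ==> ph x = 0"
 shows "integ (%x. r t x * ph x)"
proof -
 have i: "integ (%x. ph x * (indicator K x *\<^sub>R r t x))"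
  by (rule integrable_bounded_mult[OF r_int[OF assms(1,2), unfolded set_integrable_def] _ ph(2)]) (use ph(1) in simp)
 have "(%x. ph x * (indicator K x *\<^sub>R r t x)) = (%x. r t x * ph x)"
 proof
  fix x show "ph x * (indicator K x *\<^sub>R r t x) = r t x * ph x" using ph(3)[of x] by (cases "x \<in> K") auto
 qed
 with i show ?thesis by simp
qed

lemma cut_props:
 shows "cut x \<in> BM" "\<bar>cut x y\<bar> <= 1" "y \<notin> {min 0 x..max 1 x} ==> cut x y = 0"
proof -
 show "cut x \<in> BM" unfolding cut_def[abs_def] by measurable
 show "\<bar>cut x y\<bar> <= 1" using step_bounds[of y] by (auto simp: cut_def indicator_def)
 show "cut x y = 0" if "y \<notin> {min 0 x..max 1 x}"
 proof -
  from that have "(y <= 0 \<and> y <= x) \<or> (y \<ge> 1 \<and> y > x)" by (auto simp: min_def max_def split: if_splits)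
  then show ?thesis using step_eq_0[of y] step_eq_1[of y] by (auto simp: cut_def)
 qed
qed

lemma r_cut: "0 <= t ==> integ (%y. r t y * cut x y)"
 by (rule r_mult[of t "{min 0 x..max 1 x}" _ 1]) (use cut_props in auto)

lemma pot_diff:
 assumes "0 <= t" "x1 <= x2"
 shows "pot (x2, t) - pot (x1, t) = (LINT y:{x1<..x2}|lborel. r t y) + (\<Sum>y\<in>X. m y t * indicator {x1<..x2} y)"
proof -
 have c: "cut x2 y - cut x1 y = indicator {x1<..x2} y" for y using assms(2) by (auto simp: cut_def indicator_def)
 have "(LINT y|lborel. r t y * cut x2 y) - (LINT y|lborel. r t y * cut x1 y) = (LINT y|lborel. r t y * (cut x2 y - cut x1 y))"
  using r_cut[OF assms(1)] by (simp add: right_diff_distrib)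
 also have "\<dots> = (LINT y:{x1<..x2}|lborel. r t y)"
  unfolding c set_lebesgue_integral_def by (simp add: mult.commute)
 finally have 1: "(LINT y|lborel. r t y * cut x2 y) - (LINT y|lborel. r t y * cut x1 y) = (LINT y:{x1<..x2}|lborel. r t y)" .
 have "(\<Sum>y\<in>X. m y t * cut x2 y) - (\<Sum>y\<in>X. m y t * cut x1 y) = (\<Sum>y\<in>X. m y t * (cut x2 y - cut x1 y))"
  by (simp add: sum_subtractf right_diff_distrib)
 then show ?thesis using 1 unfolding c by (simp add: pot_def)
qed

text \<open>The jump of the cut-off function is smoothed to the right of \<open>z\<close>, so that the limit is the
 value of the potential that includes a point mass at \<open>z\<close>; the balance law then identifies the
 time increment of the potential at \<open>z\<close> as the flux through \<open>z\<close>.\<close>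

lemma time_limit:
 assumes t: "0 <= t"
 shows "(%n. space_flux {0..t} (ker n z)) ---> pot (z, 0) - pot (z, t)"
proof -
 define ph where "ph n y = step y - step ((y - z) / wid n - 1)" for n y
 define ph' where "ph' n y = step' y - ker n z y" for n y
 define K where "K = {min 0 z..max 1 (z + 2)}"
 have K: "compact K" by (simp add: K_def)
 have d: "(ph n has_real_derivative ph' n y) (at y)" for n y
  unfolding ph_def[abs_def] ph'_def by (auto intro!: derivative_eq_intros)
 have c: "cont (ph' n)" for n
  unfolding ph'_def[abs_def] by (intro continuous_intros) auto
 have z: "ph n y = 0" if "y \<notin> K" for n y
 proof -
  from that have "(y <= 0 \<and> y <= z) \<or> (y \<ge> 1 \<and> z + 2 <= y)" by (auto simp: K_def min_def max_def split: if_splits)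
  then show ?thesis using step_eq_0[of y] step_eq_1[of y] step_shift_eq_1[of z y n] step_shift_eq_0[of y z n]
   unfolding ph_def by auto
 qed
 have b: "\<bar>ph n y\<bar> <= indicator K y" for n y
  using z[of y n] step_bounds[of y] step_bounds[of "(y - z) / wid n - 1"]
  by (cases "y \<in> K") (auto simp: ph_def)
 have lim: "(%n. ph n y) ---> cut z y" for y
  unfolding ph_def cut_def by (intro tendsto_intros step_limit)
 have L: "(%n. (LINT y|lborel. r t y * ph n y) + (\<Sum>y\<in>X. m y t * ph n y))
   ---> (LINT y|lborel. r t y * cut z y) + (\<Sum>y\<in>X. m y t * cut z y)" if t: "0 <= t" for t
 proof (intro tendsto_add tendsto_sum tendsto_mult_left lim)
  have rm: "r t \<in> BM" by (rule r_meas[OF t])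
  have phm: "ph n \<in> BM" for n unfolding ph_def[abs_def] by measurable
  show "(%n. LINT y|lborel. r t y * ph n y) ---> (LINT y|lborel. r t y * cut z y)"
  proof (rule dominated_convergence_real(1)[where w="%y. \<bar>indicator K y *\<^sub>R r t y\<bar>"])
   show "integ (%y. \<bar>indicator K y *\<^sub>R r t y\<bar>)"
    using r_int[OF t K] unfolding set_integrable_def by (rule integrable_abs)
   show "AE y in lborel. (%n. r t y * ph n y) ---> r t y * cut z y" by (intro AE_I2 tendsto_mult_left lim)
   fix n y
   have "\<bar>r t y\<bar> * \<bar>ph n y\<bar> <= \<bar>r t y\<bar> * indicator K y" by (rule mult_left_mono[OF b]) simp
   then show "\<bar>r t y * ph n y\<bar> <= \<bar>indicator K y *\<^sub>R r t y\<bar>" by (simp add: abs_mult mult.commute)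
  qed (use rm phm cut_props(1) in auto)
 qed
 have step'i: "integ step'"
  by (rule integrable_compact_support[OF step'_cont, of "{0..1}"]) (use step'_eq_0 in auto)
 have "space_flux {0..t} (ker n z) = space_flux {0..t} step'
   - (((LINT y|lborel. r t y * ph n y) + (\<Sum>y\<in>X. m y t * ph n y)) - ((LINT y|lborel. r 0 y * ph n y) + (\<Sum>y\<in>X. m y 0 * ph n y)))" for n
 proof -
  have "(LINT w|lborel. indicator {0..t} (snd w) * (H (v w) * ph' n (fst w)))
    = (LINT w|lborel. indicator {0..t} (snd w) * (H (v w) * step' (fst w)) - indicator {0..t} (snd w) * (H (v w) * ker n z (fst w)))"
   unfolding ph'_def by (rule LINT_cong) (auto simp only: right_diff_distrib)
  also have "\<dots> = space_flux {0..t} step' - space_flux {0..t} (ker n z)"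
   unfolding space_flux_def
   by (rule Bochner_Integration.integral_diff) (intro space_flux(1) interval_measure step'i ker(1); simp)+
  finally show ?thesis using balance[OF t d[of n] c K z[of _ n]] by linarith
 qed
 moreover have "space_flux {0..0} step' = 0"
  using space_flux(2)[of "{0..0}" step'] step'i by simp
 moreover have "(%n. space_flux {0..t} step'
   - (((LINT y|lborel. r t y * ph n y) + (\<Sum>y\<in>X. m y t * ph n y)) - ((LINT y|lborel. r 0 y * ph n y) + (\<Sum>y\<in>X. m y 0 * ph n y))))
  ---> space_flux {0..t} step'
   - (((LINT y|lborel. r t y * cut z y) + (\<Sum>y\<in>X. m y t * cut z y)) - ((LINT y|lborel. r 0 y * cut z y) + (\<Sum>y\<in>X. m y 0 * cut z y)))"
  by (intro tendsto_diff tendsto_const L t order_refl)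
 ultimately show ?thesis unfolding pot_def fst_conv snd_conv by (simp only: diff_diff_eq2 diff_add_eq add_0 diff_0_right) (simp add: add.commute)
qed

lemma increment_limit:
 assumes "0 <= t" "t <= t'"
 shows "(%n. space_flux {t<..t'} (ker n z)) ---> pot (z, t) - pot (z, t')"
proof -
 have "(%n. space_flux {0..t'} (ker n z) - space_flux {0..t} (ker n z)) ---> (pot (z, 0) - pot (z, t')) - (pot (z, 0) - pot (z, t))"
  using assms by (intro tendsto_diff time_limit) auto
 then show ?thesis using space_flux_diff[OF assms ker(1)] by simp
qed

lemma flux_bound:
 assumes "t <= t'" shows "\<bar>space_flux {t<..t'} (ker n z)\<bar> <= C * (t' - t)"
proof -
 have "\<bar>space_flux {t<..t'} (ker n z)\<bar> <= C * measure lborel {t<..t'} * (LINT x|lborel. \<bar>ker n z x\<bar>)"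
  by (rule space_flux(2)[OF _ interval_measure(2) ker(1)]) simp
 also have "(%x. \<bar>ker n z x\<bar>) = ker n z" by (intro ext abs_of_nonneg ker(3))
 finally show ?thesis using assms by (simp only: ker(2) measure_lborel_Ioc mult_1_right)
qed

lemma pot_lip:
 assumes "0 <= t" "0 <= t'"
 shows "\<bar>pot (x, t) - pot (x, t')\<bar> <= C * \<bar>t - t'\<bar>"
proof -
 have *: "\<bar>pot (x, t) - pot (x, t')\<bar> <= C * (t' - t)" if "0 <= t" "t <= t'" for t t'
  by (rule LIMSEQ_le_const2[OF tendsto_rabs[OF increment_limit[OF that]]]) (use flux_bound[OF that(2)] in blast)
 show ?thesis
 proof (cases "t <= t'")
  case True then show ?thesis using *[of t t'] assms by simp
 next
  case False
  then have "\<bar>pot (x, t') - pot (x, t)\<bar> <= C * (t - t')" using * assms by simp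
  then show ?thesis using False by (simp add: abs_minus_commute)
 qed
qed

lemma ker_primitive:
 assumes "x <= y"
 shows "(LINT xi|lborel. indicator {x..y} xi * ker n xi a) = step ((a - x) / wid n - 1) - step ((a - y) / wid n - 1)"
proof -
 have "has_bochner_integral lborel (%xi. ker n xi a * indicator {x..y} xi)
   (- step ((a - y) / wid n - 1) - - step ((a - x) / wid n - 1))"
 proof (rule has_bochner_integral_FTC_Icc_real[OF assms])
  fix xi :: real
  show "((%xi. - step ((a - xi) / wid n - 1)) has_real_derivative ker n xi a) (at xi)"
   by (auto intro!: derivative_eq_intros simp: algebra_simps)
  have "cont (%xi. ker n xi a)" by (intro continuous_intros) auto
  then show "isCont (%xi. ker n xi a) xi" by (simp add: continuous_on_eq_continuous_at)
 qed
 then have "(LINT xi|lborel. ker n xi a * indicator {x..y} xi) = step ((a - x) / wid n - 1) - step ((a - y) / wid n - 1)"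
  by (simp add: has_bochner_integral_iff)
 then show ?thesis by (simp only: mult.commute)
qed

lemma flux_Fubini:
 assumes "x <= y" "t <= t'"
 shows "(%xi. space_flux {t<..t'} (ker n xi)) \<in> BM"
  and "(LINT xi|lborel. indicator {x..y} xi * space_flux {t<..t'} (ker n xi))
   = space_flux {t<..t'} (%a. step ((a - x) / wid n - 1) - step ((a - y) / wid n - 1))"
proof -
 define G where "G p = indicator {t<..t'} (snd (snd p)) * (H (v (snd p)) * ker n (fst p) (fst (snd p)))" for p :: "real \<times> real \<times> real"
 have f1: "(%p::real \<times> real \<times> real. fst p) \<in> BM" and f2: "(%p::real \<times> real \<times> real. snd p) \<in> BM"
  and f3: "(%p::real \<times> real \<times> real. snd (snd p)) \<in> BM"
  by (intro borel_measurable_continuous_onI continuous_intros)+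
 have k: "(%p::real \<times> real \<times> real. ker n (fst p) (fst (snd p))) \<in> BM"
  by (intro borel_measurable_continuous_onI continuous_intros) auto
 have Hv: "(%w. H (v w)) \<in> BM" by measurable
 have Gm: "G \<in> BM"
  unfolding G_def[abs_def]
  by (intro borel_measurable_times measurable_compose[OF f3 borel_measurable_indicator] measurable_compose[OF f2 Hv] k) auto
 have "(%xi. LINT w|lborel. G (xi, w)) \<in> LM"
  by (rule lborel.borel_measurable_lebesgue_integral) (use Gm in \<open>simp add: lborel_prod case_prod_unfold\<close>)
 then show "(%xi. space_flux {t<..t'} (ker n xi)) \<in> BM"
  by (simp add: G_def space_flux_def)
 have im: "(%p::real \<times> real \<times> real. indicator {x..y} (fst p) :: real) \<in> BM"
  by (rule measurable_compose[OF f1 borel_measurable_indicator]) auto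
 define S where "S = {x..y} \<times> {x..y + 2} \<times> {t..t'}"
 have S: "compact S" unfolding S_def by (intro compact_Times compact_Icc)
 have bd: "\<bar>indicator {x..y} (fst p) * G p\<bar> <= (C * (2 / wid n)) * indicator S p" for p
 proof (cases "p \<in> S")
  case True
  have "\<bar>ker n (fst p) (fst (snd p))\<bar> <= 2 / wid n"
   unfolding abs_of_nonneg[OF ker(3)] by (rule divide_right_mono[OF step'_bounds(2)]) simp
  then have "\<bar>H (v (snd p))\<bar> * \<bar>ker n (fst p) (fst (snd p))\<bar> <= C * (2 / wid n)"
   by (intro mult_mono H_bound C_nonneg) auto
  moreover have "0 <= C * (2 / wid n)" using C_nonneg by simp
  ultimately show ?thesis using True by (auto simp: G_def abs_mult indicator_def)
 next
  case False
  have "indicator {x..y} (fst p) * G p = 0"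
  proof (rule ccontr)
   assume nz: "indicator {x..y} (fst p) * G p \<noteq> 0"
   then have 1: "fst p \<in> {x..y}" "snd (snd p) \<in> {t<..t'}" and 2: "step' ((fst (snd p) - fst p) / wid n - 1) \<noteq> 0"
    by (auto simp: G_def indicator_def split: if_splits)
   from 2 have 3: "0 < (fst (snd p) - fst p) / wid n - 1" "(fst (snd p) - fst p) / wid n - 1 < 1"
    using step'_eq_0[of "(fst (snd p) - fst p) / wid n - 1"] by (meson not_less)+
   then have pos: "1 < (fst (snd p) - fst p) * real (Suc n)" "(fst (snd p) - fst p) * real (Suc n) < 2" by simp_all
   have "0 < fst (snd p) - fst p"
   proof (rule ccontr)
    assume "\<not> 0 < fst (snd p) - fst p"
    then have "(fst (snd p) - fst p) * real (Suc n) <= 0" by (intro mult_nonpos_nonneg) auto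
    then show False using pos by linarith
   qed
   then have "(fst (snd p) - fst p) * 1 <= (fst (snd p) - fst p) * real (Suc n)" by (intro mult_left_mono) auto
   from order.strict_trans1[OF this pos(2)] have "fst (snd p) - fst p < 2" by simp
   then have "p \<in> S" using 1 \<open>0 < fst (snd p) - fst p\<close> by (cases p) (auto simp: S_def)
   then show False using False by simp
  qed
  then show ?thesis using False by simp
 qed
 have iS: "integ (%p. (C * (2 / wid n)) * indicator S p)"
  using emeasure_compact_finite[OF S] S by (intro integrable_mult_right) (simp add: compact_imp_closed)
 have i: "integ (%p. indicator {x..y} (fst p) * G p)"
 proof (rule Bochner_Integration.integrable_bound[OF iS])
  show "AE p in lborel. norm (indicator {x..y} (fst p) * G p) <= norm (C * (2 / wid n) * indicator S p)"
   unfolding real_norm_def by (intro AE_I2 order_trans[OF bd abs_ge_self])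
  show "(%p. indicator {x..y} (fst p) * G p) \<in> LM" using im Gm by simp
 qed
 have "(LINT xi|lborel. indicator {x..y} xi * space_flux {t<..t'} (ker n xi)) = (LINT xi|lborel. LINT w|lborel. indicator {x..y} xi * G (xi, w))"
  unfolding space_flux_def by (simp add: G_def)
 also have "\<dots> = (LINT w|lborel. LINT xi|lborel. indicator {x..y} xi * G (xi, w))"
  using lborel_pair.Fubini_integral[of "%xi w. indicator {x..y} xi * G (xi, w)"] i
  by (simp add: lborel_prod case_prod_unfold)
 also have "\<dots> = (LINT w|lborel. indicator {t<..t'} (snd w) * (H (v w) * (LINT xi|lborel. indicator {x..y} xi * ker n xi (fst w))))"
 proof (rule LINT_cong[OF refl])
  fix w :: "real \<times> real"
  have "(%xi. indicator {x..y} xi * G (xi, w)) = (%xi. (indicator {t<..t'} (snd w) * H (v w)) * (indicator {x..y} xi * ker n xi (fst w)))"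
   by (simp add: G_def mult_ac)
  then show "(LINT xi|lborel. indicator {x..y} xi * G (xi, w))
    = indicator {t<..t'} (snd w) * (H (v w) * (LINT xi|lborel. indicator {x..y} xi * ker n xi (fst w)))"
   by (simp only: integral_mult_right_zero mult.assoc)
 qed
 finally show "(LINT xi|lborel. indicator {x..y} xi * space_flux {t<..t'} (ker n xi))
   = space_flux {t<..t'} (%a. step ((a - x) / wid n - 1) - step ((a - y) / wid n - 1))"
  unfolding space_flux_def ker_primitive[OF assms(1)] .
qed

text \<open>Integrating the smoothed flux through \<open>xi\<close> over \<open>xi\<close> in an interval turns
 the kernel into a difference of two steps, which tends to the indicator of the interval.\<close>

lemma pot_time_derivative:
 assumes "x <= y" "0 <= t" "t <= t'"
 shows "integral {x..y} (%xi. pot (xi, t') - pot (xi, t)) = - (LINT z:{x..y} \<times> {t..t'}|lborel. H (v z))"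
proof -
 let ?f = "%n xi. space_flux {t<..t'} (ker n xi)"
 let ?D = "%xi. pot (xi, t) - pot (xi, t')"
 let ?A = "%n a. step ((a - x) / wid n - 1) - step ((a - y) / wid n - 1)"
 note fm = flux_Fubini(1)[OF assms(1,3)]
 have Dm: "?D \<in> BM"
  by (rule borel_measurable_LIMSEQ_real[OF increment_limit[OF assms(2,3)] fm])
 have iI: "integ (%xi. (C * (t' - t)) * indicator {x..y} xi :: real)"
  by (intro integrable_mult_right interval_measure)
 have 1: "(%n. LINT xi|lborel. indicator {x..y} xi * ?f n xi) ---> (LINT xi|lborel. indicator {x..y} xi * ?D xi)"
  and iD: "integ (%xi. indicator {x..y} xi * ?D xi)"
 proof -
  have c: "AE xi in lborel. (%n. indicator {x..y} xi * ?f n xi) ---> indicator {x..y} xi * ?D xi"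
   by (intro AE_I2 tendsto_mult_left increment_limit assms(2,3))
  have d: "\<bar>indicator {x..y} xi * ?f n xi\<bar> <= (C * (t' - t)) * indicator {x..y} xi" for n xi
   using flux_bound[OF assms(3), of xi n] by (simp add: indicator_def)
  have m1: "(%xi. indicator {x..y} xi * ?D xi) \<in> LM" using Dm by simp
  have m2: "(%xi. indicator {x..y} xi * ?f n xi) \<in> LM" for n using fm[of n] by simp
  show "(%n. LINT xi|lborel. indicator {x..y} xi * ?f n xi) ---> (LINT xi|lborel. indicator {x..y} xi * ?D xi)"
   by (rule dominated_convergence_real(1)[OF m1 m2 iI c d])
  show "integ (%xi. indicator {x..y} xi * ?D xi)"
   by (rule dominated_convergence_real(2)[OF m1 m2 iI c d])
 qed
 have iB: "integ (indicator {x..y + 2} :: real => real)" by (rule interval_measure)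
 have 2: "(%n. space_flux {t<..t'} (?A n)) ---> (LINT w|lborel. indicator {t<..t'} (snd w) * (H (v w) * indicator {x<..y} (fst w)))"
  unfolding space_flux_def
 proof (rule dominated_convergence_real(1)[where w="%w. C * (indicator {x..y + 2} (fst w) * indicator {t<..t'} (snd w))"])
  have Hv: "(%w. H (v w)) \<in> LM" by measurable
  have m1: "(%w::real\<times>real. indicator {t<..t'} (snd w) :: real) \<in> LM"
   using measurable_compose[OF fst_snd_borel(2) borel_measurable_indicator[of "{t<..t'}" borel]] by simp
  have m2: "(%w::real\<times>real. indicator {x<..y} (fst w) :: real) \<in> LM"
   using measurable_compose[OF fst_snd_borel(1) borel_measurable_indicator[of "{x<..y}" borel]] by simp
  have m3: "(%w::real\<times>real. ?A n (fst w)) \<in> LM" for n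
  proof -
   have "cont (?A n)" by (intro continuous_intros) auto
   from measurable_fst_snd_continuous(1)[OF this] show ?thesis by simp
  qed
  show "(%w. indicator {t<..t'} (snd w) * (H (v w) * indicator {x<..y} (fst w))) \<in> LM"
   by (intro borel_measurable_times m1 m2 Hv)
  show "(%w. indicator {t<..t'} (snd w) * (H (v w) * ?A n (fst w))) \<in> LM" for n
   by (intro borel_measurable_times m1 m3 Hv)
  show "integ (%w::real \<times> real. C * (indicator {x..y + 2} (fst w) * indicator {t<..t'} (snd w)))"
   by (intro integrable_mult_right integrable_product_lborel(1) iB interval_measure(4))
  have l: "(%n. ?A n a) ---> indicator {x<..y} a" for a
  proof -
   have "(%n. ?A n a) ---> indicator {x<..} a - indicator {y<..} a" by (intro tendsto_diff step_limit)
   moreover have "indicator {x<..} a - indicator {y<..} a = (indicator {x<..y} a :: real)" using assms(1) by (auto simp: indicator_def)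
   ultimately show ?thesis by simp
  qed
  show "AE w in lborel. (%n. indicator {t<..t'} (snd w) * (H (v w) * ?A n (fst w))) ---> indicator {t<..t'} (snd w) * (H (v w) * indicator {x<..y} (fst w))"
   by (intro AE_I2 tendsto_mult_left l)
  fix n and w :: "real \<times> real"
  have "\<bar>?A n a\<bar> <= indicator {x..y + 2} a" for a
  proof (cases "a \<in> {x..y + 2}")
   case True
   then show ?thesis using step_bounds[of "(a - x) / wid n - 1"] step_bounds[of "(a - y) / wid n - 1"]
    by (simp add: abs_le_iff)
  next
   case False
   then have "(a <= x \<and> a <= y) \<or> (x + 2 <= a \<and> y + 2 <= a)" using assms(1) by auto
   then show ?thesis using step_shift_eq_1[of _ a n] step_shift_eq_0[of a _ n] by auto
  qed
  then have "\<bar>H (v w)\<bar> * \<bar>?A n (fst w)\<bar> <= C * indicator {x..y + 2} (fst w)"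
   by (intro mult_mono H_bound C_nonneg) auto
  then have "indicator {t<..t'} (snd w) * (\<bar>H (v w)\<bar> * \<bar>?A n (fst w)\<bar>) <= indicator {t<..t'} (snd w) * (C * indicator {x..y + 2} (fst w))"
   by (rule mult_left_mono) simp
  then show "\<bar>indicator {t<..t'} (snd w) * (H (v w) * ?A n (fst w))\<bar> <= C * (indicator {x..y + 2} (fst w) * indicator {t<..t'} (snd w))"
   by (simp only: abs_mult abs_indicator mult_ac)
 qed
 have 3: "(LINT w|lborel. indicator {t<..t'} (snd w) * (H (v w) * indicator {x<..y} (fst w))) = (LINT z:{x..y} \<times> {t..t'}|lborel. H (v z))"
  unfolding set_lebesgue_integral_def
 proof (rule integral_cong_AE)
  have Hv: "(%w. H (v w)) \<in> LM" by measurable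
  have m1: "(%w::real\<times>real. indicator {t<..t'} (snd w) :: real) \<in> LM"
   using measurable_compose[OF fst_snd_borel(2) borel_measurable_indicator[of "{t<..t'}" borel]] by simp
  have m2: "(%w::real\<times>real. indicator {x<..y} (fst w) :: real) \<in> LM"
   using measurable_compose[OF fst_snd_borel(1) borel_measurable_indicator[of "{x<..y}" borel]] by simp
  show "(%w. indicator {t<..t'} (snd w) * (H (v w) * indicator {x<..y} (fst w))) \<in> LM"
   by (intro borel_measurable_times m1 m2 Hv)
  have "({x..y} \<times> {t..t'}) \<in> sets (borel :: (real \<times> real) measure)"
   by (intro borel_closed closed_Times) auto
  then show "(%w. indicator ({x..y} \<times> {t..t'}) w *\<^sub>R H (v w)) \<in> LM"
   using Hv by (intro borel_measurable_scaleR) auto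
  show "AE w in lborel. indicator {t<..t'} (snd w) * (H (v w) * indicator {x<..y} (fst w)) = indicator ({x..y} \<times> {t..t'}) w *\<^sub>R H (v w)"
   using AE_off_lines[of x t] by eventually_elim (auto simp: indicator_def mem_Times_iff)
 qed
 have "(LINT xi|lborel. indicator {x..y} xi * ?D xi) = (LINT z:{x..y} \<times> {t..t'}|lborel. H (v z))"
  using LIMSEQ_unique[OF 1] 2 unfolding flux_Fubini(2)[OF assms(1,3)] 3 by blast
 moreover have "(LINT xi|lborel. indicator {x..y} xi * ?D xi) = integral {x..y} ?D"
  using set_borel_integral_eq_integral(2)[of "{x..y}" ?D] iD unfolding set_integrable_def set_lebesgue_integral_def by simp
 moreover have "integral {x..y} (%xi. pot (xi, t') - pot (xi, t)) = - integral {x..y} ?D"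
  using Henstock_Kurzweil_Integration.integral_neg[of "{x..y}" ?D] by simp
 ultimately show ?thesis by simp
qed

lemma pot_time_cont: "0 <= t ==> continuous_on {t..t'} (%tau. pot (x, tau))"
proof -
 assume t: "0 <= t"
 have "C-lipschitz_on {t..t'} (%tau. pot (x, tau))"
  using t by (intro lipschitz_onI C_nonneg) (auto simp: dist_real_def intro: pot_lip)
 then show ?thesis by (rule lipschitz_on_continuous_on)
qed

text \<open>On an interval without masses the increment of the potential is the integral of the density; Fubini
 integrates this in time.\<close>

lemma pot_space_derivative:
 assumes "x <= y" "0 < t" "t <= t'" and m0: "!!y' tau. y' \<in> X ==> y' \<in> {x..y} ==> tau \<in> {t..t'} ==> m y' tau = 0"
 shows "integral {t..t'} (%tau. pot (y, tau) - pot (x, tau)) = (LINT z:{x..y} \<times> {t..t'}|lborel. v z)"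
proof -
 let ?D = "%tau. pot (y, tau) - pot (x, tau)"
 let ?f = "%xi tau. indicator ({x..y} \<times> {t..t'}) (xi, tau) * v (xi, tau)"
 have sub: "{x..y} \<times> {t..t'} \<subseteq> {x..y} \<times> {0..t'}" using assms(2) by auto
 have clo: "{x..y} \<times> {t..t'} \<in> sets (lborel :: (real \<times> real) measure)" by (simp add: borel_closed closed_Times)
 have "set_integrable lborel ({x..y} \<times> {t..t'}) v" by (rule set_integrable_subset[OF v_int clo sub])
 then have i: "integrable (lborel \<Otimes>\<^sub>M lborel) (%(xi, tau). ?f xi tau)"
  by (simp add: set_integrable_def lborel_prod case_prod_unfold)
 have "(LINT z:{x..y} \<times> {t..t'}|lborel. v z) = (LINT tau|lborel. LINT xi|lborel. ?f xi tau)"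
  using lborel_pair.integral_snd[OF i] by (simp add: lborel_prod case_prod_unfold set_lebesgue_integral_def)
 also have "\<dots> = (LINT tau|lborel. indicator {t..t'} tau *\<^sub>R ?D tau)"
 proof (rule integral_cong_AE)
  show "(%tau. LINT xi|lborel. ?f xi tau) \<in> LM"
   using lborel_pair.integrable_snd[OF i] by (rule borel_measurable_integrable)
  have "continuous_on {t..t'} ?D" using assms(2) by (intro continuous_on_diff pot_time_cont) auto
  then show "(%tau. indicator {t..t'} tau *\<^sub>R ?D tau) \<in> LM"
   using borel_measurable_continuous_on_indicator[of "{t..t'}" ?D] by simp
  show "AE tau in lborel. (LINT xi|lborel. ?f xi tau) = indicator {t..t'} tau *\<^sub>R ?D tau"
   using v_slice
  proof eventually_elim
   case (elim tau)
   show ?case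
   proof (cases "tau \<in> {t..t'}")
    case True
    then have tau: "0 < tau" using assms(2) by auto
    have ri: "set_integrable lborel {x..y} (r tau)" using tau by (intro r_int) auto
    have m1: "(%xi. v (xi, tau)) \<in> BM"
     by (rule measurable_compose[OF _ v_meas]) (intro borel_measurable_continuous_onI continuous_intros)
    have m2: "r tau \<in> BM" using tau by (intro r_meas) auto
    have ae: "AE xi in lborel. v (xi, tau) = r tau xi" using elim tau by blast
    have "(LINT xi|lborel. ?f xi tau) = (LINT xi:{x..y}|lborel. r tau xi)"
     unfolding set_lebesgue_integral_def
    proof (rule integral_cong_AE)
     show "AE xi in lborel. ?f xi tau = indicator {x..y} xi *\<^sub>R r tau xi"
      using ae by eventually_elim (use True in \<open>auto simp: indicator_def\<close>)
     have "(%xi. ?f xi tau) = (%xi. indicator {x..y} xi * v (xi, tau))" using True by (auto simp: indicator_def fun_eq_iff)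
     then show "(%xi. ?f xi tau) \<in> LM" using m1 by simp
    qed (use m2 in simp)
    also have "\<dots> = (LINT xi:{x<..y}|lborel. r tau xi)"
     unfolding half_open_integral[OF ri] by (rule set_borel_integral_eq_integral(2)[OF ri])
    also have "\<dots> = ?D tau"
    proof -
     have "(\<Sum>y'\<in>X. m y' tau * indicator {x<..y} y') = 0"
      using m0[OF _ _ True] by (intro sum.neutral) (auto simp: indicator_def)
     then show ?thesis using pot_diff[of tau x y] tau assms(1) by simp
    qed
    finally show ?thesis using True by simp
   next
    case False
    then have "(%xi. ?f xi tau) = (%xi. 0)" by auto
    then show ?thesis using False by simp
   qed
  qed
 qed
 also have "\<dots> = integral {t..t'} ?D"
 proof -
  have "set_integrable lborel {t..t'} ?D"
   by (rule borel_integrable_atLeastAtMost') (use assms(2) in \<open>intro continuous_on_diff pot_time_cont; simp\<close>)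
  from set_borel_integral_eq_integral(2)[OF this] show ?thesis by (simp add: set_lebesgue_integral_def)
 qed
 finally show ?thesis by simp
qed

lemma pot_right:
 assumes t: "0 <= t" shows "((%x. pot (x, t)) \<longlongrightarrow> pot (y, t)) (at_right y)"
proof -
 have "set_integrable lborel {y..y + 1} (r t)" using t by (intro r_int) auto
 then have "r t integrable_on {y..y + 1}" by (rule set_borel_integral_eq_integral(1))
 then have "continuous_on {y..y + 1} (%x. integral {y..x} (r t))" by (rule indefinite_integral_continuous_1)
 then have "((%x. integral {y..x} (r t)) \<longlongrightarrow> integral {y..y} (r t)) (at y within {y..y + 1})"
  unfolding continuous_on_def by (rule bspec[where x=y]) simp
 then have l0: "((%x. integral {y..x} (r t)) \<longlongrightarrow> 0) (at_right y)"
  using at_within_Icc_at_right[of y "y + 1"] by simp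
 have "eventually (%x. x \<in> {y<..<y + 1}) (at_right y)" by (rule eventually_at_right_real) simp
 moreover have "eventually (%x. \<forall>y'\<in>X. y' \<notin> {y<..x}) (at_right y)"
 proof (rule eventually_ball_finite[OF X_fin], intro ballI)
  fix y' assume "y' \<in> X"
  show "eventually (%x. y' \<notin> {y<..x}) (at_right y)"
  proof (cases "y < y'")
   case True
   have "eventually (%x. x \<in> {y<..<y'}) (at_right y)" by (rule eventually_at_right_real[OF True])
   then show ?thesis by eventually_elim auto
  qed simp
 qed
 ultimately have "eventually (%x. pot (y, t) + integral {y..x} (r t) = pot (x, t)) (at_right y)"
 proof eventually_elim
  case (elim x)
  have "(\<Sum>y'\<in>X. m y' t * indicator {y<..x} y') = 0" using elim(2) by (intro sum.neutral) auto
  moreover have "set_integrable lborel {y..x} (r t)" using t by (intro r_int) auto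
  ultimately show ?case using pot_diff[OF t, of y x] elim(1) half_open_integral[of y x "r t"] by simp
 qed
 moreover have "((%x. pot (y, t) + integral {y..x} (r t)) \<longlongrightarrow> pot (y, t)) (at_right y)"
  using tendsto_add[OF tendsto_const l0] by simp
 ultimately show ?thesis by (rule Lim_transform_eventually[rotated])
qed

definition mass :: "real => real => real" where "mass y t = (if y \<in> X then m y t else 0)"

lemma pot_left:
 assumes t: "0 <= t" shows "((%x. pot (x, t)) \<longlongrightarrow> pot (y, t) - mass y t) (at_left y)"
proof -
 have "set_integrable lborel {y - 1..y} (r t)" using t by (intro r_int) auto
 then have "r t integrable_on {y - 1..y}" by (rule set_borel_integral_eq_integral(1))
 then have "continuous_on {y - 1..y} (%x. integral {x..y} (r t))" by (rule indefinite_integral_continuous_1')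
 then have "((%x. integral {x..y} (r t)) \<longlongrightarrow> integral {y..y} (r t)) (at y within {y - 1..y})"
  unfolding continuous_on_def by (rule bspec[where x=y]) simp
 then have l0: "((%x. integral {x..y} (r t)) \<longlongrightarrow> 0) (at_left y)"
  using at_within_Icc_at_left[of "y - 1" y] by simp
 have "eventually (%x. x \<in> {y - 1<..<y}) (at_left y)" by (rule eventually_at_left_real) simp
 moreover have "eventually (%x. \<forall>y'\<in>X. y' \<notin> {x<..<y}) (at_left y)"
 proof (rule eventually_ball_finite[OF X_fin], intro ballI)
  fix y' assume "y' \<in> X"
  show "eventually (%x. y' \<notin> {x<..<y}) (at_left y)"
  proof (cases "y' < y")
   case True
   have "eventually (%x. x \<in> {y'<..<y}) (at_left y)" by (rule eventually_at_left_real[OF True])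
   then show ?thesis by eventually_elim auto
  qed simp
 qed
 ultimately have "eventually (%x. (pot (y, t) - mass y t) - integral {x..y} (r t) = pot (x, t)) (at_left y)"
 proof eventually_elim
  case (elim x)
  have "(\<Sum>y'\<in>X. m y' t * indicator {x<..y} y') = (\<Sum>y'\<in>X. if y' = y then m y' t else 0)"
   using elim by (intro sum.cong) (auto simp: indicator_def)
  also have "\<dots> = mass y t" using X_fin by (simp add: mass_def)
  finally have "(\<Sum>y'\<in>X. m y' t * indicator {x<..y} y') = mass y t" .
  moreover have "set_integrable lborel {x..y} (r t)" using t by (intro r_int) auto
  ultimately show ?case using pot_diff[OF t, of x y] elim(1) half_open_integral[of x y "r t"] by simp
 qed
 moreover have "((%x. (pot (y, t) - mass y t) - integral {x..y} (r t)) \<longlongrightarrow> pot (y, t) - mass y t) (at_left y)"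
  using tendsto_diff[OF tendsto_const l0] by simp
 ultimately show ?thesis by (rule Lim_transform_eventually[rotated])
qed

lemma pot_traces:
 assumes "0 <= s"
 shows "trace_lim s T y 1 pot (%t. pot (y, t))" "trace_lim s T y (- 1) pot (%t. pot (y, t) - mass y t)"
  and "0 <= t ==> 0 <= t' ==> \<bar>mass y t - mass y t'\<bar> <= 2 * C * \<bar>t - t'\<bar>"
proof -
 have l: "\<bar>pot (x, t) - pot (x, t')\<bar> <= C * \<bar>t - t'\<bar>" if "0 <= s" "t \<in> {s..T}" "t' \<in> {s..T}" for x t t' s T
  using that by (intro pot_lip) auto
 show "trace_lim s T y 1 pot (%t. pot (y, t))"
  by (rule uniform_trace(1)[OF right_neighbourhood _ C_nonneg l[OF assms]])
   (use assms pot_right in auto)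
 show "trace_lim s T y (- 1) pot (%t. pot (y, t) - mass y t)"
  by (rule uniform_trace(1)[OF left_neighbourhood _ C_nonneg l[OF assms]])
   (use assms pot_left in auto)
 assume t: "0 <= t" "0 <= t'"
 have "\<bar>(pot (y, t) - mass y t) - (pot (y, t') - mass y t')\<bar> <= C * \<bar>t - t'\<bar>"
  by (rule uniform_trace(2)[where s=0 and T="max t t'", OF left_neighbourhood _ C_nonneg l])
   (use t pot_left in auto)
 moreover have "\<bar>pot (y, t) - pot (y, t')\<bar> <= C * \<bar>t - t'\<bar>" by (rule pot_lip[OF t])
 ultimately show "\<bar>mass y t - mass y t'\<bar> <= 2 * C * \<bar>t - t'\<bar>" by linarith
qed

lemma pot_cont:
 assumes s: "0 <= s" and m0: "!!x t. x \<in> R ==> t \<in> {s..T} ==> mass x t = 0"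
 shows "continuous_on (R \<times> {s..T}) pot"
 unfolding continuous_on_def
proof (rule ballI)
 fix z0 assume z0: "z0 \<in> R \<times> {s..T}"
 let ?F = "at z0 within R \<times> {s..T}"
 define x0 t0 where "x0 = fst z0" and "t0 = snd z0"
 have t0: "0 <= t0" "mass x0 t0 = 0" using z0 s m0 by (auto simp: x0_def t0_def)
 have "((%x. pot (x, t0)) \<longlongrightarrow> pot (x0, t0)) (at x0)"
  using pot_left[OF t0(1), of x0] pot_right[OF t0(1), of x0] t0(2) by (auto simp: filterlim_split_at)
 then have cx: "isCont (%x. pot (x, t0)) x0" by (simp add: isCont_def)
 have fz: "((%z. fst z) \<longlongrightarrow> x0) ?F" "((%z. snd z) \<longlongrightarrow> t0) ?F"
  unfolding x0_def t0_def by (intro tendsto_intros)+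
 have 1: "((%z. pot (fst z, t0)) \<longlongrightarrow> pot (x0, t0)) ?F"
  by (rule isCont_tendsto_compose[OF cx fz(1)])
 have b0: "((%z. C * \<bar>snd z - t0\<bar>) \<longlongrightarrow> 0) ?F"
 proof -
  have "((%z. C * \<bar>snd z - t0\<bar>) \<longlongrightarrow> C * \<bar>t0 - t0\<bar>) ?F" by (intro tendsto_intros fz)
  then show ?thesis by simp
 qed
 have 2: "((%z. pot z - pot (fst z, t0)) \<longlongrightarrow> 0) ?F"
 proof (rule Lim_null_comparison[OF _ b0])
  have "norm (pot z - pot (fst z, t0)) <= C * \<bar>snd z - t0\<bar>" if "z \<in> R \<times> {s..T}" for z
   using pot_lip[of "snd z" t0 "fst z"] that s t0 by auto
  then show "eventually (%z. norm (pot z - pot (fst z, t0)) <= C * \<bar>snd z - t0\<bar>) ?F"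
   unfolding eventually_at_topological by blast
 qed
 have "((%z. (pot z - pot (fst z, t0)) + pot (fst z, t0)) \<longlongrightarrow> 0 + pot (x0, t0)) ?F" by (rule tendsto_add[OF 2 1])
 then show "(pot \<longlongrightarrow> pot z0) ?F" by (simp add: x0_def t0_def)
qed

end

section \<open>Entropy solutions with finitely many point masses\<close>

lemma pairing_scale:
 "pairing \<mu> (%x. ph x * a) = pairing \<mu> ph * a" "abs_pairing \<mu> (%x. ph x * a) = abs_pairing \<mu> ph * a"
 unfolding pairing_def abs_pairing_def by (simp_all add: left_diff_distrib distrib_right)

lemma abs_pairing_dominates:
 assumes "\<bar>sig\<bar> = 1" "!!x. 0 <= ph x"
 shows "0 <= abs_pairing \<mu> ph + sig * pairing \<mu> ph"
proof -
 have "0 <= (LINT x|pos_part_on UNIV \<mu>. ph x)" "0 <= (LINT x|neg_part_on UNIV \<mu>. ph x)"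
  using assms(2) by (intro integral_nonneg_AE AE_I2; simp)+
 then show ?thesis using sign_cases[OF assms(1)] by (auto simp: pairing_def abs_pairing_def)
qed

lemma C1_test_product:
 assumes ph: "!!x. (ph has_real_derivative ph' x) (at x)" "cont ph'"
  and K: "compact K" "!!x. x \<notin> K ==> ph x = 0"
  and \<chi>: "!!t. (\<chi>0 has_real_derivative \<chi>' t) (at t)" "cont \<chi>'"
 shows "C1_test T (%z. ph (fst z) * \<chi>0 (snd z)) (%z. ph' (fst z) * \<chi>0 (snd z)) (%z. ph (fst z) * \<chi>' (snd z))"
proof -
 note cph = deriv_imp_continuous_on[OF ph(1), of UNIV] and c\<chi> = deriv_imp_continuous_on[OF \<chi>(1), of UNIV]
 have fs: "continuous_on S (%z::real \<times> real. fst z)" "continuous_on S (%z::real \<times> real. snd z)" for S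
  by (intro continuous_intros)+
 note cc = continuous_on_comp_UNIV[OF cph fs(1)] continuous_on_comp_UNIV[OF c\<chi> fs(2)]
  continuous_on_comp_UNIV[OF ph(2) fs(1)] continuous_on_comp_UNIV[OF \<chi>(2) fs(2)]
 show ?thesis
  unfolding C1_test_def cont_test_def
 proof (intro conjI exI[of _ K] exI[of _ "%z. ph' (fst z) * \<chi>' (snd z)"] allI ballI impI)
  show "((%s. ph (fst (x, s)) * \<chi>0 (snd (x, s))) has_real_derivative ph (fst (x, t)) * \<chi>' (snd (x, t))) (at t within {0..T})" for x t
   using DERIV_cmult[OF has_field_derivative_at_within[OF \<chi>(1)]] by simp
  show "((%y. ph (fst (y, t)) * \<chi>0 (snd (y, t))) has_real_derivative ph' (fst (x, t)) * \<chi>0 (snd (x, t))) (at x)" for x t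
   using DERIV_cmult_right[OF ph(1)] by simp
  show "((%y. ph (fst (y, t)) * \<chi>' (snd (y, t))) has_real_derivative ph' (fst (x, t)) * \<chi>' (snd (x, t))) (at x)" for x t
   using DERIV_cmult_right[OF ph(1)] by simp
 qed (use K in \<open>auto intro!: continuous_on_mult cc\<close>)
qed

lemma abs_scaled_diff:
 fixes k p p' e :: real
 assumes "0 <= k" "\<bar>p - p'\<bar> <= e"
 shows "\<bar>k * p - p' * k\<bar> <= e * k"
proof -
 have "k * p - p' * k = k * (p - p')" by (simp add: algebra_simps)
 then have "\<bar>k * p - p' * k\<bar> = k * \<bar>p - p'\<bar>" using assms(1) by (simp add: abs_mult)
 also have "\<dots> <= k * e" by (rule mult_left_mono[OF assms(2,1)])
 finally show ?thesis by (simp add: mult.commute)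
qed

lemma kernel_limit:
 fixes p :: "real => real"
 assumes p: "continuous_on {0..} p" and t0: "0 <= t0" "t0 + 2 <= T"
  and i: "!!n. integ (%t. indicator {0<..<T} t * (ker n t0 t * p t))"
 shows "(%n. LINT t|lborel. indicator {0<..<T} t * (ker n t0 t * p t)) ---> p t0"
proof (rule LIMSEQ_I)
 fix e :: real assume e: "0 < e"
 from p t0(1) e obtain d where d: "d > 0" "!!t. t \<in> {0..} ==> dist t t0 < d ==> dist (p t) (p t0) < e / 2"
  unfolding continuous_on_iff by (metis atLeast_iff half_gt_zero)
 obtain N :: nat where N: "2 / d < real N" using reals_Archimedean2 by blast
 have "norm ((LINT t|lborel. indicator {0<..<T} t * (ker n t0 t * p t)) - p t0) < e" if n: "n \<ge> N" for n
 proof -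
  have "2 < d * real N" using N d(1) by (simp add: field_simps)
  also have "\<dots> <= d * real (Suc n)" using d(1) n by (intro mult_left_mono) auto
  finally have w: "2 * wid n < d" by (simp add: field_simps)
  have w1: "2 * wid n <= 2" by (simp add: field_simps)
  have pw: "\<bar>indicator {0<..<T} t * (ker n t0 t * p t) - p t0 * ker n t0 t\<bar> <= e / 2 * ker n t0 t" for t
  proof (cases "t0 < t \<and> t < t0 + 2 * wid n")
   case True
   then have t: "t \<in> {0<..<T}" "t \<in> {0..}" "dist t t0 < d" using t0 w w1 by (auto simp: dist_real_def)
   have "\<bar>p t - p t0\<bar> <= e / 2" using d(2)[OF t(2,3)] by (simp add: dist_real_def)
   from abs_scaled_diff[OF ker(3) this] show ?thesis by (simp only: indicator_simps(1)[OF t(1)] mult_1_left)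
  next
   case False
   have "(t - t0) / wid n - 1 <= 0 \<or> 1 <= (t - t0) / wid n - 1"
   proof (cases "t <= t0")
    case True
    then have "(t - t0) * real (Suc n) <= 0" by (intro mult_nonpos_nonneg) auto
    then show ?thesis by simp
   next
    case f: False
    with False have "t0 + 2 * wid n <= t" by simp
    then have "2 * wid n <= t - t0" by simp
    then have "2 * wid n / wid n <= (t - t0) / wid n" by (rule divide_right_mono) simp
    moreover have "2 * wid n / wid n = 2" by (rule nonzero_mult_div_cancel_right) simp
    ultimately show ?thesis by linarith
   qed
   then have "step' ((t - t0) / wid n - 1) = 0" by (rule step'_eq_0)
   then show ?thesis by (simp del: divide_divide_eq_right)
  qed
  have "\<bar>(LINT t|lborel. indicator {0<..<T} t * (ker n t0 t * p t)) - (LINT t|lborel. p t0 * ker n t0 t)\<bar>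
    <= (LINT t|lborel. e / 2 * ker n t0 t)"
   by (rule abs_integral_diff_le[OF i _ _ pw]) (intro integrable_mult_right ker(1))+
  also have "(LINT t|lborel. e / 2 * ker n t0 t) = e / 2" by (simp only: integral_mult_right_zero ker(2) mult_1_right)
  also have "(LINT t|lborel. p t0 * ker n t0 t) = p t0" by (simp only: integral_mult_right_zero ker(2) mult_1_right)
  finally show ?thesis using e by simp
 qed
 then show "\<exists>N. \<forall>n\<ge>N. norm ((LINT t|lborel. indicator {0<..<T} t * (ker n t0 t * p t)) - p t0) < e" by blast
qed

locale entropy_data =
 fixes H :: "real => real" and u0 :: "real set => real" and u :: "real => real set => real"
  and ur :: "real \<times> real => real" and C :: real and X :: "real set" and c :: "real => real"
 assumes H_cont: "cont H" and H_bound: "!!xi. \<bar>H xi\<bar> <= C"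
  and u0: "signed_radon u0" and X_fin: "finite X" and c_nz: "!!y. y \<in> X ==> c y \<noteq> 0"
  and s0: "!!K. compact K ==> singular_part u0 K = (\<Sum>y\<in>X. c y * indicator K y)"
  and uc: "cont_signed_radon u" and reg: "is_regular_part u ur" and sol: "global_entropy_solution H u0 u ur"
  and compat: "!!y. y \<in> X ==> compatible_at H u ur y (c y)"
begin

lemma H_meas [measurable]: "H \<in> BM"
 by (rule borel_measurable_continuous_onI[OF H_cont])

lemma C_nonneg: "0 <= C" using H_bound[of 0] by linarith

lemma ur_meas [measurable]: "ur \<in> BM" using reg by (simp add: is_regular_part_def)

lemma u_signed: "0 <= t ==> signed_radon (u t)" using uc by (simp add: cont_signed_radon_def)

text \<open>Continuity in time of the slices is continuity in variation, and whatever is Lipschitz in variation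
 inherits it.\<close>

lemma controlled_cont:
 assumes K: "compact K" and d: "!!t t0. 0 <= t ==> 0 <= t0 ==> \<bar>f t - f t0\<bar> <= M * var_norm K (%E. u t E - u t0 E)"
 shows "continuous_on {0..} f"
 unfolding continuous_on_def
proof
 fix t0 :: real assume t0: "t0 \<in> {0..}"
 let ?F = "at t0 within {0..}"
 have "((%t. var_norm K (%E. u t E - u t0 E)) \<longlongrightarrow> 0) ?F" using uc K t0 by (simp add: cont_signed_radon_def)
 then have l: "((%t. M * var_norm K (%E. u t E - u t0 E)) \<longlongrightarrow> 0) ?F" by (rule tendsto_mult_right_zero)
 have "((%t. f t - f t0) \<longlongrightarrow> 0) ?F"
 proof (rule Lim_null_comparison[OF _ l])
  show "eventually (%t. norm (f t - f t0) <= M * var_norm K (%E. u t E - u t0 E)) ?F"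
   unfolding eventually_at_filter by (intro always_eventually allI impI) (use d t0 in auto)
 qed
 then show "(f \<longlongrightarrow> f t0) ?F" by (rule LIM_zero_cancel)
qed

lemma pairing_cont:
 assumes ph: "bdd_supp K M ph"
 shows "continuous_on {0..} (%t. pairing (u t) ph)" "continuous_on {0..} (%t. pairing (singular_part (u t)) ph)"
  "continuous_on {0..} (%t. abs_pairing (singular_part (u t)) ph)"
proof -
 note cc = controlled_cont[OF bdd_suppD(1)[OF ph]]
 show "continuous_on {0..} (%t. pairing (u t) ph)" by (rule cc[OF var_norm_bounds(1)[OF u_signed u_signed ph]])
 show "continuous_on {0..} (%t. pairing (singular_part (u t)) ph)" by (rule cc[OF var_norm_bounds(2)[OF u_signed u_signed ph]])
 show "continuous_on {0..} (%t. abs_pairing (singular_part (u t)) ph)" by (rule cc[OF var_norm_bounds(3)[OF u_signed u_signed ph]])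
qed

lemma var_norm_cont:
 assumes K: "compact K" shows "continuous_on {0..} (%t. var_norm K (u t))"
proof -
 have ph: "bdd_supp K 0 (%_. 0)" using K by (simp add: bdd_supp_def)
 show ?thesis
  by (rule controlled_cont[OF K, where M=1]) (use var_norm_bounds(4)[OF u_signed u_signed ph] in simp)
qed

lemma slice: "AE t in lborel. 0 < t --> (AE x in lborel. ur (x, t) = regular_part (u t) x)"
proof -
 have "AE t in lebesgue_on {0<..}. AE x in lborel. ur (x, t) = regular_part (u t) x"
  using reg by (simp add: is_regular_part_def)
 then have "AE t in lebesgue. t \<in> {0<..} --> (AE x in lborel. ur (x, t) = regular_part (u t) x)"
  by (subst (asm) AE_restrict_space_iff) auto
 then have "AE t in lborel. t \<in> {0<..} --> (AE x in lborel. ur (x, t) = regular_part (u t) x)"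
  unfolding AE_completion_iff .
 then show ?thesis by simp
qed

lemma section_meas: "(%x. ur (x, t)) \<in> BM"
 by (rule measurable_compose[OF _ ur_meas]) (intro borel_measurable_continuous_onI continuous_intros)

text \<open>By continuity in time the total variations of the slices over a compact set are bounded on
 bounded time intervals; by Fubini the density is integrable over rectangles.\<close>

lemma ur_int: "set_integrable lborel ({a..b} \<times> {0..T}) ur"
proof -
 have K: "compact {a..b}" by simp
 have "continuous_on {0..T} (%t. var_norm {a..b} (u t))" by (rule continuous_on_subset[OF var_norm_cont[OF K]]) auto
 then obtain B where B: "0 <= B" "!!t. t \<in> {0..T} ==> \<bar>var_norm {a..b} (u t)\<bar> <= B"
  using bounded_on_compact[OF _ compact_Icc] by blast
 let ?f = "%z. indicator ({a..b} \<times> {0..T}) z *\<^sub>R ur z"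
 have clo: "{a..b} \<times> {0..T} \<in> sets (borel :: (real \<times> real) measure)" by (simp add: borel_closed closed_Times)
 have fm: "?f \<in> LM" using clo by simp
 have "(\<integral>\<^sup>+z. ennreal (norm (?f z)) \<partial>lborel) = (\<integral>\<^sup>+t. \<integral>\<^sup>+x. ennreal (norm (?f (x, t))) \<partial>lborel \<partial>lborel)"
  using lborel_pair.nn_integral_snd[of "%z. ennreal (norm (?f z))"] fm by (simp add: lborel_prod)
 also have "\<dots> <= (\<integral>\<^sup>+t. ennreal B * indicator {0..T} t \<partial>lborel)"
 proof (rule nn_integral_mono_AE)
  show "AE t in lborel. (\<integral>\<^sup>+x. ennreal (norm (?f (x, t))) \<partial>lborel) <= ennreal B * indicator {0..T} t"
   using slice AE_lborel_singleton[of 0]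
  proof eventually_elim
   case (elim t)
   show ?case
   proof (cases "t \<in> {0..T}")
    case True
    then have t: "0 < t" "0 <= t" using elim by auto
    note rf = regular_part_facts[OF u_signed[OF t(2)]]
    have i: "integ (%x. indicator {a..b} x *\<^sub>R regular_part (u t) x)"
     using rf(2)[OF K] by (simp add: set_integrable_def)
    have "(\<integral>\<^sup>+x. ennreal (norm (?f (x, t))) \<partial>lborel) = (\<integral>\<^sup>+x. ennreal (norm (indicator {a..b} x *\<^sub>R regular_part (u t) x)) \<partial>lborel)"
     by (rule nn_integral_cong_AE) (use elim(1)[rule_format, OF t(1)] True in \<open>auto simp: indicator_def\<close>)
    also have "\<dots> = ennreal (LINT x|lborel. norm (indicator {a..b} x *\<^sub>R regular_part (u t) x))"
     by (rule nn_integral_eq_integral[OF integrable_norm[OF i]]) simp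
    also have "(LINT x|lborel. norm (indicator {a..b} x *\<^sub>R regular_part (u t) x)) = (LINT x:{a..b}|lborel. \<bar>regular_part (u t) x\<bar>)"
     unfolding set_lebesgue_integral_def by (rule LINT_cong) (auto simp: indicator_def)
    also have "ennreal (LINT x:{a..b}|lborel. \<bar>regular_part (u t) x\<bar>) <= ennreal B"
     using rf(3)[OF K] B(2)[OF True] by (intro ennreal_leI) linarith
    finally show ?thesis using True by simp
   next
    case False
    then have z: "(%x. ennreal (norm (?f (x, t)))) = (%_. 0)" by (auto simp: fun_eq_iff)
    show ?thesis unfolding z by simp
   qed
  qed
 qed
 also have "\<dots> = ennreal B * emeasure lborel {0..T}" by (simp add: nn_integral_cmult_indicator)
 also have "\<dots> < \<infinity>" using interval_measure(1)[of 0 T] by (simp add: ennreal_mult_less_top)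
 finally show ?thesis unfolding set_integrable_def using fm by (intro integrableI_bounded) auto
qed

lemma time_integral:
 fixes g :: "real => real"
 assumes "continuous_on {0..} g"
 shows "(LINT t|lebesgue_on {0<..<T}. g t) = (LINT t|lborel. indicator {0<..<T} t * g t)"
  and "integ (%t. indicator {0<..<T} t * g t)"
proof -
 have "continuous_on {0<..<T} g" by (rule continuous_on_subset[OF assms]) auto
 then have m: "(%t. indicator {0<..<T} t *\<^sub>R g t) \<in> LM"
  using borel_measurable_continuous_on_indicator[of "{0<..<T}" g] by simp
 have "(LINT t|lebesgue_on {0<..<T}. g t) = (LINT t|lebesgue. indicator {0<..<T} t *\<^sub>R g t)"
  by (rule integral_restrict_space) simp
 also have "\<dots> = (LINT t|lborel. indicator {0<..<T} t *\<^sub>R g t)" by (rule integral_completion[OF m])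
 finally show "(LINT t|lebesgue_on {0<..<T}. g t) = (LINT t|lborel. indicator {0<..<T} t * g t)" by simp
 have "continuous_on {0..T} g" by (rule continuous_on_subset[OF assms]) auto
 then have "set_integrable lborel {0..T} g" by (rule borel_integrable_atLeastAtMost')
 then have "set_integrable lborel {0<..<T} g" by (rule set_integrable_subset) auto
 then show "integ (%t. indicator {0<..<T} t * g t)" by (simp add: set_integrable_def)
qed

lemma strip_integral: "(LINT z:strip T|lborel. f z) = (LINT z|lborel. indicator {0<..<T} (snd z) * f z)" for f :: "real \<times> real => real"
 unfolding set_lebesgue_integral_def strip_def by (intro LINT_cong) (auto simp: indicator_def mem_Times_iff)

lemma strip_integrable:
 assumes a: "cont a" "compact K" "!!x. x \<notin> K ==> a x = 0" and b: "cont b"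
 shows "integ (%z. indicator {0<..<T} (snd z) * (ur z * (a (fst z) * b (snd z))))"
  and "!!g B. g \<in> BM ==> (!!z. \<bar>g z\<bar> <= B) ==>
   integ (%z. indicator {0<..<T} (snd z) * (g z * (a (fst z) * b (snd z))))"
proof -
 have ia: "integ a" by (rule integrable_compact_support[OF a])
 have ib: "integ (%t. indicator {0<..<T} t * b t)"
  by (rule time_integral(2)) (rule continuous_on_subset[OF b], simp)
 have *: "integ (%z. g z * (a (fst z) * (indicator {0<..<T} (snd z) * b (snd z))))"
  if "g \<in> BM" "!!z. \<bar>g z\<bar> <= B" for g B
  by (rule integrable_bounded_mult[OF integrable_product_lborel(1)[OF ia ib] _ that(2)]) (use that(1) in simp)
 show "integ (%z. indicator {0<..<T} (snd z) * (g z * (a (fst z) * b (snd z))))"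
  if "g \<in> BM" "!!z. \<bar>g z\<bar> <= B" for g B
  using *[OF that] by (simp only: mult_ac)
 obtain A where A: "0 <= A" "!!x. \<bar>a x\<bar> <= A" using bounded_compact_support[OF a] by blast
 have "continuous_on {0..T} b" by (rule continuous_on_subset[OF b]) simp
 then obtain B where B: "0 <= B" "!!t. t \<in> {0..T} ==> \<bar>b t\<bar> <= B" using bounded_on_compact[OF _ compact_Icc] by blast
 have "bounded K" using a(2) by (rule compact_imp_bounded)
 then obtain l where l: "!!x. x \<in> K ==> \<bar>x\<bar> <= l" unfolding bounded_iff by auto
 let ?w = "%z. indicator {0<..<T} (snd z) * (a (fst z) * b (snd z))"
 have m0: "(%z::real\<times>real. indicator {0<..<T} (snd z) :: real) \<in> BM"
  by (rule measurable_compose[OF fst_snd_borel(2) borel_measurable_indicator]) simp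
 have "?w \<in> BM"
  by (intro borel_measurable_times m0 measurable_fst_snd_continuous(1)[OF a(1)] measurable_fst_snd_continuous(2)[OF b])
 then have wm: "?w \<in> LM" by simp
 have "integ (%z. ?w z * (indicator ({-l..l} \<times> {0..T}) z *\<^sub>R ur z))"
 proof (rule integrable_bounded_mult[OF ur_int[unfolded set_integrable_def] wm])
  show "\<bar>?w z\<bar> <= A * B" for z
  proof (cases "snd z \<in> {0<..<T}")
   case True
   then have "\<bar>a (fst z)\<bar> * \<bar>b (snd z)\<bar> <= A * B" by (intro mult_mono A B) auto
   then show ?thesis using True by (simp add: abs_mult)
  qed (use A B in simp)
 qed
 moreover have "(%z. ?w z * (indicator ({-l..l} \<times> {0..T}) z *\<^sub>R ur z)) = (%z. indicator {0<..<T} (snd z) * (ur z * (a (fst z) * b (snd z))))"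
 proof
  fix z show "?w z * (indicator ({-l..l} \<times> {0..T}) z *\<^sub>R ur z) = indicator {0<..<T} (snd z) * (ur z * (a (fst z) * b (snd z)))"
   using a(3)[of "fst z"] l[of "fst z"] by (cases "fst z \<in> K") (auto simp: indicator_def mem_Times_iff)
 qed
 ultimately show "integ (%z. indicator {0<..<T} (snd z) * (ur z * (a (fst z) * b (snd z))))" by simp
qed

lemma strip_Fubini:
 assumes ph: "bdd_supp K M ph" "cont ph" and b: "cont b"
 shows "(LINT z|lborel. indicator {0<..<T} (snd z) * (ur z * (ph (fst z) * b (snd z))))
   = (LINT t|lborel. indicator {0<..<T} t * (b t * (pairing (u t) ph - pairing (singular_part (u t)) ph)))"
proof -
 let ?f = "%x t. indicator {0<..<T} t * (ur (x, t) * (ph x * b t))"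
 have i: "integrable (lborel \<Otimes>\<^sub>M lborel) (%(x, t). ?f x t)"
  using strip_integrable(1)[OF ph(2) bdd_suppD(1,4)[OF ph(1)] b, of T] by (simp add: lborel_prod case_prod_unfold)
 have cg: "continuous_on {0..} (%t. b t * (pairing (u t) ph - pairing (singular_part (u t)) ph))"
  by (intro continuous_on_mult continuous_on_diff pairing_cont[OF ph(1)] continuous_on_subset[OF b]) simp
 have "(LINT z|lborel. indicator {0<..<T} (snd z) * (ur z * (ph (fst z) * b (snd z)))) = (LINT t|lborel. LINT x|lborel. ?f x t)"
  using lborel_pair.integral_snd[OF i] by (simp add: lborel_prod case_prod_unfold)
 also have "\<dots> = (LINT t|lborel. indicator {0<..<T} t * (b t * (pairing (u t) ph - pairing (singular_part (u t)) ph)))"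
 proof (rule integral_cong_AE)
  show "(%t. LINT x|lborel. ?f x t) \<in> LM"
   using lborel_pair.integrable_snd[OF i] by (rule borel_measurable_integrable)
  show "(%t. indicator {0<..<T} t * (b t * (pairing (u t) ph - pairing (singular_part (u t)) ph))) \<in> LM"
   using time_integral(2)[OF cg] by (rule borel_measurable_integrable)
  show "AE t in lborel. (LINT x|lborel. ?f x t) = indicator {0<..<T} t * (b t * (pairing (u t) ph - pairing (singular_part (u t)) ph))"
   using slice
  proof eventually_elim
   case (elim t)
   show ?case
   proof (cases "t \<in> {0<..<T}")
    case True
    then have t: "0 < t" "0 <= t" by auto
    note rf = regular_part_facts[OF u_signed[OF t(2)]]
    have rm: "regular_part (u t) \<in> BM" by (rule rf(1))
    have fm: "ph \<in> BM" by (rule bdd_suppD(2)[OF ph(1)])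
    have "(LINT x|lborel. ur (x, t) * ph x) = (LINT x|lborel. regular_part (u t) x * ph x)"
     by (rule integral_cong_AE) (use elim[rule_format, OF t(1)] rm fm section_meas in auto)
    then have "(LINT x|lborel. ur (x, t) * ph x) = pairing (u t) ph - pairing (singular_part (u t)) ph"
     using rf(4)[OF ph(1)] by simp
    moreover have "(%x. ?f x t) = (%x. b t * (ur (x, t) * ph x))" using True by (simp add: mult_ac)
    ultimately show ?thesis using True by simp
   next
    case False
    then show ?thesis by simp
   qed
  qed
 qed
 finally show ?thesis .
qed

lemma weak_product:
 assumes ph: "!!x. (ph has_real_derivative ph' x) (at x)" "cont ph'"
  and K: "bdd_supp K M ph"
  and \<chi>: "!!t. (\<chi>0 has_real_derivative \<chi>' t) (at t)" "cont \<chi>'" "\<chi>0 T = 0" and T: "0 < T"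
 shows "(LINT t|lborel. indicator {0<..<T} t * (\<chi>' t * pairing (u t) ph))
   + (LINT z|lborel. indicator {0<..<T} (snd z) * (H (ur z) * (ph' (fst z) * \<chi>0 (snd z)))) = - (pairing u0 ph * \<chi>0 0)"
proof -
 note cph = deriv_imp_continuous_on[OF ph(1), of UNIV] and c\<chi> = deriv_imp_continuous_on[OF \<chi>(1), of UNIV]
 have kK: "compact K" "!!x. x \<notin> K ==> ph x = 0" by (rule bdd_suppD[OF K])+
 have ph'0: "ph' x = 0" if "x \<notin> K" for x
  by (rule deriv_zero_off_support[OF ph(1) compact_imp_closed[OF kK(1)] kK(2) that])
 have "entropy_solution H u0 T u ur" using sol T by (simp add: global_entropy_solution_def)
 then have weak: "(LINT z:strip T|lborel. ur z * zet z + H (ur z) * zex z)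
     + (LINT t|lebesgue_on {0<..<T}. pairing (singular_part (u t)) (%x. zet (x, t)))
    = - pairing u0 (%x. ze (x, 0))" if "C1_test T ze zex zet" "\<forall>x. ze (x, T) = 0" for ze zex zet
  unfolding entropy_solution_def using that by (elim conjE) simp
 have Hm: "(%z. H (ur z)) \<in> BM" by measurable
 have i1: "integ (%z. indicator {0<..<T} (snd z) * (ur z * (ph (fst z) * \<chi>' (snd z))))"
  by (rule strip_integrable(1)[OF cph kK \<chi>(2)])
 have i2: "integ (%z. indicator {0<..<T} (snd z) * (H (ur z) * (ph' (fst z) * \<chi>0 (snd z))))"
  by (rule strip_integrable(2)[OF ph(2) kK(1) ph'0 c\<chi> Hm H_bound])
 have ct: "continuous_on {0..} \<chi>'" by (rule continuous_on_subset[OF \<chi>(2)]) simp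
 have 1: "(LINT t|lebesgue_on {0<..<T}. pairing (singular_part (u t)) ph * \<chi>' t)
   = (LINT t|lborel. indicator {0<..<T} t * (\<chi>' t * pairing (singular_part (u t)) ph))"
  by (subst mult.commute) (rule time_integral(1), intro continuous_on_mult ct pairing_cont[OF K])
 have 2: "(LINT t|lborel. indicator {0<..<T} t * (\<chi>' t * (pairing (u t) ph - pairing (singular_part (u t)) ph)))
   + (LINT t|lborel. indicator {0<..<T} t * (\<chi>' t * pairing (singular_part (u t)) ph))
   = (LINT t|lborel. indicator {0<..<T} t * (\<chi>' t * pairing (u t) ph))"
 proof -
  have "(LINT t|lborel. indicator {0<..<T} t * (\<chi>' t * pairing (u t) ph))
   = (LINT t|lborel. indicator {0<..<T} t * (\<chi>' t * (pairing (u t) ph - pairing (singular_part (u t)) ph))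
    + indicator {0<..<T} t * (\<chi>' t * pairing (singular_part (u t)) ph))"
   by (rule LINT_cong) (simp_all add: algebra_simps)
  also have "\<dots> = (LINT t|lborel. indicator {0<..<T} t * (\<chi>' t * (pairing (u t) ph - pairing (singular_part (u t)) ph)))
   + (LINT t|lborel. indicator {0<..<T} t * (\<chi>' t * pairing (singular_part (u t)) ph))"
   by (rule Bochner_Integration.integral_add; rule time_integral(2); intro continuous_on_mult continuous_on_diff ct pairing_cont[OF K])
  finally show ?thesis by simp
 qed
 have "(LINT z:strip T|lborel. ur z * (ph (fst z) * \<chi>' (snd z)) + H (ur z) * (ph' (fst z) * \<chi>0 (snd z)))
   = (LINT z|lborel. indicator {0<..<T} (snd z) * (ur z * (ph (fst z) * \<chi>' (snd z))))
   + (LINT z|lborel. indicator {0<..<T} (snd z) * (H (ur z) * (ph' (fst z) * \<chi>0 (snd z))))"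
  unfolding strip_integral distrib_left by (rule Bochner_Integration.integral_add[OF i1 i2])
 moreover have "(LINT z:strip T|lborel. ur z * (ph (fst z) * \<chi>' (snd z)) + H (ur z) * (ph' (fst z) * \<chi>0 (snd z)))
   + (LINT t|lebesgue_on {0<..<T}. pairing (singular_part (u t)) ph * \<chi>' t) = - (pairing u0 ph * \<chi>0 0)"
  using weak[OF C1_test_product[OF ph kK \<chi>(1,2)]] \<chi>(3) by (simp add: pairing_scale)
 ultimately show ?thesis using strip_Fubini[OF K cph \<chi>(2), of T] 1 2 by linarith
qed

text \<open>Testing with \<open>ph(x) \<chi>(t)\<close>, where \<open>\<chi>\<close> descends from one to zero
 right after \<open>t\<close>,
 and letting the descent become steep, continuity in time gives the balance of \<open>ph\<close> at every single time.\<close>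

lemma weak_balance:
 assumes ph: "!!x. (ph has_real_derivative ph' x) (at x)" "cont ph'"
  and K: "bdd_supp K M ph" and t0: "0 <= t0"
 shows "pairing (u t0) ph = pairing u0 ph + (LINT z|lborel. indicator {0..t0} (snd z) * (H (ur z) * ph' (fst z)))"
proof -
 define T where "T = t0 + 2"
 have T: "0 < T" "t0 + 2 <= T" using t0 by (auto simp: T_def)
 define de where "de = (%n t. 1 - step ((t - t0) / wid n - 1))"
 have d\<chi>: "(de n has_real_derivative - ker n t0 t) (at t)" for n t
  unfolding de_def by (auto intro!: derivative_eq_intros)
 have ck: "continuous_on S (ker n t0)" for n S by (intro continuous_intros) auto
 have c\<chi>': "cont (%t. - ker n t0 t)" for n by (intro continuous_on_minus ck)
 have \<chi>T: "de n T = 0" for n using step_shift_eq_1[of t0 T n] T by (simp add: de_def)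
 have \<chi>0: "de n 0 = 1" for n using step_shift_eq_0[of 0 t0 n] t0 by (simp add: de_def)
 have \<chi>b: "\<bar>de n t\<bar> <= 1" for n t using step_bounds[of "(t - t0) / wid n - 1"] unfolding de_def by (simp add: abs_le_iff)
 have kK: "compact K" "!!x. x \<notin> K ==> ph x = 0" by (rule bdd_suppD[OF K])+
 have ph'0: "ph' x = 0" if "x \<notin> K" for x
  by (rule deriv_zero_off_support[OF ph(1) compact_imp_closed[OF kK(1)] kK(2) that])
 have iph': "integ ph'" by (rule integrable_compact_support[OF ph(2) kK(1) ph'0])
 let ?p = "%t. pairing (u t) ph"
 have cp: "continuous_on {0..} ?p" by (rule pairing_cont[OF K])
 have ip: "integ (%t. indicator {0<..<T} t * (ker n t0 t * ?p t))" for n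
  by (rule time_integral(2)) (intro continuous_on_mult ck cp)
 have l1: "(%n. LINT t|lborel. indicator {0<..<T} t * (ker n t0 t * ?p t)) ---> ?p t0"
  by (rule kernel_limit[OF cp t0 T(2) ip])
 have l2: "(%n. LINT z|lborel. indicator {0<..<T} (snd z) * (H (ur z) * (ph' (fst z) * de n (snd z))))
   ---> (LINT z|lborel. indicator {0..t0} (snd z) * (H (ur z) * ph' (fst z)))"
 proof (rule dominated_convergence_real(1)[where w="%z. C * (\<bar>ph' (fst z)\<bar> * indicator {0..T} (snd z))"])
  have m0: "(%z::real\<times>real. indicator A (snd z) :: real) \<in> LM" if "A \<in> sets borel" for A
   using measurable_compose[OF fst_snd_borel(2) borel_measurable_indicator[OF that]] by simp
  have m1: "(%z. H (ur z)) \<in> LM" by measurable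
  have m2: "(%z::real\<times>real. ph' (fst z)) \<in> LM" using measurable_fst_snd_continuous(1)[OF ph(2)] by simp
  have m3: "(%z::real\<times>real. de n (snd z)) \<in> LM" for n
   using measurable_fst_snd_continuous(2)[OF deriv_imp_continuous_on[OF d\<chi>]] by simp
  show "(%z. indicator {0..t0} (snd z) * (H (ur z) * ph' (fst z))) \<in> LM"
   by (intro borel_measurable_times m0 m1 m2) simp
  show "(%z. indicator {0<..<T} (snd z) * (H (ur z) * (ph' (fst z) * de n (snd z)))) \<in> LM" for n
   by (intro borel_measurable_times m0 m1 m2 m3) simp
  show "integ (%z. C * (\<bar>ph' (fst z)\<bar> * indicator {0..T} (snd z)))"
   by (intro integrable_mult_right integrable_product_lborel(1) integrable_abs iph' interval_measure(3))
  show "AE z in lborel. (%n. indicator {0<..<T} (snd z) * (H (ur z) * (ph' (fst z) * de n (snd z))))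
    ---> indicator {0..t0} (snd z) * (H (ur z) * ph' (fst z))"
   using AE_off_lines[of 0 0]
  proof eventually_elim
   case (elim z)
   have "(%n. indicator {0<..<T} (snd z) * (H (ur z) * (ph' (fst z) * de n (snd z))))
    ---> indicator {0<..<T} (snd z) * (H (ur z) * (ph' (fst z) * (1 - indicator {t0<..} (snd z))))"
    unfolding de_def by (intro tendsto_intros step_limit)
   moreover have "indicator {0<..<T} (snd z) * (H (ur z) * (ph' (fst z) * (1 - indicator {t0<..} (snd z))))
     = indicator {0..t0} (snd z) * (H (ur z) * ph' (fst z))"
    using elim T by (auto simp: indicator_def)
   ultimately show ?case by simp
  qed
  fix n and z :: "real \<times> real"
  have "\<bar>ph' (fst z)\<bar> * \<bar>de n (snd z)\<bar> <= \<bar>ph' (fst z)\<bar> * 1" by (rule mult_left_mono[OF \<chi>b]) simp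
  then have "\<bar>H (ur z)\<bar> * (\<bar>ph' (fst z)\<bar> * \<bar>de n (snd z)\<bar>) <= C * \<bar>ph' (fst z)\<bar>"
   by (intro mult_mono H_bound C_nonneg) auto
  moreover have "0 <= C * \<bar>ph' (fst z)\<bar>" using C_nonneg by simp
  ultimately show "\<bar>indicator {0<..<T} (snd z) * (H (ur z) * (ph' (fst z) * de n (snd z)))\<bar> <= C * (\<bar>ph' (fst z)\<bar> * indicator {0..T} (snd z))"
   by (auto simp: abs_mult indicator_def)
 qed
 have eq: "(LINT t|lborel. indicator {0<..<T} t * (ker n t0 t * ?p t))
   = (LINT z|lborel. indicator {0<..<T} (snd z) * (H (ur z) * (ph' (fst z) * de n (snd z)))) + pairing u0 ph" for n
 proof -
  have "(%t. indicator {0<..<T} t * (- ker n t0 t * ?p t)) = (%t. - (indicator {0<..<T} t * (ker n t0 t * ?p t)))"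
   by (simp only: mult_minus_left mult_minus_right)
  then have "(LINT t|lborel. indicator {0<..<T} t * (- ker n t0 t * ?p t)) = - (LINT t|lborel. indicator {0<..<T} t * (ker n t0 t * ?p t))"
   by (simp only: Bochner_Integration.integral_minus)
  moreover have "(LINT t|lborel. indicator {0<..<T} t * (- ker n t0 t * ?p t))
   + (LINT z|lborel. indicator {0<..<T} (snd z) * (H (ur z) * (ph' (fst z) * de n (snd z)))) = - (pairing u0 ph * de n 0)"
   by (rule weak_product[OF ph K d\<chi> c\<chi>' \<chi>T T(1)])
  ultimately show ?thesis unfolding \<chi>0 by linarith
 qed
 have "(%n. LINT t|lborel. indicator {0<..<T} t * (ker n t0 t * ?p t))
   ---> (LINT z|lborel. indicator {0..t0} (snd z) * (H (ur z) * ph' (fst z))) + pairing u0 ph"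
  unfolding eq by (intro tendsto_add l2 tendsto_const)
 from LIMSEQ_unique[OF l1 this] show ?thesis by simp
qed

end

lemma entropy_pair_bound:
 fixes sig a f g k n Ha Hk :: real
 assumes sig: "\<bar>sig\<bar> = 1" and f: "0 <= f" and k: "k = sig * n" and eq: "a = k ==> Ha = Hk"
 shows "\<bar>a - k\<bar> * (f * - 1) + sgn (a - k) * (Ha - Hk) * g + sig * (a * (f * - 1) + Ha * g)
   <= n * (f * - 1) + (sig * Hk) * g + (2 * sig * of_bool (n < sig * a) * (Ha - Hk)) * g"
proof -
 have 1: "n <= \<bar>a - k\<bar> + sig * a" using sign_cases[OF sig] k by auto
 have 2: "(\<bar>a - k\<bar> + sig * a) * (f * - 1) <= n * (f * - 1)" using mult_right_mono[OF 1 f] by simp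
 have 3: "sgn (a - k) * (Ha - Hk) + sig * Ha = sig * Hk + 2 * sig * of_bool (n < sig * a) * (Ha - Hk)"
  using sign_cases[OF sig] k eq by (auto simp: sgn_if not_less)
 have "\<bar>a - k\<bar> * (f * - 1) + sgn (a - k) * (Ha - Hk) * g + sig * (a * (f * - 1) + Ha * g)
  = (\<bar>a - k\<bar> + sig * a) * (f * - 1) + (sgn (a - k) * (Ha - Hk) + sig * Ha) * g"
  by (simp add: algebra_simps)
 also have "\<dots> <= n * (f * - 1) + (sig * Hk + 2 * sig * of_bool (n < sig * a) * (Ha - Hk)) * g"
  unfolding 3 using 2 by (rule add_right_mono)
 finally show ?thesis by (simp only: distrib_right add.assoc)
qed

lemma excess_tendsto_0:
 fixes a sig :: real
 shows "(%n. max 0 (sig * a - real n)) ---> 0" "(%n. of_bool (real n < sig * a) :: real) ---> 0"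
proof -
 obtain N :: nat where N: "sig * a < real N" using reals_Archimedean2 by blast
 have e: "eventually (%n. sig * a < real n) sequentially"
  using N by (intro eventually_sequentiallyI[of N]) (auto intro: order.strict_trans2)
 show "(%n. max 0 (sig * a - real n)) ---> 0"
  by (rule tendsto_eventually) (use e in \<open>eventually_elim, simp\<close>)
 show "(%n. of_bool (real n < sig * a) :: real) ---> 0"
  by (rule tendsto_eventually) (use e in \<open>eventually_elim, simp\<close>)
qed

text \<open>A point outside \<open>P\<close> is seen by one of the functions, and no point of \<open>P\<close> by any
 of them.\<close>

definition separating_tests ::
  "real set => (nat => real => real) => (nat => real => real) => (nat => real set) => (nat => real) => bool" where
 "separating_tests P ph ph' K M \<longleftrightarrow> (\<forall>n x. (ph n has_real_derivative ph' n x) (at x)) \<and>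
  (\<forall>n. cont (ph' n)) \<and> (\<forall>n. bdd_supp (K n) (M n) (ph n)) \<and> (\<forall>n x. 0 <= ph n x) \<and>
  (\<forall>n y. y \<in> P --> ph n y = 0) \<and> (\<forall>x. x \<notin> P --> (\<exists>n. 0 < ph n x))"

lemma separating_tests_exist:
 assumes P: "finite P"
 shows "\<exists>ph ph' K M. separating_tests P ph ph' K M"
proof -
 define q where "q = (\<Prod>y\<in>P. [:- y, 1::real:] ^ 2)"
 have q: "poly q x = (\<Prod>y\<in>P. (x - y)\<^sup>2)" for x by (simp add: q_def poly_prod)
 have q0: "0 <= poly q x" for x unfolding q by (intro prod_nonneg) auto
 define ph where "ph n x = step (x + real n + 1) * step (real n + 1 - x) * poly q x" for n :: nat and x
 define ph' where "ph' n x = (step' (x + real n + 1) * step (real n + 1 - x) - step (x + real n + 1) * step' (real n + 1 - x)) * poly q x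
   + step (x + real n + 1) * step (real n + 1 - x) * poly (pderiv q) x" for n :: nat and x
 have d: "(ph n has_real_derivative ph' n x) (at x)" for n x
  unfolding ph_def[abs_def] ph'_def
  by (rule derivative_eq_intros poly_DERIV refl | simp add: algebra_simps)+
 have c: "cont (ph' n)" for n
  unfolding ph'_def[abs_def] by (intro continuous_intros)
 have z: "ph n x = 0" if "x \<notin> {- real n - 1..real n + 1}" for n x
  using that step_eq_0[of "x + real n + 1"] step_eq_0[of "real n + 1 - x"] by (auto simp: ph_def not_le)
 have "\<exists>M. bdd_supp {- real n - 1..real n + 1} M (ph n)" for n
 proof -
  have cph: "cont (ph n)" by (rule deriv_imp_continuous_on[OF d])
  obtain M where M: "!!x. \<bar>ph n x\<bar> <= M" using bounded_compact_support[OF cph compact_Icc z] by blast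
  have "ph n \<in> BM" by (rule borel_measurable_continuous_onI[OF cph])
  then show ?thesis using M z by (auto simp: bdd_supp_def)
 qed
 then obtain M where M: "!!n. bdd_supp {- real n - 1..real n + 1} (M n) (ph n)" by metis
 have "separating_tests P ph ph' (%n. {- real n - 1..real n + 1}) M"
  unfolding separating_tests_def
 proof (intro conjI allI impI d c M)
  show "0 <= ph n x" for n x unfolding ph_def using step_bounds q0 by (intro mult_nonneg_nonneg) auto
  show "ph n y = 0" if "y \<in> P" for n y unfolding ph_def q using that P by (auto simp: prod_zero_iff)
  show "\<exists>n. 0 < ph n x" if x: "x \<notin> P" for x
  proof -
   obtain n :: nat where n: "\<bar>x\<bar> <= real n" using real_arch_simple by blast
   have "0 < poly q x" unfolding q using x by (intro prod_pos) auto
   moreover have "step (x + real n + 1) = 1" "step (real n + 1 - x) = 1" using n by (intro step_eq_1; simp)+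
   ultimately show ?thesis by (intro exI[of _ n]) (simp add: ph_def)
  qed
 qed
 then show ?thesis by (intro exI)
qed

context entropy_data begin

text \<open>Adding \<open>sig\<close> times the weak equation to the entropy inequality with the constant
 \<open>sig n\<close>
 leaves only the part of the solution where \<open>sig u > n\<close>, together with \<open>\<bar>u_s\<bar> + sig u_s\<close>. As \<open>n\<close> grows
 the former disappears, so the positive and the negative singular parts cannot appear
 where they were not present initially.\<close>

lemma entropy_concentration:
 assumes ph: "!!x. (ph has_real_derivative ph' x) (at x)" "cont ph'"
  and K: "bdd_supp K M ph" and nn: "!!x. 0 <= ph x" and sig: "\<bar>sig\<bar> = 1"
  and init: "abs_pairing (singular_part u0) ph + sig * pairing (singular_part u0) ph = 0" and t: "0 <= t"
 shows "abs_pairing (singular_part (u t)) ph + sig * pairing (singular_part (u t)) ph = 0"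
proof -
 define T where "T = t + 1"
 have T: "0 < T" "t \<in> {0..T}" using t by (auto simp: T_def)
 define S where "S t = abs_pairing (singular_part (u t)) ph + sig * pairing (singular_part (u t)) ph" for t
 have S0: "0 <= S t" for t unfolding S_def by (rule abs_pairing_dominates[OF sig nn])
 have cS: "continuous_on {0..} S" unfolding S_def by (intro continuous_intros pairing_cont[OF K])
 let ?I = "%z::real\<times>real. indicator {0<..<T} (snd z) :: real"
 let ?f = "%z::real\<times>real. ph (fst z) * - 1" and ?g = "%z::real\<times>real. ph' (fst z) * (T - snd z)"
 note cph = deriv_imp_continuous_on[OF ph(1), of UNIV]
 have kK: "compact K" "!!x. x \<notin> K ==> ph x = 0" by (rule bdd_suppD[OF K])+
 have ph'0: "ph' x = 0" if "x \<notin> K" for x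
  by (rule deriv_zero_off_support[OF ph(1) compact_imp_closed[OF kK(1)] kK(2) that])
 have iph: "integ ph" by (rule integrable_compact_support[OF cph kK])
 have iph': "integ ph'" by (rule integrable_compact_support[OF ph(2) kK(1) ph'0])
 have ph'int: "(LINT x|lborel. ph' x) = 0"
 proof -
  have "bounded K" using kK(1) by (rule compact_imp_bounded)
  then obtain l where l: "!!x. x \<in> K ==> \<bar>x\<bar> <= l" unfolding bounded_iff by auto
  show ?thesis
   by (rule integral_deriv_compact_support[OF ph, of "- l" l]) (use l kK(2) ph'0 in fastforce)
 qed
 have c1: "cont (%t::real. - 1 :: real)" and cT: "cont (%t::real. T - t)" by (intro continuous_intros)+
 have dT: "((%t. T - t) has_real_derivative - 1) (at t)" for t by (auto intro!: derivative_eq_intros)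
 have ind1: "integ (%t. indicator {0<..<T} t * (- 1 :: real))" "(LINT t|lborel. indicator {0<..<T} t * (- 1 :: real)) = - T"
  and indT: "integ (%t. indicator {0<..<T} t * (T - t))"
  using T by (auto intro!: time_integral(2) continuous_intros)
 have igen1: "integ (%z. ?I z * (q z * ?f z))" if "q \<in> BM" "!!z. \<bar>q z\<bar> <= B" for q B
  by (rule strip_integrable(2)[OF cph kK c1 that])
 have igen2: "integ (%z. ?I z * (q z * ?g z))" if "q \<in> BM" "!!z. \<bar>q z\<bar> <= B" for q B
  by (rule strip_integrable(2)[OF ph(2) kK(1) ph'0 cT that])
 have Hm: "(%z. H (ur z)) \<in> BM" by measurable
 have iu: "integ (%z. ?I z * (ur z * ?f z))" by (rule strip_integrable(1)[OF cph kK c1])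
 have iH: "integ (%z. ?I z * (H (ur z) * ?g z))" by (rule igen2[OF Hm H_bound])
 have cst1: "(LINT z|lborel. ?I z * (b * ?f z)) = - (b * T * (LINT x|lborel. ph x))" for b
 proof -
  have "(%z. ?I z * (b * ?f z)) = (%z. b * (ph (fst z) * (indicator {0<..<T} (snd z) * - 1)))" by (simp add: mult_ac)
  then show ?thesis using integrable_product_lborel(2)[OF iph ind1(1)] ind1(2) by (simp only: integral_mult_right_zero) simp
 qed
 have cst2: "(LINT z|lborel. ?I z * (b * ?g z)) = 0" for b
 proof -
  have "(%z. ?I z * (b * ?g z)) = (%z. b * (ph' (fst z) * (indicator {0<..<T} (snd z) * (T - snd z))))" by (simp add: mult_ac)
  then show ?thesis using integrable_product_lborel(2)[OF iph' indT] ph'int by (simp only: integral_mult_right_zero mult_zero_left mult_zero_right)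
 qed
 let ?ps = "%t. pairing (singular_part (u t)) ph" and ?as = "%t. abs_pairing (singular_part (u t)) ph"
 note cp = pairing_cont[OF K]
 let ?r0 = "regular_part u0"
 note r0 = regular_part_facts[OF u0]
 have r0m: "?r0 \<in> BM" and phm: "ph \<in> BM" by (rule r0(1), rule bdd_suppD(2)[OF K])
 have ir0: "integ (%x. ?r0 x * ph x)" by (rule r0(5)[OF K])
 define D where "D n = (LINT x|lborel. max 0 (sig * ?r0 x - real n) * ph x)" for n :: nat
 define B where "B n = (LINT z|lborel. ?I z * ((2 * sig * of_bool (real n < sig * ur z) * (H (ur z) - H (sig * real n))) * ?g z))" for n :: nat
 have Dd: "\<bar>max 0 (sig * ?r0 x - real n) * ph x\<bar> <= \<bar>?r0 x * ph x\<bar>" for n x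
 proof -
  have "max 0 (sig * ?r0 x - real n) <= \<bar>?r0 x\<bar>" using sign_cases[OF sig] by auto
  then have "max 0 (sig * ?r0 x - real n) * \<bar>ph x\<bar> <= \<bar>?r0 x\<bar> * \<bar>ph x\<bar>" by (rule mult_right_mono) simp
  then show ?thesis by (simp add: abs_mult)
 qed
 have Dc: "AE x in lborel. (%n. max 0 (sig * ?r0 x - real n) * ph x) ---> 0"
  by (intro AE_I2 tendsto_mult_left_zero excess_tendsto_0)
 have Dm: "(%x. max 0 (sig * ?r0 x - real n) * ph x) \<in> LM" for n using r0m phm by simp
 have zm: "(%x. 0::real) \<in> borel_measurable (lborel :: real measure)" "(%x. 0::real) \<in> borel_measurable (lborel :: (real\<times>real) measure)" by simp_all
 have Dlim: "D ---> 0" and iD: "!!n. integ (%x. max 0 (sig * ?r0 x - real n) * ph x)"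
 proof -
  note dc = dominated_convergence_real[OF zm(1) Dm integrable_abs[OF ir0] Dc Dd]
  show "D ---> 0" unfolding D_def[abs_def] using dc(1) by simp
  show "integ (%x. max 0 (sig * ?r0 x - real n) * ph x)" for n by (rule dc(3))
 qed
 have s1: "\<bar>sig * x\<bar> = \<bar>x\<bar>" for x by (rule sign_abs_mult[OF sig])
 have H2: "\<bar>H a - H b\<bar> <= 2 * C" for a b using H_bound[of a] H_bound[of b] by linarith
 have qb: "\<bar>2 * sig * of_bool (real n < sig * a) * (H a - H (sig * real n))\<bar> <= 4 * C" for n a
  using H2[of a "sig * real n"] sig C_nonneg by (auto simp: abs_mult)
 have qm: "(%z. 2 * sig * of_bool (real n < sig * ur z) * (H (ur z) - H (sig * real n))) \<in> BM" for n
  by measurable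
 have Blim: "B ---> 0"
 proof -
  let ?q = "%n z. 2 * sig * of_bool (real n < sig * ur z) * (H (ur z) - H (sig * real n))"
  have i4: "integ (%z. ?I z * (4 * C * ?g z))"
   by (rule igen2[where B="4 * C"]) (use C_nonneg in auto)
  have bd: "\<bar>?I z * (?q n z * ?g z)\<bar> <= \<bar>?I z * (4 * C * ?g z)\<bar>" for n z
  proof -
   have "\<bar>?q n z\<bar> * \<bar>?g z\<bar> <= 4 * C * \<bar>?g z\<bar>" by (rule mult_right_mono[OF qb]) simp
   then have "\<bar>?I z\<bar> * (\<bar>?q n z\<bar> * \<bar>?g z\<bar>) <= \<bar>?I z\<bar> * (4 * C * \<bar>?g z\<bar>)" by (rule mult_left_mono) simp
   moreover have "\<bar>?I z * (4 * C * ?g z)\<bar> = \<bar>?I z\<bar> * (4 * C * \<bar>?g z\<bar>)" using C_nonneg by (simp add: abs_mult)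
   ultimately show ?thesis by (simp only: abs_mult)
  qed
  have cv: "(%n. ?q n z) ---> 0" for z
  proof (rule tendsto_eventually)
   obtain N :: nat where N: "sig * ur z < real N" using reals_Archimedean2 by blast
   show "eventually (%n. ?q n z = 0) sequentially"
    using N by (intro eventually_sequentiallyI[of N]) (auto simp: not_less)
  qed
  have ae: "AE z in lborel. (%n. ?I z * (?q n z * ?g z)) ---> 0"
   by (intro AE_I2 tendsto_mult_right_zero tendsto_mult_left_zero cv)
  have bm: "(%z. ?I z * (?q n z * ?g z)) \<in> LM" for n
   by (rule borel_measurable_integrable[OF igen2[OF qm qb]])
  show ?thesis unfolding B_def[abs_def]
   using dominated_convergence_real(1)[OF zm(2) bm integrable_abs[OF i4] ae bd] by simp
 qed
 have key: "(LINT t|lborel. indicator {0<..<T} t * S t) <= B n + 2 * T * D n" for n :: nat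
 proof -
  define k where "k = sig * real n"
  let ?s = "%z. sgn (ur z - k)"
  have sm: "?s \<in> BM" by measurable
  have sb: "\<bar>?s z\<bar> <= 1" for z by (simp add: sgn_if)
  have smk: "(%z. - k * ?s z) \<in> BM" using sm by simp
  have sbk: "\<bar>- k * ?s z\<bar> <= \<bar>k\<bar>" for z by (simp add: abs_mult sgn_if)
  have "integ (%z. ?s z * (?I z * (ur z * ?f z)) + ?I z * (- k * ?s z * ?f z))"
   by (intro Bochner_Integration.integrable_add integrable_bounded_mult[OF iu _ sb] igen1[OF smk sbk]) (use sm in simp)
  moreover have "?s z * (?I z * (ur z * ?f z)) + ?I z * (- k * ?s z * ?f z) = ?I z * (\<bar>ur z - k\<bar> * ?f z)" for z
  proof -
   have "\<bar>ur z - k\<bar> = ?s z * (ur z - k)" by (simp add: abs_sgn mult.commute)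
   then show ?thesis by (simp only:) (simp add: algebra_simps)
  qed
  ultimately have ia: "integ (%z. ?I z * (\<bar>ur z - k\<bar> * ?f z))" by simp
  have sHm: "(%z. ?s z * (H (ur z) - H k)) \<in> BM" by measurable
  have sHb: "\<bar>?s z * (H (ur z) - H k)\<bar> <= 2 * C" for z
   using H2[of "ur z" k] C_nonneg by (auto simp: abs_mult sgn_if)
  have ib: "integ (%z. ?I z * (?s z * (H (ur z) - H k) * ?g z))" by (rule igen2[OF sHm sHb])
  have "entropy_solution H u0 T u ur" using sol T by (simp add: global_entropy_solution_def)
  then have ent: "- (LINT x|lborel. \<bar>?r0 x - k\<bar> * ze (x, 0)) - abs_pairing (singular_part u0) (%x. ze (x, 0))
    <= (LINT z:strip T|lborel. \<bar>ur z - k\<bar> * zet z + sgn (ur z - k) * (H (ur z) - H k) * zex z)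
     + (LINT t|lebesgue_on {0<..<T}. abs_pairing (singular_part (u t)) (%x. zet (x, t)))"
   if "C1_test T ze zex zet" "\<forall>x. ze (x, T) = 0" "\<forall>x. \<forall>t\<in>{0..T}. 0 <= ze (x, t)" for ze zex zet
   unfolding entropy_solution_def using that by (elim conjE) simp
  have E0: "- (LINT x|lborel. \<bar>?r0 x - k\<bar> * (ph x * (T - 0))) - abs_pairing (singular_part u0) ph * (T - 0)
    <= (LINT z:strip T|lborel. \<bar>ur z - k\<bar> * ?f z + ?s z * (H (ur z) - H k) * ?g z)
     + (LINT t|lebesgue_on {0<..<T}. ?as t * - 1)"
  proof -
   have C1: "C1_test T (%z. ph (fst z) * (T - snd z)) (%z. ph' (fst z) * (T - snd z)) (%z. ph (fst z) * - 1)"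
    by (rule C1_test_product[OF ph kK(1) _ dT c1]) (rule kK(2))
   have z1: "\<forall>x. ph (fst (x, T)) * (T - snd (x, T)) = 0" by simp
   have z2: "\<forall>x. \<forall>t\<in>{0..T}. 0 <= ph (fst (x, t)) * (T - snd (x, t))" using nn by auto
   show ?thesis
    using ent[OF C1 z1 z2] by (simp only: fst_conv snd_conv pairing_scale)
  qed
  have E1: "(LINT z:strip T|lborel. \<bar>ur z - k\<bar> * ?f z + ?s z * (H (ur z) - H k) * ?g z)
    = (LINT z|lborel. ?I z * (\<bar>ur z - k\<bar> * ?f z)) + (LINT z|lborel. ?I z * (?s z * (H (ur z) - H k) * ?g z))"
   unfolding strip_integral distrib_left by (rule Bochner_Integration.integral_add[OF ia ib])
  have E2: "(LINT t|lebesgue_on {0<..<T}. ?as t * - 1) = (LINT t|lborel. indicator {0<..<T} t * (?as t * - 1))"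
   by (rule time_integral(1)) (intro continuous_on_mult cp continuous_intros)
  have W1: "(LINT t|lborel. indicator {0<..<T} t * (- 1 * pairing (u t) ph)) + (LINT z|lborel. ?I z * (H (ur z) * ?g z))
    = - (pairing u0 ph * (T - 0))"
   by (rule weak_product[OF ph K dT c1 _ T(1)]) simp
  have W2: "(LINT z|lborel. ?I z * (ur z * ?f z)) = (LINT t|lborel. indicator {0<..<T} t * (- 1 * (pairing (u t) ph - ?ps t)))"
   by (rule strip_Fubini[OF K cph c1])
  have W3: "(LINT t|lborel. indicator {0<..<T} t * (- 1 * (pairing (u t) ph - ?ps t)))
    = (LINT t|lborel. indicator {0<..<T} t * (- 1 * pairing (u t) ph)) + (LINT t|lborel. indicator {0<..<T} t * ?ps t)"
  proof -
   have "(LINT t|lborel. indicator {0<..<T} t * (- 1 * (pairing (u t) ph - ?ps t)))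
    = (LINT t|lborel. indicator {0<..<T} t * (- 1 * pairing (u t) ph) + indicator {0<..<T} t * ?ps t)"
    by (rule LINT_cong) (simp_all add: algebra_simps)
   also have "\<dots> = (LINT t|lborel. indicator {0<..<T} t * (- 1 * pairing (u t) ph)) + (LINT t|lborel. indicator {0<..<T} t * ?ps t)"
    by (rule Bochner_Integration.integral_add; rule time_integral(2); intro continuous_on_mult cp continuous_on_const)
   finally show ?thesis .
  qed
  have SS: "(LINT t|lborel. indicator {0<..<T} t * S t)
    = - (LINT t|lborel. indicator {0<..<T} t * (?as t * - 1)) + sig * (LINT t|lborel. indicator {0<..<T} t * ?ps t)"
  proof -
   have i1: "integ (%t. indicator {0<..<T} t * (?as t * - 1))" "integ (%t. indicator {0<..<T} t * ?ps t)"
    by (rule time_integral(2); intro continuous_on_mult cp continuous_on_const)+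
   have "(LINT t|lborel. indicator {0<..<T} t * S t)
    = (LINT t|lborel. - (indicator {0<..<T} t * (?as t * - 1)) + sig * (indicator {0<..<T} t * ?ps t))"
    by (rule LINT_cong) (simp_all add: S_def algebra_simps)
   then show ?thesis using i1 by simp
  qed
  have P: "(LINT z|lborel. ?I z * (\<bar>ur z - k\<bar> * ?f z)) + (LINT z|lborel. ?I z * (?s z * (H (ur z) - H k) * ?g z))
    + sig * ((LINT z|lborel. ?I z * (ur z * ?f z)) + (LINT z|lborel. ?I z * (H (ur z) * ?g z)))
    <= - (real n * T * (LINT x|lborel. ph x)) + 0 + B n"
  proof -
   let ?L = "%z. ?I z * (\<bar>ur z - k\<bar> * ?f z) + ?I z * (?s z * (H (ur z) - H k) * ?g z) + sig * (?I z * (ur z * ?f z) + ?I z * (H (ur z) * ?g z))"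
   let ?q = "%z. 2 * sig * of_bool (real n < sig * ur z) * (H (ur z) - H k)"
   let ?R = "%z. ?I z * (real n * ?f z) + ?I z * ((sig * H k) * ?g z) + ?I z * (?q z * ?g z)"
   have iq: "integ (%z. ?I z * (?q z * ?g z))" unfolding k_def by (rule igen2[OF qm qb])
   have ic1: "integ (%z. ?I z * (real n * ?f z))" by (rule igen1[where B="real n"]) auto
   have ic2: "integ (%z. ?I z * ((sig * H k) * ?g z))" by (rule igen2[where B="\<bar>sig * H k\<bar>"]) auto
   have "integral\<^sup>L lborel ?L <= integral\<^sup>L lborel ?R"
   proof (rule integral_mono)
    show "integ ?L" by (intro Bochner_Integration.integrable_add integrable_mult_right ia ib iu iH)
    show "integ ?R" by (intro Bochner_Integration.integrable_add iq ic1 ic2)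
    fix z :: "real \<times> real"
    have "?I z * (\<bar>ur z - k\<bar> * ?f z + ?s z * (H (ur z) - H k) * ?g z + sig * (ur z * ?f z + H (ur z) * ?g z))
     <= ?I z * (real n * ?f z + (sig * H k) * ?g z + ?q z * ?g z)"
     by (rule mult_left_mono[OF entropy_pair_bound[OF sig nn k_def]]; simp)
    then show "?L z <= ?R z" by (simp only: distrib_left mult.left_commute)
   qed
   moreover have "integral\<^sup>L lborel ?L = (LINT z|lborel. ?I z * (\<bar>ur z - k\<bar> * ?f z)) + (LINT z|lborel. ?I z * (?s z * (H (ur z) - H k) * ?g z))
    + sig * ((LINT z|lborel. ?I z * (ur z * ?f z)) + (LINT z|lborel. ?I z * (H (ur z) * ?g z)))"
    by (simp only: Bochner_Integration.integral_add integral_mult_right_zero Bochner_Integration.integrable_add integrable_mult_right ia ib iu iH)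
   moreover have "integral\<^sup>L lborel ?R = - (real n * T * (LINT x|lborel. ph x)) + 0 + B n"
    by (simp only: Bochner_Integration.integral_add Bochner_Integration.integrable_add iq ic1 ic2 cst1 cst2) (simp only: B_def k_def)
   ultimately show ?thesis by linarith
  qed
  have R: "(LINT x|lborel. \<bar>?r0 x - k\<bar> * (ph x * (T - 0))) = T * (real n * (LINT x|lborel. ph x) + 2 * D n - sig * (LINT x|lborel. ?r0 x * ph x))"
  proof -
   have eq: "\<bar>?r0 x - k\<bar> * (ph x * (T - 0)) = T * (real n * ph x + 2 * (max 0 (sig * ?r0 x - real n) * ph x) - sig * (?r0 x * ph x))" for x
   proof -
    have "\<bar>?r0 x - k\<bar> = real n + 2 * max 0 (sig * ?r0 x - real n) - sig * ?r0 x"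
     using sign_cases[OF sig] by (auto simp: k_def max_def abs_if)
    then show ?thesis by (simp only:) (simp add: algebra_simps)
   qed
   have "(LINT x|lborel. \<bar>?r0 x - k\<bar> * (ph x * (T - 0)))
    = T * (LINT x|lborel. real n * ph x + 2 * (max 0 (sig * ?r0 x - real n) * ph x) - sig * (?r0 x * ph x))"
    unfolding eq by (rule integral_mult_right_zero)
   also have "(LINT x|lborel. real n * ph x + 2 * (max 0 (sig * ?r0 x - real n) * ph x) - sig * (?r0 x * ph x))
    = real n * (LINT x|lborel. ph x) + 2 * D n - sig * (LINT x|lborel. ?r0 x * ph x)"
    using iD[of n] ir0 iph by (simp add: D_def)
   finally show ?thesis .
  qed
  have p0: "pairing u0 ph = (LINT x|lborel. ?r0 x * ph x) + pairing (singular_part u0) ph" by (rule r0(4)[OF K])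
  have W: "(LINT z|lborel. ?I z * (ur z * ?f z)) + (LINT z|lborel. ?I z * (H (ur z) * ?g z))
   = (LINT t|lborel. indicator {0<..<T} t * ?ps t) - pairing u0 ph * T"
   using W1 W2 W3 by simp
  have iT: "T * (abs_pairing (singular_part u0) ph + sig * pairing (singular_part u0) ph) = 0" using init by simp
  have Q: "sig * ((LINT t|lborel. indicator {0<..<T} t * ?ps t) - pairing u0 ph * T)
   = sig * (LINT t|lborel. indicator {0<..<T} t * ?ps t) - T * (sig * (LINT x|lborel. ?r0 x * ph x)) - T * (sig * pairing (singular_part u0) ph)"
   unfolding p0 by (simp add: algebra_simps)
  show ?thesis
   using P[unfolded W Q] E0[unfolded E1 E2 R] SS iT by (simp add: algebra_simps)
 qed
 have "(%n. B n + 2 * T * D n) ---> 0 + 2 * T * 0" by (intro tendsto_intros Blim Dlim)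
 then have "(LINT t|lborel. indicator {0<..<T} t * S t) <= 0 + 2 * T * 0"
  by (rule LIMSEQ_le_const) (use key in blast)
 then have le: "(LINT t|lborel. indicator {0<..<T} t * S t) <= 0" by simp
 have ge: "0 <= (LINT t|lborel. indicator {0<..<T} t * S t)" by (intro integral_nonneg_AE AE_I2) (simp add: S0)
 have cS': "continuous_on {0..T} S" by (rule continuous_on_subset[OF cS]) auto
 have "set_integrable lborel {0<..<T} S" using time_integral(2)[OF cS, of T] by (simp add: set_integrable_def)
 then have "(LINT t|lborel. indicator {0<..<T} t * S t) = integral {0<..<T} S"
  using set_borel_integral_eq_integral(2)[of "{0<..<T}" S] by (simp add: set_lebesgue_integral_def)
 then have "integral {0..T} S = 0" using le ge by (simp add: integral_open_interval_real)
 then have "S t = 0" using integral_eq_0_iff[OF cS' T(1) S0] T(2) by blast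
 then show ?thesis by (simp add: S_def)
qed

definition Xp :: "real set" where "Xp = {y \<in> X. 0 < c y}"
definition Xn :: "real set" where "Xn = {y \<in> X. c y < 0}"

lemma Xpn: "finite Xp" "finite Xn" "Xp \<inter> Xn = {}" "Xp \<union> Xn = X"
 using X_fin c_nz by (auto simp: Xp_def Xn_def not_less order.order_iff_strict)

lemma initial_pairing:
 assumes "bdd_supp K M ph"
 shows "pairing (singular_part u0) ph = (\<Sum>y\<in>X. c y * ph y)" "abs_pairing (singular_part u0) ph = (\<Sum>y\<in>X. \<bar>c y\<bar> * ph y)"
 by (rule point_masses_pairing[OF X_fin s0 assms], assumption)+

lemma singular_slices:
 assumes t: "0 <= t"
 shows "bdd_supp K M ph ==> pairing (singular_part (u t)) ph = (\<Sum>y\<in>X. u t {y} * ph y)"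
  and "bdd_supp K M ph ==> abs_pairing (singular_part (u t)) ph = (\<Sum>y\<in>X. \<bar>u t {y}\<bar> * ph y)"
  and "y \<in> Xp ==> 0 <= u t {y}" "y \<in> Xn ==> u t {y} <= 0"
proof -
 obtain p p' Kp Mp where p0: "separating_tests Xp p p' Kp Mp"
  using separating_tests_exist[OF Xpn(1)] by (elim exE) (rule that)
 obtain q q' Kq Mq where q0: "separating_tests Xn q q' Kq Mq"
  using separating_tests_exist[OF Xpn(2)] by (elim exE) (rule that)
 note sep = separating_tests_def[THEN iffD1, THEN conjunct1, rule_format]
  separating_tests_def[THEN iffD1, THEN conjunct2, THEN conjunct1, rule_format]
  separating_tests_def[THEN iffD1, THEN conjunct2, THEN conjunct2, THEN conjunct1, rule_format]
  separating_tests_def[THEN iffD1, THEN conjunct2, THEN conjunct2, THEN conjunct2, THEN conjunct1, rule_format]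
  separating_tests_def[THEN iffD1, THEN conjunct2, THEN conjunct2, THEN conjunct2, THEN conjunct2, THEN conjunct1, rule_format]
  separating_tests_def[THEN iffD1, THEN conjunct2, THEN conjunct2, THEN conjunct2, THEN conjunct2, THEN conjunct2, rule_format]
 note p = sep[OF p0] and q = sep[OF q0]
 have zp: "abs_pairing (singular_part (u t)) (p n) + pairing (singular_part (u t)) (p n) = 0" for n
 proof -
  have "abs_pairing (singular_part u0) (p n) + 1 * pairing (singular_part u0) (p n) = (\<Sum>y\<in>X. (\<bar>c y\<bar> + c y) * p n y)"
   unfolding initial_pairing[OF p(3)[of n]] by (simp only: mult_1_left distrib_right sum.distrib)
  also have "\<dots> = 0"
  proof (rule sum.neutral, rule ballI)
   fix y assume "y \<in> X"
   then show "(\<bar>c y\<bar> + c y) * p n y = 0" using p(5)[of y n] by (cases "0 < c y") (simp_all add: Xp_def)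
  qed
  finally have z: "abs_pairing (singular_part u0) (p n) + 1 * pairing (singular_part u0) (p n) = 0" .
  have "abs_pairing (singular_part (u t)) (p n) + 1 * pairing (singular_part (u t)) (p n) = 0"
   by (rule entropy_concentration[OF p(1,2,3,4) _ z t]) simp
  then show ?thesis by (simp only: mult_1_left)
 qed
 have zq: "abs_pairing (singular_part (u t)) (q n) - pairing (singular_part (u t)) (q n) = 0" for n
 proof -
  have "abs_pairing (singular_part u0) (q n) + - 1 * pairing (singular_part u0) (q n) = (\<Sum>y\<in>X. (\<bar>c y\<bar> - c y) * q n y)"
   unfolding initial_pairing[OF q(3)[of n]] by (simp only: mult_minus1 add_uminus_conv_diff left_diff_distrib sum_subtractf)
  also have "\<dots> = 0"
  proof (rule sum.neutral, rule ballI)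
   fix y assume "y \<in> X"
   then show "(\<bar>c y\<bar> - c y) * q n y = 0" using q(5)[of y n] by (cases "c y < 0") (simp_all add: Xn_def)
  qed
  finally have z: "abs_pairing (singular_part u0) (q n) + - 1 * pairing (singular_part u0) (q n) = 0" .
  have "abs_pairing (singular_part (u t)) (q n) + - 1 * pairing (singular_part (u t)) (q n) = 0"
   by (rule entropy_concentration[OF q(1,2,3,4) _ z t]) simp
  then show ?thesis by (simp only: mult_minus1 add_uminus_conv_diff)
 qed
 note sc = singular_concentrated[OF u_signed[OF t] Xpn(1-3) p(3,4) _ q(3,4) _ zp zq, unfolded Xpn(4)]
 show "pairing (singular_part (u t)) ph = (\<Sum>y\<in>X. u t {y} * ph y)" if "bdd_supp K M ph"
  by (rule sc(1)) (rule p(6), assumption, rule q(6), assumption, rule that)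
 show "abs_pairing (singular_part (u t)) ph = (\<Sum>y\<in>X. \<bar>u t {y}\<bar> * ph y)" if "bdd_supp K M ph"
  by (rule sc(2)) (rule p(6), assumption, rule q(6), assumption, rule that)
 show "0 <= u t {y}" if "y \<in> Xp"
  by (rule sc(3)) (rule p(6), assumption, rule q(6), assumption, rule that)
 show "u t {y} <= 0" if "y \<in> Xn"
  by (rule sc(4)) (rule p(6), assumption, rule q(6), assumption, rule that)
qed

text \<open>At time zero the slice is replaced by the initial datum, so that the potential at time zero is
 that of the initial datum.\<close>

definition dens :: "real => real => real" where "dens t = regular_part (if t = 0 then u0 else u t)"
definition pmass :: "real => real => real" where "pmass y t = (if t = 0 then c y else u t {y})"

lemma slice_pairing:
 assumes t: "0 <= t" and ph: "bdd_supp K M ph"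
 shows "pairing (if t = 0 then u0 else u t) ph = (LINT x|lborel. dens t x * ph x) + (\<Sum>y\<in>X. pmass y t * ph y)"
 using regular_part_facts(4)[OF u0 ph] regular_part_facts(4)[OF u_signed[OF t] ph]
  initial_pairing(1)[OF ph] singular_slices(1)[OF t ph]
 by (simp add: dens_def pmass_def)

sublocale mass_flow H ur C X dens pmass
proof
 have sg: "signed_radon (if t = 0 then u0 else u t)" if "0 <= t" for t using that u0 u_signed by simp
 show "cont H" "\<bar>H xi\<bar> <= C" "finite X" "ur \<in> BM" for xi
  by (rule H_cont, rule H_bound, rule X_fin, rule ur_meas)
 show "dens t \<in> BM" if "0 <= t" for t unfolding dens_def by (rule regular_part_facts(1)[OF sg[OF that]])
 show "set_integrable lborel K (dens t)" if "0 <= t" "compact K" for t K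
  unfolding dens_def by (rule regular_part_facts(2)[OF sg[OF that(1)] that(2)])
 show "set_integrable lborel ({a..b} \<times> {0..T}) ur" for a b T by (rule ur_int)
 show "AE t in lborel. 0 < t --> (AE x in lborel. ur (x, t) = dens t x)"
  using slice by eventually_elim (simp add: dens_def)
 fix t :: real and ph ph' :: "real => real" and K :: "real set"
 assume t: "0 <= t" and ph: "!!x. (ph has_real_derivative ph' x) (at x)" "cont ph'" and K: "compact K" "!!x. x \<notin> K ==> ph x = 0"
 have cph: "cont ph" by (rule deriv_imp_continuous_on[OF ph(1)])
 obtain M where M: "!!x. \<bar>ph x\<bar> <= M" using bounded_compact_support[OF cph K] by blast
 have bs: "bdd_supp K M ph" using K M borel_measurable_continuous_onI[OF cph] by (simp add: bdd_supp_def)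
 have "pairing (if t = 0 then u0 else u t) ph = pairing u0 ph + (LINT z|lborel. indicator {0..t} (snd z) * (H (ur z) * ph' (fst z)))"
 proof (cases "t = 0")
  case True
  have "(LINT z|lborel. indicator {0..t} (snd z) * (H (ur z) * ph' (fst z))) = 0"
   by (rule integral_eq_zero_AE) (rule AE_mp[OF AE_off_lines[of 0 0]], rule AE_I2, use True in \<open>auto simp: indicator_def\<close>)
  then show ?thesis using True by simp
 next
  case False
  then show ?thesis using weak_balance[OF ph bs t] by simp
 qed
 then show "(LINT x|lborel. dens t x * ph x) + (\<Sum>y\<in>X. pmass y t * ph y)
    = (LINT x|lborel. dens 0 x * ph x) + (\<Sum>y\<in>X. pmass y 0 * ph y)
     + (LINT z|lborel. indicator {0..t} (snd z) * (H (ur z) * ph' (fst z)))"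
  using slice_pairing[OF t bs] slice_pairing[OF order_refl bs] by simp
qed

end

section \<open>From entropy solutions to entropy flows\<close>

lemma one_sided_sgn:
 assumes "sg = sgn_minus \<or> sg = sgn_plus"
 shows "sg \<in> BM" "\<bar>sg r\<bar> <= 1"
proof -
 have eq: "sgn_minus = (%r. - indicator {..<0} r)" by (simp add: fun_eq_iff sgn_minus_def)
 have "sgn_minus \<in> BM" by (subst eq) simp
 moreover have "sgn_plus \<in> BM" by (simp add: sgn_plus_def)
 ultimately
 show "sg \<in> BM" using assms by auto
 show "\<bar>sg r\<bar> <= 1" using assms by (auto simp: sgn_minus_def sgn_plus_def indicator_def)
qed

lemma compact_in_open_interval:
 fixes K :: "real set"
 assumes "compact K" "K \<subseteq> {s<..<T}"
 obtains a b where "s < a" "b < T" "K \<subseteq> {a..b}"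
proof (cases "K = {}")
 case True
 show thesis by (rule that[of "s + 1" "T - 1"]) (use True in auto)
next
 case False
 obtain a where a: "a \<in> K" "!!x. x \<in> K ==> a <= x" using compact_attains_inf[OF assms(1) False] by blast
 obtain b where b: "b \<in> K" "!!x. x \<in> K ==> x <= b" using compact_attains_sup[OF assms(1) False] by blast
 show thesis by (rule that[of a b]) (use a b assms(2) in auto)
qed

text \<open>Averaging over short intervals approximates a continuous weight by continuously
 differentiable ones, as the compatibility condition requires.\<close>

definition weight_approximation :: "real set => real set => real => (real => real) => (real => real) => bool" where
 "weight_approximation S J e bta ga \<longleftrightarrow> ga \<in> C1c S \<and> (\<forall>t. 0 <= ga t) \<and> (\<forall>t. \<bar>bta t - ga t\<bar> <= e * indicator J t) \<and>
  cont ga \<and> (\<forall>t. t \<notin> J --> ga t = 0)"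

lemma smooth_weight:
 fixes bta :: "real => real"
 assumes bta: "cont bta" "!!t. 0 <= bta t" "!!t. t \<notin> {a..b} ==> bta t = 0" and a: "s < a" "b < T" and e: "0 < e"
 shows "\<exists>ga. weight_approximation {s<..<T} {a - 1..b} e bta ga"
proof -
 have "uniformly_continuous_on {a - 1..b + 1} bta"
  by (rule compact_uniformly_continuous[OF continuous_on_subset[OF bta(1)] compact_Icc]) simp
 then obtain dl where dl: "dl > 0" "!!t t'. t \<in> {a - 1..b + 1} ==> t' \<in> {a - 1..b + 1} ==> dist t' t < dl ==> dist (bta t') (bta t) < e"
  unfolding uniformly_continuous_on_def using e by metis
 define h where "h = min (dl / 2) (min 1 ((a - s) / 2))"
 have h0: "0 < h" "h <= dl / 2" "h <= 1" using dl(1) a by (simp_all add: h_def)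
 have "h <= (a - s) / 2" unfolding h_def by (intro min.coboundedI2 order_refl)
 then have "2 * h <= a - s" by simp
 then have "s < a - h" using h0(1) by linarith
 moreover have "h < dl" using h0(2) dl(1) by linarith
 ultimately have h: "0 < h" "h < dl" "h <= 1" "s < a - h" using h0 by simp_all
 define ga where "ga t = integral {0..h} (%xi. bta (t + xi)) / h" for t
 have cbta: "continuous_on {0..h} (%xi. bta (t + xi))" for t
  by (rule continuous_on_comp_UNIV[OF bta(1)]) (intro continuous_intros)
 have d: "(ga has_real_derivative (bta (t + h) - bta t) / h) (at t)" for t
  unfolding ga_def[abs_def] by (rule DERIV_cdivide[OF sliding_integral_deriv[OF bta(1)]]) (use h in simp)
 have cd: "cont (%t. (bta (t + h) - bta t) / h)"
  by (intro continuous_on_divide continuous_on_diff continuous_on_comp_UNIV[OF bta(1)] continuous_intros) (use h in auto)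
 have z: "ga t = 0" if "t \<notin> {a - h..b}" for t
 proof -
  have "integral {0..h} (%xi. bta (t + xi)) = integral {0..h} (%xi. 0 :: real)"
   by (rule Henstock_Kurzweil_Integration.integral_cong) (use that in \<open>auto intro!: bta(3)\<close>)
  then show ?thesis by (simp add: ga_def)
 qed
 show ?thesis
  unfolding weight_approximation_def
 proof (intro exI[of _ ga] conjI allI impI)
  have "ga C1_differentiable_on UNIV"
   unfolding C1_differentiable_on_def
   using d cd by (intro exI[of _ "%t. (bta (t + h) - bta t) / h"]) (auto simp: has_real_derivative_iff_has_vector_derivative)
  moreover have "compact {a - h..b}" "{a - h..b} \<subseteq> {s<..<T}" using h a by auto
  ultimately show "ga \<in> C1c {s<..<T}" unfolding C1c_def using z by blast
  show "0 <= ga t" for t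
   unfolding ga_def using h bta(2)
   by (intro divide_nonneg_nonneg Henstock_Kurzweil_Integration.integral_nonneg integrable_continuous_interval cbta) auto
  show "cont ga" by (rule deriv_imp_continuous_on[OF d])
  show z1: "ga t = 0" if "t \<notin> {a - 1..b}" for t by (rule z) (use that h in auto)
  show "\<bar>bta t - ga t\<bar> <= e * indicator {a - 1..b} t" for t
  proof (cases "t \<in> {a - 1..b}")
   case True
   have "norm (integral {0..h} (%xi. bta (t + xi) - bta t)) <= e * (h - 0)"
   proof (rule integral_bound)
    fix xi assume "xi \<in> {0..h}"
    then have "dist (bta (t + xi)) (bta t) < e" using True h by (intro dl(2)) (auto simp: dist_real_def)
    then show "norm (bta (t + xi) - bta t) <= e" by (simp add: dist_real_def)
   qed (use h in \<open>auto intro!: continuous_on_diff cbta\<close>)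
   moreover have "integral {0..h} (%xi. bta (t + xi) - bta t) = integral {0..h} (%xi. bta (t + xi)) - h * bta t"
    using h by (subst Henstock_Kurzweil_Integration.integral_diff) (auto intro!: integrable_continuous_interval cbta)
   ultimately have "\<bar>integral {0..h} (%xi. bta (t + xi)) - h * bta t\<bar> <= e * h" by simp
   moreover have "integral {0..h} (%xi. bta (t + xi)) - h * bta t = h * (ga t - bta t)" using h by (simp add: ga_def right_diff_distrib)
   ultimately have "h * \<bar>ga t - bta t\<bar> <= h * e" using h by (simp add: abs_mult mult.commute)
   then have "\<bar>ga t - bta t\<bar> <= e" using h by simp
   then show ?thesis using True by (simp add: abs_minus_commute)
  next
   case False
   then show ?thesis using z1[OF False] bta(3)[of t] by auto
  qed
 qed
qed

context entropy_data begin

text \<open>The essential limits of the compatibility condition exist for continuously differentiable weights in time;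
 continuous weights are approximated in the mean.\<close>

lemma compat_trace:
 assumes y: "y \<in> X" and sig: "\<bar>sig\<bar> = 1" and s: "0 <= s" and T: "ereal T <= waiting_time u y"
  and sg: "sg = (if c y > 0 then sgn_minus else sgn_plus)"
 shows "trace_nonpos s T y sig (%z. sg (ur z - k) * (H (ur z) - H k))"
 unfolding trace_nonpos_def
proof (intro allI impI, elim conjE)
 fix bta :: "real => real" and K and e :: real
 assume bta: "cont bta" "\<forall>t. 0 <= bta t" and K: "compact K" "K \<subseteq> {s<..<T}" and z: "\<forall>t. t \<notin> K --> bta t = 0" and e: "0 < e"
 define g where "g z = sg (ur z - k) * (H (ur z) - H k)" for z
 have sg': "sg = sgn_minus \<or> sg = sgn_plus" using sg by simp
 note sgp = one_sided_sgn[OF sg']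
 have [measurable]: "sg \<in> BM" by (rule sgp(1))
 have gm: "g \<in> BM" unfolding g_def[abs_def] by measurable
 have gb: "\<bar>g z\<bar> <= 2 * C" for z
 proof -
  have "\<bar>sg (ur z - k)\<bar> * \<bar>H (ur z) - H k\<bar> <= 1 * (2 * C)"
   by (rule mult_mono[OF sgp(2)]) (use H_bound[of "ur z"] H_bound[of k] in auto)
  then show ?thesis by (simp add: g_def abs_mult)
 qed
 have gx: "(%t. g (x, t)) \<in> LM" for x
 proof -
  have "(%t. g (x, t)) \<in> BM"
   by (rule measurable_compose[OF _ gm]) (intro borel_measurable_continuous_onI continuous_intros)
  then show ?thesis by simp
 qed
 obtain a b where ab: "s < a" "b < T" "K \<subseteq> {a..b}" by (rule compact_in_open_interval[OF K])
 define L where "L = measure lborel {a - 1..b}"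
 define e' where "e' = e / (2 * ((2 * C + 1) * (L + 1)))"
 have L0: "0 <= L" by (simp add: L_def)
 have e': "0 < e'" using e C_nonneg L0 by (simp add: e'_def)
 have "(2 * C) * L <= (2 * C + 1) * (L + 1)" by (intro mult_mono) (use C_nonneg L0 in auto)
 then have "(2 * C) * L * e' <= (2 * C + 1) * (L + 1) * e'" by (rule mult_right_mono) (use e' in simp)
 moreover have "(2 * C + 1) * (L + 1) * e' = e / 2"
 proof -
  have "(2 * C + 1) * (L + 1) > 0" using C_nonneg L0 by (intro mult_pos_pos) auto
  then show ?thesis unfolding e'_def by (simp add: field_simps)
 qed
 ultimately have "(2 * C) * L * e' <= e / 2" by (simp only:)
 then have small: "2 * C * e' * L <= e / 2" by (simp only: mult_ac)
 have bta0: "0 <= bta t" "t \<notin> {a..b} ==> bta t = 0" for t using bta(2) z ab(3) by auto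
 have "\<exists>ga. weight_approximation {s<..<T} {a - 1..b} e' bta ga"
  by (rule smooth_weight[OF bta(1) bta0(1) _ ab(1,2) e']) (rule bta0(2))
 then obtain ga where ga0: "weight_approximation {s<..<T} {a - 1..b} e' bta ga" by (elim exE) (rule that)
 have ga: "ga \<in> C1c {s<..<T}" "0 <= ga t" "\<bar>bta t - ga t\<bar> <= e' * indicator {a - 1..b} t"
  "cont ga" "t \<notin> {a - 1..b} ==> ga t = 0" for t
  using ga0 unfolding weight_approximation_def by auto
 have ibta: "integ (%t. g (x, t) * bta t)" for x
  by (rule integrable_bounded_mult[OF integrable_compact_support[OF bta(1) compact_Icc bta0(2)] gx gb])
 have iga: "integ (%t. g (x, t) * ga t)" for x
  by (rule integrable_bounded_mult[OF integrable_compact_support[OF ga(4) compact_Icc ga(5)] gx gb])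
 have close: "\<bar>(LINT t|lborel. g (x, t) * bta t) - (LINT t|lborel. g (x, t) * ga t)\<bar> <= e / 2" for x
 proof -
  have pw: "\<bar>g (x, t) * bta t - g (x, t) * ga t\<bar> <= 2 * C * e' * indicator {a - 1..b} t" for t
  proof -
   have "\<bar>g (x, t)\<bar> * \<bar>bta t - ga t\<bar> <= (2 * C) * (e' * indicator {a - 1..b} t)"
    by (rule mult_mono[OF gb ga(3)]) (use C_nonneg in auto)
   then show ?thesis by (simp only: right_diff_distrib[symmetric] abs_mult mult.assoc)
  qed
  have "\<bar>(LINT t|lborel. g (x, t) * bta t) - (LINT t|lborel. g (x, t) * ga t)\<bar> <= (LINT t|lborel. 2 * C * e' * indicator {a - 1..b} t)"
   by (rule abs_integral_diff_le[OF ibta iga _ pw]) (intro integrable_mult_right interval_measure(3))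
  also have "\<dots> = 2 * C * e' * L" by (simp add: L_def)
  finally show ?thesis using small by linarith
 qed
 define I where "I = {t. 0 < t \<and> ereal t < waiting_time u y}"
 have sub: "{s<..<T} \<subseteq> I"
 proof
  fix t assume "t \<in> {s<..<T}"
  then have "0 < t" "ereal t < ereal T" using s by auto
  then show "t \<in> I" using order.strict_trans2[OF \<open>ereal t < ereal T\<close> T] unfolding I_def by simp
 qed
 have gaI: "ga \<in> C1c I" using ga(1) sub unfolding C1c_def by blast
 have F: "(LINT t:I|lborel. sg (ur (x, t) - k) * (H (ur (x, t)) - H k) * ga t) = (LINT t|lborel. g (x, t) * ga t)" for x
  unfolding set_lebesgue_integral_def
 proof (rule LINT_cong[OF refl])
  fix t
  have "ga t = 0" if "t \<notin> I" using gaI that unfolding C1c_def by blast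
  then show "indicator I t *\<^sub>R (sg (ur (x, t) - k) * (H (ur (x, t)) - H k) * ga t) = g (x, t) * ga t"
   by (cases "t \<in> I") (auto simp: g_def)
 qed
 have "(\<exists>L. has_ess_lim (%x. LINT t|lborel. g (x, t) * ga t) L y {y<..} \<and> L <= 0) \<and>
    (\<exists>L. has_ess_lim (%x. LINT t|lborel. g (x, t) * ga t) L y {..<y} \<and> L \<ge> 0)"
  using compat[OF y, unfolded compatible_at_def Let_def, folded I_def sg, rule_format, OF gaI ga(2), of k]
  unfolding F .
 then obtain L1 L2 where L1: "has_ess_lim (%x. LINT t|lborel. g (x, t) * ga t) L1 y {y<..}" "L1 <= 0"
  and L2: "has_ess_lim (%x. LINT t|lborel. g (x, t) * ga t) L2 y {..<y}" "L2 \<ge> 0" by (elim conjE exE)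
 have e2: "e / 2 > 0" using e by simp
 have "\<exists>d>0. AE x in lborel. 0 < sig * (x - y) \<and> sig * (x - y) < d --> sig * (LINT t|lborel. g (x, t) * ga t) <= e / 2"
 proof (cases "sig = 1")
  case True
  obtain d where d: "d > 0" "AE x in lborel. x \<in> {y<..} \<and> dist x y < d --> dist (LINT t|lborel. g (x, t) * ga t) L1 < e / 2"
   using L1(1) e2 unfolding has_ess_lim_def by blast
  from d(2) have "AE x in lborel. 0 < sig * (x - y) \<and> sig * (x - y) < d --> sig * (LINT t|lborel. g (x, t) * ga t) <= e / 2"
  proof eventually_elim
   case (elim x)
   show ?case
   proof
    assume h: "0 < sig * (x - y) \<and> sig * (x - y) < d"
    then have "x \<in> {y<..} \<and> dist x y < d" unfolding True by (auto simp: dist_real_def)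
    with elim have "dist (LINT t|lborel. g (x, t) * ga t) L1 < e / 2" by (rule mp)
    then show "sig * (LINT t|lborel. g (x, t) * ga t) <= e / 2"
     using L1(2) unfolding True dist_real_def by linarith
   qed
  qed
  then show ?thesis using d(1) by blast
 next
  case False
  then have sig1: "sig = - 1" using sign_cases[OF sig] by simp
  obtain d where d: "d > 0" "AE x in lborel. x \<in> {..<y} \<and> dist x y < d --> dist (LINT t|lborel. g (x, t) * ga t) L2 < e / 2"
   using L2(1) e2 unfolding has_ess_lim_def by blast
  from d(2) have "AE x in lborel. 0 < sig * (x - y) \<and> sig * (x - y) < d --> sig * (LINT t|lborel. g (x, t) * ga t) <= e / 2"
  proof eventually_elim
   case (elim x)
   show ?case
   proof
    assume h: "0 < sig * (x - y) \<and> sig * (x - y) < d"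
    then have "x \<in> {..<y} \<and> dist x y < d" unfolding sig1 by (auto simp: dist_real_def)
    with elim have "dist (LINT t|lborel. g (x, t) * ga t) L2 < e / 2" by (rule mp)
    then show "sig * (LINT t|lborel. g (x, t) * ga t) <= e / 2"
     using L2(2) unfolding sig1 dist_real_def by linarith
   qed
  qed
  then show ?thesis using d(1) by blast
 qed
 then obtain d where d: "d > 0" "AE x in lborel. 0 < sig * (x - y) \<and> sig * (x - y) < d --> sig * (LINT t|lborel. g (x, t) * ga t) <= e / 2"
  by blast
 have cl: "sig * (LINT t|lborel. g (x, t) * bta t) <= sig * (LINT t|lborel. g (x, t) * ga t) + e / 2" for x
 proof -
  have cb: "(LINT t|lborel. g (x, t) * bta t) <= (LINT t|lborel. g (x, t) * ga t) + e / 2"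
   "(LINT t|lborel. g (x, t) * ga t) <= (LINT t|lborel. g (x, t) * bta t) + e / 2"
   using close[of x] unfolding abs_le_iff by linarith+
  from sign_cases[OF sig] show ?thesis
  proof
   assume "sig = 1" then show ?thesis using cb(1) by (simp only: mult_1_left)
  next
   assume "sig = - 1"
   moreover have "- (LINT t|lborel. g (x, t) * bta t) <= - (LINT t|lborel. g (x, t) * ga t) + e / 2" using cb(2) by linarith
   ultimately show ?thesis by (simp only: mult_minus1)
  qed
 qed
 from d(2) have "AE x in lborel. 0 < sig * (x - y) \<and> sig * (x - y) < d --> sig * (LINT t|lborel. g (x, t) * bta t) <= e"
 proof eventually_elim
  case (elim x)
  then show ?case using cl[of x] by auto
 qed
 then show "\<exists>d>0. AE x in lborel. 0 < sig * (x - y) \<and> sig * (x - y) < d --> sig * (LINT t|lborel. sg (ur (x, t) - k) * (H (ur (x, t)) - H k) * bta t) <= e"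
  using d(1) unfolding g_def by blast
qed

lemma mass_eq: "y \<in> X ==> mass y t = pmass y t" by (simp add: mass_def)

text \<open>Point masses vanish after their waiting time by definition, and at the waiting time itself
 by continuity. In particular the waiting time of a nonzero initial mass is positive.\<close>

lemma mass_after_waiting:
 assumes y: "y \<in> X" and t: "0 <= t" and w: "waiting_time u y <= ereal t"
 shows "pmass y t = 0"
proof -
 have after: "pmass y t' = 0" if "t < t'" for t'
 proof (rule ccontr)
  have t': "0 < t'" "0 <= t'" using that t by auto
  assume "pmass y t' \<noteq> 0"
  then have "singular_part (u t') {y} \<noteq> 0" using regular_part_facts(6)[OF u_signed[OF t'(2)]] t' by (simp add: pmass_def)
  then have "ereal t' \<in> {ereal t | t. t > 0 \<and> singular_part (u t) {y} \<noteq> 0}" using t' by blast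
  then have "ereal t' <= waiting_time u y" unfolding waiting_time_def by (rule Sup_upper)
  then have "ereal t' <= ereal t" using w by (rule order_trans)
  then show False using that by simp
 qed
 have "\<bar>pmass y t\<bar> <= 0 + e" if e: "0 < e" for e
 proof -
  define t' where "t' = t + e / (2 * C + 1)"
  have t': "t < t'" "0 <= t'" using e C_nonneg t by (auto simp: t'_def intro!: add_nonneg_nonneg divide_nonneg_nonneg)
  have "\<bar>mass y t - mass y t'\<bar> <= 2 * C * \<bar>t - t'\<bar>" by (rule pot_traces(3)[OF order_refl t t'(2)])
  then have "\<bar>pmass y t\<bar> <= 2 * C * (e / (2 * C + 1))" using after[OF t'(1)] y e C_nonneg by (simp add: mass_eq t'_def)
  also have "\<dots> <= e" using e C_nonneg by (simp add: field_simps)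
  finally show ?thesis by simp
 qed
 then have "\<bar>pmass y t\<bar> <= 0" by (rule field_le_epsilon)
 then show ?thesis by simp
qed

lemma pmass_sign:
 assumes "0 <= t" shows "y \<in> Xp ==> 0 <= pmass y t" "y \<in> Xn ==> pmass y t <= 0"
 using singular_slices(3,4)[OF assms, of y] by (auto simp: pmass_def Xp_def Xn_def)

text \<open>The support of the test function avoids the points that carry mass during the window, so the singular part
 contributes nothing.\<close>

lemma interior_entropy:
 assumes s: "0 <= s" and T: "s < T" and R: "!!y t. y \<in> R ==> y \<in> X ==> t \<in> {s..T} ==> pmass y t = 0"
  and K: "compact K" "K \<subseteq> R \<times> {s<..<T}" and ze: "C1_plane ze zex zet" "!!z. 0 <= ze z"
  and z: "!!z. z \<notin> K ==> ze z = 0 \<and> zex z = 0 \<and> zet z = 0"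
 shows "0 <= (LINT z|lborel. \<bar>ur z - k\<bar> * zet z + sgn (ur z - k) * (H (ur z) - H k) * zex z)"
proof -
 let ?f = "%z. \<bar>ur z - k\<bar> * zet z + sgn (ur z - k) * (H (ur z) - H k) * zex z"
 have T0: "0 < T" using s T by simp
 obtain zetx where tx: "cont ze" "cont zex" "cont zet" "cont zetx"
  "!!x t. ((%y. ze (y, t)) has_real_derivative zex (x, t)) (at x)"
  "!!x t. ((%s. ze (x, s)) has_real_derivative zet (x, t)) (at t)"
  "!!x t. ((%y. zet (y, t)) has_real_derivative zetx (x, t)) (at x)"
  using ze(1) unfolding C1_plane_def by (elim conjE exE) blast
 have K1: "compact (fst ` K)" by (rule compact_continuous_image[OF continuous_on_fst[OF continuous_on_id] K(1)])
 have off: "(x, t) \<notin> K" if "x \<notin> fst ` K" for x t using that by force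
 have late: "(x, t) \<notin> K" if "t <= s \<or> T <= t" for x t using that K(2) by auto
 have C1: "C1_test T ze zex zet"
  unfolding C1_test_def cont_test_def
 proof (intro conjI exI[of _ "fst ` K"] exI[of _ zetx] allI ballI impI)
  show "((%s. ze (x, s)) has_real_derivative zet (x, t)) (at t within {0..T})" for x t
   by (rule has_field_derivative_at_within[OF tx(6)])
 qed (use tx(5,7) K1 z[OF off] in \<open>auto intro: continuous_on_subset[OF tx(1)] continuous_on_subset[OF tx(2)]
    continuous_on_subset[OF tx(3)] continuous_on_subset[OF tx(4)]\<close>)
 have "entropy_solution H u0 T u ur" using sol T0 by (simp add: global_entropy_solution_def)
 then have ent: "- (LINT x|lborel. \<bar>regular_part u0 x - k\<bar> * ze (x, 0)) - abs_pairing (singular_part u0) (%x. ze (x, 0))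
    <= (LINT z:strip T|lborel. ?f z) + (LINT t|lebesgue_on {0<..<T}. abs_pairing (singular_part (u t)) (%x. zet (x, t)))"
  if "\<forall>x. ze (x, T) = 0" "\<forall>x. \<forall>t\<in>{0..T}. 0 <= ze (x, t)"
  unfolding entropy_solution_def using that C1 by (elim conjE) simp
 have ze0: "ze (x, 0) = 0" "ze (x, T) = 0" for x using z[OF late, of 0 x] z[OF late, of T x] s by auto
 have "abs_pairing (singular_part u0) (%x. 0) = 0" by (simp add: abs_pairing_def)
 then have 1: "0 <= (LINT z:strip T|lborel. ?f z) + (LINT t|lebesgue_on {0<..<T}. abs_pairing (singular_part (u t)) (%x. zet (x, t)))"
  using ent ze(2) ze0 by simp
 have 2: "(LINT z:strip T|lborel. ?f z) = (LINT z|lborel. ?f z)"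
  unfolding strip_integral
 proof (rule LINT_cong[OF refl])
  fix w :: "real \<times> real"
  show "indicator {0<..<T} (snd w) * ?f w = ?f w"
  proof (cases "snd w \<in> {0<..<T}")
   case False
   then have "w \<notin> K" using late[of "snd w" "fst w"] s by auto
   then show ?thesis using z by simp
  qed simp
 qed
 have "abs_pairing (singular_part (u t)) (%x. zet (x, t)) = 0" if t: "t \<in> {0<..<T}" for t
 proof -
  have ct: "cont (%x. zet (x, t))" by (rule continuous_on_comp_UNIV[OF tx(3)]) (intro continuous_intros)
  have zt: "zet (x, t) = 0" if "x \<notin> fst ` K" for x using z[OF off[OF that]] by simp
  obtain M where M: "!!x. \<bar>zet (x, t)\<bar> <= M" using bounded_compact_support[OF ct K1 zt] by blast
  have bs: "bdd_supp (fst ` K) M (%x. zet (x, t))"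
   using K1 M zt borel_measurable_continuous_onI[OF ct] by (simp add: bdd_supp_def)
  have t0: "0 <= t" using t by simp
  have "abs_pairing (singular_part (u t)) (%x. zet (x, t)) = (\<Sum>y\<in>X. \<bar>u t {y}\<bar> * zet (y, t))"
   by (rule singular_slices(2)[OF t0 bs])
  also have "\<dots> = 0"
  proof (rule sum.neutral, rule ballI)
   fix y assume y: "y \<in> X"
   show "\<bar>u t {y}\<bar> * zet (y, t) = 0"
   proof (cases "(y, t) \<in> K")
    case True
    then have "y \<in> R" "t \<in> {s..T}" using K(2) by auto
    then have "pmass y t = 0" using R y by blast
    then show ?thesis using t by (simp add: pmass_def)
   next
    case False then show ?thesis using z by simp
   qed
  qed
  finally show ?thesis .
 qed
 then have "(LINT t|lebesgue_on {0<..<T}. abs_pairing (singular_part (u t)) (%x. zet (x, t))) = (LINT t|lebesgue_on {0<..<T}. 0)"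
  by (intro LINT_cong) simp_all
 then show ?thesis using 1 2 by simp
qed

lemma flow_family_pot:
 "flow_family H ur pot C Xp Xn (waiting_time u) (%y t. pot (y, t)) (%y t. pot (y, t) - mass y t)"
proof (rule flow_family.intro)
 show "finite Xp" "finite Xn" by (rule Xpn)+
 show "0 <= C" by (rule C_nonneg)
 show "\<bar>pot (x, t) - pot (x, t')\<bar> <= C * \<bar>t - t'\<bar>" if "0 <= t" "0 <= t'" for x t t' by (rule pot_lip[OF that])
 fix s T l r :: real
 assume s: "0 <= s" and T: "s < T" and lr: "l < r"
  and w: "!!y. y \<in> Xp \<union> Xn ==> y \<in> {l<..<r} ==> ereal T <= waiting_time u y \<or> waiting_time u y <= ereal s"
 define Yp Yn where "Yp = {y \<in> Xp. y \<in> {l<..<r} \<and> ereal T <= waiting_time u y}"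
  and "Yn = {y \<in> Xn. y \<in> {l<..<r} \<and> ereal T <= waiting_time u y}"
 have Y: "Yp \<subseteq> Xp" "Yn \<subseteq> Xn" "Yp \<subseteq> {l<..<r}" "Yn \<subseteq> {l<..<r}" by (auto simp: Yp_def Yn_def)
 have YX: "y \<in> X" if "y \<in> Yp \<union> Yn" for y using that Y Xpn(4) by blast
 have Yw: "ereal T <= waiting_time u y" if "y \<in> Yp \<union> Yn" for y using that by (auto simp: Yp_def Yn_def)
 have gone: "pmass y t = 0" if y: "y \<in> {l<..<r} - (Yp \<union> Yn)" "y \<in> X" and t: "t \<in> {s..T}" for y t
 proof -
  have "waiting_time u y <= ereal s" using w[of y] y Xpn(4) by (auto simp: Yp_def Yn_def)
  moreover have "ereal s <= ereal t" using t by simp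
  ultimately have "waiting_time u y <= ereal t" by (rule order_trans)
  then show ?thesis using y(2) s t by (intro mass_after_waiting) auto
 qed
 have "entropy_flow H ur pot s T l r C Yp Yn (%y t. pot (y, t)) (%y t. pot (y, t) - mass y t)"
 proof
  show "cont H" "\<bar>H xi\<bar> <= C" "s < T" "ur \<in> BM" for xi
   by (rule H_cont, rule H_bound, rule T, rule ur_meas)
  show "finite Yp" "finite Yn" "Yp \<inter> Yn = {}" "Yp \<subseteq> {l<..<r}" "Yn \<subseteq> {l<..<r}"
   using Y Xpn by (auto intro: finite_subset)
  show "set_integrable lborel ({l..r} \<times> {s..T}) ur"
   by (rule set_integrable_subset[OF ur_int[of l r T]]) (use s in \<open>auto simp: borel_closed closed_Times\<close>)
  show "0 <= (LINT z|lborel. \<bar>ur z - k\<bar> * zet z + sgn (ur z - k) * (H (ur z) - H k) * zex z)"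
   if "compact K" "K \<subseteq> ({l<..<r} - (Yp \<union> Yn)) \<times> {s<..<T}" "C1_plane ze zex zet" "!!z. 0 <= ze z"
    "!!z. z \<notin> K ==> ze z = 0 \<and> zex z = 0 \<and> zet z = 0" for k K ze zex zet
   by (rule interior_entropy[OF s T gone that])
  show "continuous_on (({l<..<r} - (Yp \<union> Yn)) \<times> {s..T}) pot"
   by (rule pot_cont[OF s]) (auto simp: mass_def intro: gone)
  show "\<bar>pot (x, t) - pot (x, t')\<bar> <= C * \<bar>t - t'\<bar>" if "t \<in> {s..T}" "t' \<in> {s..T}" for x t t'
   using that s by (intro pot_lip) auto
  show "integral {t..t'} (%tau. pot (y, tau) - pot (x, tau)) = (LINT z:{x..y} \<times> {t..t'}|lborel. ur z)"
   if h: "x <= y" "t <= t'" "{x..y} \<subseteq> {l<..<r} - (Yp \<union> Yn)" "{t..t'} \<subseteq> {s<..<T}" for x y t t'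
  proof (rule pot_space_derivative[OF h(1) _ h(2)])
   show "0 < t" using h(2,4) s by auto
   show "pmass y' tau = 0" if "y' \<in> X" "y' \<in> {x..y}" "tau \<in> {t..t'}" for y' tau
    by (rule gone[OF subsetD[OF h(3) that(2)] that(1)]) (use h(4) that(3) in auto)
  qed
  show "integral {x..y} (%xi. pot (xi, t') - pot (xi, t)) = - (LINT z:{x..y} \<times> {t..t'}|lborel. H (ur z))"
   if h: "x <= y" "t <= t'" "{t..t'} \<subseteq> {s<..<T}" for x y t t'
   by (rule pot_time_derivative[OF h(1) _ h(2)]) (use h s in auto)
  show "trace_lim s T y 1 pot (%t. pot (y, t))" "trace_lim s T y (- 1) pot (%t. pot (y, t) - mass y t)" for y
   by (rule pot_traces[OF s])+
  show "pot (y, t) - mass y t <= pot (y, t)" if "y \<in> Yp" "t \<in> {s..T}" for y t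
   using pmass_sign(1)[of t y] that s Y(1) YX[of y] by (auto simp: mass_eq)
  show "pot (y, t) <= pot (y, t) - mass y t" if "y \<in> Yn" "t \<in> {s..T}" for y t
   using pmass_sign(2)[of t y] that s Y(2) YX[of y] by (auto simp: mass_eq)
  show "trace_nonpos s T y sig (%z. sgn_minus (ur z - k) * (H (ur z) - H k))" if y: "y \<in> Yp" and sig: "\<bar>sig\<bar> = 1" for y k sig
   by (rule compat_trace[OF YX sig s Yw]) (use y Y(1) in \<open>auto simp: Xp_def\<close>)
  show "trace_nonpos s T y sig (%z. sgn_plus (ur z - k) * (H (ur z) - H k))" if y: "y \<in> Yn" and sig: "\<bar>sig\<bar> = 1" for y k sig
   by (rule compat_trace[OF YX sig s Yw]) (use y Y(2) in \<open>auto simp: Xn_def\<close>)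
 qed
 then show "entropy_flow H ur pot s T l r C {y \<in> Xp. y \<in> {l<..<r} \<and> ereal T <= waiting_time u y}
   {y \<in> Xn. y \<in> {l<..<r} \<and> ereal T <= waiting_time u y} (%y t. pot (y, t)) (%y t. pot (y, t) - mass y t)"
  unfolding Yp_def Yn_def .
qed

text \<open>Up to the finitely many point masses, the increments of the initial potential are the integrals of the
 initial density.\<close>

lemma pot_growth:
 assumes g: "!!y. \<bar>LBINT s=ereal 0..ereal y. regular_part u0 s\<bar> <= A + B * \<bar>y\<bar>"
 shows "\<bar>pot (x, 0)\<bar> <= (A + (\<Sum>y\<in>X. \<bar>c y\<bar>) + \<bar>pot (0, 0)\<bar>) + B * \<bar>x\<bar>"
proof -
 have d: "dens 0 = regular_part u0" "pmass y 0 = c y" for y by (simp_all add: dens_def pmass_def)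
 have cb: "\<bar>\<Sum>y\<in>X. pmass y 0 * indicator S y\<bar> <= (\<Sum>y\<in>X. \<bar>c y\<bar>)" for S :: "real set"
  unfolding d by (rule order_trans[OF sum_abs sum_mono]) (auto simp: abs_mult indicator_def)
 show ?thesis
 proof (cases "0 <= x")
  case True
  have "(LBINT s=ereal 0..ereal x. regular_part u0 s) = (LINT y:{0<..x}|lborel. dens 0 y)"
   unfolding d by (rule interval_integral_Ioc[OF True])
  then show ?thesis using pot_diff[OF order_refl True] g[of x] cb[of "{0<..x}"] by linarith
 next
  case False
  then have x: "x <= 0" by simp
  have "(LBINT s=ereal 0..ereal x. regular_part u0 s) = - (LBINT s=ereal x..ereal 0. regular_part u0 s)"
   by (rule interval_integral_endpoints_reverse)
  also have "(LBINT s=ereal x..ereal 0. regular_part u0 s) = (LINT y:{x<..0}|lborel. dens 0 y)"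
   unfolding d by (rule interval_integral_Ioc[OF x])
  finally show ?thesis using pot_diff[OF order_refl x] g[of x] cb[of "{x<..0}"] by linarith
 qed
qed

end

section \<open>Waiting times\<close>

lemma frequently_mirror:
 fixes P :: "real => bool"
 assumes "frequently P at_bot" shows "frequently (%xi. P (- xi)) at_top"
 using assms unfolding frequently_def at_bot_mirror eventually_filtermap by simp

lemma real_limsup_liminf:
 fixes H :: "real => real"
 assumes b: "!!xi. \<bar>H xi\<bar> <= C" and F: "F \<noteq> bot"
 obtains hs hi where "Limsup F (%xi. ereal (H xi)) = ereal hs" "Liminf F (%xi. ereal (H xi)) = ereal hi"
proof -
 let ?s = "Limsup F (%xi. ereal (H xi))" and ?i = "Liminf F (%xi. ereal (H xi))"
 have "- C <= H xi" "H xi <= C" for xi using b[of xi] by auto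
 then have 1: "?s <= ereal C" "ereal (- C) <= ?i"
  by (intro Limsup_bounded Liminf_bounded always_eventually; simp)+
 have 2: "?i <= ?s" by (rule Liminf_le_Limsup[OF F])
 obtain hs where hs: "?s = ereal hs" using 1 2 by (cases ?s) auto
 obtain hi where hi: "?i = ereal hi" using 1 2 by (cases ?i) auto
 show thesis by (rule that[OF hs hi])
qed

lemma frequently_near_limsup:
 fixes H :: "real => real"
 assumes "Limsup F (%xi. ereal (H xi)) = ereal hs" "h < hs"
 shows "frequently (%xi. h <= H xi) F"
proof (rule ccontr)
 assume "\<not> frequently (%xi. h <= H xi) F"
 then have "eventually (%xi. ereal (H xi) <= ereal h) F"
  unfolding frequently_def not_not by (rule eventually_mono) simp
 then have "Limsup F (%xi. ereal (H xi)) <= ereal h" by (rule Limsup_bounded)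
 then show False using assms by simp
qed

lemma frequently_near_liminf:
 fixes H :: "real => real"
 assumes "Liminf F (%xi. ereal (H xi)) = ereal hi" "hi < h"
 shows "frequently (%xi. H xi <= h) F"
proof (rule ccontr)
 assume "\<not> frequently (%xi. H xi <= h) F"
 then have "eventually (%xi. ereal h <= ereal (H xi)) F"
  unfolding frequently_def not_not by (rule eventually_mono) simp
 then have "ereal h <= Liminf F (%xi. ereal (H xi))" by (rule Liminf_bounded)
 then show False using assms by simp
qed

context flow_family begin

text \<open>The rates of \<open>waiting_rate\<close> come arbitrarily close to \<open>hs - hi\<close>.\<close>

lemma waiting_bound:
 assumes a: "a \<in> Xp" and d: "hi < hs" and M: "0 < Ur a 0 - Ul a 0"
  and s: "!!h. h < hs ==> frequently (%xi. h <= H xi) at_top" and i: "!!h. hi < h ==> frequently (%xi. H xi <= h) at_top"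
 shows "tau a <= ereal ((Ur a 0 - Ul a 0) / (hs - hi))"
proof (rule ccontr)
 assume "\<not> tau a <= ereal ((Ur a 0 - Ul a 0) / (hs - hi))"
 then have "ereal ((Ur a 0 - Ul a 0) / (hs - hi)) < tau a" by simp
 then obtain t where t: "ereal ((Ur a 0 - Ul a 0) / (hs - hi)) < ereal t" "ereal t < tau a" using ereal_dense2 by blast
 then have t1: "(Ur a 0 - Ul a 0) / (hs - hi) < t" by simp
 have "0 < (Ur a 0 - Ul a 0) / (hs - hi)" using M d by simp
 then have t0: "0 < t" using t1 by linarith
 have "(hs - hi) * t <= (Ur a 0 - Ul a 0) + e" if e: "0 < e" for e
 proof -
  define \<epsilon> where "\<epsilon> = e / (2 * t)"
  have \<epsilon>: "0 < \<epsilon>" using e t0 by (simp add: \<epsilon>_def)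
  have "((hs - \<epsilon>) - (hi + \<epsilon>)) * t <= Ur a 0 - Ul a 0"
   by (rule waiting_rate[OF a s i _ t(2)]) (use \<epsilon> t0 in auto)
  moreover have "((hs - \<epsilon>) - (hi + \<epsilon>)) * t = (hs - hi) * t - 2 * t * \<epsilon>" by (simp add: algebra_simps)
  moreover have "2 * t * \<epsilon> = e" using t0 by (simp add: \<epsilon>_def)
  ultimately show ?thesis by linarith
 qed
 then have "(hs - hi) * t <= Ur a 0 - Ul a 0" by (rule field_le_epsilon)
 moreover have "Ur a 0 - Ul a 0 < t * (hs - hi)" using t1 d by (simp add: pos_divide_less_eq)
 ultimately show False by (simp add: mult.commute)
qed

lemma immortal_imp_constant:
 assumes a: "a \<in> Xp" "tau a = \<infinity>" and g: "!!x. \<bar>U (x, 0)\<bar> <= A + B * \<bar>x\<bar>" and B: "0 < B" and k: "B < k" "B < k'"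
 shows "H k = H k'"
 using immortal_flux_constant[OF a g less_imp_le[OF B] k(1) k(2)] immortal_flux_constant[OF a g less_imp_le[OF B] k(2) k(1)]
 by (rule antisym)

end

theorem corollary4p6:
  fixes H :: "real \<Rightarrow> real" and u0 :: "real set \<Rightarrow> real"
    and u :: "real \<Rightarrow> real set \<Rightarrow> real" and ur :: "real \<times> real \<Rightarrow> real"
    and p :: nat and x c :: "nat \<Rightarrow> real" and j :: nat
  assumes "W1_inf H"
    and "signed_radon u0"
    and "strict_mono_on {1..p} x"
    and "\<forall>i\<in>{1..p}. c i \<noteq> 0"
    and "\<forall>K. compact K \<longrightarrow> singular_part u0 K = (\<Sum>i=1..p. c i * indicator K (x i))"
    and "cont_signed_radon u"
    and "is_regular_part u ur"
    and "global_entropy_solution H u0 u ur"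
    and "\<forall>i\<in>{1..p}. compatible_at H u ur (x i) (c i)"
    and "j \<in> {1..p}"
  defines "Hsup_p \<equiv> Limsup at_top (\<lambda>\<xi>. ereal (H \<xi>))"
    and "Hinf_p \<equiv> Liminf at_top (\<lambda>\<xi>. ereal (H \<xi>))"
    and "Hsup_m \<equiv> Limsup at_bot (\<lambda>\<xi>. ereal (H \<xi>))"
    and "Hinf_m \<equiv> Liminf at_bot (\<lambda>\<xi>. ereal (H \<xi>))"
  shows "(c j > 0 \<and> Hsup_p > Hinf_p \<longrightarrow> waiting_time u (x j) \<le> ereal (c j) / (Hsup_p - Hinf_p)) \<and>
    (c j < 0 \<and> Hsup_m > Hinf_m \<longrightarrow> waiting_time u (x j) \<le> ereal \<bar>c j\<bar> / (Hsup_m - Hinf_m)) \<and>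
    ((\<exists>A>0. \<exists>B>0. \<forall>y. \<bar>LBINT s=ereal 0..ereal y. regular_part u0 s\<bar> \<le> A + B * \<bar>y\<bar>) \<longrightarrow>
      (c j > 0 \<and> (\<exists>L. (H \<longlongrightarrow> L) at_top) \<and> \<not> (\<exists>a>0. H constant_on {a<..})) \<or>
      (c j < 0 \<and> (\<exists>L. (H \<longlongrightarrow> L) at_bot) \<and> \<not> (\<exists>d<0. H constant_on {..<d})) \<longrightarrow>
      waiting_time u (x j) < \<infinity>)"
proof -
 have Hc: "cont H" and Hb: "bounded (range H)" using assms(1) by (auto simp: W1_inf_def)
 obtain C where C: "!!xi. \<bar>H xi\<bar> <= C" using Hb unfolding bounded_iff by auto
 have inj: "inj_on x {1..p}" by (rule strict_mono_on_imp_inj_on[OF assms(3)])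
 define X where "X = x ` {1..p}"
 define cc where "cc y = c (the_inv_into {1..p} x y)" for y
 have cc: "cc (x i) = c i" if "i \<in> {1..p}" for i unfolding cc_def the_inv_into_f_f[OF inj that] ..
 interpret E: entropy_data H u0 u ur C X cc
 proof
  show "cont H" "signed_radon u0" "cont_signed_radon u" "is_regular_part u ur" "global_entropy_solution H u0 u ur"
   by (rule Hc, rule assms(2), rule assms(6), rule assms(7), rule assms(8))
  show "\<bar>H xi\<bar> <= C" for xi by (rule C)
  show "finite X" by (simp add: X_def)
  show "cc y \<noteq> 0" if "y \<in> X" for y using that assms(4) cc by (auto simp: X_def)
  show "compatible_at H u ur y (cc y)" if "y \<in> X" for y using that assms(9) cc by (auto simp: X_def)
  show "singular_part u0 K = (\<Sum>y\<in>X. cc y * indicator K y)" if "compact K" for K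
  proof -
   have "(\<Sum>y\<in>X. cc y * indicator K y) = (\<Sum>i=1..p. cc (x i) * indicator K (x i))"
    unfolding X_def sum.reindex[OF inj] comp_def ..
   also have "\<dots> = (\<Sum>i=1..p. c i * indicator K (x i))" by (rule sum.cong) (simp_all add: cc)
   finally show ?thesis using assms(5) that by simp
  qed
 qed
 define M where "M = c j"
 define a where "a = x j"
 have aX: "a \<in> X" and cca: "cc a = M" using assms(10) cc by (auto simp: X_def a_def M_def)
 have mass: "E.mass a 0 = M" using aX cca by (simp add: E.mass_def E.pmass_def)
 have aXp: "a \<in> E.Xp" if "0 < M" using aX cca that by (simp add: E.Xp_def)
 have aXn: "a \<in> E.Xn" if "M < 0" using aX cca that by (simp add: E.Xn_def)
 note flow = E.flow_family_pot
 \<comment> \<open>the reflected flow, in which the negative masses are positive and the flux at minus infinity is seen at plus infinity\<close>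
 note mirrored = flow_family.flip_family[OF flow]
 have rate_p: "waiting_time u a <= ereal M / (Hsup_p - Hinf_p)" if M: "0 < M" and lt: "Hinf_p < Hsup_p"
 proof -
  obtain hs hi where h: "Limsup at_top (%xi. ereal (H xi)) = ereal hs" "Liminf at_top (%xi. ereal (H xi)) = ereal hi"
   by (rule real_limsup_liminf[OF C, of at_top]) simp
  have d: "hi < hs" using lt h by (simp add: Hsup_p_def Hinf_p_def)
  have "waiting_time u a <= ereal ((E.pot (a, 0) - (E.pot (a, 0) - E.mass a 0)) / (hs - hi))"
   by (rule flow_family.waiting_bound[OF flow aXp[OF M] d])
    (use M mass frequently_near_limsup[OF h(1)] frequently_near_liminf[OF h(2)] in auto)
  then show ?thesis using h d mass by (simp add: Hsup_p_def Hinf_p_def)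
 qed
 have rate_n: "waiting_time u a <= ereal \<bar>M\<bar> / (Hsup_m - Hinf_m)" if M: "M < 0" and lt: "Hinf_m < Hsup_m"
 proof -
  obtain hs hi where h: "Limsup at_bot (%xi. ereal (H xi)) = ereal hs" "Liminf at_bot (%xi. ereal (H xi)) = ereal hi"
   by (rule real_limsup_liminf[OF C, of at_bot]) simp
  have d: "- hs < - hi" using lt h by (simp add: Hsup_m_def Hinf_m_def)
  have f1: "frequently (%xi. h' <= - H (- xi)) at_top" if "h' < - hi" for h'
   using frequently_mirror[OF frequently_near_liminf[OF h(2), of "- h'"]] that
   by (auto elim!: frequently_elim1)
  have f2: "frequently (%xi. - H (- xi) <= h') at_top" if "- hs < h'" for h'
   using frequently_mirror[OF frequently_near_limsup[OF h(1), of "- h'"]] that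
   by (auto elim!: frequently_elim1)
  have "waiting_time u a <= ereal ((- E.pot (a, 0) - - (E.pot (a, 0) - E.mass a 0)) / (- hi - - hs))"
   by (rule flow_family.waiting_bound[OF mirrored aXn[OF M] d _ f1 f2]) (use M mass in auto)
  then show ?thesis using h d mass M by (simp add: Hsup_m_def Hinf_m_def)
 qed
 have finite_p: "waiting_time u a < \<infinity>"
  if M: "0 < M" and B: "0 < B" and g: "!!z. \<bar>E.pot (z, 0)\<bar> <= A + B * \<bar>z\<bar>" and nc: "\<not> (\<exists>b>0. H constant_on {b<..})" for A B
 proof (rule ccontr)
  assume "\<not> waiting_time u a < \<infinity>"
  then have inf: "waiting_time u a = \<infinity>" by simp
  have "H k = H (B + 1)" if "k \<in> {B<..}" for k
   by (rule flow_family.immortal_imp_constant[OF flow aXp[OF M] inf g B]) (use that in auto)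
  then have "H constant_on {B<..}" unfolding constant_on_def by blast
  then show False using nc B by blast
 qed
 have finite_n: "waiting_time u a < \<infinity>"
  if M: "M < 0" and B: "0 < B" and g: "!!z. \<bar>E.pot (z, 0)\<bar> <= A + B * \<bar>z\<bar>" and nc: "\<not> (\<exists>d<0. H constant_on {..<d})" for A B
 proof (rule ccontr)
  assume "\<not> waiting_time u a < \<infinity>"
  then have inf: "waiting_time u a = \<infinity>" by simp
  have g': "\<bar>- E.pot (z, 0)\<bar> <= A + B * \<bar>z\<bar>" for z using g[of z] by simp
  have "H k = H (- (B + 1))" if "k \<in> {..<- B}" for k
  proof -
   have "- H (- (- k)) = - H (- (B + 1))"
    by (rule flow_family.immortal_imp_constant[OF mirrored aXn[OF M] inf g' B]) (use that in auto)
   then show ?thesis by simp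
  qed
  then have "H constant_on {..<- B}" unfolding constant_on_def by blast
  moreover have "- B < 0" using B by simp
  ultimately show False using nc by blast
 qed
 have finite: "waiting_time u a < \<infinity>"
  if g: "\<exists>A>0. \<exists>B>0. \<forall>y. \<bar>LBINT s=ereal 0..ereal y. regular_part u0 s\<bar> <= A + B * \<bar>y\<bar>"
   and alt: "0 < M \<and> \<not> (\<exists>b>0. H constant_on {b<..}) \<or> M < 0 \<and> \<not> (\<exists>d<0. H constant_on {..<d})"
 proof -
  obtain A B where AB: "0 < B" "!!y. \<bar>LBINT s=ereal 0..ereal y. regular_part u0 s\<bar> <= A + B * \<bar>y\<bar>" using g by blast
  note gr = E.pot_growth[OF AB(2)]
  from alt show ?thesis
  proof
   assume "0 < M \<and> \<not> (\<exists>b>0. H constant_on {b<..})"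
   then show ?thesis using finite_p[OF _ AB(1) gr] by blast
  next
   assume "M < 0 \<and> \<not> (\<exists>d<0. H constant_on {..<d})"
   then show ?thesis using finite_n[OF _ AB(1) gr] by blast
  qed
 qed
 show ?thesis
  unfolding M_def[symmetric] a_def[symmetric]
  using rate_p rate_n finite by blast
qed

end
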